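(* Let $\Omega$ be a chord-arc domain and let $\varphi$ be a quasiconformal mapping of $\Delta$ onto $\Omega$ such that (S1) $\varphi$ is bi-Lipschitz with respect to the Poincaré (hyperbolic) metrics of $\Delta$ and $\Omega$, and (S2) the boundary map $\varphi|_{\mathbb{S}}:\mathbb{S}\to\partial\Omega$ is a strongly quasisymmetric homeomorphism. If $\alpha\ge0$ and $\alpha(z)\,dxdy\in CM(\Omega)$, then $\alpha\circ\varphi(z)\,|\partial\varphi(z)|\,dxdy\in CM(\Delta)$. Moreover, if $\alpha(z)\,dxdy\in CM_0(\Omega)$, then $\alpha\circ\varphi(z)\,|\partial\varphi(z)|\,dxdy\in CM_0(\Delta)$.
   Context: $\Delta$ is the unit disk, $\mathbb{S}$ the unit circle, $\partial=\partial/\partial z$. A curve $\Gamma$ is chord-arc (Lavrentiev) with constant $C$ if $\Lambda^1(\widetilde{\zeta z})\le C|\zeta-z|$ for the smaller subarc $\widetilde{\zeta z}$ of $\Gamma$ joining any two finite points $\zeta,z\in\Gamma$ ($\Lambda^1$ = arclength / linear Hausdorff measure); a chord-arc domain is a domain bounded by a chord-arc curve. The Poincaré metric of $\Omega$ is $\rho_\Omega(z)|dz|=|df(z)|/(1-|f(z)|^2)$ for a conformal $f:\Omega\to\Delta$. A positive weight $\omega$ on $\mathbb{S}$ satisfies $A_\infty$ if there are $C_1,C_2>0$ with $\omega(E)/\omega(I)\le C_2(|E|/|I|)^{C_1}$ for all arcs $I\subset\mathbb{S}$ and measurable $E\subset I$, where $\omega(E)=\int_E\omega|dz|$. A homeomorphism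 $\gamma$ of $\mathbb{S}$ onto a curve $\Gamma$ is strongly quasisymmetric if it is locally absolutely continuous, $\Gamma$ is chord-arc, and $|\gamma'|\in A_\infty$. Carleson measures: for a simply connected domain $\Omega$, $\|\mu\|_*=\sup\{\mu(\Omega\cap D(z,r))/r: z\in\partial\Omega, 0<r<\operatorname{diam}\partial\Omega\}$, $CM(\Omega)=\{\mu\ge0:\|\mu\|_*<\infty\}$, and $CM_0(\Omega)$ consists of those $\mu\in CM(\Omega)$ with $\mu(\Omega\cap D(z,r))/r\to0$ as $r\to0$ uniformly in $z\in\partial\Omega$. *)

theory Defs
  imports "HOL-Analysis.Analysis"
begin

definition abs_cont_on :: "(real \<Rightarrow> complex) \<Rightarrow> real \<Rightarrow> real \<Rightarrow> bool" where
  "abs_cont_on f a b \<longleftrightarrow>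
     (\<forall>\<epsilon>>0. \<exists>\<delta>>0. \<forall>(n::nat) (u::nat \<Rightarrow> real) (v::nat \<Rightarrow> real).
        (\<forall>i<n. a \<le> u i \<and> u i \<le> v i \<and> v i \<le> b) \<and>
        (\<forall>i<n. \<forall>j<n. i \<noteq> j \<longrightarrow> v i \<le> u j \<or> v j \<le> u i) \<and>
        (\<Sum>i<n. v i - u i) < \<delta>
        \<longrightarrow> (\<Sum>i<n. cmod (f (v i) - f (u i))) < \<epsilon>)"

definition ACL :: "(complex \<Rightarrow> complex) \<Rightarrow> complex set \<Rightarrow> bool" where
  "ACL f U \<longleftrightarrow>
     (\<forall>a b c d. a \<le> b \<and> c \<le> d \<and> {z. a \<le> Re z \<and> Re z \<le> b \<and> c \<le> Im z \<and> Im z \<le> d} \<subseteq> U \<longrightarrow>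
        (AE y in lborel. y \<in> {c..d} \<longrightarrow> abs_cont_on (\<lambda>t. f (Complex t y)) a b) \<and>
        (AE x in lborel. x \<in> {a..b} \<longrightarrow> abs_cont_on (\<lambda>t. f (Complex x t)) c d))"

definition dz :: "(complex \<Rightarrow> complex) \<Rightarrow> complex \<Rightarrow> complex" where
  "dz f z = (frechet_derivative f (at z) 1 - \<i> * frechet_derivative f (at z) \<i>) / 2"

definition dzbar :: "(complex \<Rightarrow> complex) \<Rightarrow> complex \<Rightarrow> complex" where
  "dzbar f z = (frechet_derivative f (at z) 1 + \<i> * frechet_derivative f (at z) \<i>) / 2"

definition quasiconformal :: "(complex \<Rightarrow> complex) \<Rightarrow> complex set \<Rightarrow> complex set \<Rightarrow> bool" where
  "quasiconformal f U V \<longleftrightarrow>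
     (\<exists>g. homeomorphism U V f g) \<and> ACL f U \<and>
     (AE z in lebesgue. z \<in> U \<longrightarrow> f differentiable (at z)) \<and>
     (\<exists>k<1. AE z in lebesgue. z \<in> U \<longrightarrow> cmod (dzbar f z) \<le> k * cmod (dz f z))"

definition hausdorff1 :: "complex set \<Rightarrow> ennreal" where
  "hausdorff1 E = (SUP \<delta>\<in>{0<..}. INF U\<in>{U::nat \<Rightarrow> complex set.
        E \<subseteq> (\<Union>i. U i) \<and> (\<forall>i. bounded (U i) \<and> diameter (U i) \<le> \<delta>)}.
        (\<Sum>i. ennreal (diameter (U i))))"

definition jordan_curve :: "complex set \<Rightarrow> bool" where
  "jordan_curve \<Gamma> \<longleftrightarrow> (\<exists>c. simple_path c \<and> pathfinish c = pathstart c \<and> path_image c = \<Gamma>)"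

text \<open>The subarcs of a Jordan curve joining two distinct points are exactly the arcs in
  the curve with those end points; the smaller one has length \<open>\<le> C|\<zeta>-z|\<close> iff one of them does.\<close>
definition chord_arc :: "complex set \<Rightarrow> real \<Rightarrow> bool" where
  "chord_arc \<Gamma> C \<longleftrightarrow> jordan_curve \<Gamma> \<and>
     (\<forall>\<zeta>\<in>\<Gamma>. \<forall>z\<in>\<Gamma>. \<zeta> \<noteq> z \<longrightarrow>
        (\<exists>g. arc g \<and> pathstart g = \<zeta> \<and> pathfinish g = z \<and> path_image g \<subseteq> \<Gamma> \<and>
             hausdorff1 (path_image g) \<le> ennreal (C * cmod (\<zeta> - z))))"

definition chord_arc_domain :: "complex set \<Rightarrow> bool" where
  "chord_arc_domain \<Omega> \<longleftrightarrow> (\<exists>\<Gamma> C. chord_arc \<Gamma> C \<and> \<Omega> \<in> components (- \<Gamma>))"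

definition conformal_onto_disc :: "(complex \<Rightarrow> complex) \<Rightarrow> complex set \<Rightarrow> bool" where
  "conformal_onto_disc f \<Omega> \<longleftrightarrow> f holomorphic_on \<Omega> \<and> inj_on f \<Omega> \<and> f ` \<Omega> = ball 0 1"

definition poincare_density :: "complex set \<Rightarrow> complex \<Rightarrow> real" where
  "poincare_density \<Omega> z =
     (let f = (SOME f. conformal_onto_disc f \<Omega>) in cmod (deriv f z) / (1 - (cmod (f z))\<^sup>2))"

definition poincare_dist :: "complex set \<Rightarrow> complex \<Rightarrow> complex \<Rightarrow> ennreal" where
  "poincare_dist \<Omega> a b =
     (INF g\<in>{g. valid_path g \<and> path_image g \<subseteq> \<Omega> \<and> pathstart g = a \<and> pathfinish g = b}.
        (\<integral>\<^sup>+ t\<in>{0..1}. ennreal (poincare_density \<Omega> (g t) * cmod (vector_derivative g (at t))) \<partial>lborel))"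

definition poincare_bilipschitz :: "(complex \<Rightarrow> complex) \<Rightarrow> complex set \<Rightarrow> complex set \<Rightarrow> bool" where
  "poincare_bilipschitz f U V \<longleftrightarrow> (\<exists>L>0. \<forall>z\<in>U. \<forall>w\<in>U.
      poincare_dist V (f z) (f w) \<le> ennreal L * poincare_dist U z w \<and>
      poincare_dist U z w \<le> ennreal L * poincare_dist V (f z) (f w))"

text \<open>Points of the circle are parametrized by \<open>cis t\<close>, \<open>t \<in> (-\<pi>,\<pi>]\<close>; arclength on the
  circle is Lebesgue measure of the parameter set.\<close>
definition circ_param :: "complex set \<Rightarrow> real set" where
  "circ_param E = {t \<in> {-pi<..pi}. cis t \<in> E}"

definition circle_arc :: "complex set \<Rightarrow> bool" where
  "circle_arc I \<longleftrightarrow> (\<exists>a b. a < b \<and> b \<le> a + 2 * pi \<and> I = cis ` {a..b})"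

definition weight_meas :: "(complex \<Rightarrow> real) \<Rightarrow> complex set \<Rightarrow> ennreal" where
  "weight_meas \<omega> E = (\<integral>\<^sup>+ t\<in>circ_param E. ennreal (\<omega> (cis t)) \<partial>lebesgue)"

definition A_infinity :: "(complex \<Rightarrow> real) \<Rightarrow> bool" where
  "A_infinity \<omega> \<longleftrightarrow>
     (\<lambda>t. \<omega> (cis t)) \<in> borel_measurable (lebesgue_on {-pi<..pi}) \<and>
     (\<forall>z\<in>sphere 0 1. \<omega> z \<ge> 0) \<and>
     (AE t in lebesgue. t \<in> {-pi<..pi} \<longrightarrow> \<omega> (cis t) > 0) \<and>
     weight_meas \<omega> (sphere 0 1) < \<infinity> \<and>
     (\<exists>C1>0. \<exists>C2>0. \<forall>I E. circle_arc I \<and> E \<subseteq> I \<and> circ_param E \<in> sets lebesgue \<longrightarrow>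
        weight_meas \<omega> E \<le>
          ennreal (C2 * (measure lebesgue (circ_param E) / measure lebesgue (circ_param I)) powr C1)
          * weight_meas \<omega> I)"

definition abs_deriv_circ :: "(complex \<Rightarrow> complex) \<Rightarrow> complex \<Rightarrow> real" where
  "abs_deriv_circ \<gamma> z = cmod (vector_derivative (\<lambda>t. \<gamma> (cis t)) (at (Arg z)))"

definition strongly_quasisymmetric :: "(complex \<Rightarrow> complex) \<Rightarrow> complex set \<Rightarrow> bool" where
  "strongly_quasisymmetric \<gamma> \<Gamma> \<longleftrightarrow>
     (\<exists>g. homeomorphism (sphere 0 1) \<Gamma> \<gamma> g) \<and>
     (\<forall>a b. abs_cont_on (\<lambda>t. \<gamma> (cis t)) a b) \<and>
     (\<exists>C. chord_arc \<Gamma> C) \<and>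
     A_infinity (abs_deriv_circ \<gamma>)"

definition carleson :: "complex set \<Rightarrow> complex measure \<Rightarrow> bool" where
  "carleson \<Omega> \<mu> \<longleftrightarrow> (\<exists>M. \<forall>z\<in>frontier \<Omega>. \<forall>r. 0 < r \<and> r < diameter (frontier \<Omega>) \<longrightarrow>
      emeasure \<mu> (\<Omega> \<inter> ball z r) \<le> ennreal (M * r))"

definition vanishing_carleson :: "complex set \<Rightarrow> complex measure \<Rightarrow> bool" where
  "vanishing_carleson \<Omega> \<mu> \<longleftrightarrow> carleson \<Omega> \<mu> \<and>
     (\<forall>\<epsilon>>0. \<exists>\<delta>>0. \<forall>z\<in>frontier \<Omega>. \<forall>r. 0 < r \<and> r < \<delta> \<longrightarrow>
        emeasure \<mu> (\<Omega> \<inter> ball z r) \<le> ennreal (\<epsilon> * r))"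

end

(*
  Idea of the proof.  Koebe-type bounds for the Poincare metric and the hyperbolic bi-Lipschitz
  condition give |d phi(z)| <= const * kappa(z) * J_phi(z) with
  kappa(z) = (1 - |z|) / dist(phi(z), boundary), so a change of variables turns the claim into a
  bound for the integral of kappa against the pullback of the measure alpha dx dy.

  Let omega = |gamma'| be the boundary weight.  A length-area argument (logarithmic weight of annuli
  centred at a boundary point) combined with the chord-arc condition and the doubling property of
  omega shows that phi maps the Carleson box over an arc I into a disc of radius <= const * omega(I)
  about a boundary point, and keeps the top half of the box at distance >= const * omega(I) from
  the boundary.  Hence the pullback measure of the box is <= const * omega(I), while
  kappa <= const * |I| / omega(I) on its top half.

  It remains to bound the sum of |J| / omega(J) * tau(J) over the dyadic J inside I by const * |I|,
  where tau(J) is the pullback measure of the top half over J.  Stop at the maximal J with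
  |J| / omega(J) > 2 |I| / omega(I).  The J that are not stopped contribute at most const * |I|;
  the stopped ones carry at most half of omega(I), so by the A_infinity condition their total
  length is at most (1 - c) |I|, and the bound follows by iteration.
*)
theory Submission
  imports Defs "HOL-Complex_Analysis.Complex_Analysis" "HOL-Library.Real_Mod"
begin

subsection \<open>Differentiability almost everywhere\<close>

text \<open>Boundary and interior data are given in different terms. On the curve, the chord-arc
  condition speaks of Hausdorff measure and the weight of a derivative; they become comparable
  through chords, which takes almost everywhere differentiability and the fundamental theorem of
  calculus for the epsilon-delta notion of absolute continuity. Inside, the Poincare density comes
  from an arbitrary Riemann map, so it is controlled by bounds valid for every such map: Schwarz
  from above, and from below Bloch applied to a logarithm of the inverse. This is the origin of the
  factors 12 * pi and exp (12 * pi * L). The stopping argument by itself only improves a bound that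
  is already finite. The sums are therefore cut off after finitely many generations; a crude bound
  growing with their number starts the iteration, whose fixed point no longer depends on it. The
  composed density is not known to be measurable, so the conclusion is one about lower integrals.
  Its majorant, built from the Jacobian, is measurable, because the change of variables makes it
  integrable.\<close>

definition fine_at :: "(real \<Rightarrow> real \<Rightarrow> bool) \<Rightarrow> real \<Rightarrow> bool" where
  "fine_at P x \<longleftrightarrow> (\<forall>d>0. \<exists>s t. s < t \<and> s \<le> x \<and> x \<le> t \<and> t - s < d \<and> P s t)"

text \<open>\<open>fine_at\<close> is the Vitali covering condition with the point anywhere in the
  short intervals, endpoints included, so that one-sided and two-sided difference quotients are
  treated alike. Intervals are read as closed balls about their midpoints to apply the covering
  theorem.\<close>

lemma Vitali_intervals:
  assumes "\<And>x. x \<in> S \<Longrightarrow> fine_at P x"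
  obtains C where "countable C" "\<And>s t. (s, t) \<in> C \<Longrightarrow> s < t \<and> P s t"
    "disjoint_family_on (\<lambda>(s, t). {s..t}) C" "negligible (S - (\<Union>(s,t)\<in>C. {s..t}))"
proof -
  define K where "K = {(s,t). s < t \<and> P s t}"
  have eq: "cball ((fst i + snd i) / 2) ((snd i - fst i) / 2) = {fst i..snd i}" for i :: "real \<times> real"
    by (auto simp: cball_eq_atLeastAtMost field_simps)
  obtain C where C: "countable C" "C \<subseteq> K"
     "pairwise (\<lambda>i j. disjnt (cball ((fst i + snd i) / 2) ((snd i - fst i) / 2)) (cball ((fst j + snd j) / 2) ((snd j - fst j) / 2))) C"
     "negligible (S - (\<Union>i \<in> C. cball ((fst i + snd i) / 2) ((snd i - fst i) / 2)))"
  proof (rule Vitali_covering_theorem_cballs[where K=K and S=S and a="\<lambda>i. (fst i + snd i) / 2" and r="\<lambda>i. (snd i - fst i) / 2"])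
    show "0 < (snd i - fst i) / 2" if "i \<in> K" for i using that by (auto simp: K_def)
    fix x d :: real assume "x \<in> S" "0 < d"
    then have "0 < 2 * d" "fine_at P x" using assms by auto
    then obtain s t where "s < t" "s \<le> x" "x \<le> t" "t - s < 2 * d" "P s t"
      unfolding fine_at_def by blast
    moreover have "x \<in> cball ((fst (s,t) + snd (s,t)) / 2) ((snd (s,t) - fst (s,t)) / 2)"
      unfolding eq using \<open>s \<le> x\<close> \<open>x \<le> t\<close> by simp
    ultimately show "\<exists>i. i \<in> K \<and> x \<in> cball ((fst i + snd i) / 2) ((snd i - fst i) / 2) \<and> (snd i - fst i) / 2 < d"
      by (intro exI[of _ "(s,t)"] conjI) (auto simp: K_def)
  qed auto
  show thesis
  proof
    show "countable C" by fact
    show "s < t \<and> P s t" if "(s, t) \<in> C" for s t using that C(2) by (auto simp: K_def)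
    show "disjoint_family_on (\<lambda>(s, t). {s..t}) C"
      using C(3) unfolding eq pairwise_def disjoint_family_on_def disjnt_def by (auto simp: split_beta)
    show "negligible (S - (\<Union>(s,t)\<in>C. {s..t}))"
      using C(4) unfolding eq by (simp add: split_beta)
  qed
qed

text \<open>Disjointness of the closed intervals orders their endpoints, so monotonicity keeps the
  open image gaps disjoint, jumps of \<open>F\<close> included. A sum of increments thus becomes the
  measure of a set, and two such sums can be compared by inclusion.\<close>

lemma mono_increments_emeasure:
  fixes F :: "real \<Rightarrow> real"
  assumes "mono F" "countable C" "\<And>s t. (s, t) \<in> C \<Longrightarrow> s < t" "disjoint_family_on (\<lambda>(s, t). {s..t}) C"
  shows "emeasure lborel (\<Union>(s,t)\<in>C. {F s<..<F t}) = (\<integral>\<^sup>+i. ennreal (F (snd i) - F (fst i)) \<partial>count_space C)"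
proof -
  have "emeasure lborel (\<Union>(s,t)\<in>C. {F s<..<F t}) = (\<integral>\<^sup>+i. emeasure lborel (case i of (s,t) \<Rightarrow> {F s<..<F t}) \<partial>count_space C)"
  proof (rule emeasure_UN_countable)
    show "disjoint_family_on (\<lambda>(s, t). {F s<..<F t}) C"
      unfolding disjoint_family_on_def
    proof (intro ballI impI)
      fix i j assume ij: "i \<in> C" "j \<in> C" "i \<noteq> j"
      obtain s t u v where [simp]: "i = (s,t)" "j = (u,v)" by (cases i, cases j)
      have lt: "s < t" "u < v" using assms(3) ij by auto
      have "{s..t} \<inter> {u..v} = {}" using assms(4) ij unfolding disjoint_family_on_def by fastforce
      moreover have "max s u \<in> {s..t} \<inter> {u..v}" if "\<not> (t < u \<or> v < s)" using that lt by auto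
      ultimately have "t < u \<or> v < s" by blast
      then have "F t \<le> F u \<or> F v \<le> F s" using assms(1) by (auto simp: mono_def)
      then show "(case i of (s, t) \<Rightarrow> {F s<..<F t}) \<inter> (case j of (s, t) \<Rightarrow> {F s<..<F t}) = {}" by auto
    qed
  qed (use assms(2) in auto)
  also have "\<dots> = (\<integral>\<^sup>+i. ennreal (F (snd i) - F (fst i)) \<partial>count_space C)"
  proof (rule nn_integral_cong)
    fix i assume "i \<in> space (count_space C)"
    then have "fst i < snd i" using assms(3)[of "fst i" "snd i"] by simp
    then have "F (fst i) \<le> F (snd i)" using assms(1) by (auto simp: mono_def)
    then show "emeasure lborel (case i of (s, t) \<Rightarrow> {F s<..<F t}) = ennreal (F (snd i) - F (fst i))"
      by (simp add: split_beta)
  qed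
  finally show ?thesis .
qed

lemma intervals_emeasure:
  fixes C :: "(real \<times> real) set"
  assumes "countable C" "\<And>s t. (s, t) \<in> C \<Longrightarrow> s < t" "disjoint_family_on (\<lambda>(s, t). {s..t}) C"
  shows "emeasure lborel (\<Union>(s,t)\<in>C. {s..t}) = (\<integral>\<^sup>+i. ennreal (snd i - fst i) \<partial>count_space C)"
proof -
  have "emeasure lborel (\<Union>(s,t)\<in>C. {s..t}) = (\<integral>\<^sup>+i. emeasure lborel (case i of (s,t) \<Rightarrow> {s..t}) \<partial>count_space C)"
    by (rule emeasure_UN_countable) (use assms in auto)
  also have "\<dots> = (\<integral>\<^sup>+i. ennreal (snd i - fst i) \<partial>count_space C)"
    by (rule nn_integral_cong) (use assms(2) in \<open>auto simp: split_beta less_imp_le\<close>)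
  finally show ?thesis .
qed

lemma Un_intervals_borel: "countable C \<Longrightarrow> (\<Union>(s::real,t)\<in>C. {s..t}) \<in> sets borel"
  by (intro sets.countable_UN') auto

text \<open>Outer measure is used because the exceptional sets of difference quotients are not known
  to be measurable beforehand.\<close>

lemma outer_measure_le_intervals:
  fixes S :: "real set"
  assumes "negligible (S - (\<Union>(s,t)\<in>C. {s..t}))" "countable C"
  shows "outer_measure_of lebesgue S \<le> emeasure lborel (\<Union>(s,t)\<in>C. {s..t})"
proof -
  let ?U = "\<Union>(s,t)\<in>C. {s..t}"
  have N: "S - ?U \<in> null_sets lebesgue" using assms(1) by (simp add: negligible_iff_null_sets)
  have U: "?U \<in> sets lebesgue" using Un_intervals_borel[OF assms(2)] by simp
  have "?U \<union> (S - ?U) \<in> sets lebesgue" using N U by (intro sets.Un) auto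
  then have "outer_measure_of lebesgue S \<le> emeasure lebesgue (?U \<union> (S - ?U))"
    unfolding outer_measure_of_def by (intro INF_lower) blast
  also have "\<dots> = emeasure lebesgue ?U" by (rule emeasure_Un_null_set[OF U N])
  also have "\<dots> = emeasure lborel ?U" using Un_intervals_borel[OF assms(2)] by simp
  finally show ?thesis .
qed

lemma negligible_outer_measure_0:
  fixes S :: "real set"
  assumes "outer_measure_of lebesgue S = 0" shows "negligible S"
proof -
  obtain B where "B \<in> sets lebesgue" "S \<subseteq> B" "emeasure lebesgue B = 0"
    using outer_measure_of_attain[of S lebesgue] assms by auto
  then show ?thesis by (meson negligible_iff_null_sets negligible_subset null_setsI)
qed

lemma outer_measure_open:
  fixes S :: "real set"
  assumes "outer_measure_of lebesgue S < \<infinity>" "0 < e"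
  obtains U where "open U" "S \<subseteq> U" "emeasure lborel U \<le> outer_measure_of lebesgue S + ennreal e"
proof -
  obtain B where B: "B \<in> sets lebesgue" "S \<subseteq> B" "outer_measure_of lebesgue S = emeasure lebesgue B"
    using outer_measure_of_attain[of S lebesgue] by auto
  obtain T where T: "open T" "B \<subseteq> T" "(T - B) \<in> lmeasurable" "emeasure lebesgue (T - B) < ennreal e"
    using sets_lebesgue_outer_open[OF B(1) assms(2)] by blast
  have "B \<union> (T - B) = T" using T(2) by blast
  then have "emeasure lborel T = emeasure lebesgue (B \<union> (T - B))" using T(1) by simp
  also have "emeasure lebesgue (B \<union> (T - B)) \<le> emeasure lebesgue B + emeasure lebesgue (T - B)"
    using B(1) T(1) by (intro emeasure_subadditive) auto
  also have "\<dots> \<le> outer_measure_of lebesgue S + ennreal e" using B(3) T(4) by (intro add_mono) auto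
  finally show thesis using T(1,2) B(2) by (intro that[of T]) auto
qed

text \<open>Lebesgue's double covering. Inside an open set of nearly the outer measure o of
  \<open>E\<close>, intervals of slope at most \<open>p\<close> are chosen; inside these, intervals
  of slope at least \<open>q\<close>. Both families cover almost all of \<open>E\<close>, and the
  increments over the inner one cannot exceed those over the outer one, so q * o \<le> p * (o + e),
  which forces o = 0.\<close>

lemma mono_oscillating_quotient_negligible:
  fixes F :: "real \<Rightarrow> real"
  assumes F: "mono F" and "bounded E" and pq: "p < q"
    and lo: "\<And>x. x \<in> E \<Longrightarrow> fine_at (\<lambda>s t. F t - F s \<le> p * (t - s)) x"
    and hi: "\<And>x. x \<in> E \<Longrightarrow> fine_at (\<lambda>s t. q * (t - s) \<le> F t - F s) x"
  shows "negligible E"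
proof (cases "E = {}")
  case False
  then obtain x where "x \<in> E" by blast
  then obtain s t where "s < t" "F t - F s \<le> p * (t - s)"
    using lo unfolding fine_at_def by (meson zero_less_one)
  moreover then have "F s \<le> F t" using F by (simp add: mono_def)
  ultimately have p: "0 \<le> p"
    by (smt (verit) mult_neg_pos)
  let ?o = "outer_measure_of lebesgue E"
  obtain R where R: "E \<subseteq> cball 0 R" using \<open>bounded E\<close> by (force simp: bounded_iff)
  have "?o \<le> emeasure lebesgue (cball 0 R :: real set)" 
    unfolding outer_measure_of_def using R by (intro INF_lower) auto
  also have "\<dots> < \<infinity>" using emeasure_bounded_finite[of "cball 0 R :: real set"] by auto
  finally have fin: "?o < \<infinity>" .
  define o' where "o' = enn2real ?o"
  have o': "?o = ennreal o'" "0 \<le> o'" using fin by (auto simp: o'_def)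
  have key: "q * o' \<le> p * (o' + e)" if e: "0 < e" for e
  proof -
    obtain U where U: "open U" "E \<subseteq> U" "emeasure lborel U \<le> ?o + ennreal e"
      by (rule outer_measure_open[OF fin e])
    have "fine_at (\<lambda>s t. F t - F s \<le> p * (t - s) \<and> {s..t} \<subseteq> U) x" if xE: "x \<in> E" for x
      unfolding fine_at_def
    proof (intro allI impI)
      fix d :: real assume "0 < d"
      obtain r where r: "0 < r" "cball x r \<subseteq> U" using U(1,2) xE open_contains_cball[of U] by blast
      have "0 < min d r" using r \<open>0 < d\<close> by simp
      then obtain s t where "s < t \<and> s \<le> x \<and> x \<le> t \<and> t - s < min d r \<and> F t - F s \<le> p * (t - s)"
        using lo[OF xE, unfolded fine_at_def, rule_format, of "min d r"] by auto
      moreover then have "{s..t} \<subseteq> cball x r" by (auto simp: cball_eq_atLeastAtMost)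
      ultimately show "\<exists>s t. s < t \<and> s \<le> x \<and> x \<le> t \<and> t - s < d \<and> F t - F s \<le> p * (t - s) \<and> {s..t} \<subseteq> U"
        using r by auto
    qed
    note * = this
    obtain C where C: "countable C" "\<And>s t. (s, t) \<in> C \<Longrightarrow> s < t \<and> F t - F s \<le> p * (t - s) \<and> {s..t} \<subseteq> U"
      "disjoint_family_on (\<lambda>(s, t). {s..t}) C" "negligible (E - (\<Union>(s,t)\<in>C. {s..t}))"
      by (rule Vitali_intervals[OF *]) (assumption | rule that)+
    \<comment> \<open>Only countably many endpoints are lost, and every remaining point has room on
      both sides, so the second family can be nested strictly inside the first.\<close>
    define E1 where "E1 = E \<inter> (\<Union>(s,t)\<in>C. {s<..<t})"
    have "E - E1 \<subseteq> (E - (\<Union>(s,t)\<in>C. {s..t})) \<union> (fst ` C \<union> snd ` C)"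
      by (fastforce simp: E1_def image_iff)
    moreover have "negligible (fst ` C \<union> snd ` C)" 
      unfolding negligible_iff_null_sets using C(1)
      by (intro null_sets_completionI countable_imp_null_set_lborel) auto
    ultimately have E1: "negligible (E - E1)" using C(4) by (meson negligible_Un negligible_subset)
    have "fine_at (\<lambda>s t. q * (t - s) \<le> F t - F s \<and> (\<exists>(a,b)\<in>C. a < s \<and> t < b)) x" if xE: "x \<in> E1" for x
      unfolding fine_at_def
    proof (intro allI impI)
      fix d :: real assume "0 < d"
      obtain a b where ab: "(a,b) \<in> C" "a < x" "x < b" using xE by (auto simp: E1_def)
      have "0 < min d (min (x - a) (b - x))" using ab \<open>0 < d\<close> by auto
      then obtain s t where st: "s < t" "s \<le> x" "x \<le> t" "t - s < min d (min (x - a) (b - x))" "q * (t - s) \<le> F t - F s"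
        using hi[of x, unfolded fine_at_def, rule_format, of "min d (min (x - a) (b - x))"] xE unfolding E1_def by auto
      then show "\<exists>s t. s < t \<and> s \<le> x \<and> x \<le> t \<and> t - s < d \<and> q * (t - s) \<le> F t - F s \<and> (\<exists>(a,b)\<in>C. a < s \<and> t < b)"
        using ab by (intro exI[of _ s] exI[of _ t]) (auto intro!: bexI[of _ "(a,b)"])
    qed
    note * = this
    obtain D where D: "countable D" "\<And>s t. (s, t) \<in> D \<Longrightarrow> s < t \<and> q * (t - s) \<le> F t - F s \<and> (\<exists>(a,b)\<in>C. a < s \<and> t < b)"
      "disjoint_family_on (\<lambda>(s, t). {s..t}) D" "negligible (E1 - (\<Union>(s,t)\<in>D. {s..t}))"
      by (rule Vitali_intervals[OF *]) (assumption | rule that)+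
    have "E - (\<Union>(s,t)\<in>D. {s..t}) \<subseteq> (E - E1) \<union> (E1 - (\<Union>(s,t)\<in>D. {s..t}))" by blast
    then have ED: "negligible (E - (\<Union>(s,t)\<in>D. {s..t}))" using E1 D(4) by (meson negligible_Un negligible_subset)
    have "ennreal q * ?o \<le> ennreal q * (\<integral>\<^sup>+i. ennreal (snd i - fst i) \<partial>count_space D)"
      using outer_measure_le_intervals[OF ED D(1)] intervals_emeasure[OF D(1) _ D(3)] D(2)
      by (intro mult_left_mono) auto
    also have "\<dots> = (\<integral>\<^sup>+i. ennreal q * ennreal (snd i - fst i) \<partial>count_space D)"
      by (simp add: nn_integral_cmult)
    also have "\<dots> \<le> (\<integral>\<^sup>+i. ennreal (F (snd i) - F (fst i)) \<partial>count_space D)"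
    proof (rule nn_integral_mono)
      fix i assume "i \<in> space (count_space D)"
      then have "fst i < snd i" "q * (snd i - fst i) \<le> F (snd i) - F (fst i)" using D(2)[of "fst i" "snd i"] by auto
      then show "ennreal q * ennreal (snd i - fst i) \<le> ennreal (F (snd i) - F (fst i))"
        using p pq by (simp add: ennreal_mult[symmetric] ennreal_leI)
    qed
    also have "\<dots> = emeasure lborel (\<Union>(s,t)\<in>D. {F s<..<F t})"
      using mono_increments_emeasure[OF F D(1) _ D(3)] D(2) by simp
    also have "\<dots> \<le> emeasure lborel (\<Union>(s,t)\<in>C. {F s<..<F t})"
    proof (rule emeasure_mono)
      show "(\<Union>(s,t)\<in>D. {F s<..<F t}) \<subseteq> (\<Union>(s,t)\<in>C. {F s<..<F t})"
      proof
        fix y assume "y \<in> (\<Union>(s,t)\<in>D. {F s<..<F t})"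
        then obtain s t where st: "(s,t) \<in> D" "F s < y" "y < F t" by auto
        then obtain a b where ab: "(a,b) \<in> C" "a < s" "t < b" using D(2)[OF st(1)] by auto
        then have "F a \<le> F s" "F t \<le> F b" using F by (auto simp: mono_def)
        then show "y \<in> (\<Union>(s,t)\<in>C. {F s<..<F t})" using st ab
            by (intro UN_I[OF ab(1)]) auto
      qed
    qed (use C(1) in \<open>auto intro!: sets.countable_UN'\<close>)
    also have "\<dots> = (\<integral>\<^sup>+i. ennreal (F (snd i) - F (fst i)) \<partial>count_space C)"
      using mono_increments_emeasure[OF F C(1) _ C(3)] C(2) by simp
    also have "\<dots> \<le> (\<integral>\<^sup>+i. ennreal p * ennreal (snd i - fst i) \<partial>count_space C)"
    proof (rule nn_integral_mono)
      fix i assume "i \<in> space (count_space C)"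
      then have "fst i < snd i" "F (snd i) - F (fst i) \<le> p * (snd i - fst i)" using C(2)[of "fst i" "snd i"] by auto
      then show "ennreal (F (snd i) - F (fst i)) \<le> ennreal p * ennreal (snd i - fst i)"
        using p by (simp add: ennreal_mult[symmetric] ennreal_leI)
    qed
    also have "\<dots> = ennreal p * emeasure lborel (\<Union>(s,t)\<in>C. {s..t})"
      using intervals_emeasure[OF C(1) _ C(3)] C(2) by (simp add: nn_integral_cmult)
    also have "\<dots> \<le> ennreal p * emeasure lborel U"
      using C(2) U(1) by (intro mult_left_mono emeasure_mono) fastforce+
    also have "\<dots> \<le> ennreal p * (?o + ennreal e)" using U(3) by (intro mult_left_mono) auto
    finally show ?thesis using o' p pq e
      by (simp add: ennreal_mult[symmetric] ennreal_plus[symmetric] ennreal_le_iff del: ennreal_plus)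
  qed
  have "q * o' \<le> p * o'"
  proof (rule field_le_epsilon)
    fix e :: real assume "0 < e"
    have "q * o' \<le> p * (o' + e / (p + 1))" using \<open>0 < e\<close> p by (intro key) auto
    also have "\<dots> \<le> p * o' + e" using p \<open>0 < e\<close> by (simp add: field_simps)
    finally show "q * o' \<le> p * o' + e" .
  qed
  then have "o' = 0" using pq o'(2) by (metis antisym mult_le_cancel_right not_le)
  then show ?thesis using o' by (intro negligible_outer_measure_0) auto
qed auto

text \<open>A Vitali family of slope at least q has total increment at most v - u, so q times the
  outer measure stays below v - u for every natural q.\<close>

lemma mono_infinite_quotient_negligible:
  fixes F :: "real \<Rightarrow> real"
  assumes F: "mono F" and rg: "range F \<subseteq> {u..v}"
    and hi: "\<And>x q. x \<in> E \<Longrightarrow> fine_at (\<lambda>s t. real q * (t - s) \<le> F t - F s) x"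
  shows "negligible E"
proof -
  let ?o = "outer_measure_of lebesgue E"
  have uv: "u \<le> v" using rg[THEN subsetD, of "F 0"] by auto
  have key: "ennreal (real q) * ?o \<le> ennreal (v - u)" for q
  proof -
    obtain D where D: "countable D" "\<And>s t. (s, t) \<in> D \<Longrightarrow> s < t \<and> real q * (t - s) \<le> F t - F s"
      "disjoint_family_on (\<lambda>(s, t). {s..t}) D" "negligible (E - (\<Union>(s,t)\<in>D. {s..t}))"
      by (rule Vitali_intervals[OF hi]) (assumption | rule that)+
    have "ennreal (real q) * ?o \<le> ennreal (real q) * (\<integral>\<^sup>+i. ennreal (snd i - fst i) \<partial>count_space D)"
      using outer_measure_le_intervals[OF D(4) D(1)] intervals_emeasure[OF D(1) _ D(3)] D(2)
      by (intro mult_left_mono) auto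
    also have "\<dots> = (\<integral>\<^sup>+i. ennreal (real q) * ennreal (snd i - fst i) \<partial>count_space D)"
      by (simp add: nn_integral_cmult)
    also have "\<dots> \<le> (\<integral>\<^sup>+i. ennreal (F (snd i) - F (fst i)) \<partial>count_space D)"
    proof (rule nn_integral_mono)
      fix i assume "i \<in> space (count_space D)"
      then have "fst i < snd i" "real q * (snd i - fst i) \<le> F (snd i) - F (fst i)" using D(2)[of "fst i" "snd i"] by auto
      then show "ennreal (real q) * ennreal (snd i - fst i) \<le> ennreal (F (snd i) - F (fst i))"
        by (simp add: ennreal_mult[symmetric] ennreal_leI)
    qed
    also have "\<dots> = emeasure lborel (\<Union>(s,t)\<in>D. {F s<..<F t})"
      using mono_increments_emeasure[OF F D(1) _ D(3)] D(2) by simp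
    also have "\<dots> \<le> emeasure lborel {u..v}"
    proof (rule emeasure_mono)
      show "(\<Union>(s,t)\<in>D. {F s<..<F t}) \<subseteq> {u..v}"
      proof clarify
        fix y s t assume "y \<in> {F s<..<F t}"
        moreover have "F s \<in> {u..v}" "F t \<in> {u..v}" using rg by blast+
        ultimately show "y \<in> {u..v}" by auto
      qed
    qed auto
    finally show ?thesis using uv by simp
  qed
  have fin: "?o < \<infinity>"
  proof -
    have "?o \<le> ennreal (v - u)" using key[of 1] by simp
    also have "\<dots> < \<infinity>" by simp
    finally show ?thesis .
  qed
  define o' where "o' = enn2real ?o"
  have o': "?o = ennreal o'" "0 \<le> o'" using fin by (auto simp: o'_def)
  have "real q * o' \<le> v - u" for q
    using key[of q] o' uv by (simp add: ennreal_mult[symmetric])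
  then have "\<not> 0 < o'" using reals_Archimedean3[of o'] by (metis not_le)
  then show ?thesis using o' by (intro negligible_outer_measure_0) auto
qed

text \<open>If the derivative fails to exist, either the quotients over short intervals are
  unbounded or they fall below one rational slope and rise above a larger one at all small scales;
  countably many negligible sets account for both cases. The radius \<open>n\<close> only supplies
  boundedness.\<close>

theorem mono_differentiable_ae:
  fixes F :: "real \<Rightarrow> real"
  assumes F: "mono F" and rg: "range F \<subseteq> {u..v}"
  shows "negligible {x. \<not> F differentiable at x}"
proof -
  define A where "A n p q = {x \<in> cball 0 (real n). p < q \<and> fine_at (\<lambda>s t. F t - F s \<le> p * (t - s)) x \<and>
     fine_at (\<lambda>s t. q * (t - s) \<le> F t - F s) x}" for n p q
  define B where "B = {x. \<forall>q::nat. fine_at (\<lambda>s t. real q * (t - s) \<le> F t - F s) x}"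
  have A: "negligible (A n p q)" for n p q
  proof (cases "p < q")
    case True
    then show ?thesis
    proof (intro mono_oscillating_quotient_negligible[OF F, of _ p q])
      show "bounded (A n p q)" by (rule bounded_subset[OF bounded_cball[of 0 "real n"]]) (auto simp: A_def)
    qed (auto simp: A_def)
  qed (simp add: A_def)
  have B: "negligible B" by (rule mono_infinite_quotient_negligible[OF F rg]) (auto simp: B_def)
  have N: "negligible (B \<union> (\<Union>n. \<Union>p\<in>\<rat>. \<Union>q\<in>\<rat>. A n p q))"
    using A B countable_rat by (intro negligible_Un negligible_Union_nat negligible_countable_Union) auto
  moreover have "F differentiable at x" if x: "x \<notin> B \<union> (\<Union>n. \<Union>p\<in>\<rat>. \<Union>q\<in>\<rat>. A n p q)" for x
  proof -
    have notA: "\<not> (fine_at (\<lambda>s t. F t - F s \<le> p * (t - s)) x \<and> fine_at (\<lambda>s t. q * (t - s) \<le> F t - F s) x)"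
      if "p \<in> \<rat>" "q \<in> \<rat>" "p < q" for p q
    proof -
      obtain n where "\<bar>x\<bar> \<le> real n" using real_arch_simple by blast
      moreover have "x \<notin> A n p q" using x that by blast
      ultimately show ?thesis using that by (auto simp: A_def dist_real_def)
    qed
    \<comment> \<open>These rational slopes exceed all quotients over sufficiently short intervals
      around \<open>x\<close>. The infimum is the derivative: slopes above it are upper bounds by
      choice, and a rational slope below it is reached at all small scales, so that
      \<open>notA\<close> turns every smaller rational slope into a lower bound.\<close>
    define Q where "Q = {q\<in>\<rat>. \<not> fine_at (\<lambda>s t. q * (t - s) \<le> F t - F s) x}"
    obtain k :: nat where "\<not> fine_at (\<lambda>s t. real k * (t - s) \<le> F t - F s) x" using x by (auto simp: B_def)
    then have "real k \<in> Q" by (simp add: Q_def)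
    then have "Q \<noteq> {}" by blast
    have Qpos: "0 \<le> q" if "q \<in> Q" for q
    proof (rule ccontr)
      assume "\<not> 0 \<le> q"
      have "fine_at (\<lambda>s t. q * (t - s) \<le> F t - F s) x" unfolding fine_at_def
      proof (intro allI impI)
        fix d :: real assume "0 < d"
        have "F x \<le> F (x + d/2)" using F \<open>0 < d\<close> by (simp add: mono_def)
        moreover have "q * (d/2) \<le> 0" using \<open>\<not> 0 \<le> q\<close> \<open>0 < d\<close> by (simp add: mult_nonpos_nonneg)
        ultimately show "\<exists>s t. s < t \<and> s \<le> x \<and> x \<le> t \<and> t - s < d \<and> q * (t - s) \<le> F t - F s"
          using \<open>0 < d\<close> by (intro exI[of _ x] exI[of _ "x + d/2"]) auto
      qed
      then show False using that by (auto simp: Q_def)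
    qed
    have bdd: "bdd_below Q" using Qpos by (auto simp: bdd_below_def)
    define D where "D = Inf Q"
    have main: "\<exists>d>0. \<forall>s t. s < t \<and> s \<le> x \<and> x \<le> t \<and> t - s < d \<longrightarrow> \<bar>F t - F s - D * (t - s)\<bar> \<le> e * (t - s)"
      if e: "0 < e" for e
    proof -
      obtain q where q: "q \<in> Q" "q < D + e" 
        using cInf_lessD[OF \<open>Q \<noteq> {}\<close>, of "D + e"] e by (auto simp: D_def)
      then have "\<not> fine_at (\<lambda>s t. q * (t - s) \<le> F t - F s) x" by (simp add: Q_def)
      then obtain d1 where d1: "0 < d1" "\<And>s t. s < t \<Longrightarrow> s \<le> x \<Longrightarrow> x \<le> t \<Longrightarrow> t - s < d1 \<Longrightarrow> F t - F s < q * (t - s)"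
        unfolding fine_at_def not_all not_imp not_ex by (metis not_le)
      obtain p where p: "p \<in> \<rat>" "D - e < p" "p < D" using Rats_dense_in_real[of "D - e" D] e by auto
      obtain q' where q': "q' \<in> \<rat>" "p < q'" "q' < D" using Rats_dense_in_real[of p D] p by auto
      have "q' \<notin> Q" using q' bdd by (metis D_def cInf_lower not_le)
      then have "fine_at (\<lambda>s t. q' * (t - s) \<le> F t - F s) x" using q' by (simp add: Q_def)
      then have "\<not> fine_at (\<lambda>s t. F t - F s \<le> p * (t - s)) x" using notA p q' by blast
      then obtain d2 where d2: "0 < d2" "\<And>s t. s < t \<Longrightarrow> s \<le> x \<Longrightarrow> x \<le> t \<Longrightarrow> t - s < d2 \<Longrightarrow> p * (t - s) < F t - F s"
        unfolding fine_at_def not_all not_imp not_ex by (metis not_le)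
      show ?thesis
      proof (intro exI[of _ "min d1 d2"] conjI allI impI)
        fix s t assume st: "s < t \<and> s \<le> x \<and> x \<le> t \<and> t - s < min d1 d2"
        have "q * (t - s) \<le> (D + e) * (t - s)" "(D - e) * (t - s) \<le> p * (t - s)"
          using st p q by (auto intro!: mult_right_mono)
        moreover have "F t - F s < q * (t - s)" "p * (t - s) < F t - F s" using d1(2) d2(2) st by auto
        ultimately show "\<bar>F t - F s - D * (t - s)\<bar> \<le> e * (t - s)"
          by (simp add: abs_le_iff algebra_simps)
      qed (use d1 d2 in auto)
    qed
    have "(F has_derivative (\<lambda>h. h * D)) (at x)"
      unfolding has_derivative_at_alt
    proof (intro conjI allI impI bounded_linear_mult_left)
      fix e :: real assume "0 < e"
      obtain d where d0: "0 < d" "\<forall>s t. s < t \<and> s \<le> x \<and> x \<le> t \<and> t - s < d \<longrightarrow> \<bar>F t - F s - D * (t - s)\<bar> \<le> e * (t - s)"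
        using main[OF \<open>0 < e\<close>] by auto
      have d: "0 < d" "\<And>s t. s < t \<Longrightarrow> s \<le> x \<Longrightarrow> x \<le> t \<Longrightarrow> t - s < d \<Longrightarrow> \<bar>F t - F s - D * (t - s)\<bar> \<le> e * (t - s)"
        using d0 by auto
      show "\<exists>d>0. \<forall>y. norm (y - x) < d \<longrightarrow> norm (F y - F x - (y - x) * D) \<le> e * norm (y - x)"
      proof (intro exI[of _ d] conjI allI impI)
        fix y assume y: "norm (y - x) < d"
        consider "y = x" | "x < y" | "y < x" by linarith
        then show "norm (F y - F x - (y - x) * D) \<le> e * norm (y - x)"
        proof cases
          case 2 then show ?thesis using d(2)[of x y] y by (simp add: mult.commute)
        next
          case 3 then show ?thesis using d(2)[of y x] y
            by (simp add: abs_minus_commute[of "F x - F y - D * (x - y)"] algebra_simps abs_if split: if_splits)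
        qed simp
      qed (use d in auto)
    qed
    then show ?thesis by (auto simp: differentiable_def)
  qed
  ultimately show ?thesis by (blast intro: negligible_subset)
qed

text \<open>Tagged divisions and partitions supply intervals that contain \<open>t\<close> somewhere
  rather than start there; the error terms on the two sides of \<open>t\<close> add up.\<close>

lemma straddle_derivative:
  fixes g :: "real \<Rightarrow> 'a::real_normed_vector"
  assumes "(g has_vector_derivative D) (at t)" "0 < e"
  shows "\<exists>d>0. \<forall>u v. u \<le> t \<and> t \<le> v \<and> v - u < d \<longrightarrow> norm (g v - g u - (v - u) *\<^sub>R D) \<le> e * (v - u)"
proof -
  obtain d where d: "0 < d" "\<And>y. norm (y - t) < d \<Longrightarrow> norm (g y - g t - (y - t) *\<^sub>R D) \<le> e * norm (y - t)"
    using assms unfolding has_vector_derivative_def has_derivative_at_alt by auto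
  show ?thesis
  proof (intro exI[of _ d] conjI allI impI)
    fix u v assume uv: "u \<le> t \<and> t \<le> v \<and> v - u < d"
    have "norm (g v - g t - (v - t) *\<^sub>R D) \<le> e * (v - t)" using d(2)[of v] uv by auto
    moreover have "norm (g u - g t - (u - t) *\<^sub>R D) \<le> e * (t - u)" using d(2)[of u] uv by auto
    moreover have eq: "g v - g u - (v - u) *\<^sub>R D = (g v - g t - (v - t) *\<^sub>R D) - (g u - g t - (u - t) *\<^sub>R D)"
      by (simp add: algebra_simps)
    have "norm (g v - g u - (v - u) *\<^sub>R D) \<le> norm (g v - g t - (v - t) *\<^sub>R D) + norm (g u - g t - (u - t) *\<^sub>R D)"
      unfolding eq by (rule norm_triangle_ineq4)
    ultimately show "norm (g v - g u - (v - u) *\<^sub>R D) \<le> e * (v - u)" by (simp add: algebra_simps)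
  qed (use d in auto)
qed

text \<open>\<open>chain_sum g a t v\<close>: some subdivision of \<open>{a..t}\<close> has increments of \<open>g\<close> adding up to \<open>v\<close>.\<close>
inductive chain_sum :: "(real \<Rightarrow> complex) \<Rightarrow> real \<Rightarrow> real \<Rightarrow> real \<Rightarrow> bool" for g a where
  base: "chain_sum g a a 0"
| step: "chain_sum g a s v \<Longrightarrow> s \<le> t \<Longrightarrow> chain_sum g a t (v + cmod (g t - g s))"

text \<open>A chain unrolls into adjacent intervals of total length t - a, the format that
  \<open>abs_cont_on\<close> quantifies over.\<close>

lemma chain_sum_partition:
  assumes "chain_sum g a t v"
  shows "a \<le> t \<and> (\<exists>(n::nat) u w. (\<forall>i<n. a \<le> u i \<and> u i \<le> w i \<and> w i \<le> t) \<and>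
        (\<forall>i<n. \<forall>j<n. i \<noteq> j \<longrightarrow> w i \<le> u j \<or> w j \<le> u i) \<and>
        (\<Sum>i<n. w i - u i) = t - a \<and> (\<Sum>i<n. cmod (g (w i) - g (u i))) = v)"
  using assms
proof induction
  case base
  then show ?case by (auto intro!: exI[of _ 0])
next
  case (step s v t)
  have as: "a \<le> s" using step.IH by blast
  obtain n u w where n: "\<forall>i<n::nat. a \<le> u i \<and> u i \<le> w i \<and> w i \<le> s"
    "\<forall>i<n. \<forall>j<n. i \<noteq> j \<longrightarrow> w i \<le> u j \<or> w j \<le> u i"
    "(\<Sum>i<n. w i - u i) = s - a" "(\<Sum>i<n. cmod (g (w i) - g (u i))) = v"
    using step.IH by blast
  show ?case
    by (intro conjI exI[of _ "Suc n"] exI[of _ "u(n := s)"] exI[of _ "w(n := t)"])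
      (use n as step.hyps in \<open>auto simp: less_Suc_eq intro: order_trans\<close>)
qed

lemma abs_cont_onE:
  assumes "abs_cont_on f a b" "0 < \<epsilon>"
  obtains \<delta> where "0 < \<delta>" "\<And>(n::nat) u v.
        \<forall>i<n. a \<le> u i \<and> u i \<le> v i \<and> v i \<le> b \<Longrightarrow>
        \<forall>i<n. \<forall>j<n. i \<noteq> j \<longrightarrow> v i \<le> u j \<or> v j \<le> u i \<Longrightarrow>
        (\<Sum>i<n. v i - u i) < \<delta> \<Longrightarrow> (\<Sum>i<n. cmod (f (v i) - f (u i))) < \<epsilon>"
proof -
  have "\<exists>\<delta>>0. \<forall>(n::nat) u v.
        (\<forall>i<n. a \<le> u i \<and> u i \<le> v i \<and> v i \<le> b) \<and>
        (\<forall>i<n. \<forall>j<n. i \<noteq> j \<longrightarrow> v i \<le> u j \<or> v j \<le> u i) \<and>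
        (\<Sum>i<n. v i - u i) < \<delta>
        \<longrightarrow> (\<Sum>i<n. cmod (f (v i) - f (u i))) < \<epsilon>"
    by (rule assms(1)[unfolded abs_cont_on_def, THEN spec, THEN mp, OF assms(2)])
  then obtain \<delta> where \<delta>: "\<delta> > 0 \<and> (\<forall>(n::nat) u v.
        (\<forall>i<n. a \<le> u i \<and> u i \<le> v i \<and> v i \<le> b) \<and>
        (\<forall>i<n. \<forall>j<n. i \<noteq> j \<longrightarrow> v i \<le> u j \<or> v j \<le> u i) \<and>
        (\<Sum>i<n. v i - u i) < \<delta>
        \<longrightarrow> (\<Sum>i<n. cmod (f (v i) - f (u i))) < \<epsilon>)" by (rule exE)
  show thesis
    by (rule that[of \<delta>]) (use \<delta> in \<open>simp_all\<close>)
qed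

lemma abs_cont_variation:
  assumes "abs_cont_on g c d" "\<epsilon> > 0"
  obtains \<delta> where "\<delta> > 0" "\<And>a t v. c \<le> a \<Longrightarrow> t \<le> d \<Longrightarrow> t - a < \<delta> \<Longrightarrow> chain_sum g a t v \<Longrightarrow> v < \<epsilon>"
proof -
  obtain \<delta> where \<delta>: "\<delta> > 0" "\<And>(n::nat) u v.
        \<forall>i<n. c \<le> u i \<and> u i \<le> v i \<and> v i \<le> d \<Longrightarrow>
        \<forall>i<n. \<forall>j<n. i \<noteq> j \<longrightarrow> v i \<le> u j \<or> v j \<le> u i \<Longrightarrow>
        (\<Sum>i<n. v i - u i) < \<delta> \<Longrightarrow> (\<Sum>i<n. cmod (g (v i) - g (u i))) < \<epsilon>"
    using abs_cont_onE[OF assms] by blast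
  show thesis
  proof
    fix a t v assume a: "c \<le> a" "t \<le> d" "t - a < \<delta>" "chain_sum g a t v"
    obtain n u w where n: "\<forall>i<n::nat. a \<le> u i \<and> u i \<le> w i \<and> w i \<le> t"
      "\<forall>i<n. \<forall>j<n. i \<noteq> j \<longrightarrow> w i \<le> u j \<or> w j \<le> u i"
      "(\<Sum>i<n. w i - u i) = t - a" "(\<Sum>i<n. cmod (g (w i) - g (u i))) = v"
      using chain_sum_partition[OF a(4)] by blast
    have "\<forall>i<n. c \<le> u i \<and> u i \<le> w i \<and> w i \<le> d" using n(1) a(1,2) by (meson order_trans)
    then have "(\<Sum>i<n. cmod (g (w i) - g (u i))) < \<epsilon>"
      by (rule \<delta>(2)) (use n a in auto)
    then show "v < \<epsilon>" using n by simp
  qed fact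
qed

text \<open>Jordan decomposition: the variation \<open>V\<close> and \<open>V\<close> minus the real
  part are both monotone, and the real part is their difference.\<close>

lemma bounded_variation_Re_differentiable_ae:
  assumes bv: "\<And>t v. t \<le> d \<Longrightarrow> chain_sum g c t v \<Longrightarrow> v \<le> B" and "c \<le> d"
  shows "negligible {t\<in>{c<..<d}. \<not> (\<lambda>t. Re (g t)) differentiable at t}"
proof -
  define V where "V t = Sup {v. chain_sum g c t v}" for t
  \<comment> \<open>Clamping to \<open>{c..d}\<close> produces monotone functions on the whole line
    with bounded range, as the theorem on monotone functions requires.\<close>
  define cl where "cl t = max c (min d t)" for t
  have ne: "{v. chain_sum g c t v} \<noteq> {}" if "c \<le> t" for t
    using chain_sum.step[OF chain_sum.base that, of g] by blast
  have bdd: "bdd_above {v. chain_sum g c t v}" if "t \<le> d" for t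
    using bv[OF that] by (intro bdd_aboveI[of _ B]) auto
  have step: "V s + cmod (g t - g s) \<le> V t" if "c \<le> s" "s \<le> t" "t \<le> d" for s t
  proof -
    have "V s \<le> V t - cmod (g t - g s)" unfolding V_def
    proof (rule cSup_least)
      show "{v. chain_sum g c s v} \<noteq> {}" using ne that by auto
      fix v assume "v \<in> {v. chain_sum g c s v}"
      then have "chain_sum g c t (v + cmod (g t - g s))" using that by (auto intro: chain_sum.step)
      then have "v + cmod (g t - g s) \<le> Sup {v. chain_sum g c t v}"
        using that by (intro cSup_upper bdd) auto
      then show "v \<le> Sup {v. chain_sum g c t v} - cmod (g t - g s)" by simp
    qed
    then show ?thesis by simp
  qed
  have cl: "c \<le> cl t" "cl t \<le> d" "s \<le> t \<Longrightarrow> cl s \<le> cl t" for s t using \<open>c \<le> d\<close> by (auto simp: cl_def)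
  have *: "negligible {t. \<not> F differentiable at t}" if F: "F = (\<lambda>t. V (cl t)) \<or> F = (\<lambda>t. V (cl t) - Re (g (cl t)))" for F
  proof -
    have m: "F s \<le> F t" if "s \<le> t" for s t
    proof -
      have "Re (g (cl t)) - Re (g (cl s)) \<le> cmod (g (cl t) - g (cl s))"
        by (metis complex_Re_le_cmod minus_complex.simps(1))
      moreover have "V (cl s) + cmod (g (cl t) - g (cl s)) \<le> V (cl t)" using cl that by (intro step) auto
      moreover have "0 \<le> cmod (g (cl t) - g (cl s))" by simp
      ultimately have "V (cl s) \<le> V (cl t)" "V (cl s) - Re (g (cl s)) \<le> V (cl t) - Re (g (cl t))" by linarith+
      then show ?thesis using F by auto
    qed
    show ?thesis
    proof (rule mono_differentiable_ae)
      show "mono F" using m by (auto simp: mono_def)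
      show "range F \<subseteq> {F c..F d}"
      proof clarify
        fix t
        have "F t = F (cl t)" using F \<open>c \<le> d\<close> by (auto simp: cl_def)
        then show "F t \<in> {F c..F d}" using m[of c "cl t"] m[of "cl t" d] cl[of t] by simp
      qed
    qed
  qed
  have "negligible ({t. \<not> (\<lambda>t. V (cl t)) differentiable at t} \<union> {t. \<not> (\<lambda>t. V (cl t) - Re (g (cl t))) differentiable at t})"
    using * by (intro negligible_Un) auto
  moreover have "(\<lambda>t. Re (g t)) differentiable at t"
    if "t \<in> {c<..<d}" "(\<lambda>t. V (cl t)) differentiable at t" "(\<lambda>t. V (cl t) - Re (g (cl t))) differentiable at t" for t
  proof -
    have "(\<lambda>t. V (cl t) - (V (cl t) - Re (g (cl t)))) differentiable at t"
      by (intro differentiable_diff that(2,3))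
    then obtain D where "((\<lambda>t. V (cl t) - (V (cl t) - Re (g (cl t)))) has_derivative D) (at t)" by (auto simp: differentiable_def)
    then have "((\<lambda>t. Re (g t)) has_derivative D) (at t)"
      by (rule has_derivative_transform_within_open[OF _ open_greaterThanLessThan[of c d]]) (use that in \<open>auto simp: cl_def\<close>)
    then show ?thesis by (auto simp: differentiable_def)
  qed
  ultimately show ?thesis by (blast intro: negligible_subset)
qed

text \<open>Rotation preserves variation. Used for the factor \<i>, because the real part of \<i> *
  g is minus the imaginary part of g.\<close>

lemma chain_sum_mult:
  assumes "chain_sum g a t v" "cmod k = 1" shows "chain_sum (\<lambda>t. k * g t) a t v"
  using assms(1)
proof induction
  case (step s v t)
  have "cmod (k * g t - k * g s) = cmod (g t - g s)"
    using assms(2) by (metis mult_1 norm_mult right_diff_distrib)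
  then show ?case using chain_sum.step[OF step.IH step.hyps(2)] by simp
qed (rule chain_sum.base)

text \<open>Around each point there is an interval shorter than the \<delta> that belongs to
  \<epsilon> = 1, so the variation there is at most 1 and the bounded variation result applies;
  negligibility is a local property.\<close>

theorem abs_cont_differentiable_ae:
  assumes ac: "\<And>a b. abs_cont_on g a b"
  shows "negligible {t. \<not> g differentiable at t}"
proof -
  have "\<exists>U. openin (top_of_set {t. \<not> g differentiable at t}) U \<and> x \<in> U \<and> negligible U" if x: "x \<in> {t. \<not> g differentiable at t}" for x
  proof -
    obtain \<delta> where \<delta>: "\<delta> > 0" "\<And>a t v. x - 1 \<le> a \<Longrightarrow> t \<le> x + 1 \<Longrightarrow> t - a < \<delta> \<Longrightarrow> chain_sum g a t v \<Longrightarrow> v < 1"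
      using abs_cont_variation[OF ac, of 1 "x - 1" "x + 1"] by auto
    define r where "r = min (\<delta>/3) 1"
    have r: "0 < r" "r \<le> 1" "2 * r < \<delta>" using \<delta> by (auto simp: r_def)
    let ?I = "{x-r<..<x+r}"
    have "v \<le> 1" if "t \<le> x + r" "chain_sum g (x-r) t v" for t v
      using \<delta>(2)[of "x-r" t v] that r by auto
    then have N1: "negligible {t\<in>?I. \<not> (\<lambda>t. Re (g t)) differentiable at t}"
      using r by (intro bounded_variation_Re_differentiable_ae[where B=1]) auto
    have "v \<le> 1" if "t \<le> x + r" "chain_sum (\<lambda>t. \<i> * g t) (x-r) t v" for t v
    proof -
      have "chain_sum (\<lambda>t. - \<i> * (\<i> * g t)) (x-r) t v" using chain_sum_mult[OF that(2), of "-\<i>"] by simp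
      then show ?thesis using \<delta>(2)[of "x-r" t v] that r by auto
    qed
    then have N2: "negligible {t\<in>?I. \<not> (\<lambda>t. Re (\<i> * g t)) differentiable at t}"
      using r by (intro bounded_variation_Re_differentiable_ae[where B=1]) auto
    have diff: "g differentiable at t" if dd: "(\<lambda>t. Re (g t)) differentiable at t" "(\<lambda>t. Re (\<i> * g t)) differentiable at t" for t
    proof -
      obtain D1 D2 where D: "((\<lambda>t. Re (g t)) has_real_derivative D1) (at t)" "((\<lambda>t. Re (\<i> * g t)) has_real_derivative D2) (at t)"
        using dd unfolding real_differentiable_def by blast
      have "((\<lambda>t. of_real (Re (g t)) - \<i> * of_real (Re (\<i> * g t))) has_vector_derivative (of_real D1 - \<i> * of_real D2)) (at t)"
        by (intro has_vector_derivative_diff has_vector_derivative_mult_right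
            bounded_linear.has_vector_derivative[OF bounded_linear_of_real]
            D[unfolded has_real_derivative_iff_has_vector_derivative])
      moreover have "(\<lambda>t. of_real (Re (g t)) - \<i> * of_real (Re (\<i> * g t))) = g"
        by (auto simp: complex_eq_iff)
      ultimately show ?thesis by (auto simp: has_vector_derivative_def differentiable_def)
    qed
    have "{t. \<not> g differentiable at t} \<inter> ?I \<subseteq> {t\<in>?I. \<not> (\<lambda>t. Re (g t)) differentiable at t} \<union> {t\<in>?I. \<not> (\<lambda>t. Re (\<i> * g t)) differentiable at t}"
      using diff by blast
    then have "negligible ({t. \<not> g differentiable at t} \<inter> ?I)" using N1 N2 by (meson negligible_Un negligible_subset)
    moreover have "openin (top_of_set {t. \<not> g differentiable at t}) ({t. \<not> g differentiable at t} \<inter> ?I)" by auto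
    ultimately show ?thesis using x r by (intro exI[of _ "{t. \<not> g differentiable at t} \<inter> ?I"]) auto
  qed
  then show ?thesis by (subst locally_negligible_alt) blast
qed

section \<open>The fundamental theorem of calculus for absolutely continuous functions\<close>

lemma has_integral_norm_le_nn_integral:
  fixes f :: "real \<Rightarrow> 'a::euclidean_space"
  assumes f: "(f has_integral I) S"
  shows "ennreal (norm I) \<le> (\<integral>\<^sup>+x\<in>S. ennreal (norm (f x)) \<partial>lebesgue)"
proof (cases "(\<integral>\<^sup>+x\<in>S. ennreal (norm (f x)) \<partial>lebesgue) = \<infinity>")
  case False
  define h where "h x = indicator S x *\<^sub>R f x" for x
  have eq: "(\<integral>\<^sup>+x\<in>S. ennreal (norm (f x)) \<partial>lebesgue) = (\<integral>\<^sup>+x. ennreal (norm (h x)) \<partial>lebesgue)"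
    by (intro nn_integral_cong) (auto simp: h_def indicator_def)
  have "h \<in> borel_measurable lebesgue" unfolding h_def by (rule has_integral_implies_lebesgue_measurable[OF f])
  then have int: "integrable lebesgue h" using False eq by (intro integrableI_bounded) (auto simp: less_top)
  have "(h has_integral (integral\<^sup>L lebesgue h)) UNIV" by (rule has_integral_integral_lebesgue[OF int])
  moreover have "(h has_integral I) UNIV"
  proof -
    have "h = (\<lambda>x. if x \<in> S then f x else 0)" by (auto simp: h_def)
    then show ?thesis using f by (simp only: has_integral_restrict_UNIV)
  qed
  ultimately have "I = integral\<^sup>L lebesgue h" by (rule has_integral_unique[symmetric])
  then show ?thesis using integral_norm_bound_ennreal[OF int] eq by simp
qed simp

text \<open>Proved directly for the gauge integral. Intervals tagged outside \<open>N\<close> are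
  handled by the derivative; those tagged in \<open>N\<close> lie in an open set of measure below
  \<delta>, so absolute continuity makes their increments small. No integrability of
  \<open>g'\<close> has to be known beforehand.\<close>

theorem abs_cont_FTC:
  assumes ac: "abs_cont_on g a b" and ab: "a \<le> b" and N: "negligible N"
    and der: "\<And>t. t \<in> {a..b} - N \<Longrightarrow> (g has_vector_derivative g' t) (at t)"
  shows "(g' has_integral (g b - g a)) {a..b}"
proof -
  define f where "f t = (if t \<in> N then 0 else g' t)" for t
  have "(f has_integral (g b - g a)) {a..b}"
    unfolding box_real[symmetric] has_integral
  proof (intro allI impI)
    fix e :: real assume e: "0 < e"
    define e' where "e' = e / (3 * (b - a + 1))"
    have e': "0 < e'" using e ab by (simp add: e'_def)
    have e'2: "e' * (b - a) \<le> e / 3" using e ab by (simp add: e'_def field_simps)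
    have "0 < e / 3" using e by simp
    from abs_cont_onE[OF ac this] obtain \<delta> where \<delta>: "\<delta> > 0" "\<And>(n::nat) u v.
        \<forall>i<n. a \<le> u i \<and> u i \<le> v i \<and> v i \<le> b \<Longrightarrow>
        \<forall>i<n. \<forall>j<n. i \<noteq> j \<longrightarrow> v i \<le> u j \<or> v j \<le> u i \<Longrightarrow>
        (\<Sum>i<n. v i - u i) < \<delta> \<Longrightarrow> (\<Sum>i<n. cmod (g (v i) - g (u i))) < e / 3"
      by blast
    have Nl: "N \<in> null_sets lebesgue" using N by (simp add: negligible_iff_null_sets)
    then obtain U where U: "open U" "N \<subseteq> U" "U - N \<in> lmeasurable" "emeasure lebesgue (U - N) < ennreal \<delta>"
      using sets_lebesgue_outer_open[of N \<delta>] \<delta> by auto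
    have Um: "emeasure lborel U < ennreal \<delta>"
    proof -
      have "emeasure lborel U = emeasure lebesgue ((U - N) \<union> N)" using U by (simp add: Un_absorb2)
      also have "\<dots> = emeasure lebesgue (U - N)" using U(3) Nl by (intro emeasure_Un_null_set) auto
      finally show ?thesis using U(4) by simp
    qed
    have "\<exists>d>0. t \<in> {a..b} - N \<longrightarrow> (\<forall>u v. u \<le> t \<and> t \<le> v \<and> v - u < d \<longrightarrow> norm (g v - g u - (v - u) *\<^sub>R g' t) \<le> e' * (v - u))" for t
      using straddle_derivative[OF der e'] by (cases "t \<in> {a..b} - N") (auto intro: zero_less_one)
    then obtain d where d: "\<And>t. 0 < d t" "\<And>t u v. t \<in> {a..b} - N \<Longrightarrow> u \<le> t \<Longrightarrow> t \<le> v \<Longrightarrow> v - u < d t \<Longrightarrow> norm (g v - g u - (v - u) *\<^sub>R g' t) \<le> e' * (v - u)"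
      by metis
    \<comment> \<open>Half of \<open>d t\<close> as radius makes every interval tagged at
      \<open>t\<close> shorter than \<open>d t\<close>.\<close>
    define \<gamma> where "\<gamma> t = (if t \<in> N then U else ball t (d t / 2))" for t
    show "\<exists>\<gamma>. gauge \<gamma> \<and> (\<forall>\<D>. \<D> tagged_division_of cbox a b \<and> \<gamma> fine \<D> \<longrightarrow>
        norm ((\<Sum>(x, k)\<in>\<D>. measure lborel k *\<^sub>R f x) - (g b - g a)) < e)"
    proof (intro exI[of _ \<gamma>] conjI allI impI)
      show "gauge \<gamma>" using U d(1) by (auto simp: gauge_def \<gamma>_def)
      fix p assume "p tagged_division_of cbox a b \<and> \<gamma> fine p"
      then have p: "p tagged_division_of cbox a b" and fine: "\<gamma> fine p" by auto
      have fin: "finite p" using p by auto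
      have K: "\<exists>u v. K = {u..v} \<and> u \<le> x \<and> x \<le> v \<and> a \<le> u \<and> v \<le> b" if "(x, K) \<in> p" for x K
      proof -
        have "x \<in> K" "K \<subseteq> cbox a b" "\<exists>u v. K = cbox u v" using p that unfolding tagged_division_of by blast+
        then show ?thesis by (auto simp: box_real)
      qed
      let ?inc = "\<lambda>K. g (Sup K) - g (Inf K)"
      have tele: "(\<Sum>(x,K)\<in>p. ?inc K) = g b - g a" using additive_tagged_division_1[OF ab, of p g] p by (simp add: box_real)
      let ?P = "{q\<in>p. fst q \<in> N}" and ?Q = "{q\<in>p. fst q \<notin> N}"
      have pPQ: "p = ?Q \<union> ?P" "?Q \<inter> ?P = {}" by auto
      have split: "(\<Sum>(x, k)\<in>p. measure lborel k *\<^sub>R f x) - (g b - g a) =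
         (\<Sum>(x,K)\<in>?Q. measure lborel K *\<^sub>R g' x - ?inc K) - (\<Sum>(x,K)\<in>?P. ?inc K)"
      proof -
        have "(\<Sum>(x, k)\<in>p. measure lborel k *\<^sub>R f x) - (g b - g a) = (\<Sum>(x,K)\<in>p. measure lborel K *\<^sub>R f x - ?inc K)"
          unfolding tele[symmetric] by (simp add: sum_subtractf split_beta)
        also have "\<dots> = (\<Sum>(x,K)\<in>?Q. measure lborel K *\<^sub>R f x - ?inc K) + (\<Sum>(x,K)\<in>?P. measure lborel K *\<^sub>R f x - ?inc K)"
          using fin pPQ by (metis (no_types, lifting) finite_Un sum.union_disjoint)
        also have "(\<Sum>(x,K)\<in>?P. measure lborel K *\<^sub>R f x - ?inc K) = (\<Sum>(x,K)\<in>?P. - ?inc K)"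
          by (intro sum.cong) (auto simp: f_def)
        also have "(\<Sum>(x,K)\<in>?Q. measure lborel K *\<^sub>R f x - ?inc K) = (\<Sum>(x,K)\<in>?Q. measure lborel K *\<^sub>R g' x - ?inc K)"
          by (intro sum.cong) (auto simp: f_def)
        finally show ?thesis by (simp add: sum_negf[symmetric] split_beta)
      qed
      have Q: "norm (\<Sum>(x,K)\<in>?Q. measure lborel K *\<^sub>R g' x - ?inc K) \<le> e / 3"
      proof -
        have "norm (\<Sum>(x,K)\<in>?Q. measure lborel K *\<^sub>R g' x - ?inc K) \<le> (\<Sum>(x,K)\<in>?Q. e' * measure lborel K)"
        proof (rule sum_norm_le)
          fix q assume q: "q \<in> ?Q"
          obtain x K where [simp]: "q = (x,K)" by (cases q)
          obtain u v where uv: "K = {u..v}" "u \<le> x" "x \<le> v" "a \<le> u" "v \<le> b" using K[of x K] q by auto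
          have "K \<subseteq> \<gamma> x" using fine q unfolding fine_def by auto
          then have "K \<subseteq> ball x (d x / 2)" using q by (simp add: \<gamma>_def)
          moreover have "u \<in> K" "v \<in> K" using uv by auto
          ultimately have "u \<in> ball x (d x / 2)" "v \<in> ball x (d x / 2)" by blast+
          then have "v - u < d x" using uv by (auto simp: dist_real_def)
          then have "norm (g v - g u - (v - u) *\<^sub>R g' x) \<le> e' * (v - u)" using q uv by (intro d(2)) auto
          then show "norm (case q of (x, K) \<Rightarrow> measure lborel K *\<^sub>R g' x - ?inc K) \<le> (case q of (x, K) \<Rightarrow> e' * measure lborel K)"
            using uv by (simp add: norm_minus_commute)
        qed
        also have "\<dots> \<le> (\<Sum>(x,K)\<in>p. e' * measure lborel K)" using fin e' by (intro sum_mono2) auto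
        also have "\<dots> = e' * (b - a)"
          using additive_content_tagged_division[OF p] ab by (simp add: sum_distrib_left[symmetric] split_beta)
        finally show ?thesis using e'2 by simp
      qed
      have P: "norm (\<Sum>(x,K)\<in>?P. ?inc K) < e / 3"
      proof -
        \<comment> \<open>Degenerate intervals have zero increment and are dropped. For the others,
          disjoint interiors mean that one lies entirely to the left of the other, which is the form
          of disjointness in \<open>abs_cont_on\<close>.\<close>
        let ?R = "{q\<in>?P. measure lborel (snd q) \<noteq> 0}"
        have finR: "finite ?R" using fin by auto
        have "(\<Sum>(x,K)\<in>?P. ?inc K) = (\<Sum>(x,K)\<in>?R. ?inc K)"
        proof (rule sum.mono_neutral_right)
          show "\<forall>i\<in>?P - ?R. (case i of (x, K) \<Rightarrow> ?inc K) = 0"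
          proof
            fix q assume q: "q \<in> ?P - ?R"
            obtain x K where [simp]: "q = (x,K)" by (cases q)
            obtain u v where "K = {u..v}" "u \<le> x" "x \<le> v" using K[of x K] q by auto
            then show "(case q of (x, K) \<Rightarrow> ?inc K) = 0" using q by auto
          qed
        qed (use fin in auto)
        also have "norm \<dots> \<le> (\<Sum>(x,K)\<in>?R. norm (?inc K))" by (rule order_trans[OF norm_sum]) (simp add: split_beta)
        also have "\<dots> < e / 3"
        proof -
          obtain h where h: "bij_betw h {..<card ?R} ?R" using ex_bij_betw_nat_finite[OF finR] by (auto simp: atLeast0LessThan)
          have hR: "h i \<in> ?R" if "i < card ?R" for i using h that by (auto simp: bij_betw_def)
          have hK: "Inf (snd (h i)) < Sup (snd (h i)) \<and> snd (h i) = {Inf (snd (h i))..Sup (snd (h i))} \<and> a \<le> Inf (snd (h i)) \<and> Sup (snd (h i)) \<le> b"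
            if ic: "i < card ?R" for i
          proof -
            obtain u v where "snd (h i) = {u..v}" "u \<le> v" "a \<le> u" "v \<le> b" using K[of "fst (h i)" "snd (h i)"] hR[OF ic] by auto
            moreover have "measure lborel (snd (h i)) \<noteq> 0" using hR[OF ic] by auto
            ultimately show ?thesis by (cases "u = v") auto
          qed
          have dis: "{Inf (snd (h i))<..<Sup (snd (h i))} \<inter> {Inf (snd (h j))<..<Sup (snd (h j))} = {}"
            if ij: "i < card ?R" "j < card ?R" "i \<noteq> j" for i j
          proof -
            have "h i \<noteq> h j" using h ij by (auto simp: bij_betw_def inj_on_def)
            then have "interior (snd (h i)) \<inter> interior (snd (h j)) = {}"
              using p hR[OF ij(1)] hR[OF ij(2)] unfolding tagged_division_of
              by (metis (mono_tags, lifting) mem_Collect_eq prod.collapse)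
            then show ?thesis using hK[OF ij(1)] hK[OF ij(2)] by (metis interior_atLeastAtMost_real)
          qed
          have sep: "Sup (snd (h i)) \<le> Inf (snd (h j)) \<or> Sup (snd (h j)) \<le> Inf (snd (h i))"
            if ij: "i < card ?R" "j < card ?R" "i \<noteq> j" for i j
          proof (rule ccontr)
            assume "\<not> ?thesis"
            then have "max (Inf (snd (h i))) (Inf (snd (h j))) < min (Sup (snd (h i))) (Sup (snd (h j)))"
              using hK[OF ij(1)] hK[OF ij(2)] by auto
            then obtain y where "max (Inf (snd (h i))) (Inf (snd (h j))) < y" "y < min (Sup (snd (h i))) (Sup (snd (h j)))"
              using dense by blast
            then have "y \<in> {Inf (snd (h i))<..<Sup (snd (h i))} \<inter> {Inf (snd (h j))<..<Sup (snd (h j))}" by auto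
            then show False using dis[OF ij] by blast
          qed
          have "ennreal (\<Sum>i<card ?R. Sup (snd (h i)) - Inf (snd (h i))) = (\<Sum>i<card ?R. emeasure lborel {Inf (snd (h i))<..<Sup (snd (h i))})"
            using hK by (subst sum_ennreal[symmetric]) (auto simp: less_imp_le)
          also have "\<dots> = emeasure lborel (\<Union>i<card ?R. {Inf (snd (h i))<..<Sup (snd (h i))})"
            using dis by (intro sum_emeasure) (auto simp: disjoint_family_on_def)
          also have "\<dots> \<le> emeasure lborel U"
          proof (rule emeasure_mono)
            show "(\<Union>i<card ?R. {Inf (snd (h i))<..<Sup (snd (h i))}) \<subseteq> U"
            proof (rule UN_least)
              fix i assume i: "i \<in> {..<card ?R}"
              have hp: "h i \<in> p" "fst (h i) \<in> N" using hR[of i] i by auto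
              have "snd (h i) \<subseteq> \<gamma> (fst (h i))" using fine hp(1) unfolding fine_def by (auto simp: split_beta)
              then have "snd (h i) \<subseteq> U" using hp(2) by (simp add: \<gamma>_def)
              moreover have "{Inf (snd (h i))<..<Sup (snd (h i))} \<subseteq> {Inf (snd (h i))..Sup (snd (h i))}" by auto
              moreover have "snd (h i) = {Inf (snd (h i))..Sup (snd (h i))}" using hK[of i] i by blast
              ultimately show "{Inf (snd (h i))<..<Sup (snd (h i))} \<subseteq> U" by blast
            qed
          qed (use U in auto)
          also have "\<dots> < ennreal \<delta>" by fact
          finally have small: "(\<Sum>i<card ?R. Sup (snd (h i)) - Inf (snd (h i))) < \<delta>"
            using hK \<delta>(1) by (subst (asm) ennreal_less_iff) (auto intro!: sum_nonneg simp: less_imp_le)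
          have "(\<Sum>(x,K)\<in>?R. norm (?inc K)) = (\<Sum>q\<in>?R. norm (?inc (snd q)))" by (simp add: split_beta)
          also have "\<dots> = (\<Sum>i<card ?R. norm (?inc (snd (h i))))" by (rule sum.reindex_bij_betw[OF h, symmetric])
          also have "\<dots> < e / 3"
            using \<delta>(2)[of "card ?R" "\<lambda>i. Inf (snd (h i))" "\<lambda>i. Sup (snd (h i))"] small sep hK by (auto simp: less_imp_le)
          finally show ?thesis .
        qed
        finally show ?thesis .
      qed
      show "norm ((\<Sum>(x, k)\<in>p. measure lborel k *\<^sub>R f x) - (g b - g a)) < e"
        unfolding split using Q P e norm_triangle_ineq4[of "\<Sum>(x,K)\<in>?Q. measure lborel K *\<^sub>R g' x - ?inc K" "\<Sum>(x,K)\<in>?P. ?inc K"]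
        by linarith
    qed
  qed
  then show ?thesis using N by (rule has_integral_spike[rotated 2]) (auto simp: f_def)
qed

subsection \<open>Dyadic sums against a weight\<close>

text \<open>Intervals are given by left endpoint and length. The cutoff after \<open>n\<close>
  generations keeps every sum finite; the estimates are uniform in \<open>n\<close>.\<close>

primrec dyadic_sum :: "(real \<Rightarrow> real \<Rightarrow> real) \<Rightarrow> (real \<Rightarrow> real \<Rightarrow> real) \<Rightarrow> nat \<Rightarrow> real \<Rightarrow> real \<Rightarrow> real" where
  "dyadic_sum W \<tau> 0 a l = 0"
| "dyadic_sum W \<tau> (Suc n) a l =
     l / W a l * \<tau> a l + dyadic_sum W \<tau> n a (l/2) + dyadic_sum W \<tau> n (a + l/2) (l/2)"

text \<open>The union of the maximal dyadic subintervals, down to generation \<open>n\<close>, on which the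
  ratio of length to weight exceeds the threshold \<open>L\<close>.\<close>
primrec stopped :: "(real \<Rightarrow> real \<Rightarrow> real) \<Rightarrow> real \<Rightarrow> nat \<Rightarrow> real \<Rightarrow> real \<Rightarrow> real set" where
  "stopped W L 0 a l = (if l / W a l > L then {a..<a+l} else {})"
| "stopped W L (Suc n) a l = (if l / W a l > L then {a..<a+l}
     else stopped W L n a (l/2) \<union> stopped W L n (a + l/2) (l/2))"

lemma stopped_subset: "0 < l \<Longrightarrow> stopped W L n a l \<subseteq> {a..<a+l}"
proof (induction n arbitrary: a l)
  case 0
  then show ?case by auto
next
  case (Suc n)
  have "stopped W L n a (l/2) \<subseteq> {a..<a+l/2}" "stopped W L n (a+l/2) (l/2) \<subseteq> {a+l/2..<a+l/2+l/2}"
    using Suc by (meson half_gt_zero)+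
  moreover have "{a..<a+l/2} \<subseteq> {a..<a+l}" "{a+l/2..<a+l/2+l/2} \<subseteq> {a..<a+l}"
    using Suc.prems by (auto simp: field_simps)
  ultimately have "stopped W L n a (l/2) \<union> stopped W L n (a + l/2) (l/2) \<subseteq> {a..<a+l}" by blast
  then show ?case by (simp only: stopped.simps) (auto)
qed

lemma stopped_borel: "stopped W L n a l \<in> sets borel"
  by (induction n arbitrary: a l) auto

lemma stopped_measure:
  assumes "0 < l" "\<not> l / W a l > L"
  shows "measure lborel (stopped W L (Suc n) a l)
       = measure lborel (stopped W L n a (l/2)) + measure lborel (stopped W L n (a + l/2) (l/2))"
proof -
  have sub: "stopped W L n a (l/2) \<subseteq> {a..<a+l/2}" "stopped W L n (a+l/2) (l/2) \<subseteq> {a+l/2..<a+l/2+l/2}"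
    using stopped_subset assms(1) by (meson half_gt_zero)+
  have fin: "emeasure lborel (stopped W L n b k) < \<infinity>" if "0 < k" for b k
  proof -
    have "emeasure lborel (stopped W L n b k) \<le> emeasure lborel {b..b+k}"
      using stopped_subset[OF that, of W L n b] by (intro emeasure_mono) auto
    also have "\<dots> < \<infinity>" using that by simp
    finally show ?thesis .
  qed
  have "measure lborel (stopped W L n a (l/2) \<union> stopped W L n (a + l/2) (l/2))
     = measure lborel (stopped W L n a (l/2)) + measure lborel (stopped W L n (a + l/2) (l/2))"
  proof (rule measure_Un_AE)
    show "AE x in lborel. x \<notin> stopped W L n a (l/2) \<or> x \<notin> stopped W L n (a + l/2) (l/2)"
      using sub by (intro AE_I2) (fastforce)
    show "stopped W L n a (l/2) \<in> fmeasurable lborel" "stopped W L n (a + l/2) (l/2) \<in> fmeasurable lborel"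
      using fin[of "l/2"] assms(1) by (auto simp: fmeasurable_def stopped_borel)
  qed
  then show ?thesis using assms by simp
qed

text \<open>\<open>small\<close> is the A_infinity condition seen from the complement: a set
  carrying at most half of the mass misses a fixed share \<open>c\<close> of the length. The bound
  \<open>l0\<close> on the scale allows the argument to be run on short intervals only.\<close>

locale dyadic_weight =
  fixes m :: "real set \<Rightarrow> real" and c l0 :: real
  assumes m_empty: "m {} = 0"
    and m_Un: "\<And>A B. A \<in> sets borel \<Longrightarrow> B \<in> sets borel \<Longrightarrow> bounded A \<Longrightarrow> bounded B \<Longrightarrow> m (A \<union> B) \<le> m A + m B"
    and m_pos: "\<And>a l. 0 < l \<Longrightarrow> l \<le> l0 \<Longrightarrow> 0 < m {a..<a+l}"
    and c: "0 < c" "c \<le> 1"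
    and small: "\<And>a l E. 0 < l \<Longrightarrow> l \<le> l0 \<Longrightarrow> E \<in> sets borel \<Longrightarrow> E \<subseteq> {a..<a+l} \<Longrightarrow>
        2 * m E \<le> m {a..<a+l} \<Longrightarrow> measure lborel E \<le> (1 - c) * l"
begin

abbreviation "W \<equiv> \<lambda>a l. m {a..<a+l}"

text \<open>Each maximal interval satisfies L * W \<le> length by its stopping rule. Summation uses
  subadditivity of \<open>m\<close> on the left and additivity of length on the right.\<close>

lemma m_stopped:
  assumes "0 < l" "l \<le> l0" "0 < L"
  shows "L * m (stopped W L n a l) \<le> measure lborel (stopped W L n a l)"
  using assms
proof (induction n arbitrary: a l)
  case 0
  have "L * W a l \<le> l" if "L < l / W a l"
    using that m_pos[of l a] 0 by (simp add: field_simps)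
  then show ?case using 0 by (auto simp: m_empty)
next
  case (Suc n)
  show ?case
  proof (cases "L < l / W a l")
    case True
    then have "L * W a l \<le> l" 
      using m_pos[of l a] Suc by (simp add: field_simps)
    then show ?thesis using True Suc by auto
  next
    case False
    have bd: "bounded (stopped W L n b k)" if "0 < k" for b k
      by (rule bounded_subset[OF _ stopped_subset[OF that]]) auto
    have "L * m (stopped W L (Suc n) a l) \<le> L * (m (stopped W L n a (l/2)) + m (stopped W L n (a + l/2) (l/2)))"
      using False Suc.prems bd[of "l/2"] by (auto intro!: mult_left_mono m_Un stopped_borel)
    also have "\<dots> \<le> measure lborel (stopped W L n a (l/2)) + measure lborel (stopped W L n (a + l/2) (l/2))"
      using Suc.IH[of "l/2" a] Suc.IH[of "l/2" "a+l/2"] Suc.prems by (simp add: distrib_left)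
    also have "\<dots> = measure lborel (stopped W L (Suc n) a l)"
      using stopped_measure[of l L W a n] False Suc.prems by simp
    finally show ?thesis .
  qed
qed

text \<open>Here \<nu> stands for the measure of a whole Carleson box and \<tau> for that of its top
  half; \<open>split\<close> reflects that the top half and the two child boxes are disjoint parts
  of the box.\<close>

context
  fixes \<tau> \<nu> :: "real \<Rightarrow> real \<Rightarrow> real" and M :: real
  assumes \<tau>0: "\<And>a l. 0 < l \<Longrightarrow> l \<le> l0 \<Longrightarrow> 0 \<le> \<tau> a l"
    and \<nu>0: "\<And>a l. 0 < l \<Longrightarrow> l \<le> l0 \<Longrightarrow> 0 \<le> \<nu> a l"
    and split: "\<And>a l. 0 < l \<Longrightarrow> l \<le> l0 \<Longrightarrow> \<tau> a l + \<nu> a (l/2) + \<nu> (a + l/2) (l/2) \<le> \<nu> a l"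
    and \<nu>_le: "\<And>a l. 0 < l \<Longrightarrow> l \<le> l0 \<Longrightarrow> \<nu> a l \<le> M * W a l"
begin

abbreviation "S \<equiv> dyadic_sum W \<tau>"

text \<open>On intervals that are not stopped the coefficient is at most \<open>L\<close>, and their
  \<tau> add up to at most \<nu> of the base. A stopped interval keeps its whole subtree, which the
  assumed bound \<open>s\<close> estimates by length.\<close>

lemma dyadic_sum_stopped:
  assumes "0 < l" "l \<le> l0" "0 < L" "0 \<le> s"
    and s: "\<And>a l k. k \<le> n \<Longrightarrow> 0 < l \<Longrightarrow> l \<le> l0 \<Longrightarrow> S k a l \<le> s * l"
  shows "S n a l \<le> L * \<nu> a l + s * measure lborel (stopped W L n a l)"
  using assms
proof (induction n arbitrary: a l)
  case 0
  then show ?case using \<nu>0[of l a] by auto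
next
  case (Suc n)
  show ?case
  proof (cases "L < l / W a l")
    case True
    have "S (Suc n) a l \<le> s * l" using Suc.prems by blast
    moreover have "0 \<le> L * \<nu> a l" using \<nu>0[of l a] Suc.prems by simp
    ultimately show ?thesis using True Suc.prems by auto
  next
    case False
    have "S n a (l/2) \<le> L * \<nu> a (l/2) + s * measure lborel (stopped W L n a (l/2))"
      "S n (a+l/2) (l/2) \<le> L * \<nu> (a+l/2) (l/2) + s * measure lborel (stopped W L n (a+l/2) (l/2))"
      by (rule Suc.IH; use Suc.prems in auto)+
    moreover have "l / W a l * \<tau> a l \<le> L * \<tau> a l"
      using False \<tau>0[of l a] Suc.prems by (intro mult_right_mono) auto
    moreover have "L * (\<tau> a l + \<nu> a (l/2) + \<nu> (a + l/2) (l/2)) \<le> L * \<nu> a l"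
      using split[of l a] Suc.prems by (intro mult_left_mono) auto
    moreover have "measure lborel (stopped W L (Suc n) a l) = measure lborel (stopped W L n a (l/2)) + measure lborel (stopped W L n (a+l/2) (l/2))"
      using stopped_measure[of l L W a n] False Suc.prems by auto
    ultimately show ?thesis by (simp only: dyadic_sum.simps distrib_left)
  qed
qed

text \<open>The threshold is twice the ratio of the base interval. Then L * m of the stopped set is
  at most l, that is, the stopped set has at most half of the mass, and \<open>small\<close> leaves
  it at most (1 - c) * l of the length. The other intervals cost L * M * W = 2 * M * l.\<close>

lemma dyadic_sum_improve:
  assumes "0 \<le> s" and s: "\<And>a l k. k \<le> n \<Longrightarrow> 0 < l \<Longrightarrow> l \<le> l0 \<Longrightarrow> S k a l \<le> s * l"
    and "k \<le> n" "0 < l" "l \<le> l0"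
  shows "S k a l \<le> (2 * M + (1 - c) * s) * l"
proof -
  define L where "L = 2 * l / W a l"
  have Wp: "0 < W a l" using m_pos assms by blast
  then have L: "0 < L" using assms by (simp add: L_def)
  let ?E = "stopped W L k a l"
  have "measure lborel ?E \<le> measure lborel {a..<a+l}"
  proof (rule measure_mono_fmeasurable)
    show "{a..<a+l} \<in> fmeasurable lborel" using assms(4) by (auto simp: fmeasurable_def)
  qed (use stopped_subset[OF assms(4)] stopped_borel in auto)
  then have "L * m ?E \<le> l" using m_stopped[OF assms(4,5) L, of k a] assms(4) by simp
  then have "2 * m ?E \<le> W a l" using Wp assms(4) by (simp add: L_def field_simps)
  then have "measure lborel ?E \<le> (1 - c) * l"
    using small[OF assms(4,5) stopped_borel stopped_subset[OF assms(4)]] by blast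
  then have "s * measure lborel ?E \<le> s * ((1 - c) * l)" using assms(1) by (rule mult_left_mono)
  moreover have "S k a l \<le> L * \<nu> a l + s * measure lborel ?E"
    using assms L by (intro dyadic_sum_stopped) auto
  moreover have "L * \<nu> a l \<le> L * (M * W a l)" using \<nu>_le[OF assms(4,5)] L by (intro mult_left_mono) auto
  moreover have "L * (M * W a l) = 2 * M * l" using Wp by (simp add: L_def)
  ultimately show ?thesis by (simp add: algebra_simps)
qed

text \<open>One generation costs at most M * l, since \<tau> \<le> \<nu> \<le> M * W on each of its
  intervals.\<close>

lemma dyadic_sum_crude:
  assumes "0 \<le> M" shows "0 < l \<Longrightarrow> l \<le> l0 \<Longrightarrow> S n a l \<le> real n * M * l"
proof (induction n arbitrary: a l)
  case (Suc n)
  have Wp: "0 < W a l" using m_pos Suc.prems by blast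
  have "\<tau> a l \<le> M * W a l"
    using split[OF Suc.prems, of a] \<nu>_le[OF Suc.prems, of a] \<nu>0[of "l/2" a] \<nu>0[of "l/2" "a+l/2"] Suc.prems by auto
  then have "l / W a l * \<tau> a l \<le> l / W a l * (M * W a l)" using Suc.prems Wp by (intro mult_left_mono) auto
  also have "\<dots> = M * l" using Wp by simp
  finally show ?case using Suc.IH[of "l/2" a] Suc.IH[of "l/2" "a+l/2"] Suc.prems by (simp add: algebra_simps)
qed auto

theorem dyadic_sum_le:
  assumes "0 \<le> M" "0 < l" "l \<le> l0" shows "S n a l \<le> 2 * M / c * l"
proof -
  \<comment> \<open>The iterates of s \<mapsto> 2 * M + (1 - c) * s with fixed point 2 * M / c,
    started above the crude bound. For fixed \<open>n\<close> the limit in \<open>j\<close> removes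
    the term that depends on \<open>n\<close>.\<close>
  define s where "s j = 2 * M / c + (1 - c) ^ j * (real n * M)" for j
  have s0: "0 \<le> s j" for j using assms c by (auto simp: s_def)
  have *: "S k b r \<le> s j * r" if "k \<le> n" "0 < r" "r \<le> l0" for j k b r
    using that
  proof (induction j arbitrary: k b r)
    case 0
    have "S k b r \<le> real k * M * r" by (rule dyadic_sum_crude) (use assms 0 in auto)
    also have "\<dots> \<le> s 0 * r"
    proof (rule mult_right_mono)
      have "real k * M \<le> real n * M" using 0 assms by (intro mult_right_mono) auto
      then show "real k * M \<le> s 0" using assms c by (simp add: s_def add_increasing)
    qed (use 0 in auto)
    finally show ?case .
  next
    case (Suc j)
    have "S k b r \<le> (2 * M + (1 - c) * s j) * r"
      using dyadic_sum_improve[OF s0 Suc.IH] Suc.prems by blast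
    also have "2 * M + (1 - c) * s j = s (Suc j)"
      using c by (simp add: s_def field_simps)
    finally show ?case .
  qed
  have "norm (1 - c) < 1" using c by (simp add: abs_if)
  then have "(\<lambda>j. (1 - c) ^ j) \<longlonglongrightarrow> 0" by (rule LIMSEQ_power_zero)
  then have "(\<lambda>j. s j * l) \<longlonglongrightarrow> (2 * M / c + 0 * (real n * M)) * l"
    unfolding s_def by (intro tendsto_mult tendsto_add tendsto_const)
  then show ?thesis using *[of n l a] assms by (intro LIMSEQ_le_const[of "\<lambda>j. s j * l"]) auto
qed

end
end

subsection \<open>Linear measure and arc length\<close>

abbreviation node :: "real \<Rightarrow> real \<Rightarrow> nat \<Rightarrow> nat \<Rightarrow> real" where
  "node a b n i \<equiv> a + real i * (b - a) / real n"

text \<open>Fatou's lemma for the step functions \<open>w m\<close> whose values are the chord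
  slopes over the cells of the equal partition into m + 1 parts: they converge to the norm of the
  derivative wherever it exists, and their integrals are the partition sums.\<close>

lemma nn_integral_derivative_le_partition_sums:
  fixes g :: "real \<Rightarrow> complex"
  assumes ab: "a < b" and N: "negligible N"
    and der: "\<And>t. t \<in> {a..b} - N \<Longrightarrow> (g has_vector_derivative g' t) (at t)"
    and B: "\<And>n. 0 < n \<Longrightarrow> ennreal (\<Sum>i<n. cmod (g (node a b n (Suc i)) - g (node a b n i))) \<le> B"
  shows "(\<integral>\<^sup>+t\<in>{a..b}. ennreal (cmod (g' t)) \<partial>lebesgue) \<le> B"
proof -
  define nd where "nd m i = node a b (Suc m) i" for m i
  define \<Delta> where "\<Delta> m i = cmod (g (nd m (Suc i)) - g (nd m i)) * (real (Suc m) / (b - a))" for m i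
  define w where "w m t = (\<Sum>i<Suc m. ennreal (\<Delta> m i) * indicator {nd m i<..<nd m (Suc i)} t)" for m t
  have len: "nd m (Suc i) - nd m i = (b - a) / real (Suc m)" for m i
    by (simp add: nd_def distrib_right add_divide_distrib)
  have \<Delta>0: "0 \<le> \<Delta> m i" for m i using ab by (simp add: \<Delta>_def)
  have ndlt: "nd m i < nd m (Suc i)" for m i
    using len[of m i] ab by (smt (verit) divide_pos_pos of_nat_0_less_iff zero_less_Suc)
  have meas: "(\<lambda>t. c * indicator {x<..<y} t) \<in> borel_measurable lebesgue" for c :: ennreal and x y :: real
    by (intro borel_measurable_times_ennreal borel_measurable_const borel_measurable_indicator) auto
  have intw: "(\<integral>\<^sup>+t. w m t \<partial>lebesgue) \<le> B" for m
  proof -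
    have "(\<integral>\<^sup>+t. w m t \<partial>lebesgue) = (\<Sum>i<Suc m. ennreal (\<Delta> m i) * emeasure lebesgue {nd m i<..<nd m (Suc i)})"
      unfolding w_def by (subst nn_integral_sum[OF meas]) (auto simp: nn_integral_cmult_indicator)
    also have "\<dots> = (\<Sum>i<Suc m. ennreal (cmod (g (nd m (Suc i)) - g (nd m i))))"
    proof (rule sum.cong)
      fix i
      have "emeasure lebesgue {nd m i<..<nd m (Suc i)} = ennreal ((b - a) / real (Suc m))"
        using ndlt[of m i] len[of m i] by simp
      then show "ennreal (\<Delta> m i) * emeasure lebesgue {nd m i<..<nd m (Suc i)} = ennreal (cmod (g (nd m (Suc i)) - g (nd m i)))"
        using ab by (simp add: ennreal_mult[symmetric] \<Delta>_def)
    qed simp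
    also have "\<dots> = ennreal (\<Sum>i<Suc m. cmod (g (nd m (Suc i)) - g (nd m i)))" by (rule sum_ennreal) auto
    also have "\<dots> \<le> B" unfolding nd_def by (rule B) simp
    finally show ?thesis .
  qed
  \<comment> \<open>The partition points, a countable set. Away from them a point lies in the
    interior of exactly one cell at each stage.\<close>
  define Z where "Z = (\<Union>m. range (nd m))"
  have Z: "negligible Z"
    unfolding negligible_iff_null_sets Z_def
    by (intro null_sets_completionI countable_imp_null_set_lborel) auto
  have lim: "(\<lambda>m. w m t) \<longlonglongrightarrow> ennreal (cmod (g' t))" if t: "t \<in> {a..b} - N" "t \<notin> Z" for t
  proof -
    define j where "j m = nat \<lfloor>(t - a) * real (Suc m) / (b - a)\<rfloor>" for m
    have j: "nd m (j m) < t \<and> t < nd m (Suc (j m)) \<and> j m < Suc m" for m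
    proof -
      let ?x = "(t - a) * real (Suc m) / (b - a)"
      have "0 \<le> ?x" using t ab by (auto simp: divide_simps)
      then have jx: "real (j m) = of_int \<lfloor>?x\<rfloor>" by (simp add: j_def)
      have 1: "real (j m) \<le> ?x" "?x < real (j m) + 1" unfolding jx by linarith+
      have tn: "nd m i \<noteq> t" for i using t by (auto simp: Z_def)
      have "nd m (j m) \<le> t" using 1(1) ab by (simp add: nd_def field_simps)
      moreover have "t < nd m (Suc (j m))" using 1(2) ab by (simp add: nd_def field_simps)
      moreover have "j m < Suc m"
      proof (rule ccontr)
        assume "\<not> j m < Suc m"
        then have "real (Suc m) \<le> real (j m)" by (simp only: of_nat_le_iff not_less)
        then have "real (Suc m) \<le> ?x" using 1(1) by linarith
        moreover have "0 < b - a" using ab by simp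
        ultimately have "real (Suc m) * (b - a) \<le> (t - a) * real (Suc m)" by (simp only: pos_le_divide_eq)
        then have "real (Suc m) * (b - a) \<le> real (Suc m) * (t - a)" by (simp only: mult.commute)
        then have "b - a \<le> t - a" by (rule mult_left_le_imp_le) simp
        then have "t = b" using t by auto
        moreover have "nd m (Suc m) = b" by (simp add: nd_def del: of_nat_Suc)
        ultimately show False using tn by blast
      qed
      ultimately show ?thesis using tn[of "j m"] by simp
    qed
    have weq: "w m t = ennreal (\<Delta> m (j m))" for m
    proof -
      have uniq: "i = j m" if "t \<in> {nd m i<..<nd m (Suc i)}" for i
      proof -
        have mono: "nd m p \<le> nd m q" if "p \<le> q" for p q
          using that ab unfolding nd_def by (auto intro!: divide_right_mono mult_right_mono)
        show ?thesis
        proof (rule ccontr)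
          assume "i \<noteq> j m"
          then consider "Suc i \<le> j m" | "Suc (j m) \<le> i" by linarith
          then show False using mono[of "Suc i" "j m"] mono[of "Suc (j m)" i] j[of m] that by cases auto
        qed
      qed
      have "w m t = (\<Sum>i<Suc m. if i = j m then ennreal (\<Delta> m i) else 0)"
        unfolding w_def by (intro sum.cong) (use uniq j[of m] in \<open>auto simp: indicator_def\<close>)
      also have "\<dots> = ennreal (\<Delta> m (j m))" using j[of m] by (subst sum.delta) auto
      finally show ?thesis .
    qed
    have "(\<lambda>m. \<Delta> m (j m)) \<longlonglongrightarrow> cmod (g' t)"
    proof (rule LIMSEQ_I)
      fix e :: real assume "0 < e"
      then have "0 < e/2" by simp
      from straddle_derivative[OF der[OF t(1)] this] obtain d where d: "d > 0"
        "\<forall>u v. u \<le> t \<and> t \<le> v \<and> v - u < d \<longrightarrow> norm (g v - g u - (v - u) *\<^sub>R g' t) \<le> e/2 * (v - u)" by auto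
      obtain M :: nat where M: "(b - a) / d < real M" using reals_Archimedean2 by blast
      show "\<exists>no. \<forall>n\<ge>no. norm (\<Delta> n (j n) - cmod (g' t)) < e"
      proof (intro exI[of _ M] allI impI)
        fix n assume "M \<le> n"
        let ?u = "nd n (j n)" and ?v = "nd n (Suc (j n))"
        define h where "h = ?v - ?u"
        have h: "0 < h" "h = (b - a) / real (Suc n)" using ndlt[of n "j n"] len[of n "j n"] by (simp_all add: h_def)
        have "(b - a) / d < real (Suc n)" using M \<open>M \<le> n\<close> by linarith
        then have "h < d" using d(1) unfolding h(2) by (simp add: field_simps)
        then have "norm (g ?v - g ?u - h *\<^sub>R g' t) \<le> e/2 * h" using d(2) j[of n] by (simp add: h_def)
        moreover have "\<bar>norm (g ?v - g ?u) - norm (h *\<^sub>R g' t)\<bar> \<le> norm (g ?v - g ?u - h *\<^sub>R g' t)"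
          by (rule norm_triangle_ineq3)
        moreover have "norm (h *\<^sub>R g' t) = h * cmod (g' t)" using h(1) by simp
        ultimately have *: "\<bar>norm (g ?v - g ?u) - h * cmod (g' t)\<bar> \<le> e/2 * h" by linarith
        have "\<Delta> n (j n) = norm (g ?v - g ?u) / h" using ab by (simp add: \<Delta>_def h(2))
        then have "\<Delta> n (j n) - cmod (g' t) = (norm (g ?v - g ?u) - h * cmod (g' t)) / h" using h(1) by (simp add: field_simps)
        then have "norm (\<Delta> n (j n) - cmod (g' t)) = \<bar>norm (g ?v - g ?u) - h * cmod (g' t)\<bar> / h" using h(1) by (simp add: abs_divide)
        also have "\<dots> \<le> e / 2" using * h(1) by (simp add: field_simps)
        finally show "norm (\<Delta> n (j n) - cmod (g' t)) < e" using \<open>0 < e\<close> by simp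
      qed
    qed
    then show ?thesis unfolding weq by (intro tendsto_ennrealI)
  qed
  have "(\<integral>\<^sup>+t\<in>{a..b}. ennreal (cmod (g' t)) \<partial>lebesgue) \<le> (\<integral>\<^sup>+t. liminf (\<lambda>m. w m t) \<partial>lebesgue)"
  proof (rule nn_integral_mono_AE)
    have "AE t in lebesgue. t \<notin> N \<union> Z"
      using negligible_Un[OF N Z] by (simp only: negligible_iff_null_sets AE_not_in)
    then show "AE t in lebesgue. ennreal (cmod (g' t)) * indicator {a..b} t \<le> liminf (\<lambda>m. w m t)"
    proof (eventually_elim)
      fix t assume "t \<notin> N \<union> Z"
      then show "ennreal (cmod (g' t)) * indicator {a..b} t \<le> liminf (\<lambda>m. w m t)"
      proof (cases "t \<in> {a..b}")
        case True
        then have "liminf (\<lambda>m. w m t) = ennreal (cmod (g' t))"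
          using \<open>t \<notin> N \<union> Z\<close> by (intro lim_imp_Liminf lim) auto
        then show ?thesis using True by simp
      qed simp
    qed
  qed
  also have "\<dots> \<le> liminf (\<lambda>m. \<integral>\<^sup>+t. w m t \<partial>lebesgue)"
    unfolding w_def by (intro nn_integral_liminf borel_measurable_sum meas)
  also have "\<dots> \<le> B"
    by (rule Liminf_le) (auto intro: always_eventually intw)
  finally show ?thesis .
qed

lemma hausdorff1_mono: "E \<subseteq> E' \<Longrightarrow> hausdorff1 E \<le> hausdorff1 E'"
  unfolding hausdorff1_def by (intro SUP_mono' INF_superset_mono) auto

text \<open>The distance from \<open>x\<close> maps the connected set \<open>K\<close> onto a set
  containing {0..dist x y}. Each cover set that meets \<open>K\<close> is sent into an interval of
  twice its diameter, which explains the factor 2; cover sets that miss \<open>K\<close> cost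
  nothing.\<close>

lemma cmod_diff_le_cover_sum:
  fixes U :: "nat \<Rightarrow> complex set"
  assumes K: "connected K" "x \<in> K" "y \<in> K" "K \<subseteq> (\<Union>k. U k)" and bd: "\<And>k. bounded (U k)"
  shows "ennreal (cmod (y - x)) \<le> (\<Sum>k. 2 * (if U k \<inter> K = {} then 0 else ennreal (diameter (U k))))"
proof -
  define J where "J k = (if U k \<inter> K = {} then {} else
      {dist x (SOME z. z \<in> U k \<inter> K) - diameter (U k)..dist x (SOME z. z \<in> U k \<inter> K) + diameter (U k)})" for k
  have "connected (dist x ` K)" by (intro connected_continuous_image continuous_intros K)
  then have "{0..dist x y} \<subseteq> dist x ` K"
    using K(2,3) connected_contains_Icc[of "dist x ` K" "dist x x" "dist x y"] by auto
  moreover have "dist x ` K \<subseteq> (\<Union>k. J k)"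
  proof clarify
    fix z assume z: "z \<in> K"
    then obtain k where k: "z \<in> U k" using K by auto
    then have ne: "U k \<inter> K \<noteq> {}" using z by auto
    let ?s = "SOME z. z \<in> U k \<inter> K"
    have "?s \<in> U k \<inter> K" using ne by (intro someI_ex[of "\<lambda>z. z \<in> U k \<inter> K"]) auto
    then have "dist z ?s \<le> diameter (U k)" using k by (intro diameter_bounded_bound bd) auto
    moreover have "dist x z \<le> dist x ?s + dist z ?s" "dist x ?s \<le> dist x z + dist z ?s"
      by (metis dist_commute dist_triangle)+
    ultimately have "dist x z \<in> J k" using ne by (simp add: J_def)
    then show "dist x z \<in> (\<Union>k. J k)" by blast
  qed
  ultimately have "{0..dist x y} \<subseteq> (\<Union>k. J k)" by blast
  then have "emeasure lborel {0..dist x y} \<le> emeasure lborel (\<Union>k. J k)"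
    by (intro emeasure_mono) (auto simp: J_def)
  also have "\<dots> \<le> (\<Sum>k. emeasure lborel (J k))"
    by (intro emeasure_subadditive_countably) (auto simp: J_def)
  also have "(\<lambda>k. emeasure lborel (J k)) = (\<lambda>k. 2 * (if U k \<inter> K = {} then 0 else ennreal (diameter (U k))))"
  proof
    fix k
    have "0 \<le> diameter (U k)" using bd by (rule diameter_ge_0)
    then show "emeasure lborel (J k) = 2 * (if U k \<inter> K = {} then 0 else ennreal (diameter (U k)))"
      by (auto simp: J_def ennreal_mult''[symmetric] simp flip: ennreal_numeral ennreal_mult)
  qed
  finally show ?thesis by (simp add: dist_norm norm_minus_commute)
qed

lemma separated_compact_family:
  fixes K :: "nat \<Rightarrow> complex set"
  assumes "\<And>i. compact (K i)" "\<And>i j. i < n \<Longrightarrow> j < n \<Longrightarrow> i \<noteq> j \<Longrightarrow> K i \<inter> K j = {}"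
  obtains \<delta> where "0 < \<delta>" "\<And>i j x y. i < n \<Longrightarrow> j < n \<Longrightarrow> i \<noteq> j \<Longrightarrow> x \<in> K i \<Longrightarrow> y \<in> K j \<Longrightarrow> \<delta> \<le> dist x y"
proof -
  have "\<exists>d>0. i < n \<and> j < n \<and> i \<noteq> j \<longrightarrow> (\<forall>x\<in>K i. \<forall>y\<in>K j. d \<le> dist x y)" for i j
  proof (cases "i < n \<and> j < n \<and> i \<noteq> j")
    case True
    then show ?thesis using separate_compact_closed[of "K i" "K j"] assms by (auto simp: compact_imp_closed)
  next
    case False
    then show ?thesis by (intro exI[of _ 1]) auto
  qed
  then obtain d where d: "\<And>i j. 0 < d i j" "\<And>i j x y. i < n \<Longrightarrow> j < n \<Longrightarrow> i \<noteq> j \<Longrightarrow> x \<in> K i \<Longrightarrow> y \<in> K j \<Longrightarrow> d i j \<le> dist x y"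
    by metis
  define \<delta> where "\<delta> = Min (insert 1 ((\<lambda>(i,j). d i j) ` ({..<n} \<times> {..<n})))"
  show thesis
  proof
    show "0 < \<delta>" unfolding \<delta>_def using d(1) by (subst Min_gr_iff) auto
    fix i j x y assume ij: "i < n" "j < n" "i \<noteq> j" "x \<in> K i" "y \<in> K j"
    have "\<delta> \<le> d i j" unfolding \<delta>_def using ij by (intro Min_le) auto
    then show "\<delta> \<le> dist x y" using d(2)[OF ij] by simp
  qed
qed

text \<open>Disjoint compact sets have a positive distance \<delta>, and a set of diameter at most
  \<delta>/2 meets at most one of them. Hence the cover sums of the single pieces add up without
  multiple counting.\<close>

lemma separated_sum_le_hausdorff1:
  fixes K :: "nat \<Rightarrow> complex set"
  assumes K: "\<And>i. compact (K i)" "\<And>i. connected (K i)" "\<And>i j. i < n \<Longrightarrow> j < n \<Longrightarrow> i \<noteq> j \<Longrightarrow> K i \<inter> K j = {}"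
    "\<And>i. i < n \<Longrightarrow> K i \<subseteq> E" and xy: "\<And>i. i < n \<Longrightarrow> x i \<in> K i" "\<And>i. i < n \<Longrightarrow> y i \<in> K i"
  shows "ennreal (\<Sum>i<n. cmod (y i - x i)) \<le> 2 * hausdorff1 E"
proof -
  obtain \<delta> where \<delta>: "0 < \<delta>" "\<And>i j x y. i < n \<Longrightarrow> j < n \<Longrightarrow> i \<noteq> j \<Longrightarrow> x \<in> K i \<Longrightarrow> y \<in> K j \<Longrightarrow> \<delta> \<le> dist x y"
    by (rule separated_compact_family[of K n, OF K(1) K(3)]) (assumption | rule that)+
  let ?C = "{U::nat \<Rightarrow> complex set. E \<subseteq> (\<Union>i. U i) \<and> (\<forall>i. bounded (U i) \<and> diameter (U i) \<le> \<delta>/2)}"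
  have "ennreal (\<Sum>i<n. cmod (y i - x i)) \<le> 2 * (\<Sum>k. ennreal (diameter (U k)))" if U: "U \<in> ?C" for U
  proof -
    define c where "c i k = (if U k \<inter> K i = {} then 0 else ennreal (diameter (U k)))" for i k
    have "ennreal (\<Sum>i<n. cmod (y i - x i)) = (\<Sum>i<n. ennreal (cmod (y i - x i)))" by (rule sum_ennreal[symmetric]) auto
    also have "\<dots> \<le> (\<Sum>i<n. \<Sum>k. 2 * c i k)"
      unfolding c_def
    proof (intro sum_mono cmod_diff_le_cover_sum)
      fix i assume i: "i \<in> {..<n}"
      show "K i \<subseteq> (\<Union>k. U k)" using K(4)[of i] U i by blast
    qed (use U K xy in auto)
    also have "\<dots> = (\<Sum>k. \<Sum>i<n. 2 * c i k)" by (rule suminf_sum[symmetric]) auto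
    also have "\<dots> \<le> (\<Sum>k. 2 * ennreal (diameter (U k)))"
    proof (rule suminf_le)
      fix k
      have "(\<Sum>i<n. c i k) \<le> ennreal (diameter (U k))"
      proof (cases "\<exists>i<n. U k \<inter> K i \<noteq> {}")
        case True
        then obtain i0 where i0: "i0 < n" "U k \<inter> K i0 \<noteq> {}" by blast
        have "U k \<inter> K i = {}" if "i < n" "i \<noteq> i0" for i
        proof (rule ccontr)
          assume "U k \<inter> K i \<noteq> {}"
          then obtain p q where pq: "p \<in> U k" "p \<in> K i" "q \<in> U k" "q \<in> K i0" using i0 by blast
          have "dist p q \<le> diameter (U k)" using pq U by (intro diameter_bounded_bound) auto
          also have "\<dots> \<le> \<delta> / 2" using U by auto
          finally show False using \<delta>(1) \<delta>(2)[OF that(1) i0(1) that(2) pq(2,4)] by simp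
        qed
        then have "(\<Sum>i<n. c i k) = (\<Sum>i<n. if i = i0 then ennreal (diameter (U k)) else 0)"
          using i0 by (intro sum.cong) (auto simp: c_def)
        also have "\<dots> = ennreal (diameter (U k))" using i0 by (subst sum.delta) auto
        finally show ?thesis by simp
      next
        case False
        then have "(\<Sum>i<n. c i k) = 0" by (intro sum.neutral) (auto simp: c_def)
        then show ?thesis by simp
      qed
      then show "(\<Sum>i<n. 2 * c i k) \<le> 2 * ennreal (diameter (U k))"
        unfolding sum_distrib_left[symmetric] by (rule mult_left_mono) simp
    qed auto
    also have "\<dots> = 2 * (\<Sum>k. ennreal (diameter (U k)))" by (rule ennreal_suminf_cmult)
    finally show ?thesis .
  qed
  then have *: "ennreal (\<Sum>i<n. cmod (y i - x i)) / 2 \<le> (INF U\<in>?C. \<Sum>k. ennreal (diameter (U k)))"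
    by (intro INF_greatest divide_le_posI_ennreal) auto
  define s where "s = (\<Sum>i<n. cmod (y i - x i))"
  have "0 \<le> s" by (simp add: s_def sum_nonneg)
  then have "ennreal s / 2 = ennreal (s / 2)" "2 * ennreal (s / 2) = ennreal s"
    using divide_ennreal[of s 2] ennreal_mult[of 2 "s / 2"] by simp_all
  then have "ennreal (\<Sum>i<n. cmod (y i - x i)) = 2 * (ennreal (\<Sum>i<n. cmod (y i - x i)) / 2)"
    by (simp add: s_def)
  also have "\<dots> \<le> 2 * (INF U\<in>?C. \<Sum>k. ennreal (diameter (U k)))"
    using * by (rule mult_left_mono) simp
  also have "\<dots> \<le> 2 * hausdorff1 E"
    unfolding hausdorff1_def using \<delta>(1) by (intro mult_left_mono SUP_upper2[of "\<delta>/2"]) auto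
  finally show ?thesis .
qed

text \<open>Neighbouring pieces of the curve share an endpoint and are not separated. Each parameter
  interval is shortened by \<eta> at both ends, and \<eta> tends to 0 afterwards.\<close>

lemma partition_sum_le_hausdorff1:
  fixes g :: "real \<Rightarrow> complex"
  assumes ab: "a < b" and cont: "continuous_on {a..b} g" and inj: "inj_on g {a..b}" and n: "0 < n"
  shows "ennreal (\<Sum>i<n. cmod (g (node a b n (Suc i)) - g (node a b n i))) \<le> 2 * hausdorff1 (g ` {a..b})"
proof -
  let ?h = "(b - a) / real n"
  have h: "0 < ?h" using ab n by simp
  have nd: "a \<le> node a b n i" "node a b n (Suc i) = node a b n i + ?h" for i
    using ab n by (auto simp: distrib_right add_divide_distrib)
  have ndb: "node a b n (Suc i) \<le> b" if "i < n" for i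
  proof -
    have "real (Suc i) * (b - a) \<le> real n * (b - a)" using that ab by (intro mult_right_mono) auto
    then show ?thesis using n by (simp add: field_simps)
  qed
  have mono: "node a b n p \<le> node a b n q" if "p \<le> q" for p q
    using that ab n by (auto intro!: divide_right_mono mult_right_mono)
  have main: "ennreal (\<Sum>i<n. cmod (g (node a b n (Suc i) - \<eta>) - g (node a b n i + \<eta>))) \<le> 2 * hausdorff1 (g ` {a..b})"
    if \<eta>: "0 < \<eta>" "2 * \<eta> < ?h" for \<eta>
  proof -
    define I where "I i = (if i < n then {node a b n i + \<eta>..node a b n (Suc i) - \<eta>} else {})" for i
    have sub: "I i \<subseteq> {a..b}" for i using nd[of i] ndb[of i] \<eta> by (auto simp: I_def)
    have 1: "compact (g ` I i)" for i
      by (rule compact_continuous_image[OF continuous_on_subset[OF cont sub]]) (auto simp: I_def)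
    have 2: "connected (g ` I i)" for i
      by (rule connected_continuous_image[OF continuous_on_subset[OF cont sub]]) (auto simp: I_def)
    have 3: "g ` I i \<inter> g ` I j = {}" if "i < n" "j < n" "i \<noteq> j" for i j
    proof -
      have "I i \<inter> I j = {}"
      proof (cases "i < j")
        case True
        then show ?thesis using mono[of "Suc i" j] \<eta> by (auto simp: I_def)
      next
        case False
        then show ?thesis using mono[of "Suc j" i] \<eta> that by (auto simp: I_def)
      qed
      then show ?thesis using inj_on_image_Int[OF inj sub sub, of i j] by simp
    qed
    have 4: "g ` I i \<subseteq> g ` {a..b}" for i by (rule image_mono[OF sub])
    have "node a b n i + \<eta> \<in> I i" "node a b n (Suc i) - \<eta> \<in> I i" if "i < n" for i
      using nd(2)[of i] \<eta> that unfolding I_def by auto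
    then have 5: "g (node a b n i + \<eta>) \<in> g ` I i" "g (node a b n (Suc i) - \<eta>) \<in> g ` I i" if "i < n" for i
      using that by blast+
    show ?thesis
      by (rule separated_sum_le_hausdorff1[OF 1 2 3 4 5])
  qed
  have "((\<lambda>\<eta>. ennreal (\<Sum>i<n. cmod (g (node a b n (Suc i) - \<eta>) - g (node a b n i + \<eta>)))) \<longlongrightarrow>
      ennreal (\<Sum>i<n. cmod (g (node a b n (Suc i) - 0) - g (node a b n i + 0)))) (at_right 0)"
  proof (intro tendsto_ennrealI tendsto_sum tendsto_norm tendsto_diff)
    fix i assume i: "i \<in> {..<n}"
    have c: "continuous (at x within {a..b}) g" if "x \<in> {a..b}" for x
      using cont that by (simp add: continuous_on_eq_continuous_within)
    have ev: "eventually (\<lambda>\<eta>. \<eta> < ?h) (at_right 0)" "eventually (\<lambda>\<eta>. (0::real) < \<eta>) (at_right 0)"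
      using h by (auto intro: eventually_at_right_less order_tendstoD[OF tendsto_ident_at])
    show "((\<lambda>\<eta>. g (node a b n (Suc i) - \<eta>)) \<longlongrightarrow> g (node a b n (Suc i) - 0)) (at_right 0)"
    proof (rule continuous_within_tendsto_compose[where f=g and S="{a..b}"])
      show "continuous (at (node a b n (Suc i) - 0) within {a..b}) g" using nd[of "Suc i"] ndb i by (intro c) auto
      show "\<forall>\<^sub>F \<eta> in at_right 0. node a b n (Suc i) - \<eta> \<in> {a..b}"
        using ev
      proof eventually_elim
        case (elim \<eta>)
        then show ?case using nd[of i] ndb[of i] i by auto
      qed
    qed (intro tendsto_intros)
    show "((\<lambda>\<eta>. g (node a b n i + \<eta>)) \<longlongrightarrow> g (node a b n i + 0)) (at_right 0)"
    proof (rule continuous_within_tendsto_compose[where f=g and S="{a..b}"])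
      show "continuous (at (node a b n i + 0) within {a..b}) g" using nd[of i] ndb[of i] i h by (intro c) auto
      show "\<forall>\<^sub>F \<eta> in at_right 0. node a b n i + \<eta> \<in> {a..b}"
        using ev
      proof eventually_elim
        case (elim \<eta>)
        then show ?case using nd[of i] ndb[of i] i by auto
      qed
    qed (intro tendsto_intros)
  qed
  then have "ennreal (\<Sum>i<n. cmod (g (node a b n (Suc i) - 0) - g (node a b n i + 0))) \<le> 2 * hausdorff1 (g ` {a..b})"
  proof (rule tendsto_upperbound)
    show "\<forall>\<^sub>F \<eta> in at_right 0. ennreal (\<Sum>i<n. cmod (g (node a b n (Suc i) - \<eta>) - g (node a b n i + \<eta>))) \<le> 2 * hausdorff1 (g ` {a..b})"
      unfolding eventually_at_right_field using h main by (intro exI[of _ "?h/2"]) auto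
  qed simp
  then show ?thesis by simp
qed

lemma has_vector_derivative_quotient:
  fixes g :: "real \<Rightarrow> complex"
  assumes "(g has_vector_derivative D) (at t)"
  shows "((\<lambda>h. (g (t + h) - g t) /\<^sub>R h) \<longlongrightarrow> D) (at 0)"
proof -
  have "((\<lambda>h. norm (g (t + h) - g t - h *\<^sub>R D) / norm h) \<longlongrightarrow> 0) (at 0)"
    using assms unfolding has_vector_derivative_def has_derivative_at by simp
  then have "((\<lambda>h. norm ((g (t + h) - g t) /\<^sub>R h - D)) \<longlongrightarrow> 0) (at 0)"
  proof (rule Lim_transform_within[OF _ zero_less_one])
    fix h :: real assume "0 < dist h 0"
    then have "(g (t + h) - g t) /\<^sub>R h - D = (g (t + h) - g t - h *\<^sub>R D) /\<^sub>R h" by (simp add: scaleR_diff_right)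
    then show "norm (g (t + h) - g t - h *\<^sub>R D) / norm h = norm ((g (t + h) - g t) /\<^sub>R h - D)"
      by (simp add: divide_inverse mult.commute)
  qed
  then show ?thesis by (rule LIM_zero_cancel[OF tendsto_norm_zero_cancel])
qed

lemma cmod_cis_diff: "cmod (cis a - cis b) = 2 * \<bar>sin ((a - b) / 2)\<bar>"
proof -
  have "cis a - cis b = cis b * (exp (\<i> * of_real (a - b)) - 1)"
    by (simp add: cis_conv_exp right_diff_distrib exp_add[symmetric] algebra_simps)
  then have "cmod (cis a - cis b) = cmod (exp (\<i> * of_real (a - b)) - 1)" by (simp only: norm_mult norm_cis mult_1_left)
  also have "\<dots> = 2 * \<bar>sin ((a - b) / 2)\<bar>" by (rule dist_exp_i_1)
  finally show ?thesis .
qed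

text \<open>Unlike the norm of the derivative, this lower limit is Borel measurable for every continuous \<open>g\<close>.\<close>
definition speed :: "(real \<Rightarrow> complex) \<Rightarrow> real \<Rightarrow> ennreal" where
  "speed g t = liminf (\<lambda>n. ennreal (real (Suc n) * cmod (g (t + 1 / real (Suc n)) - g t)))"

definition arc_mass :: "(real \<Rightarrow> complex) \<Rightarrow> real set \<Rightarrow> ennreal" where
  "arc_mass g E = (\<integral>\<^sup>+t\<in>E. speed g t \<partial>lborel)"

lemma speed_borel:
  assumes "continuous_on UNIV g" shows "speed g \<in> borel_measurable borel"
proof -
  have [measurable]: "g \<in> borel_measurable borel" using assms by (rule borel_measurable_continuous_onI)
  show ?thesis unfolding speed_def by measurable
qed

lemma speed_eq:
  assumes "(g has_vector_derivative D) (at t)" shows "speed g t = ennreal (cmod D)"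
proof -
  have "((\<lambda>h. (g (t + h) - g t) /\<^sub>R h) \<longlongrightarrow> D) (at 0)" by (rule has_vector_derivative_quotient[OF assms])
  moreover have "filterlim (\<lambda>n. 1 / real (Suc n)) (at 0) sequentially"
    unfolding filterlim_at using LIMSEQ_inverse_real_of_nat by (simp add: inverse_eq_divide)
  ultimately have "(\<lambda>n. (g (t + 1 / real (Suc n)) - g t) /\<^sub>R (1 / real (Suc n))) \<longlonglongrightarrow> D"
    by (rule filterlim_compose)
  then have "(\<lambda>n. cmod ((g (t + 1 / real (Suc n)) - g t) /\<^sub>R (1 / real (Suc n)))) \<longlonglongrightarrow> cmod D"
    by (rule tendsto_norm)
  then have "(\<lambda>n. real (Suc n) * cmod (g (t + 1 / real (Suc n)) - g t)) \<longlonglongrightarrow> cmod D" by (simp add: divide_inverse)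
  then show ?thesis unfolding speed_def by (intro lim_imp_Liminf tendsto_ennrealI) auto
qed

lemma speed_periodic: "(\<And>t. g (t + p) = g t) \<Longrightarrow> speed g (t + p) = speed g t"
proof -
  assume p: "\<And>t. g (t + p) = g t"
  have "g (t + p + h) = g (t + h)" for h
    using p[of "t + h"] by (simp add: add.assoc add.commute[of h])
  then show ?thesis unfolding speed_def by (simp add: p)
qed

context
  fixes g :: "real \<Rightarrow> complex"
  assumes ac: "\<And>a b. abs_cont_on g a b"
begin

lemma abs_cont_vector_derivative:
  "t \<notin> {t. \<not> g differentiable at t} \<Longrightarrow> (g has_vector_derivative vector_derivative g (at t)) (at t)"
  by (simp add: vector_derivative_works[symmetric])

lemma speed_AE: "AE t in lebesgue. speed g t = ennreal (cmod (vector_derivative g (at t)))"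
proof -
  have "AE t in lebesgue. t \<notin> {t. \<not> g differentiable at t}"
    using abs_cont_differentiable_ae[OF ac] by (simp only: negligible_iff_null_sets AE_not_in)
  then show ?thesis by eventually_elim (rule speed_eq[OF abs_cont_vector_derivative])
qed

lemma abs_cont_imp_continuous: "continuous_on UNIV g"
  unfolding continuous_on_iff
proof (intro ballI allI impI)
  fix x e :: real assume "0 < e"
  from abs_cont_onE[OF ac[of "x - 1" "x + 1"] this] obtain \<delta> where \<delta>: "0 < \<delta>" "\<And>(n::nat) u v.
        \<forall>i<n. x - 1 \<le> u i \<and> u i \<le> v i \<and> v i \<le> x + 1 \<Longrightarrow>
        \<forall>i<n. \<forall>j<n. i \<noteq> j \<longrightarrow> v i \<le> u j \<or> v j \<le> u i \<Longrightarrow>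
        (\<Sum>i<n. v i - u i) < \<delta> \<Longrightarrow> (\<Sum>i<n. cmod (g (v i) - g (u i))) < e" by blast
  show "\<exists>d>0. \<forall>x'\<in>UNIV. dist x' x < d \<longrightarrow> dist (g x') (g x) < e"
  proof (intro exI[of _ "min \<delta> 1"] conjI ballI impI)
    fix y assume "dist y x < min \<delta> 1"
    then show "dist (g y) (g x) < e"
      using \<delta>(2)[of 1 "\<lambda>_. min x y" "\<lambda>_. max x y"]
      by (cases "x \<le> y") (auto simp: dist_norm norm_minus_commute)
  qed (use \<delta> in auto)
qed

lemma arc_mass_lebesgue:
  assumes "E \<in> sets borel"
  shows "(\<integral>\<^sup>+t\<in>E. ennreal (cmod (vector_derivative g (at t))) \<partial>lebesgue) = arc_mass g E"
proof -
  have "(\<integral>\<^sup>+t\<in>E. ennreal (cmod (vector_derivative g (at t))) \<partial>lebesgue) = (\<integral>\<^sup>+t\<in>E. speed g t \<partial>lebesgue)"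
    by (rule nn_integral_cong_AE) (use speed_AE in eventually_elim, simp)
  also have "\<dots> = (\<integral>\<^sup>+t\<in>E. speed g t \<partial>lborel)"
    using speed_borel[OF abs_cont_imp_continuous] assms
    by (intro nn_integral_completion borel_measurable_times_ennreal borel_measurable_indicator; simp)
  finally show ?thesis by (simp add: arc_mass_def)
qed

text \<open>The lower of the two comparisons for \<open>arc_mass\<close>. It needs absolute
  continuity, since differentiability almost everywhere alone does not recover increments.\<close>

lemma chord_le_arc_mass:
  assumes "a \<le> b" shows "ennreal (cmod (g b - g a)) \<le> arc_mass g {a..b}"
proof -
  have "((\<lambda>t. vector_derivative g (at t)) has_integral (g b - g a)) {a..b}"
    by (rule abs_cont_FTC[OF ac assms abs_cont_differentiable_ae[OF ac]]) (blast intro: abs_cont_vector_derivative)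
  from has_integral_norm_le_nn_integral[OF this] show ?thesis
    using arc_mass_lebesgue[of "{a..b}"] by simp
qed

text \<open>The upper comparison, through partition sums. Injectivity makes pieces with disjoint
  parameters disjoint in the image, so that the measure of the image sees each of them.\<close>

lemma arc_mass_le_hausdorff1:
  assumes "a < b" "inj_on g {a..b}" shows "arc_mass g {a..b} \<le> 2 * hausdorff1 (g ` {a..b})"
proof -
  have "(\<integral>\<^sup>+t\<in>{a..b}. ennreal (cmod (vector_derivative g (at t))) \<partial>lebesgue) \<le> 2 * hausdorff1 (g ` {a..b})"
  proof (rule nn_integral_derivative_le_partition_sums[OF assms(1) abs_cont_differentiable_ae[OF ac]])
    show "ennreal (\<Sum>i<n. cmod (g (node a b n (Suc i)) - g (node a b n i))) \<le> 2 * hausdorff1 (g ` {a..b})" if "0 < n" for n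
      by (rule partition_sum_le_hausdorff1[OF assms(1) continuous_on_subset[OF abs_cont_imp_continuous] assms(2) that]) simp
  qed (blast intro: abs_cont_vector_derivative)
  then show ?thesis by (simp add: arc_mass_lebesgue)
qed

end

section \<open>Angular parametrization of the circle and of the curve\<close>

lemma cis_eq_cis: "cis s = cis t \<longleftrightarrow> (\<exists>n::int. s = t + of_int n * (2 * pi))"
proof -
  have "cis s = cis t \<longleftrightarrow> cis (s - t) = 1" by (metis cis_divide cis_neq_zero divide_eq_1_iff)
  also have "\<dots> \<longleftrightarrow> (\<exists>n::int. s = t + of_int n * (2 * pi))"
    unfolding cis_eq_1_iff by (auto simp: algebra_simps)
  finally show ?thesis .
qed

lemma inj_on_cis: "inj_on cis {a..<a + 2 * pi}"
proof (rule inj_onI)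
  fix s t assume st: "s \<in> {a..<a + 2 * pi}" "t \<in> {a..<a + 2 * pi}" "cis s = cis t"
  then obtain n :: int where n: "s = t + of_int n * (2 * pi)" by (auto simp: cis_eq_cis)
  have "\<bar>of_int n * (2 * pi)\<bar> < 1 * (2 * pi)" using st n by auto
  then have "\<bar>of_int n * (2 * pi)\<bar> < 1 * (2 * pi)" by simp
  then have "\<bar>real_of_int n\<bar> < 1" by (simp add: abs_mult)
  then have "n = 0" by linarith
  then show "s = t" using n by simp
qed

lemma periodic_representative: obtains n :: int where "a \<le> t + of_int n * (2 * pi)" "t + of_int n * (2 * pi) < a + 2 * pi"
proof (rule that[of "- \<lfloor>(t - a) / (2 * pi)\<rfloor>"])
  define x where "x = (t - a) / (2 * pi)"
  have ta: "t - a = x * (2 * pi)" by (simp add: x_def)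
  have "of_int \<lfloor>x\<rfloor> * (2 * pi) \<le> x * (2 * pi)" "x * (2 * pi) < (of_int \<lfloor>x\<rfloor> + 1) * (2 * pi)"
    by (intro mult_right_mono mult_strict_right_mono; simp)+
  then have "of_int \<lfloor>(t - a) / (2 * pi)\<rfloor> * (2 * pi) \<le> t - a" "t - a < (of_int \<lfloor>(t - a) / (2 * pi)\<rfloor> + 1) * (2 * pi)"
    unfolding ta[symmetric] by (simp_all add: x_def)
  then show "a \<le> t + of_int (- \<lfloor>(t - a) / (2 * pi)\<rfloor>) * (2 * pi)" "t + of_int (- \<lfloor>(t - a) / (2 * pi)\<rfloor>) * (2 * pi) < a + 2 * pi"
    by (auto simp: algebra_simps)
qed

lemma cis_image_sphere: "cis ` {a..<a + 2 * pi} = sphere 0 1"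
proof
  show "sphere 0 1 \<subseteq> cis ` {a..<a + 2 * pi}"
  proof
    fix z :: complex assume "z \<in> sphere 0 1"
    then have "z = cis (Arg z)" by (metis cis_Arg mem_sphere_0 norm_eq_zero sgn_div_norm zero_neq_one inverse_1 scaleR_one)
    moreover obtain n :: int where "a \<le> Arg z + of_int n * (2 * pi)" "Arg z + of_int n * (2 * pi) < a + 2 * pi"
      by (rule periodic_representative)
    moreover have "cis (Arg z + of_int n * (2 * pi)) = cis (Arg z)" unfolding cis_eq_cis by blast
    ultimately show "z \<in> cis ` {a..<a + 2 * pi}" by (metis atLeastLessThan_iff image_eqI)
  qed
qed auto

text \<open>The short arc comes as an unspecified path inside the curve. Being connected it must
  contain one of the two parametrized arcs: omitting a point of each would split it into two
  relatively closed parts, one for each of its ends.\<close>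

lemma chord_arc_two_arcs:
  assumes ca: "chord_arc \<Gamma> C" and inj: "inj_on \<phi> (sphere 0 1)" and im: "\<phi> ` sphere 0 1 = \<Gamma>"
    and cont: "continuous_on UNIV (\<lambda>t. \<phi> (cis t))" and ab: "a < b" "b < a + 2 * pi"
  defines "g \<equiv> \<lambda>t. \<phi> (cis t)"
  shows "hausdorff1 (g ` {a..b}) \<le> ennreal (C * cmod (g b - g a)) \<or>
    hausdorff1 (g ` {b..a + 2 * pi}) \<le> ennreal (C * cmod (g b - g a))"
proof -
  have inj_g: "inj_on g {x..<x + 2 * pi}" for x
    unfolding g_def using comp_inj_on[OF inj_on_cis inj_on_subset[OF inj]] by (force simp: o_def)
  have per: "g (t + 2 * pi) = g t" for t by (simp add: g_def cis_mult[symmetric])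
  have im_g: "g ` {x..<x + 2 * pi} = \<Gamma>" for x
  proof -
    have "g ` {x..<x + 2 * pi} = \<phi> ` (cis ` {x..<x + 2 * pi})" unfolding g_def by (simp add: image_image)
    then show ?thesis by (simp only: cis_image_sphere im)
  qed
  have gG: "g t \<in> \<Gamma>" for t using im_g[of t] imageI[of t "{t..<t + 2 * pi}" g] by simp
  have ne: "g a \<noteq> g b" using inj_onD[OF inj_g[of a], of a b] ab by auto
  have "\<exists>p. arc p \<and> pathstart p = g a \<and> pathfinish p = g b \<and> path_image p \<subseteq> \<Gamma> \<and>
    hausdorff1 (path_image p) \<le> ennreal (C * cmod (g a - g b))"
    by (rule ca[unfolded chord_arc_def, THEN conjunct2, rule_format, OF gG gG ne])
  then obtain p where p: "arc p" "pathstart p = g a" "pathfinish p = g b" "path_image p \<subseteq> \<Gamma>"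
    "hausdorff1 (path_image p) \<le> ennreal (C * cmod (g a - g b))"
    by (elim exE conjE)
  have "g ` {a..b} \<subseteq> path_image p \<or> g ` {b..a + 2 * pi} \<subseteq> path_image p"
  proof (rule ccontr)
    assume "\<not> ?thesis"
    then have "\<exists>s\<in>{a..b}. g s \<notin> path_image p" "\<exists>t\<in>{b..a + 2 * pi}. g t \<notin> path_image p"
      unfolding de_Morgan_disj image_subset_iff by simp_all
    then obtain s t where st: "s \<in> {a..b}" "g s \<notin> path_image p" "t \<in> {b..a + 2 * pi}" "g t \<notin> path_image p"
      by (elim bexE)
    have ends: "g a \<in> path_image p" "g b \<in> path_image p"
      using pathstart_in_path_image[of p] pathfinish_in_path_image[of p] unfolding p(2,3) .
    have "g (a + 2 * pi) \<in> path_image p" using ends per by simp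
    then have lt: "a < s" "s < b" "b < t" "t < a + 2 * pi" using st ends by (auto simp: less_le)
    \<comment> \<open>The two arcs between the omitted points. They cover the curve and meet only in
      these points, so they separate the path.\<close>
    define A B where "A = g ` {s..t}" and "B = g ` {t..s + 2 * pi}"
    have cg: "continuous_on S g" for S unfolding g_def by (rule continuous_on_subset[OF cont]) simp
    have cl: "closed A" "closed B" unfolding A_def B_def
      by (intro compact_imp_closed compact_continuous_image cg compact_Icc)+
    have cover: "path_image p \<subseteq> A \<union> B"
    proof -
      have "\<Gamma> \<subseteq> A \<union> B"
      proof -
        have "{s..<s + 2 * pi} \<subseteq> {s..t} \<union> {t..s + 2 * pi}" by auto
        then have "g ` {s..<s + 2 * pi} \<subseteq> A \<union> B" unfolding A_def B_def by blast
        then show ?thesis using im_g by blast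
      qed
      then show ?thesis using p by blast
    qed
    have "A \<inter> B \<inter> path_image p = {}"
    proof (rule ccontr)
      assume "A \<inter> B \<inter> path_image p \<noteq> {}"
      then obtain w where w: "w \<in> g ` {s..t}" "w \<in> g ` {t..s + 2 * pi}" "w \<in> path_image p"
        unfolding A_def B_def by blast
      obtain u where u: "u \<in> {s..t}" "w = g u" using w(1) by (rule imageE)
      obtain v where v: "v \<in> {t..s + 2 * pi}" "w = g v" using w(2) by (rule imageE)
      have uv: "u \<in> {s..t}" "v \<in> {t..s + 2 * pi}" "g u = g v" "g u \<in> path_image p"
        using u v w(3) by simp_all
      show False
      proof (cases "v = s + 2 * pi")
        case True
        then show ?thesis using uv st per by auto
      next
        case False
        then have "u = v" using uv lt inj_onD[OF inj_g[of s] uv(3)] by auto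
        then have "u = t" using uv by auto
        then show ?thesis using uv st by simp
      qed
    qed
    moreover have "connected (path_image p)" using p(1) by (simp add: arc_imp_path connected_path_image)
    ultimately have "A \<inter> path_image p = {} \<or> B \<inter> path_image p = {}"
      using cl cover connected_closedD by blast
    moreover have "g b \<in> A \<inter> path_image p" using ends lt by (auto simp: A_def)
    moreover have "g a \<in> B \<inter> path_image p"
    proof -
      have "a + 2 * pi \<in> {t..s + 2 * pi}" using lt by auto
      then have "g (a + 2 * pi) \<in> B" unfolding B_def by (rule imageI)
      then show ?thesis using ends per[of a] by simp
    qed
    ultimately show False by blast
  qed
  then show ?thesis using p(5) hausdorff1_mono unfolding norm_minus_commute[of "g a" "g b"] by (elim disjE) (blast intro: order_trans)+
qed

text \<open>\<open>circ_param\<close> looks through the fixed window (-pi, pi], which may cut an arc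
  in two. Unfolding over all translations by 2 * pi and shifting the variable in each term replaces
  the window by the parameter set \<open>E\<close>.\<close>

lemma circ_param_integral:
  fixes F :: "real \<Rightarrow> ennreal"
  assumes F: "F \<in> borel_measurable borel" "\<And>t. F (t + 2 * pi) = F t"
    and E: "E \<in> sets borel" "E \<subseteq> {a..<a + 2 * pi}"
  shows "circ_param (cis ` E) \<in> sets borel"
    and "(\<integral>\<^sup>+t\<in>circ_param (cis ` E). F t \<partial>lborel) = (\<integral>\<^sup>+t\<in>E. F t \<partial>lborel)"
proof -
  define J :: "real set" where "J = {-pi<..pi}"
  define e where "e n t = t + of_int n * (2 * pi)" for n :: int and t :: real
  have meas_e[measurable]: "e n \<in> borel_measurable borel" for n unfolding e_def by measurable
  note F(1)[measurable] E(1)[measurable]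
  have Jm[measurable]: "J \<in> sets borel" by (simp add: J_def)
  have Fe: "F (e n t) = F t" for n t
  proof -
    have nat: "F (t + real k * (2 * pi)) = F t" for k t
    proof (induction k)
      case (Suc k)
      have "F (t + real (Suc k) * (2 * pi)) = F ((t + real k * (2 * pi)) + 2 * pi)" by (simp add: algebra_simps)
      then show ?case using Suc F(2) by simp
    qed simp
    show ?thesis
    proof (cases "0 \<le> n")
      case True
      then show ?thesis using nat[of t "nat n"] by (simp add: e_def)
    next
      case False
      then show ?thesis using nat[of "e n t" "nat (-n)"] by (simp add: e_def)
    qed
  qed
  have cp: "circ_param (cis ` E) = (\<Union>n. {t\<in>J. e n t \<in> E})"
    unfolding circ_param_def J_def e_def using cis_eq_cis by (auto simp: image_iff) (metis)+
  show "circ_param (cis ` E) \<in> sets borel"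
    unfolding cp by measurable
  \<comment> \<open>Exactly one translate of a point of the window lies in \<open>E\<close>, because
    \<open>E\<close> fits into one period.\<close>
  have ind: "indicator (circ_param (cis ` E)) t = (\<integral>\<^sup>+n. indicator J t * indicator E (e n t) \<partial>count_space (UNIV::int set))" for t :: real
  proof (cases "t \<in> circ_param (cis ` E)")
    case True
    then obtain n where n: "t \<in> J" "e n t \<in> E" by (auto simp: cp)
    have "e k t \<notin> E" if "k \<noteq> n" for k
    proof
      assume "e k t \<in> E"
      moreover have "cis (e k t) = cis (e n t)" unfolding e_def cis_eq_cis by (intro exI[of _ "k - n"]) (simp add: algebra_simps)
      ultimately have "e k t = e n t" using inj_onD[OF inj_on_cis[of a]] n E by blast
      then show False using that by (simp add: e_def)
    qed
    then show ?thesis using n True by (subst nn_integral_count_space'[of "{n}"]) auto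
  next
    case False
    then have "(\<lambda>n. indicator J t * indicator E (e n t)) = (\<lambda>n. 0::ennreal)" by (auto simp: cp indicator_def fun_eq_iff)
    then show ?thesis using False by (simp only:) simp
  qed
  have one: "(\<integral>\<^sup>+n. indicator J (e (-n) t) \<partial>count_space (UNIV::int set)) = (1::ennreal)" for t
  proof -
    obtain n :: int where n: "- pi \<le> (- t) + of_int n * (2 * pi)" "(- t) + of_int n * (2 * pi) < - pi + 2 * pi" by (rule periodic_representative)
    then have nJ: "e (-n) t \<in> J" by (auto simp: e_def J_def)
    have "e (-k) t \<notin> J" if "k \<noteq> n" for k
    proof
      assume k: "e (-k) t \<in> J"
      have "cis (- e (-k) t) = cis (- e (-n) t)" unfolding e_def cis_eq_cis by (intro exI[of _ "k - n"]) (simp add: algebra_simps)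
      moreover have "- e (-k) t \<in> {-pi..<-pi + 2 * pi}" "- e (-n) t \<in> {-pi..<-pi + 2 * pi}" using k nJ by (auto simp: J_def)
      ultimately have "- e (-k) t = - e (-n) t" using inj_onD[OF inj_on_cis[of "-pi"]] by blast
      then show False using that by (simp add: e_def)
    qed
    then show ?thesis using nJ by (subst nn_integral_count_space'[of "{n}"]) auto
  qed
  have "(\<integral>\<^sup>+t\<in>circ_param (cis ` E). F t \<partial>lborel) = (\<integral>\<^sup>+t. \<integral>\<^sup>+n. F t * (indicator J t * indicator E (e n t)) \<partial>count_space UNIV \<partial>lborel)"
    unfolding ind by (simp add: nn_integral_cmult)
  also have "\<dots> = (\<integral>\<^sup>+n. \<integral>\<^sup>+t. F t * (indicator J t * indicator E (e n t)) \<partial>lborel \<partial>count_space UNIV)"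
    by (intro nn_integral_count_space_nn_integral) (auto intro: measurable_compose[OF meas_e])
  also have "\<dots> = (\<integral>\<^sup>+n. \<integral>\<^sup>+t. F t * (indicator J (e (-n) t) * indicator E t) \<partial>lborel \<partial>count_space UNIV)"
  proof (rule nn_integral_cong)
    fix n :: int
    have "(\<integral>\<^sup>+t. F t * (indicator J (e (-n) t) * indicator E t) \<partial>lborel)
       = (\<integral>\<^sup>+t. F t * (indicator J (e (-n) t) * indicator E t) \<partial>distr lborel borel ((+) (of_int n * (2 * pi))))"
      by (simp add: lborel_distr_plus)
    also have "\<dots> = (\<integral>\<^sup>+t. F (e n t) * (indicator J (e (-n) (e n t)) * indicator E (e n t)) \<partial>lborel)"
      by (subst nn_integral_distr) (auto simp: e_def add.commute intro!: nn_integral_cong)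
    also have "\<dots> = (\<integral>\<^sup>+t. F t * (indicator J t * indicator E (e n t)) \<partial>lborel)"
      unfolding Fe by (simp add: e_def)
    finally show "(\<integral>\<^sup>+t. F t * (indicator J t * indicator E (e n t)) \<partial>lborel) = (\<integral>\<^sup>+t. F t * (indicator J (e (-n) t) * indicator E t) \<partial>lborel)" by simp
  qed
  also have "\<dots> = (\<integral>\<^sup>+t. \<integral>\<^sup>+n. F t * (indicator J (e (-n) t) * indicator E t) \<partial>count_space UNIV \<partial>lborel)"
    by (intro nn_integral_count_space_nn_integral[symmetric]) (auto intro: measurable_compose[OF meas_e])
  also have "\<dots> = (\<integral>\<^sup>+t\<in>E. F t \<partial>lborel)"
  proof (rule nn_integral_cong)
    fix t
    have "(\<integral>\<^sup>+n. F t * (indicator J (e (-n) t) * indicator E t) \<partial>count_space (UNIV::int set)) = F t * (\<integral>\<^sup>+n. indicator J (e (-n) t) \<partial>count_space (UNIV::int set)) * indicator E t"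
      by (simp add: nn_integral_cmult nn_integral_multc mult.assoc)
    then show "(\<integral>\<^sup>+n. F t * (indicator J (e (-n) t) * indicator E t) \<partial>count_space (UNIV::int set)) = F t * indicator E t"
      unfolding one by simp
  qed
  finally show "(\<integral>\<^sup>+t\<in>circ_param (cis ` E). F t \<partial>lborel) = (\<integral>\<^sup>+t\<in>E. F t \<partial>lborel)" .
qed

subsection \<open>Strongly quasisymmetric curves\<close>

lemma arc_mass_mono: "E \<subseteq> F \<Longrightarrow> arc_mass g E \<le> arc_mass g F"
  unfolding arc_mass_def by (intro nn_integral_mono mult_left_mono) (auto simp: indicator_def)

lemma arc_mass_Un:
  assumes "continuous_on UNIV g" "A \<in> sets borel" "B \<in> sets borel"
  shows "arc_mass g (A \<union> B) \<le> arc_mass g A + arc_mass g B"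
proof -
  note [measurable] = speed_borel[OF assms(1)] assms(2,3)
  have "arc_mass g (A \<union> B) \<le> (\<integral>\<^sup>+t. speed g t * indicator A t + speed g t * indicator B t \<partial>lborel)"
    unfolding arc_mass_def by (intro nn_integral_mono) (auto simp: indicator_def)
  also have "\<dots> = arc_mass g A + arc_mass g B" unfolding arc_mass_def by (rule nn_integral_add) measurable
  finally show ?thesis .
qed

text \<open>Passes from a weight on the circle to the mass of real parameter intervals. Positivity
  of the mass reflects that the weight is positive almost everywhere; finiteness is inherited from
  the full circle.\<close>

lemma A_infinity_arc_mass:
  fixes \<phi> :: "complex \<Rightarrow> complex"
  defines "g \<equiv> \<lambda>t. \<phi> (cis t)"
  assumes ac: "\<And>a b. abs_cont_on g a b" and A: "A_infinity (abs_deriv_circ \<phi>)"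
  obtains C1 C2 where "0 < C1" "0 < C2"
    "\<And>a b E. a < b \<Longrightarrow> b < a + 2 * pi \<Longrightarrow> E \<subseteq> {a..b} \<Longrightarrow> E \<in> sets borel \<Longrightarrow>
      arc_mass g E \<le> ennreal (C2 * (measure lborel E / (b - a)) powr C1) * arc_mass g {a..b}"
    "\<And>a b. a < b \<Longrightarrow> b < a + 2 * pi \<Longrightarrow> 0 < arc_mass g {a..b} \<and> arc_mass g {a..b} < \<infinity>"
proof -
  let ?w = "abs_deriv_circ \<phi>"
  have gper: "g (t + 2 * pi) = g t" for t by (simp add: g_def cis_mult[symmetric])
  note cont = abs_cont_imp_continuous[OF ac]
  have wm: "weight_meas ?w E = arc_mass g (circ_param E)" if "circ_param E \<in> sets borel" for E
  proof -
    have "weight_meas ?w E = (\<integral>\<^sup>+t\<in>circ_param E. ennreal (cmod (vector_derivative g (at t))) \<partial>lebesgue)"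
      unfolding weight_meas_def
    proof (rule nn_integral_cong)
      fix t :: real
      have "?w (cis t) = cmod (vector_derivative g (at t))" if "t \<in> circ_param E"
        using that Arg_cis[of t] by (simp add: abs_deriv_circ_def circ_param_def g_def)
      then show "ennreal (?w (cis t)) * indicator (circ_param E) t = ennreal (cmod (vector_derivative g (at t))) * indicator (circ_param E) t"
        by (auto simp: indicator_def)
    qed
    then show ?thesis using arc_mass_lebesgue[OF ac that] by simp
  qed
  have main: "circ_param (cis ` E) \<in> sets borel" "weight_meas ?w (cis ` E) = arc_mass g E"
    "emeasure lborel (circ_param (cis ` E)) = emeasure lborel E"
    if E: "E \<in> sets borel" "E \<subseteq> {a..<a + 2 * pi}" for E a
  proof -
    show 1: "circ_param (cis ` E) \<in> sets borel"
      by (rule circ_param_integral(1)[of "\<lambda>_. 1", OF _ _ E]) auto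
    have "weight_meas ?w (cis ` E) = arc_mass g (circ_param (cis ` E))" by (rule wm[OF 1])
    also have "\<dots> = arc_mass g E" unfolding arc_mass_def
      by (rule circ_param_integral(2)[OF speed_borel[OF cont] speed_periodic[of g "2 * pi", OF gper] E])
    finally show "weight_meas ?w (cis ` E) = arc_mass g E" .
    show "emeasure lborel (circ_param (cis ` E)) = emeasure lborel E"
      using circ_param_integral(2)[of "\<lambda>_. 1", OF _ _ E] 1 E(1) by simp
  qed
  have sub: "{a..b} \<subseteq> {a..<a + 2 * pi}" if "b < a + 2 * pi" for a b :: real using that by auto
  obtain C1 C2 where C: "0 < C1" "0 < C2" "\<And>I E. circle_arc I \<Longrightarrow> E \<subseteq> I \<Longrightarrow> circ_param E \<in> sets lebesgue \<Longrightarrow>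
        weight_meas ?w E \<le>
          ennreal (C2 * (measure lebesgue (circ_param E) / measure lebesgue (circ_param I)) powr C1)
          * weight_meas ?w I"
    using A unfolding A_infinity_def by (elim conjE exE) blast
  show thesis
  proof (rule that[OF C(1,2)])
    fix a b :: real and E assume ab: "a < b" "b < a + 2 * pi" and E: "E \<subseteq> {a..b}" "E \<in> sets borel"
    have E': "E \<subseteq> {a..<a + 2 * pi}" using E sub[OF ab(2)] by blast
    have "circle_arc (cis ` {a..b})" unfolding circle_arc_def using ab by (intro exI[of _ a] exI[of _ b]) auto
    from C(3)[OF this, of "cis ` E"] E main(1)[OF E(2) E']
    have "arc_mass g E \<le> ennreal (C2 * (measure lebesgue (circ_param (cis ` E)) / measure lebesgue (circ_param (cis ` {a..b}))) powr C1) * arc_mass g {a..b}"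
      using main(2)[OF E(2) E'] main(2)[OF _ sub[OF ab(2)]] by (simp add: image_mono)
    moreover have "measure lebesgue (circ_param (cis ` E)) = measure lborel E"
      using main(1,3)[OF E(2) E'] by (simp add: measure_def)
    moreover have "measure lebesgue (circ_param (cis ` {a..b})) = b - a"
      using main(1,3)[OF _ sub[OF ab(2)]] ab by (simp add: measure_def)
    ultimately show "arc_mass g E \<le> ennreal (C2 * (measure lborel E / (b - a)) powr C1) * arc_mass g {a..b}" by simp
  next
    fix a b :: real assume ab: "a < b" "b < a + 2 * pi"
    let ?P = "circ_param (cis ` {a..b})"
    have P: "?P \<in> sets borel" "emeasure lborel ?P = ennreal (b - a)" using main(1,3)[OF _ sub[OF ab(2)]] ab by auto
    have mP: "arc_mass g {a..b} = weight_meas ?w (cis ` {a..b})" using main(2)[OF _ sub[OF ab(2)]] by simp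
    have "weight_meas ?w (cis ` {a..b}) \<le> weight_meas ?w (sphere 0 1)"
      unfolding weight_meas_def by (intro nn_integral_mono mult_left_mono) (auto simp: indicator_def circ_param_def)
    also have "\<dots> < \<infinity>" using A unfolding A_infinity_def by blast
    finally have fin: "arc_mass g {a..b} < \<infinity>" using mP by simp
    have "arc_mass g {a..b} \<noteq> 0"
    proof
      assume "arc_mass g {a..b} = 0"
      then have "(\<integral>\<^sup>+t\<in>?P. speed g t \<partial>lborel) = 0" 
        using mP wm[OF P(1)] by (simp add: arc_mass_def)
      then have "AE t in lborel. speed g t * indicator ?P t = 0"
        using P(1) speed_borel[OF cont] by (subst (asm) nn_integral_0_iff_AE) auto
      then have "AE t in lebesgue. speed g t * indicator ?P t = 0" by (rule AE_completion)
      moreover have "AE t in lebesgue. t \<in> {-pi<..pi} \<longrightarrow> ?w (cis t) > 0" using A unfolding A_infinity_def by blast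
      ultimately have "AE t in lebesgue. t \<notin> ?P"
        using speed_AE[OF ac]
      proof eventually_elim
        case (elim t)
        show ?case
        proof
          assume t: "t \<in> ?P"
          then have "?w (cis t) = cmod (vector_derivative g (at t))"
            using Arg_cis[of t] by (simp add: abs_deriv_circ_def circ_param_def g_def)
          moreover have "t \<in> {-pi<..pi}" using t by (simp add: circ_param_def)
          ultimately show False using elim t by simp
        qed
      qed
      then have "AE t in lborel. t \<notin> ?P" by (simp add: AE_completion_iff)
      then have "emeasure lborel ?P = 0" using P(1) AE_iff_null_sets[of ?P lborel] by (auto simp: null_sets_def)
      then show False using P(2) ab by simp
    qed
    then show "0 < arc_mass g {a..b} \<and> arc_mass g {a..b} < \<infinity>" using fin by (simp add: zero_less_iff_neq_zero)
  qed
qed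

text \<open>The boundary parametrization \<open>g t = \<phi> (cis t)\<close> of a strongly quasisymmetric map.\<close>
locale sqs_curve =
  fixes g :: "real \<Rightarrow> complex" and C C1 C2 :: real
  assumes ac: "\<And>a b. abs_cont_on g a b"
    and per: "\<And>t. g (t + 2 * pi) = g t"
    and Cpos: "0 < C1" "0 < C2"
    and A_inf: "\<And>a b E. a < b \<Longrightarrow> b < a + 2 * pi \<Longrightarrow> E \<subseteq> {a..b} \<Longrightarrow> E \<in> sets borel \<Longrightarrow>
      arc_mass g E \<le> ennreal (C2 * (measure lborel E / (b - a)) powr C1) * arc_mass g {a..b}"
    and mass_pos_fin: "\<And>a b. a < b \<Longrightarrow> b < a + 2 * pi \<Longrightarrow> 0 < arc_mass g {a..b} \<and> arc_mass g {a..b} < \<infinity>"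
    and two_arcs: "\<And>a b. a < b \<Longrightarrow> b < a + 2 * pi \<Longrightarrow>
      arc_mass g {a..b} \<le> ennreal (C * cmod (g b - g a)) \<or> arc_mass g {b..a + 2 * pi} \<le> ennreal (C * cmod (g b - g a))"
begin

lemma cont: "continuous_on UNIV g" by (rule abs_cont_imp_continuous[OF ac])

definition len :: "real \<Rightarrow> real \<Rightarrow> real" where "len a b = enn2real (arc_mass g {a..b})"

lemma mass_fin: "bounded E \<Longrightarrow> arc_mass g E < \<infinity>"
proof -
  assume "bounded E"
  then obtain R where R: "E \<subseteq> cball 0 R" by (force simp: bounded_iff)
  have fin: "arc_mass g {a..a + real n} < \<infinity>" for a n
  proof (induction n)
    case 0
    have "arc_mass g {a..a} \<le> arc_mass g {a..a+1}" by (rule arc_mass_mono) auto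
    also have "\<dots> < \<infinity>" using mass_pos_fin[of a "a+1"] pi_gt3 by auto
    finally show ?case by simp
  next
    case (Suc n)
    have "arc_mass g {a..a + real (Suc n)} \<le> arc_mass g ({a..a + real n} \<union> {a + real n..a + real n + 1})"
      by (rule arc_mass_mono) auto
    also have "\<dots> \<le> arc_mass g {a..a + real n} + arc_mass g {a + real n..a + real n + 1}"
      by (rule arc_mass_Un[OF cont]) auto
    also have "\<dots> < \<infinity>" using Suc mass_pos_fin[of "a + real n" "a + real n + 1"] pi_gt3 by auto
    finally show ?case .
  qed
  obtain n :: nat where "2 * R \<le> real n" using real_arch_simple by blast
  then have "E \<subseteq> {- R..- R + real n}" using R by (auto simp: cball_eq_atLeastAtMost)
  then have "arc_mass g E \<le> arc_mass g {- R..- R + real n}" by (rule arc_mass_mono)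
  also have "\<dots> < \<infinity>" by (rule fin)
  finally show ?thesis .
qed

lemma mass_len: "arc_mass g {a..b} = ennreal (len a b)"
  using mass_fin[of "{a..b}"] by (simp add: len_def)

lemma len_nonneg: "0 \<le> len a b" by (simp add: len_def)

lemma len_pos: "a < b \<Longrightarrow> b < a + 2 * pi \<Longrightarrow> 0 < len a b"
  using mass_pos_fin[of a b] by (simp add: mass_len)

lemma len_mono: "a \<le> c \<Longrightarrow> d \<le> b \<Longrightarrow> len c d \<le> len a b"
  using arc_mass_mono[of "{c..d}" "{a..b}" g] by (simp add: mass_len len_nonneg)

lemma chord_le_len: "a \<le> b \<Longrightarrow> cmod (g b - g a) \<le> len a b"
  using chord_le_arc_mass[OF ac, of a b] by (simp add: mass_len len_nonneg)

lemma arc_mass_shift: "arc_mass g {a + 2 * pi..b + 2 * pi} = arc_mass g {a..b}"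
proof -
  note [measurable] = speed_borel[OF cont]
  have "arc_mass g {a + 2 * pi..b + 2 * pi} = (\<integral>\<^sup>+t. speed g t * indicator {a + 2 * pi..b + 2 * pi} t \<partial>distr lborel borel ((+) (2 * pi)))"
    unfolding arc_mass_def by (simp add: lborel_distr_plus)
  also have "\<dots> = (\<integral>\<^sup>+t. speed g (2 * pi + t) * indicator {a + 2 * pi..b + 2 * pi} (2 * pi + t) \<partial>lborel)"
    by (rule nn_integral_distr) auto
  also have "\<dots> = arc_mass g {a..b}" unfolding arc_mass_def
  proof (rule nn_integral_cong)
    fix t
    have "speed g (2 * pi + t) = speed g t" using speed_periodic[of g "2 * pi" t, OF per] by (simp only: add.commute)
    then show "speed g (2 * pi + t) * indicator {a + 2 * pi..b + 2 * pi} (2 * pi + t) = speed g t * indicator {a..b} t"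
      by (simp add: indicator_def)
  qed
  finally show ?thesis .
qed

lemma len_shift: "len (a + 2 * pi) (b + 2 * pi) = len a b"
  by (simp add: len_def arc_mass_shift)

lemma len_le_chord:
  assumes "a < b" "b < a + 2 * pi"
  shows "min (len a b) (len b (a + 2 * pi)) \<le> \<bar>C\<bar> * cmod (g b - g a)"
proof -
  have "ennreal (C * cmod (g b - g a)) \<le> ennreal (\<bar>C\<bar> * cmod (g b - g a))" by (intro ennreal_leI mult_right_mono) auto
  then have "ennreal (len a b) \<le> ennreal (\<bar>C\<bar> * cmod (g b - g a)) \<or> ennreal (len b (a + 2 * pi)) \<le> ennreal (\<bar>C\<bar> * cmod (g b - g a))"
    using two_arcs[OF assms] unfolding mass_len by (meson order_trans)
  then show ?thesis by (auto simp: min_le_iff_disj)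
qed

definition mass :: "real set \<Rightarrow> real" where "mass E = enn2real (arc_mass g E)"

lemma mass_ennreal: "bounded E \<Longrightarrow> arc_mass g E = ennreal (mass E)"
  using mass_fin[of E] by (simp add: mass_def)

lemma mass_nonneg: "0 \<le> mass E" by (simp add: mass_def)

lemma mass_Un:
  assumes "A \<in> sets borel" "B \<in> sets borel" "bounded A" "bounded B"
  shows "mass (A \<union> B) \<le> mass A + mass B"
  using arc_mass_Un[OF cont assms(1,2)] assms(3,4)
  by (simp add: mass_ennreal mass_nonneg flip: ennreal_plus)

lemma mass_interval: "mass {a..<b} = len a b"
proof -
  have "arc_mass g {a..<b} = arc_mass g {a..b}"
    unfolding arc_mass_def
    by (rule nn_integral_cong_AE, rule AE_mp[OF AE_lborel_singleton[of b]]) (auto simp: indicator_def)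
  then show ?thesis by (simp add: mass_def len_def)
qed

lemma A_inf_real:
  assumes "a < b" "b < a + 2 * pi" "E \<subseteq> {a..b}" "E \<in> sets borel"
  shows "mass E \<le> C2 * (measure lborel E / (b - a)) powr C1 * len a b"
proof -
  have "bounded E" using assms(3) bounded_closed_interval bounded_subset by blast
  then have "ennreal (mass E) \<le> ennreal (C2 * (measure lborel E / (b - a)) powr C1) * ennreal (len a b)"
    using A_inf[OF assms] by (simp add: mass_ennreal[symmetric] mass_len[symmetric])
  also have "\<dots> = ennreal (C2 * (measure lborel E / (b - a)) powr C1 * len a b)"
    using Cpos by (intro ennreal_mult[symmetric]) (auto simp: len_nonneg)
  finally show ?thesis using Cpos by (simp add: len_nonneg)
qed

text \<open>Half of the mass requires 1 \<le> 2 * C2 * x powr C1 for the proportion x of length;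
  \<open>c\<close> solves the equality case, capped at 1.\<close>

lemma half_mass_proportion:
  obtains c where "0 < c" "c \<le> 1" "\<And>a b E. a < b \<Longrightarrow> b < a + 2 * pi \<Longrightarrow> E \<subseteq> {a..b} \<Longrightarrow> E \<in> sets borel \<Longrightarrow>
     len a b \<le> 2 * mass E \<Longrightarrow> c * (b - a) \<le> measure lborel E"
proof -
  define c where "c = min 1 ((1 / (2 * C2)) powr (1 / C1))"
  show thesis
  proof
    show "0 < c" "c \<le> 1" using Cpos by (auto simp: c_def)
    fix a b :: real and E assume ab: "a < b" "b < a + 2 * pi" and E: "E \<subseteq> {a..b}" "E \<in> sets borel" and half: "len a b \<le> 2 * mass E"
    define x where "x = measure lborel E / (b - a)"
    have x0: "0 \<le> x" using ab by (simp add: x_def)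
    have "len a b \<le> 2 * (C2 * x powr C1 * len a b)" using A_inf_real[OF ab E] half by (simp add: x_def)
    then have "1 * len a b \<le> (2 * (C2 * x powr C1)) * len a b" by simp
    then have "1 \<le> 2 * (C2 * x powr C1)" using len_pos[OF ab] by (rule mult_right_le_imp_le)
    then have "1 / (2 * C2) \<le> x powr C1" using Cpos by (simp add: field_simps)
    then have "(1 / (2 * C2)) powr (1 / C1) \<le> (x powr C1) powr (1 / C1)" using Cpos by (intro powr_mono2) auto
    also have "\<dots> = x" using Cpos x0 by (simp add: powr_powr)
    finally have "c \<le> x" by (simp add: c_def)
    then show "c * (b - a) \<le> measure lborel E" using ab by (simp add: x_def field_simps)
  qed
qed

text \<open>The proportion is known only to exist, while a locale instance needs a term, hence
  \<open>SOME\<close>. The axiom \<open>small\<close> follows by complementation: if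
  \<open>E\<close> has at most half of the mass, its complement has at least half and so at least
  the proportion \<open>c\<close> of the length.\<close>

sublocale dyadic: dyadic_weight mass "SOME c. 0 < c \<and> c \<le> 1 \<and> (\<forall>a b E. a < b \<longrightarrow> b < a + 2 * pi \<longrightarrow> E \<subseteq> {a..b} \<longrightarrow> E \<in> sets borel \<longrightarrow>
     len a b \<le> 2 * mass E \<longrightarrow> c * (b - a) \<le> measure lborel E)" 1
proof -
  let ?P = "\<lambda>c. 0 < c \<and> c \<le> 1 \<and> (\<forall>a b E. a < b \<longrightarrow> b < a + 2 * pi \<longrightarrow> E \<subseteq> {a..b} \<longrightarrow> E \<in> sets borel \<longrightarrow>
     len a b \<le> 2 * mass E \<longrightarrow> c * (b - a) \<le> measure lborel E)"
  obtain c0 where "?P c0" by (rule half_mass_proportion) blast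
  then have P: "?P (Eps ?P)" by (rule someI)
  define c where "c = Eps ?P"
  have c: "0 < c" "c \<le> 1" "\<And>a b E. a < b \<Longrightarrow> b < a + 2 * pi \<Longrightarrow> E \<subseteq> {a..b} \<Longrightarrow> E \<in> sets borel \<Longrightarrow>
     len a b \<le> 2 * mass E \<Longrightarrow> c * (b - a) \<le> measure lborel E"
    using P unfolding c_def by simp_all
  show "dyadic_weight mass (Eps ?P) 1"
    unfolding c_def[symmetric]
  proof
    show "mass {} = 0" by (simp add: mass_def arc_mass_def)
    show "mass (A \<union> B) \<le> mass A + mass B" if "A \<in> sets borel" "B \<in> sets borel" "bounded A" "bounded B" for A B
      by (rule mass_Un[OF that])
    show "0 < mass {a..<a + l}" if "0 < l" "l \<le> 1" for a l
      using that pi_gt3 by (auto simp: mass_interval intro!: len_pos)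
    show "0 < c" "c \<le> 1" by fact+
    fix a l :: real and E assume l: "0 < l" "l \<le> 1" and E: "E \<in> sets borel" "E \<subseteq> {a..<a + l}" and half: "2 * mass E \<le> mass {a..<a + l}"
    let ?F = "{a..<a + l} - E"
    have Eb: "bounded E" using E by (meson bounded_subset bounded_closed_interval atLeastLessThan_subseteq_atLeastAtMost_iff order_refl)
    have "mass (E \<union> ?F) \<le> mass E + mass ?F" using E Eb by (intro mass_Un) (auto intro: bounded_subset[OF bounded_closed_interval[of a "a + l"]])
    moreover have "E \<union> ?F = {a..<a + l}" using E by auto
    ultimately have "len a (a + l) \<le> 2 * mass ?F" using half by (simp add: mass_interval)
    then have "c * (a + l - a) \<le> measure lborel ?F" using l pi_gt3 E by (intro c(3)) auto
    also have "measure lborel ?F = measure lborel {a..<a + l} - measure lborel E"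
      using E l by (intro measure_Diff) auto
    finally show "measure lborel E \<le> (1 - c) * l" using l by (simp add: algebra_simps)
  qed
qed

text \<open>What is removed has proportion at most k/2, less than the proportion k that any set with
  half of the mass must have. So the remaining interval keeps half of the mass.\<close>

lemma doubling_step:
  obtains \<epsilon> where "0 < \<epsilon>" "\<epsilon> < 1" "\<And>a b c d. a \<le> c \<Longrightarrow> c < d \<Longrightarrow> d \<le> b \<Longrightarrow> b < a + 2 * pi \<Longrightarrow>
     (1 - \<epsilon>) * (b - a) \<le> d - c \<Longrightarrow> len a b \<le> 2 * len c d"
proof -
  obtain k where k: "0 < k" "k \<le> 1" "\<And>a b E. a < b \<Longrightarrow> b < a + 2 * pi \<Longrightarrow> E \<subseteq> {a..b} \<Longrightarrow> E \<in> sets borel \<Longrightarrow>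
     len a b \<le> 2 * mass E \<Longrightarrow> k * (b - a) \<le> measure lborel E" by (rule half_mass_proportion) blast
  show thesis
  proof
    show "0 < k / 2" "k / 2 < 1" using k by auto
    fix a b c d assume le: "a \<le> c" "c < d" "d \<le> b" "b < a + 2 * pi" "(1 - k / 2) * (b - a) \<le> d - c"
    let ?E = "{a..b} - {c..<d}"
    have ab: "a < b" using le by simp
    have "measure lborel ?E = (b - a) - (d - c)"
      using le by (subst measure_Diff) auto
    also have "\<dots> \<le> k / 2 * (b - a)"
    proof -
      define x where "x = k / 2 * (b - a)"
      have "(1 - k / 2) * (b - a) = (b - a) - x" by (simp only: x_def left_diff_distrib mult_1_left)
      then show ?thesis using le(5) unfolding x_def[symmetric] by linarith
    qed
    also have "\<dots> < k * (b - a)" using k ab by simp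
    finally have "\<not> len a b \<le> 2 * mass ?E" using k(3)[of a b ?E] ab le by auto
    moreover have "mass {a..<b} \<le> mass ({c..<d} \<union> ?E)"
      unfolding mass_def using mass_fin[of "{c..<d} \<union> ?E"]
      by (intro enn2real_mono arc_mass_mono) (auto intro: bounded_subset[OF bounded_closed_interval[of a b]])
    moreover have "mass ({c..<d} \<union> ?E) \<le> mass {c..<d} + mass ?E"
      by (intro mass_Un) (auto intro: bounded_subset[OF bounded_closed_interval[of a b]] bounded_subset[OF bounded_closed_interval[of c d]])
    ultimately show "len a b \<le> 2 * len c d" by (simp add: mass_interval)
  qed
qed

text \<open>The inner interval is enlarged by the factor 1 / (1 - \<epsilon>) at each step, and each
  step at most doubles the mass. The number of steps depends only on \<open>k\<close>.\<close>

lemma doubling: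
  fixes k :: real
  obtains D where "0 < D" "\<And>a b c d. a \<le> c \<Longrightarrow> c < d \<Longrightarrow> d \<le> b \<Longrightarrow> b < a + 2 * pi \<Longrightarrow> b - a \<le> k * (d - c) \<Longrightarrow> len a b \<le> D * len c d"
proof -
  obtain \<epsilon> where \<epsilon>: "0 < \<epsilon>" "\<epsilon> < 1" "\<And>a b c d. a \<le> c \<Longrightarrow> c < d \<Longrightarrow> d \<le> b \<Longrightarrow> b < a + 2 * pi \<Longrightarrow>
     (1 - \<epsilon>) * (b - a) \<le> d - c \<Longrightarrow> len a b \<le> 2 * len c d" by (rule doubling_step) blast
  have it: "len a b \<le> 2 ^ n * len c d"
    if "a \<le> c" "c < d" "d \<le> b" "b < a + 2 * pi" "(1 - \<epsilon>) ^ n * (b - a) \<le> d - c" for n a b c d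
    using that
  proof (induction n arbitrary: a b)
    case 0
    then have "a = c" "b = d" by auto
    then show ?case by simp
  next
    case (Suc n)
    show ?case
    proof (cases "(1 - \<epsilon>) * (b - a) \<le> d - c")
      case True
      then have "len a b \<le> 2 * len c d" using Suc.prems by (intro \<epsilon>(3)) auto
      also have "2 * len c d \<le> 2 ^ Suc n * len c d" by (intro mult_right_mono) (auto simp: len_nonneg)
      finally show ?thesis .
    next
      case False
      \<comment> \<open>Interpolation parameter between the inner and the outer interval, chosen so
        that the intermediate one has length exactly (1 - \<epsilon>) * (b - a). Interpolating both
        endpoints keeps the three intervals nested.\<close>
      define s where "s = ((1 - \<epsilon>) * (b - a) - (d - c)) / ((b - a) - (d - c))"
      have pos: "0 < (b - a) - (d - c)"
      proof -
        have "(1 - \<epsilon>) * (b - a) \<le> 1 * (b - a)" using \<epsilon> Suc.prems by (intro mult_right_mono) auto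
        then show ?thesis using False by simp
      qed
      have s: "0 \<le> s" "s \<le> 1"
      proof -
        show "0 \<le> s" using False pos by (simp add: s_def)
        have "(1 - \<epsilon>) * (b - a) \<le> 1 * (b - a)" using \<epsilon> Suc.prems by (intro mult_right_mono) auto
        then show "s \<le> 1" using pos by (simp add: s_def)
      qed
      define a' b' where "a' = c - s * (c - a)" and "b' = d + s * (b - d)"
      have "s * (c - a) \<le> 1 * (c - a)" "s * (b - d) \<le> 1 * (b - d)" using s Suc.prems by (intro mult_right_mono; simp)+
      then have in1: "a \<le> a'" "b' \<le> b" by (auto simp: a'_def b'_def)
      have "0 \<le> s * (c - a)" "0 \<le> s * (b - d)" using s Suc.prems by auto
      then have in2: "a' \<le> c" "d \<le> b'" by (auto simp: a'_def b'_def)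
      have "b' - a' = (d - c) + s * ((b - a) - (d - c))" by (simp add: a'_def b'_def algebra_simps)
      also have "\<dots> = (1 - \<epsilon>) * (b - a)" using pos by (simp add: s_def)
      finally have len: "b' - a' = (1 - \<epsilon>) * (b - a)" .
      have "len a b \<le> 2 * len a' b'" using in1 in2 Suc.prems len by (intro \<epsilon>(3)) auto
      also have "(1 - \<epsilon>) ^ n * (b' - a') \<le> d - c"
        unfolding len using Suc.prems(5) by (simp only: power_Suc2 mult.assoc)
      then have "len a' b' \<le> 2 ^ n * len c d"
        using in1 in2 Suc.prems by (intro Suc.IH) auto
      finally show ?thesis by simp
    qed
  qed
  obtain n where n: "(1 - \<epsilon>) ^ n < 1 / max k 1" 
  proof -
    have "0 < 1 / max k 1" "1 - \<epsilon> < 1" using \<epsilon> by auto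
    from real_arch_pow_inv[OF this] show ?thesis using that by blast
  qed
  show thesis
  proof
    show "0 < (2::real) ^ n" by simp
    fix a b c d assume le: "a \<le> c" "c < d" "d \<le> b" "b < a + 2 * pi" "b - a \<le> k * (d - c)"
    have "(1 - \<epsilon>) ^ n * (b - a) \<le> 1 / max k 1 * (max k 1 * (d - c))"
    proof (rule mult_mono)
      have "k * (d - c) \<le> max k 1 * (d - c)" using le by (intro mult_right_mono) auto
      then show "b - a \<le> max k 1 * (d - c)" using le(5) by linarith
    qed (use n le \<epsilon> in auto)
    then show "len a b \<le> 2 ^ n * len c d" using le by (intro it) auto
  qed
qed

lemma len_shift_int: "len (a + of_int n * (2 * pi)) (b + of_int n * (2 * pi)) = len a b"
proof -
  have nat: "len (a + real k * (2 * pi)) (b + real k * (2 * pi)) = len a b" for k a b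
  proof (induction k)
    case (Suc k)
    have "len (a + real (Suc k) * (2 * pi)) (b + real (Suc k) * (2 * pi))
        = len ((a + real k * (2 * pi)) + 2 * pi) ((b + real k * (2 * pi)) + 2 * pi)" by (simp add: algebra_simps)
    then show ?case using Suc len_shift by simp
  qed simp
  show ?thesis
  proof (cases "0 \<le> n")
    case True
    then show ?thesis using nat[where k="nat n"] by simp
  next
    case False
    then show ?thesis
      using nat[of "a + of_int n * (2 * pi)" "nat (-n)" "b + of_int n * (2 * pi)"] by simp
  qed
qed

text \<open>The A_infinity inequality is applied inside an interval of length 3, which is below 2 *
  pi. The mass of such intervals is bounded uniformly by periodicity, so the modulus does not depend
  on the position.\<close>

lemma len_small:
  assumes "0 < \<epsilon>" obtains \<delta> where "0 < \<delta>" "\<And>a b. a < b \<Longrightarrow> b - a < \<delta> \<Longrightarrow> len a b < \<epsilon>"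
proof -
  define B where "B = len 0 (2 * pi + 3) + 1"
  have Bpos: "0 < B" using len_nonneg[of 0 "2 * pi + 3"] by (simp add: B_def)
  have B: "len a (a + 3) \<le> B" for a
  proof -
    obtain n :: int where n: "0 \<le> a + of_int n * (2 * pi)" "a + of_int n * (2 * pi) < 0 + 2 * pi"
      by (rule periodic_representative)
    have "len a (a + 3) = len (a + of_int n * (2 * pi)) (a + 3 + of_int n * (2 * pi))" by (rule len_shift_int[symmetric])
    also have "\<dots> \<le> len 0 (2 * pi + 3)" using n by (intro len_mono) auto
    finally show ?thesis by (simp add: B_def)
  qed
  \<comment> \<open>Solves C2 * y powr C1 * B = \<epsilon> / 2.\<close>
  define y where "y = (\<epsilon> / (2 * C2 * B)) powr (1 / C1)"
  have q: "0 < \<epsilon> / (2 * C2 * B)" using assms Cpos Bpos by simp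
  have y: "0 < y" unfolding y_def powr_gt_zero using q by linarith
  show thesis
  proof
    show "0 < min 1 (3 * y)" using y by simp
    fix a b :: real assume ab: "a < b" "b - a < min 1 (3 * y)"
    have "len a b \<le> C2 * (measure lborel {a..<b} / (a + 3 - a)) powr C1 * len a (a + 3)"
      unfolding mass_interval[symmetric, of a b] using ab pi_gt3 by (intro A_inf_real) auto
    also have "\<dots> = C2 * ((b - a) / 3) powr C1 * len a (a + 3)" using ab by simp
    also have "\<dots> \<le> C2 * y powr C1 * B"
      using ab Cpos y B[of a] len_nonneg by (intro mult_mono mult_left_mono powr_mono2) auto
    also have "y powr C1 = (\<epsilon> / (2 * C2 * B)) powr (1 / C1 * C1)" unfolding y_def by (rule powr_powr)
    also have "1 / C1 * C1 = 1" using Cpos by simp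
    also have "(\<epsilon> / (2 * C2 * B)) powr 1 = \<epsilon> / (2 * C2 * B)" by (rule powr_one, insert q, linarith)
    also have "C2 * (\<epsilon> / (2 * C2 * B)) * B = \<epsilon> / 2" using Cpos Bpos by simp
    also have "\<dots> < \<epsilon>" using assms by simp
    finally show "len a b < \<epsilon>" .
  qed
qed

end

subsection \<open>The Poincare metric\<close>

lemma one_minus_cnj_mult: "1 - cnj w * w = of_real (1 - (cmod w)\<^sup>2)"
  by (simp only: of_real_diff of_real_1 complex_norm_square mult.commute[of "cnj w" w])

lemma Moebius_function_has_derivative_zero:
  assumes "cmod w < 1"
  shows "(Moebius_function 0 w has_field_derivative of_real (1 / (1 - (cmod w)\<^sup>2))) (at w)"
proof -
  have "(cmod w)\<^sup>2 < 1" using assms by (simp add: abs_square_less_1)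
  then have ne: "1 - cnj w * w \<noteq> 0" unfolding one_minus_cnj_mult by (simp only: of_real_eq_0_iff)
  have "((\<lambda>z. (z - w) / (1 - cnj w * z)) has_field_derivative
      ((1 - 0) * (1 - cnj w * w) - (w - w) * (0 - cnj w * 1)) / ((1 - cnj w * w) * (1 - cnj w * w))) (at w)"
    by (intro DERIV_divide DERIV_diff DERIV_ident DERIV_const DERIV_cmult ne)
  moreover have "((1 - 0) * (1 - cnj w * w) - (w - w) * (0 - cnj w * 1)) / ((1 - cnj w * w) * (1 - cnj w * w)) = 1 / (1 - cnj w * w)"
    using ne by simp
  moreover have "1 / (1 - cnj w * w) = of_real (1 / (1 - (cmod w)\<^sup>2))"
    unfolding one_minus_cnj_mult by (simp only: of_real_divide of_real_1)
  moreover have "Moebius_function 0 w = (\<lambda>z. (z - w) / (1 - cnj w * z))" by (auto simp: Moebius_function_simple)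
  ultimately show ?thesis by (simp only:)
qed

lemma Moebius_function_has_derivative_at_0:
  "(Moebius_function 0 (- w) has_field_derivative of_real (1 - (cmod w)\<^sup>2)) (at 0)"
proof -
  have "((\<lambda>z. (z - (- w)) / (1 - cnj (- w) * z)) has_field_derivative 1 - cnj w * w) (at 0)"
    by (auto intro!: derivative_eq_intros)
  moreover have "Moebius_function 0 (- w) = (\<lambda>z. (z - (- w)) / (1 - cnj (- w) * z))" by (auto simp: Moebius_function_simple)
  ultimately show ?thesis by (simp only: one_minus_cnj_mult)
qed

text \<open>Schwarz's lemma for \<open>f\<close> on the disc of radius \<open>d\<close>, rescaled to
  the unit disc and followed by the Moebius map that sends f a to 0.\<close>

lemma conformal_density_le:
  assumes f: "conformal_onto_disc f \<Omega>" and d: "0 < d" "ball a d \<subseteq> \<Omega>" and op: "open \<Omega>"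
  shows "cmod (deriv f a) / (1 - (cmod (f a))\<^sup>2) \<le> 1 / d"
proof -
  have holf: "f holomorphic_on \<Omega>" and fim: "f ` \<Omega> = ball 0 1" using f by (auto simp: conformal_onto_disc_def)
  have a: "a \<in> \<Omega>" using d by auto
  then have fa: "cmod (f a) < 1" using fim by force
  define h where "h \<xi> = Moebius_function 0 (f a) (f (a + of_real d * \<xi>))" for \<xi>
  have inO: "a + of_real d * \<xi> \<in> \<Omega>" if "cmod \<xi> < 1" for \<xi>
    using that d by (intro d(2)[THEN subsetD]) (simp add: dist_norm norm_mult)
  have hol1: "(\<lambda>\<xi>. f (a + of_real d * \<xi>)) holomorphic_on ball 0 1"
    by (rule holomorphic_on_compose_gen[OF _ holf, unfolded o_def]) (auto intro!: holomorphic_intros inO)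
  have holh: "h holomorphic_on ball 0 1"
    unfolding h_def
    by (rule holomorphic_on_compose_gen[OF hol1 Moebius_function_holomorphic[OF fa, of 0], unfolded o_def])
      (use inO fim in force)
  have "cmod (deriv h 0) \<le> 1"
  proof (rule Schwarz_Lemma(2)[OF holh])
    show "h 0 = 0" by (simp add: h_def Moebius_function_eq_zero)
    show "cmod (h z) < 1" if "cmod z < 1" for z
      unfolding h_def using inO[OF that] fim by (intro Moebius_function_norm_lt_1[OF fa]) force
    show "cmod (0::complex) < 1" by simp
  qed
  moreover have "(h has_field_derivative of_real (1 / (1 - (cmod (f a))\<^sup>2)) * (deriv f a * of_real d)) (at 0)"
  proof -
    have "(f has_field_derivative deriv f a) (at (a + of_real d * 0))"
      using holomorphic_derivI[OF holf op a] by simp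
    moreover have "((\<lambda>\<xi>. a + of_real d * \<xi>) has_field_derivative of_real d) (at 0)" by (auto intro!: derivative_eq_intros)
    ultimately have "((\<lambda>\<xi>. f (a + of_real d * \<xi>)) has_field_derivative deriv f a * of_real d) (at 0)"
      by (rule DERIV_chain2)
    moreover have "(Moebius_function 0 (f a) has_field_derivative of_real (1 / (1 - (cmod (f a))\<^sup>2))) (at (f (a + of_real d * 0)))"
      using Moebius_function_has_derivative_zero[OF fa] by simp
    ultimately show ?thesis unfolding h_def by (rule DERIV_chain2[rotated])
  qed
  ultimately have "cmod (of_real (1 / (1 - (cmod (f a))\<^sup>2)) * (deriv f a * of_real d)) \<le> 1" by (simp only: DERIV_imp_deriv)
  moreover have "0 < 1 - (cmod (f a))\<^sup>2" using fa by (simp add: abs_square_less_1)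
  moreover have "cmod (of_real (1 / (1 - (cmod (f a))\<^sup>2)) * (deriv f a * of_real d)) = 1 / (1 - (cmod (f a))\<^sup>2) * (cmod (deriv f a) * d)"
    using d(1) \<open>0 < 1 - (cmod (f a))\<^sup>2\<close> by (simp only: norm_mult norm_of_real) simp
  moreover have "X / P \<le> 1 / d" if "0 < P" "1 / P * (X * d) \<le> 1" for X P :: real
    using that d(1) by (simp add: field_simps)
  ultimately show ?thesis by simp
qed

text \<open>The logarithm of a univalent function omitting \<open>0\<close> cannot cover a disc of radius larger
  than \<open>\<pi>\<close>, because \<open>exp\<close> identifies two points of such a disc; so Bloch's theorem bounds its derivative.\<close>
lemma univalent_omitting_deriv_le:
  assumes holH: "H holomorphic_on ball 0 1" and inj: "inj_on H (ball 0 1)" and omit: "\<And>z. z \<in> ball 0 1 \<Longrightarrow> H z \<noteq> w0"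
  shows "cmod (deriv H 0) \<le> 12 * pi * cmod (H 0 - w0)"
proof -
  have hol: "(\<lambda>z. H z - w0) holomorphic_on ball 0 1" by (intro holomorphic_intros holH)
  obtain l where l: "l holomorphic_on ball 0 1" "\<And>z. z \<in> ball 0 1 \<Longrightarrow> H z - w0 = exp (l z)"
  proof (rule contractible_imp_holomorphic_log[OF hol convex_imp_contractible[OF convex_ball]])
    show "H z - w0 \<noteq> 0" if "z \<in> ball 0 1" for z using omit[OF that] by simp
  qed (rule that)
  have "cmod (deriv l 0) / 12 \<le> pi"
  proof (rule ccontr)
    assume neg: "\<not> cmod (deriv l 0) / 12 \<le> pi"
    obtain b where b: "ball b (cmod (deriv l 0) / 12) \<subseteq> l ` ball 0 1"
      by (rule Bloch[OF l(1), of "cmod (deriv l 0) / 12"]) auto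
    have "b + of_real pi * \<i> \<in> ball b (cmod (deriv l 0) / 12)" "b - of_real pi * \<i> \<in> ball b (cmod (deriv l 0) / 12)"
      using neg by (auto simp: dist_norm norm_mult)
    then have im: "b + of_real pi * \<i> \<in> l ` ball 0 1" "b - of_real pi * \<i> \<in> l ` ball 0 1"
      using b by (auto simp del: mem_ball dest: subsetD)
    obtain p where p: "b + of_real pi * \<i> = l p" "p \<in> ball 0 1" using im(1) by (rule imageE)
    obtain q where q: "b - of_real pi * \<i> = l q" "q \<in> ball 0 1" using im(2) by (rule imageE)
    note pq = p(2) q(2) p(1)[symmetric] q(1)[symmetric]
    have "exp (l p) = exp (l q)" unfolding pq by (simp add: exp_add exp_diff)
    then have "H p = H q" using l(2) pq(1,2) by (metis diff_add_cancel)
    then have "p = q" using inj pq by (auto simp: inj_on_def)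
    then have "b + of_real pi * \<i> = b - of_real pi * \<i>" unfolding pq(3,4)[symmetric] by (rule arg_cong)
    then show False by (auto simp: complex_eq_iff)
  qed
  have 0: "(0::complex) \<in> ball 0 1" by simp
  have "((\<lambda>z. exp (l z)) has_field_derivative exp (l 0) * deriv l 0) (at 0)"
    using holomorphic_derivI[OF l(1) open_ball 0] by (auto intro!: derivative_eq_intros)
  moreover have "((\<lambda>z. exp (l z)) has_field_derivative deriv H 0) (at 0)"
  proof (rule has_field_derivative_transform_within_open[OF _ open_ball 0])
    show "((\<lambda>z. H z - w0) has_field_derivative deriv H 0) (at 0)"
      using holomorphic_derivI[OF holH open_ball 0] by (auto intro!: derivative_eq_intros)
  qed (use l(2) in auto)
  ultimately have "deriv H 0 = (H 0 - w0) * deriv l 0" using DERIV_unique l(2)[OF 0] by metis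
  then have "cmod (deriv H 0) = cmod (H 0 - w0) * cmod (deriv l 0)" by (simp add: norm_mult)
  also have "\<dots> \<le> cmod (H 0 - w0) * (12 * pi)"
    using \<open>cmod (deriv l 0) / 12 \<le> pi\<close> by (intro mult_left_mono) auto
  finally show ?thesis by (simp add: mult.commute)
qed

text \<open>The inverse of \<open>f\<close>, preceded by a Moebius map taking 0 to f z, is univalent
  and omits \<open>w0\<close>. Its derivative at 0 has the reciprocal of the density as its modulus,
  so an upper bound for the one is a lower bound for the other.\<close>

lemma conformal_density_ge:
  assumes f: "conformal_onto_disc f \<Omega>" and op: "open \<Omega>" and z: "z \<in> \<Omega>" and w0: "w0 \<notin> \<Omega>"
  shows "1 \<le> 12 * pi * cmod (z - w0) * (cmod (deriv f z) / (1 - (cmod (f z))\<^sup>2))"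
proof -
  have holf: "f holomorphic_on \<Omega>" and fim: "f ` \<Omega> = ball 0 1" and inj: "inj_on f \<Omega>" using f by (auto simp: conformal_onto_disc_def)
  obtain g where g: "g holomorphic_on f ` \<Omega>" "\<And>z. z \<in> \<Omega> \<Longrightarrow> deriv f z * deriv g (f z) = 1" "\<And>z. z \<in> \<Omega> \<Longrightarrow> g (f z) = z"
    by (rule holomorphic_has_inverse[OF holf op inj]) blast
  define b where "b = f z"
  have b: "cmod b < 1" using z fim by (force simp: b_def)
  let ?M = "Moebius_function 0 (- b)"
  have Mball: "?M \<xi> \<in> ball 0 1" if "\<xi> \<in> ball 0 1" for \<xi>
    using Moebius_function_norm_lt_1[of "-b" \<xi> 0] b that by simp
  have fg: "f (g v) = v \<and> g v \<in> \<Omega>" if "v \<in> ball 0 1" for v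
    using that g(3) unfolding fim[symmetric] by auto
  define H where "H \<xi> = g (?M \<xi>)" for \<xi>
  have M0: "?M 0 = b" by (simp add: Moebius_function_of_zero)
  have "cmod (deriv H 0) \<le> 12 * pi * cmod (H 0 - w0)"
  proof (rule univalent_omitting_deriv_le)
    show "H holomorphic_on ball 0 1" unfolding H_def
      by (rule holomorphic_on_compose_gen[OF Moebius_function_holomorphic g(1), unfolded o_def]) (use b Mball fim in auto)
    show "inj_on H (ball 0 1)"
    proof (rule inj_onI)
      fix x y assume xy: "x \<in> ball 0 1" "y \<in> ball 0 1" "H x = H y"
      then have "?M x = ?M y" using fg Mball unfolding H_def by metis
      moreover have "Moebius_function 0 b (?M v) = v" if "v \<in> ball 0 1" for v
        using Moebius_function_compose[of b "-b" v] b that by simp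
      ultimately show "x = y" using xy by metis
    qed
    show "H v \<noteq> w0" if "v \<in> ball 0 1" for v using fg[OF Mball[OF that]] w0 by (auto simp: H_def)
  qed
  moreover have "H 0 = g b" by (simp only: H_def M0)
  then have "H 0 = z" using g(3)[OF z] by (simp only: b_def)
  moreover have "deriv H 0 = deriv g b * of_real (1 - (cmod b)\<^sup>2)"
  proof (rule DERIV_imp_deriv)
    have "(g has_field_derivative deriv g b) (at (?M 0))"
      unfolding M0 using holomorphic_derivI[OF g(1)[unfolded fim] open_ball] b by simp
    then show "(H has_field_derivative deriv g b * of_real (1 - (cmod b)\<^sup>2)) (at 0)"
      unfolding H_def by (rule DERIV_chain2[OF _ Moebius_function_has_derivative_at_0])
  qed
  ultimately have "cmod (deriv g b * of_real (1 - (cmod b)\<^sup>2)) \<le> 12 * pi * cmod (z - w0)" by simp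
  moreover have p: "0 < 1 - (cmod b)\<^sup>2" using b by (simp add: abs_square_less_1)
  moreover have "cmod (deriv g b * of_real (1 - (cmod b)\<^sup>2)) = cmod (deriv g b) * (1 - (cmod b)\<^sup>2)"
    using p by (simp only: norm_mult norm_of_real abs_of_pos)
  ultimately have le: "cmod (deriv g b) * (1 - (cmod b)\<^sup>2) \<le> 12 * pi * cmod (z - w0)" by simp
  have one: "cmod (deriv f z) * cmod (deriv g b) = 1" using g(2)[OF z] unfolding b_def norm_mult[symmetric] by simp
  have "1 = (cmod (deriv g b) * (1 - (cmod b)\<^sup>2)) * (cmod (deriv f z) / (1 - (cmod b)\<^sup>2))"
    using p one by (simp add: field_simps)
  also have "\<dots> \<le> (12 * pi * cmod (z - w0)) * (cmod (deriv f z) / (1 - (cmod b)\<^sup>2))"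
    using le p by (intro mult_right_mono) auto
  finally show ?thesis by (simp add: b_def)
qed

lemma norm_exp_minus_one_le: "norm (exp z - 1) \<le> exp (norm z) - (1::real)" for z :: complex
proof -
  have s: "summable (\<lambda>n. norm (inverse (fact (Suc n)) *\<^sub>R z ^ Suc n))"
    using summable_norm_exp[of z] by (subst summable_Suc_iff)
  have "exp z - 1 = (\<Sum>n. inverse (fact (Suc n)) *\<^sub>R z ^ Suc n)" using exp_first_term[of z] by simp
  also have "norm \<dots> \<le> (\<Sum>n. norm (inverse (fact (Suc n)) *\<^sub>R z ^ Suc n))" by (rule summable_norm[OF s])
  also have "\<dots> = (\<Sum>n. inverse (fact (Suc n)) *\<^sub>R norm z ^ Suc n)" by (simp add: norm_mult norm_power)
  also have "\<dots> = exp (norm z) - 1" using exp_first_term[of "norm z"] by simp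
  finally show ?thesis .
qed

text \<open>\<open>poincare_density\<close> fixes one Riemann map by choice. The bounds on it hold
  for every Riemann map, so only existence is assumed here.\<close>

locale conformal_disc =
  fixes \<Omega> :: "complex set"
  assumes op: "open \<Omega>" and ex: "\<exists>f. conformal_onto_disc f \<Omega>"
begin

lemma density_le: "0 < d \<Longrightarrow> ball a d \<subseteq> \<Omega> \<Longrightarrow> poincare_density \<Omega> a \<le> 1 / d"
  unfolding poincare_density_def Let_def by (rule conformal_density_le[OF someI_ex[OF ex] _ _ op])

lemma density_ge: "z \<in> \<Omega> \<Longrightarrow> w0 \<notin> \<Omega> \<Longrightarrow> 1 \<le> 12 * pi * cmod (z - w0) * poincare_density \<Omega> z"
  unfolding poincare_density_def Let_def by (rule conformal_density_ge[OF someI_ex[OF ex] op])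

text \<open>Along a path the density is at least 1 / (12 * pi * |z - w0|), so its length dominates
  |X| / (12 * pi) for the integral X of dz / (z - w0). Since exp X = (b - w0) / (a - w0), the
  estimate |exp X - 1| \<le> exp |X| - 1 bounds |X| below by a logarithm.\<close>

lemma poincare_dist_ge:
  assumes w0: "w0 \<notin> \<Omega>" and ab: "a \<in> \<Omega>" "b \<in> \<Omega>"
  shows "ennreal (ln (1 + cmod (b - a) / cmod (a - w0)) / (12 * pi)) \<le> poincare_dist \<Omega> a b"
  unfolding poincare_dist_def
proof (rule INF_greatest)
  fix \<gamma> assume "\<gamma> \<in> {g. valid_path g \<and> path_image g \<subseteq> \<Omega> \<and> pathstart g = a \<and> pathfinish g = b}"
  then have \<gamma>: "valid_path \<gamma>" "path_image \<gamma> \<subseteq> \<Omega>" "\<gamma> 0 = a" "\<gamma> 1 = b" by (auto simp: pathstart_def pathfinish_def)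
  have in\<Omega>: "\<gamma> t \<in> \<Omega>" if "t \<in> {0..1}" for t using that \<gamma>(2) by (auto simp: path_image_def)
  have nin: "w0 \<notin> \<gamma> ` {0..1}" using in\<Omega> w0 by blast
  let ?F = "\<lambda>t. vector_derivative \<gamma> (at t) / (\<gamma> t - w0)"
  define X where "X = integral {0..1} ?F"
  note W = winding_number_exp_integral[OF \<gamma>(1)[unfolded valid_path_def] zero_le_one nin]
  have hi: "(?F has_integral X) {0..1}" unfolding X_def by (rule integrable_integral[OF W(1)])
  have aw: "a - w0 \<noteq> 0" using ab w0 by auto
  have "exp (- X) * (b - w0) = a - w0" using W(2) \<gamma> by (simp add: X_def)
  then have "b - w0 = exp X * (a - w0)" by (metis exp_minus_inverse mult.assoc mult.left_neutral)
  then have "b - a = (exp X - 1) * (a - w0)" by (simp add: algebra_simps)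
  then have "cmod (b - a) = cmod (exp X - 1) * cmod (a - w0)" by (simp add: norm_mult)
  then have "cmod (b - a) / cmod (a - w0) \<le> exp (cmod X) - 1"
    using aw norm_exp_minus_one_le[of X] by simp
  then have "1 + cmod (b - a) / cmod (a - w0) \<le> exp (cmod X)" by simp
  then have "ln (1 + cmod (b - a) / cmod (a - w0)) \<le> cmod X"
    by (subst ln_exp[of "cmod X", symmetric], subst ln_le_cancel_iff) (auto simp: add_pos_nonneg)
  then have "ln (1 + cmod (b - a) / cmod (a - w0)) / (12 * pi) \<le> norm ((1 / (12 * pi)) *\<^sub>R X)"
    by (simp add: divide_right_mono)
  then have "ennreal (ln (1 + cmod (b - a) / cmod (a - w0)) / (12 * pi)) \<le> ennreal (norm ((1 / (12 * pi)) *\<^sub>R X))"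
    by (rule ennreal_leI)
  also have "\<dots> \<le> (\<integral>\<^sup>+t\<in>{0..1}. ennreal (norm ((1 / (12 * pi)) *\<^sub>R ?F t)) \<partial>lborel)"
    using has_integral_norm_le_nn_integral[OF has_integral_cmul[OF hi]] unfolding nn_integral_completion .
  also have "\<dots> \<le> (\<integral>\<^sup>+ t\<in>{0..1}. ennreal (poincare_density \<Omega> (\<gamma> t) * cmod (vector_derivative \<gamma> (at t))) \<partial>lborel)"
  proof (rule nn_integral_mono)
    fix t :: real
    have "norm ((1 / (12 * pi)) *\<^sub>R ?F t) \<le> poincare_density \<Omega> (\<gamma> t) * cmod (vector_derivative \<gamma> (at t))" if t: "t \<in> {0..1}"
    proof -
      have p: "0 < cmod (\<gamma> t - w0)" using in\<Omega>[OF t] w0 by auto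
      have "1 / (12 * pi * cmod (\<gamma> t - w0)) \<le> poincare_density \<Omega> (\<gamma> t)"
        using density_ge[OF in\<Omega>[OF t] w0] p by (simp add: divide_simps mult.commute)
      then have "1 / (12 * pi * cmod (\<gamma> t - w0)) * cmod (vector_derivative \<gamma> (at t)) \<le> poincare_density \<Omega> (\<gamma> t) * cmod (vector_derivative \<gamma> (at t))"
        by (rule mult_right_mono) simp
      then show ?thesis by (simp add: norm_divide)
    qed
    then show "ennreal (norm ((1 / (12 * pi)) *\<^sub>R ?F t)) * indicator {0..1} t
      \<le> ennreal (poincare_density \<Omega> (\<gamma> t) * cmod (vector_derivative \<gamma> (at t))) * indicator {0..1} t"
      by (auto simp: indicator_def simp del: norm_scaleR intro!: ennreal_leI)
  qed
  finally show "ennreal (ln (1 + cmod (b - a) / cmod (a - w0)) / (12 * pi))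
     \<le> (\<integral>\<^sup>+ t\<in>{0..1}. ennreal (poincare_density \<Omega> (\<gamma> t) * cmod (vector_derivative \<gamma> (at t))) \<partial>lborel)" .
qed

lemma poincare_dist_segment_le:
  assumes d: "0 < d" and seg: "\<And>z. z \<in> closed_segment a b \<Longrightarrow> ball z d \<subseteq> \<Omega>"
  shows "poincare_dist \<Omega> a b \<le> ennreal (cmod (b - a) / d)"
proof -
  let ?\<gamma> = "linepath a b"
  have "?\<gamma> \<in> {g. valid_path g \<and> path_image g \<subseteq> \<Omega> \<and> pathstart g = a \<and> pathfinish g = b}"
    using seg d by (auto simp: subset_iff)
  then have "poincare_dist \<Omega> a b \<le> (\<integral>\<^sup>+ t\<in>{0..1}. ennreal (poincare_density \<Omega> (?\<gamma> t) * cmod (vector_derivative ?\<gamma> (at t))) \<partial>lborel)"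
    unfolding poincare_dist_def by (rule INF_lower)
  also have "\<dots> \<le> (\<integral>\<^sup>+ t. ennreal (cmod (b - a) / d) * indicator {0..1::real} t \<partial>lborel)"
  proof (rule nn_integral_mono)
    fix t :: real
    have "poincare_density \<Omega> (?\<gamma> t) * cmod (vector_derivative ?\<gamma> (at t)) \<le> cmod (b - a) / d" if "t \<in> {0..1}"
    proof -
      have "?\<gamma> t \<in> closed_segment a b" using that by (auto simp: linepath_in_path)
      then have "poincare_density \<Omega> (?\<gamma> t) \<le> 1 / d" using d seg by (intro density_le) auto
      then have "poincare_density \<Omega> (?\<gamma> t) * cmod (b - a) \<le> 1 / d * cmod (b - a)" by (rule mult_right_mono) simp
      then show ?thesis by simp
    qed
    then show "ennreal (poincare_density \<Omega> (?\<gamma> t) * cmod (vector_derivative ?\<gamma> (at t))) * indicator {0..1} t \<le> ennreal (cmod (b - a) / d) * indicator {0..1} t"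
      by (auto simp: indicator_def intro!: ennreal_leI)
  qed
  also have "\<dots> = ennreal (cmod (b - a) / d)" by (simp add: nn_integral_cmult_indicator)
  finally show ?thesis .
qed

end

subsection \<open>Change of variables in the plane\<close>

text \<open>The change of variables theorem is available on \<open>real ^ 2\<close>; this pair of
  maps carries it to the complex plane.\<close>

definition cplx :: "real ^ 2 \<Rightarrow> complex" where "cplx v = Complex (v $ 1) (v $ 2)"
definition vec2 :: "complex \<Rightarrow> real ^ 2" where "vec2 z = vector [Re z, Im z]"

lemma vec2_cplx [simp]: "vec2 (cplx v) = v" by (simp add: vec2_def cplx_def vec_eq_iff forall_2)
lemma cplx_vec2 [simp]: "cplx (vec2 z) = z" by (simp add: vec2_def cplx_def)

lemma bounded_linear_cplx: "bounded_linear cplx"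
  unfolding linear_conv_bounded_linear[symmetric]
  by (rule linearI) (simp_all add: cplx_def complex_eq_iff)

lemma bounded_linear_vec2: "bounded_linear vec2"
  unfolding linear_conv_bounded_linear[symmetric]
  by (rule linearI) (simp_all add: vec2_def vec_eq_iff forall_2)

lemma cplx_borel [measurable]: "cplx \<in> borel \<rightarrow>\<^sub>M borel"
  by (intro borel_measurable_continuous_onI linear_continuous_on bounded_linear_cplx)

lemma distr_cplx: "distr lborel borel cplx = lborel"
proof (rule lborel_eqI[symmetric])
  fix l u :: complex assume lu: "\<And>b. b \<in> Basis \<Longrightarrow> l \<bullet> b \<le> u \<bullet> b"
  then have le: "Re l \<le> Re u" "Im l \<le> Im u" using lu[of 1] lu[of \<i>] by (auto simp: Basis_complex_def inner_complex_def)
  have pre: "cplx -` box l u \<inter> space lborel = box (vec2 l) (vec2 u)"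
    by (auto simp: box_complex_eq cplx_def vec2_def mem_box_cart forall_2)
  have "emeasure (distr lborel borel cplx) (box l u) = emeasure lborel (box (vec2 l) (vec2 u))"
    by (subst emeasure_distr) (auto simp: pre[simplified])
  also have "\<dots> = emeasure lborel (cbox (vec2 l) (vec2 u))"
    by (simp add: emeasure_lborel_box_eq emeasure_lborel_cbox_eq)
  also have "\<dots> = ennreal (measure lborel (cbox (vec2 l) (vec2 u)))"
    using emeasure_lborel_cbox_finite[of "vec2 l" "vec2 u"] by (intro emeasure_eq_ennreal_measure) simp
  also have "measure lborel (cbox (vec2 l) (vec2 u)) = prod (\<lambda>i. vec2 u $ i - vec2 l $ i) UNIV"
    by (rule content_cbox_cart) (use le in \<open>auto simp: interval_ne_empty_cart forall_2 vec2_def\<close>)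
  also have "\<dots> = (\<Prod>b\<in>Basis. (u - l) \<bullet> b)"
    by (simp add: UNIV_2 vec2_def Basis_complex_def)
  finally show "emeasure (distr lborel borel cplx) (box l u) = ennreal (\<Prod>b\<in>Basis. (u - l) \<bullet> b)" by simp
qed simp

lemma null_sets_cplx: "null_sets (distr lebesgue lborel cplx) = null_sets lborel"
proof -
  have "distr lebesgue lborel cplx = distr lborel lborel cplx" by (rule distr_completion) simp
  also have "\<dots> = distr lborel borel cplx" by (rule distr_cong) auto
  finally show ?thesis by (simp add: distr_cplx)
qed

lemma cplx_lebesgue [measurable]: "cplx \<in> lebesgue \<rightarrow>\<^sub>M lebesgue"
  by (rule completion.measurable_completion2) (auto simp: null_sets_cplx intro: measurable_completion)

lemma distr_lebesgue_cplx: "distr lebesgue lebesgue cplx = lebesgue"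
proof -
  have "distr lebesgue lebesgue cplx = completion (distr lebesgue lborel cplx)"
    by (rule completion.completion_distr_eq[symmetric]) (auto simp: null_sets_cplx intro: measurable_completion)
  also have "distr lebesgue lborel cplx = distr lborel lborel cplx" by (rule distr_completion) simp
  also have "\<dots> = distr lborel borel cplx" by (rule distr_cong) auto
  finally show ?thesis by (simp add: distr_cplx)
qed

lemma vec2_lebesgue [measurable]: "vec2 \<in> lebesgue \<rightarrow>\<^sub>M lebesgue"
proof (rule measurableI)
  fix A :: "(real ^ 2) set" assume A: "A \<in> sets lebesgue"
  have "vec2 -` A \<inter> space lebesgue = cplx ` A"
    by (auto simp: image_iff) (metis cplx_vec2)
  also have "\<dots> \<in> sets lebesgue"
    by (rule differentiable_image_in_sets_lebesgue[OF A]) (auto simp: bounded_linear_imp_differentiable_on[OF bounded_linear_cplx])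
  finally show "vec2 -` A \<inter> space lebesgue \<in> sets lebesgue" .
qed simp

lemma integrable_cplx:
  fixes F :: "complex \<Rightarrow> real"
  assumes "integrable lebesgue (\<lambda>v. F (cplx v))"
  shows "integrable lebesgue F" "integral\<^sup>L lebesgue F = integral\<^sup>L lebesgue (\<lambda>v. F (cplx v))"
proof -
  have "(\<lambda>z. F (cplx (vec2 z))) \<in> borel_measurable lebesgue"
    by (rule measurable_compose[OF vec2_lebesgue borel_measurable_integrable[OF assms]])
  then have m: "F \<in> borel_measurable lebesgue" by simp
  show "integrable lebesgue F"
    using integrable_distr_eq[OF cplx_lebesgue m] assms by (simp add: distr_lebesgue_cplx)
  show "integral\<^sup>L lebesgue F = integral\<^sup>L lebesgue (\<lambda>v. F (cplx v))"
    using integral_distr[OF cplx_lebesgue m] by (simp add: distr_lebesgue_cplx)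
qed

lemma integrable_cplx':
  fixes F :: "complex \<Rightarrow> real"
  assumes "integrable lebesgue F"
  shows "integrable lebesgue (\<lambda>v. F (cplx v))"
  using integrable_distr[OF cplx_lebesgue, of F] assms by (simp add: distr_lebesgue_cplx)

text \<open>The determinant of a real linear map in the basis 1, \<i>.\<close>

definition jac :: "(complex \<Rightarrow> complex) \<Rightarrow> real" where
  "jac D = Re (D 1) * Im (D \<i>) - Im (D 1) * Re (D \<i>)"

text \<open>The derivative is required at every point of \<open>S\<close>, but \<open>S\<close> is
  any measurable set, so exceptional null sets are removed from \<open>S\<close> before use. Values
  are packed into \<open>real^1\<close>, the format of the underlying theorem.\<close>

theorem complex_change_of_variables:
  fixes \<phi> :: "complex \<Rightarrow> complex" and f :: "complex \<Rightarrow> real"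
  assumes S: "S \<in> sets lebesgue" and der: "\<And>x. x \<in> S \<Longrightarrow> (\<phi> has_derivative D x) (at x)"
    and inj: "inj_on \<phi> S" and f: "f absolutely_integrable_on (\<phi> ` S)"
  shows "(\<lambda>x. \<bar>jac (D x)\<bar> * f (\<phi> x)) absolutely_integrable_on S"
    and "integral S (\<lambda>x. \<bar>jac (D x)\<bar> * f (\<phi> x)) = integral (\<phi> ` S) f"
proof -
  define S' where "S' = cplx -` S"
  define g where "g v = vec2 (\<phi> (cplx v))" for v
  define g' where "g' v = (\<lambda>w. vec2 (D (cplx v) (cplx w)))" for v
  define F where "F v = (vec (f (cplx v)) :: real^1)" for v
  have S'm: "S' \<in> sets lebesgue" unfolding S'_def using measurable_sets[OF cplx_lebesgue S] by simp
  have gd: "(g has_derivative g' v) (at v within S')" if "v \<in> S'" for v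
  proof -
    have c: "(cplx has_derivative cplx) (at v)" by (rule bounded_linear_imp_has_derivative[OF bounded_linear_cplx])
    have "((\<lambda>v. \<phi> (cplx v)) has_derivative (\<lambda>w. D (cplx v) (cplx w))) (at v)"
      by (rule has_derivative_compose[OF c der]) (use that in \<open>simp add: S'_def\<close>)
    then have "(g has_derivative g' v) (at v)"
      unfolding g_def g'_def by (rule bounded_linear.has_derivative[OF bounded_linear_vec2])
    then show ?thesis by (rule has_derivative_at_withinI)
  qed
  have injg: "inj_on g S'"
  proof (rule inj_onI)
    fix v w assume vw: "v \<in> S'" "w \<in> S'" "g v = g w"
    then have "\<phi> (cplx v) = \<phi> (cplx w)" unfolding g_def by (metis cplx_vec2)
    then have "cplx v = cplx w" using inj vw by (auto simp: inj_on_def S'_def)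
    then show "v = w" by (metis vec2_cplx)
  qed
  have img: "g ` S' = cplx -` (\<phi> ` S)"
  proof (intro equalityI subsetI)
    fix y assume "y \<in> cplx -` (\<phi> ` S)"
    then obtain x where "x \<in> S" "cplx y = \<phi> x" by auto
    then have "vec2 x \<in> S'" "g (vec2 x) = y" by (simp_all add: S'_def g_def) (metis vec2_cplx)
    then show "y \<in> g ` S'" by blast
  qed (auto simp: g_def S'_def)
  have detg: "det (matrix (g' v)) = jac (D (cplx v))" for v
  proof -
    have "cplx (axis 1 1) = 1" "cplx (axis 2 1) = \<i>" by (simp_all add: cplx_def axis_def complex_eq_iff)
    then show ?thesis by (simp add: det_2 matrix_def g'_def vec2_def jac_def mult.commute)
  qed
  have F1: "F v $ 1 = f (cplx v)" for v by (simp add: F_def)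
  have ind: "indicator (cplx -` A) v = indicator A (cplx v)" for A v by (simp add: indicator_def)
  have fi: "integrable lebesgue (\<lambda>z. indicator (\<phi> ` S) z *\<^sub>R f z)" using f by (simp add: set_integrable_def)
  have fi': "(\<lambda>v. f (cplx v)) absolutely_integrable_on (g ` S')"
    unfolding set_integrable_def img ind by (rule integrable_cplx'[OF fi])
  then have Fa: "F absolutely_integrable_on (g ` S')" by (simp add: absolutely_integrable_on_1_iff F1)
  have iF: "integral (g ` S') (\<lambda>v. f (cplx v)) = integral (\<phi> ` S) f"
  proof -
    have "integral (g ` S') (\<lambda>v. f (cplx v)) = integral\<^sup>L lebesgue (\<lambda>v. indicator (\<phi> ` S) (cplx v) *\<^sub>R f (cplx v))"
      using set_lebesgue_integral_eq_integral(2)[OF fi'] unfolding set_lebesgue_integral_def img ind by (rule sym)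
    also have "\<dots> = integral\<^sup>L lebesgue (\<lambda>z. indicator (\<phi> ` S) z *\<^sub>R f z)"
      by (rule integrable_cplx(2)[OF integrable_cplx'[OF fi], symmetric])
    also have "\<dots> = integral (\<phi> ` S) f"
      using set_lebesgue_integral_eq_integral(2)[OF f] unfolding set_lebesgue_integral_def .
    finally show ?thesis .
  qed
  let ?G = "\<lambda>v. \<bar>det (matrix (g' v))\<bar> *\<^sub>R F (g v)"
  have cv: "?G absolutely_integrable_on S' \<and> integral S' ?G = integral (g ` S') F"
    using has_absolute_integral_change_of_variables[OF S'm gd injg, of F "integral (g ` S') F"] Fa by blast
  let ?H = "\<lambda>x. \<bar>jac (D x)\<bar> * f (\<phi> x)"
  have G1: "?G v $ 1 = ?H (cplx v)" for v by (simp add: detg F1 g_def)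
  have Ha: "(\<lambda>v. ?H (cplx v)) absolutely_integrable_on S'"
    using cv unfolding absolutely_integrable_on_1_iff G1 by blast
  have "integral S' ?G $ 1 = integral (g ` S') F $ 1" using cv by simp
  then have iH: "integral S' (\<lambda>v. ?H (cplx v)) = integral (g ` S') (\<lambda>v. f (cplx v))"
    unfolding integral_on_1_eq[of S'] integral_on_1_eq[of "g ` S'"] G1 F1 by simp
  have Hi: "integrable lebesgue (\<lambda>v. (\<lambda>z. indicator S z *\<^sub>R ?H z) (cplx v))"
    using Ha unfolding set_integrable_def S'_def ind .
  show a: "?H absolutely_integrable_on S"
    unfolding set_integrable_def by (rule integrable_cplx(1)[OF Hi])
  have "integral S ?H = integral S' (\<lambda>v. ?H (cplx v))"
  proof -
    have "integral S ?H = integral\<^sup>L lebesgue (\<lambda>z. indicator S z *\<^sub>R ?H z)"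
      using set_lebesgue_integral_eq_integral(2)[OF a] unfolding set_lebesgue_integral_def by (rule sym)
    also have "\<dots> = integral\<^sup>L lebesgue (\<lambda>v. indicator S (cplx v) *\<^sub>R ?H (cplx v))"
      by (rule integrable_cplx(2)[OF Hi])
    also have "\<dots> = integral S' (\<lambda>v. ?H (cplx v))"
      using set_lebesgue_integral_eq_integral(2)[OF Ha] unfolding set_lebesgue_integral_def S'_def ind .
    finally show ?thesis .
  qed
  then show "integral S ?H = integral (\<phi> ` S) f" using iH iF by simp
qed

lemma nn_integral_absolutely_integrable:
  fixes f :: "complex \<Rightarrow> real"
  assumes "f absolutely_integrable_on S" "\<And>x. x \<in> S \<Longrightarrow> 0 \<le> f x"
  shows "(\<integral>\<^sup>+x\<in>S. ennreal (f x) \<partial>lebesgue) = ennreal (integral S f)"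
proof -
  have "(\<integral>\<^sup>+x\<in>S. ennreal (f x) \<partial>lebesgue) = (\<integral>\<^sup>+x. ennreal (indicator S x *\<^sub>R f x) \<partial>lebesgue)"
    by (intro nn_integral_cong) (auto simp: indicator_def)
  also have "\<dots> = ennreal (integral\<^sup>L lebesgue (\<lambda>x. indicator S x *\<^sub>R f x))"
    using assms unfolding set_integrable_def by (intro nn_integral_eq_integral) (auto simp: indicator_def)
  also have "\<dots> = ennreal (integral S f)"
    using set_lebesgue_integral_eq_integral(2)[OF assms(1)] by (simp add: set_lebesgue_integral_def)
  finally show ?thesis .
qed

corollary complex_change_of_variables_nn:
  fixes \<phi> :: "complex \<Rightarrow> complex" and f :: "complex \<Rightarrow> real"
  assumes S: "S \<in> sets lebesgue" and der: "\<And>x. x \<in> S \<Longrightarrow> (\<phi> has_derivative D x) (at x)"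
    and inj: "inj_on \<phi> S" and f: "f absolutely_integrable_on (\<phi> ` S)" and f0: "\<And>x. x \<in> S \<Longrightarrow> 0 \<le> f (\<phi> x)"
  shows "(\<integral>\<^sup>+x\<in>S. ennreal (\<bar>jac (D x)\<bar> * f (\<phi> x)) \<partial>lebesgue) = (\<integral>\<^sup>+y\<in>\<phi> ` S. ennreal (f y) \<partial>lebesgue)"
proof -
  have "(\<integral>\<^sup>+x\<in>S. ennreal (\<bar>jac (D x)\<bar> * f (\<phi> x)) \<partial>lebesgue) = ennreal (integral S (\<lambda>x. \<bar>jac (D x)\<bar> * f (\<phi> x)))"
    by (rule nn_integral_absolutely_integrable[OF complex_change_of_variables(1)[OF S der inj f]]) (auto intro!: mult_nonneg_nonneg f0)
  also have "integral S (\<lambda>x. \<bar>jac (D x)\<bar> * f (\<phi> x)) = integral (\<phi> ` S) f"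
    by (rule complex_change_of_variables(2)[OF S der inj f])
  also have "ennreal (integral (\<phi> ` S) f) = (\<integral>\<^sup>+y\<in>\<phi> ` S. ennreal (f y) \<partial>lebesgue)"
    using f0 by (intro nn_integral_absolutely_integrable[OF f, symmetric]) auto
  finally show ?thesis .
qed

text \<open>The ordinate is the first component, so that Fubini integrates over horizontal lines
  first; in logarithmic coordinates these are the radial segments.\<close>

lemma distr_Complex: "distr (lborel \<Otimes>\<^sub>M lborel) borel (\<lambda>(y, x). Complex x y) = lborel"
proof (rule lborel_eqI[symmetric])
  have [measurable]: "(\<lambda>(y, x). Complex x y) \<in> borel_measurable (lborel \<Otimes>\<^sub>M lborel)"
  proof -
    have "(\<lambda>(y, x). Complex x y) = (\<lambda>p. of_real (snd p) + \<i> * of_real (fst p))" by (auto simp: complex_eq_iff)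
    then show ?thesis by simp
  qed
  fix l u :: complex assume lu: "\<And>b. b \<in> Basis \<Longrightarrow> l \<bullet> b \<le> u \<bullet> b"
  then have le: "Re l \<le> Re u" "Im l \<le> Im u" using lu[of 1] lu[of \<i>] by (auto simp: Basis_complex_def inner_complex_def)
  have pre: "(\<lambda>(y, x). Complex x y) -` box l u \<inter> space (lborel \<Otimes>\<^sub>M lborel) = {Im l<..<Im u} \<times> {Re l<..<Re u}"
    by (auto simp: box_complex_eq space_pair_measure)
  have "emeasure (distr (lborel \<Otimes>\<^sub>M lborel) borel (\<lambda>(y, x). Complex x y)) (box l u) = emeasure (lborel \<Otimes>\<^sub>M lborel) ({Im l<..<Im u} \<times> {Re l<..<Re u})"
    by (subst emeasure_distr) (auto simp: pre[simplified])
  also have "\<dots> = ennreal (Im u - Im l) * ennreal (Re u - Re l)"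
    using le by (subst lborel.emeasure_pair_measure_Times) auto
  also have "\<dots> = ennreal (\<Prod>b\<in>Basis. (u - l) \<bullet> b)"
    using le by (simp add: Basis_complex_def ennreal_mult mult.commute)
  finally show "emeasure (distr (lborel \<Otimes>\<^sub>M lborel) borel (\<lambda>(y, x). Complex x y)) (box l u) = ennreal (\<Prod>b\<in>Basis. (u - l) \<bullet> b)" .
qed simp

subsection \<open>The length-area method\<close>

lemma Lipschitz_imp_abs_cont_on:
  assumes "\<And>s t. a \<le> s \<Longrightarrow> s \<le> t \<Longrightarrow> t \<le> b \<Longrightarrow> cmod (f t - f s) \<le> M * (t - s)" and M: "0 \<le> M"
  shows "abs_cont_on f a b"
  unfolding abs_cont_on_def
proof (intro allI impI)
  fix \<epsilon> :: real assume e: "0 < \<epsilon>"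
  show "\<exists>\<delta>>0. \<forall>(n::nat) (u::nat \<Rightarrow> real) (v::nat \<Rightarrow> real).
        (\<forall>i<n. a \<le> u i \<and> u i \<le> v i \<and> v i \<le> b) \<and>
        (\<forall>i<n. \<forall>j<n. i \<noteq> j \<longrightarrow> v i \<le> u j \<or> v j \<le> u i) \<and>
        (\<Sum>i<n. v i - u i) < \<delta>
        \<longrightarrow> (\<Sum>i<n. cmod (f (v i) - f (u i))) < \<epsilon>"
  proof (intro exI[of _ "\<epsilon> / (M + 1)"] conjI allI impI)
    show "0 < \<epsilon> / (M + 1)" using e M by simp
    fix n :: nat and u v :: "nat \<Rightarrow> real"
    assume A: "(\<forall>i<n. a \<le> u i \<and> u i \<le> v i \<and> v i \<le> b) \<and>
        (\<forall>i<n. \<forall>j<n. i \<noteq> j \<longrightarrow> v i \<le> u j \<or> v j \<le> u i) \<and> (\<Sum>i<n. v i - u i) < \<epsilon> / (M + 1)"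
    have "(\<Sum>i<n. cmod (f (v i) - f (u i))) \<le> (\<Sum>i<n. M * (v i - u i))"
      using A by (intro sum_mono assms(1)) auto
    also have "\<dots> = M * (\<Sum>i<n. v i - u i)" by (rule sum_distrib_left[symmetric])
    also have "\<dots> \<le> M * (\<epsilon> / (M + 1))" using A M by (intro mult_left_mono) auto
    also have "\<dots> < \<epsilon>" using e M by (simp add: field_simps)
    finally show "(\<Sum>i<n. cmod (f (v i) - f (u i))) < \<epsilon>" .
  qed
qed

text \<open>\<open>x1\<close> is the last parameter with value at most \<open>r1\<close>, and
  \<open>x2\<close> the first one after it with value at least \<open>r2\<close>; in between, the
  values cannot leave the range.\<close>

lemma crossing_subinterval:
  fixes q :: "real \<Rightarrow> real"
  assumes "a \<le> b" "continuous_on {a..b} q" "q a \<le> r1" "r2 \<le> q b" "r1 < r2"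
  obtains x1 x2 where "a \<le> x1" "x1 < x2" "x2 \<le> b" "q x1 = r1" "q x2 = r2" "\<And>x. x1 \<le> x \<Longrightarrow> x \<le> x2 \<Longrightarrow> r1 \<le> q x \<and> q x \<le> r2"
proof -
  define A where "A = {x\<in>{a..b}. q x \<le> r1}"
  have "A = {a..b} \<inter> q -` {..r1}" by (auto simp: A_def)
  then have cA: "closed A" using continuous_closed_preimage[OF assms(2) closed_atLeastAtMost closed_atMost] by simp
  have A: "a \<in> A" "bdd_above A" using assms by (auto simp: A_def)
  define x1 where "x1 = Sup A"
  have x1A: "x1 \<in> A" unfolding x1_def using closed_contains_Sup[OF _ A(2) cA] A(1) by blast
  have above: "r1 < q x" if "x1 < x" "x \<le> b" for x
  proof (rule ccontr)
    assume "\<not> r1 < q x"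
    then have "x \<in> A" using that x1A by (auto simp: A_def)
    then show False using cSup_upper[OF _ A(2), of x] that by (simp add: x1_def)
  qed
  define B where "B = {x\<in>{x1..b}. r2 \<le> q x}"
  have x1ab: "a \<le> x1" "x1 \<le> b" "q x1 \<le> r1" using x1A by (auto simp: A_def)
  have c1: "continuous_on {x1..b} q" by (rule continuous_on_subset[OF assms(2)]) (use x1ab in auto)
  have "B = {x1..b} \<inter> q -` {r2..}" by (auto simp: B_def)
  then have cB: "closed B" using continuous_closed_preimage[OF c1 closed_atLeastAtMost closed_atLeast] by simp
  have B: "b \<in> B" "bdd_below B" using assms x1ab by (auto simp: B_def)
  define x2 where "x2 = Inf B"
  have x2B: "x2 \<in> B" unfolding x2_def using closed_contains_Inf[OF _ B(2) cB] B(1) by blast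
  have below: "q x < r2" if "x1 \<le> x" "x < x2" for x
  proof (rule ccontr)
    assume "\<not> q x < r2"
    then have "x \<in> B" using that x2B by (auto simp: B_def)
    then show False using cInf_lower[OF _ B(2), of x] that by (simp add: x2_def)
  qed
  have x2b: "x1 \<le> x2" "x2 \<le> b" "r2 \<le> q x2" using x2B by (auto simp: B_def)
  have lt: "x1 < x2" using x2b x1ab assms(5) by (cases "x1 = x2") auto
  have q1: "q x1 = r1"
  proof -
    have "continuous_on {x1..x2} q" by (rule continuous_on_subset[OF c1]) (use x2b in auto)
    then obtain x where x: "x1 \<le> x" "x \<le> x2" "q x = r1"
      using IVT'[of q x1 r1 x2] x1ab x2b assms(5) lt by auto
    then have "x = x1" using above[of x] x2b by force
    then show ?thesis using x by simp
  qed
  have q2: "q x2 = r2"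
  proof -
    have "continuous_on {x1..x2} q" by (rule continuous_on_subset[OF c1]) (use x2b in auto)
    then obtain x where x: "x1 \<le> x" "x \<le> x2" "q x = r2"
      using IVT'[of q x1 r2 x2] x1ab x2b assms(5) lt by auto
    then have "x = x2" using below[of x] by force
    then show ?thesis using x by simp
  qed
  show thesis
  proof (rule that[OF x1ab(1) lt x2b(2) q1 q2])
    fix x assume "x1 \<le> x" "x \<le> x2"
    then show "r1 \<le> q x \<and> q x \<le> r2"
      using above[of x] below[of x] q1 q2 x2b assms(5) by (cases "x = x1"; cases "x = x2") auto
  qed
qed

lemma ln_diff_le_of_ge:
  fixes p q :: real
  assumes "0 < r" "r \<le> p" "r \<le> q" shows "\<bar>ln p - ln q\<bar> \<le> \<bar>p - q\<bar> / r"
proof -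
  have *: "ln x - ln y \<le> \<bar>x - y\<bar> / r" if "r \<le> x" "r \<le> y" for x y
  proof -
    have "ln x - ln y = ln (x / y)" using that assms by (simp add: ln_div)
    also have "\<dots> \<le> x / y - 1" using that assms by (intro ln_le_minus_one) auto
    also have "\<dots> = (x - y) / y" using that assms by (simp add: field_simps)
    also have "\<dots> \<le> \<bar>x - y\<bar> / y" using that assms by (intro divide_right_mono) auto
    also have "\<dots> \<le> \<bar>x - y\<bar> / r" using that assms by (intro divide_left_mono) auto
    finally show ?thesis .
  qed
  show ?thesis using *[OF assms(2,3)] *[OF assms(3,2)] by (simp add: abs_minus_commute)
qed

text \<open>The logarithm of the distance to \<open>w0\<close> changes by ln (r2 / r1) during a
  crossing, and the modulus of its derivative is at most |p'| / |p - w0|. The fundamental theorem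
  applies because the logarithm is Lipschitz on values above \<open>r1\<close>.\<close>

lemma annulus_crossing:
  fixes p :: "real \<Rightarrow> complex"
  assumes ab: "a \<le> b" and lip: "\<And>s t. a \<le> s \<Longrightarrow> s \<le> t \<Longrightarrow> t \<le> b \<Longrightarrow> cmod (p t - p s) \<le> M * (t - s)" and M: "0 \<le> M"
    and N: "negligible N" and der: "\<And>t. t \<in> {a..b} - N \<Longrightarrow> (p has_vector_derivative p' t) (at t)"
    and r: "0 < r1" "r1 < r2"
    and ends: "cmod (p a - w0) \<le> r1 \<and> r2 \<le> cmod (p b - w0) \<or> r2 \<le> cmod (p a - w0) \<and> cmod (p b - w0) \<le> r1"
  shows "ennreal (ln (r2 / r1)) \<le> (\<integral>\<^sup>+t\<in>{t\<in>{a..b}. r1 \<le> cmod (p t - w0) \<and> cmod (p t - w0) \<le> r2}. ennreal (cmod (p' t) / cmod (p t - w0)) \<partial>lborel)"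
proof -
  let ?q = "\<lambda>t. cmod (p t - w0)"
  have acp: "abs_cont_on p a b" by (rule Lipschitz_imp_abs_cont_on[OF lip M])
  have "M-lipschitz_on {a..b} p"
  proof (rule lipschitz_onI[OF _ M])
    fix x y assume "x \<in> {a..b}" "y \<in> {a..b}"
    then show "dist (p x) (p y) \<le> M * dist x y"
      using lip[of x y] lip[of y x] by (cases "x \<le> y") (auto simp: dist_norm norm_minus_commute)
  qed
  then have contp: "continuous_on {a..b} p" by (rule lipschitz_on_continuous_on)
  have contq: "continuous_on {a..b} ?q" by (intro continuous_intros contp)
  obtain x1 x2 where x: "a \<le> x1" "x1 < x2" "x2 \<le> b" and xr: "?q x1 = r1 \<and> ?q x2 = r2 \<or> ?q x1 = r2 \<and> ?q x2 = r1"
    and btw: "\<And>x. x1 \<le> x \<Longrightarrow> x \<le> x2 \<Longrightarrow> r1 \<le> ?q x \<and> ?q x \<le> r2"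
  proof (cases "?q a \<le> r1 \<and> r2 \<le> ?q b")
    case True
    then obtain x1 x2 where "a \<le> x1" "x1 < x2" "x2 \<le> b" "?q x1 = r1" "?q x2 = r2"
      "\<And>x. x1 \<le> x \<Longrightarrow> x \<le> x2 \<Longrightarrow> r1 \<le> ?q x \<and> ?q x \<le> r2"
      using crossing_subinterval[OF ab contq _ _ r(2)] by metis
    then show thesis by (intro that[of x1 x2]) auto
  next
    case False
    have c: "continuous_on {a..b} (\<lambda>t. - ?q t)" by (intro continuous_intros contp)
    have e: "- ?q a \<le> - r2" "- r1 \<le> - ?q b" "- r2 < - r1" using ends False r by auto
    obtain x1 x2 where 1: "a \<le> x1" "x1 < x2" "x2 \<le> b" "- ?q x1 = - r2" "- ?q x2 = - r1"
      "\<And>x. x1 \<le> x \<Longrightarrow> x \<le> x2 \<Longrightarrow> - r2 \<le> - ?q x \<and> - ?q x \<le> - r1"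
      using crossing_subinterval[OF ab c e] by metis
    show thesis by (rule that[of x1 x2]) (use 1 in auto)
  qed
  \<comment> \<open>Complex valued because \<open>abs_cont_FTC\<close> is stated for complex
    functions.\<close>
  define v where "v t = complex_of_real (ln (?q t))" for t
  define v' where "v' t = complex_of_real (((p t - w0) \<bullet> p' t) / (?q t)\<^sup>2)" for t
  have vac: "abs_cont_on v x1 x2"
  proof (rule Lipschitz_imp_abs_cont_on)
    fix s t assume st: "x1 \<le> s" "s \<le> t" "t \<le> x2"
    have "cmod (v t - v s) = \<bar>ln (?q t) - ln (?q s)\<bar>" unfolding v_def of_real_diff[symmetric] norm_of_real ..
    also have "\<dots> \<le> \<bar>?q t - ?q s\<bar> / r1" using btw[of t] btw[of s] st r by (intro ln_diff_le_of_ge) auto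
    also have "\<dots> \<le> cmod (p t - p s) / r1"
      using norm_triangle_ineq3[of "p t - w0" "p s - w0"] r by (intro divide_right_mono) auto
    also have "\<dots> \<le> M * (t - s) / r1" using lip[of s t] st x r by (intro divide_right_mono) auto
    finally show "cmod (v t - v s) \<le> M / r1 * (t - s)" by simp
  qed (use M r in simp)
  have vder: "(v has_vector_derivative v' t) (at t)" if t: "t \<in> {x1..x2} - N" for t
  proof -
    have pd: "(p has_vector_derivative p' t) (at t)" using t x by (intro der) auto
    have pos: "0 < (p t - w0) \<bullet> (p t - w0)" using btw[of t] t r by auto
    have "((\<lambda>t. (p t - w0) \<bullet> (p t - w0)) has_derivative (\<lambda>h. (p t - w0) \<bullet> (h *\<^sub>R p' t) + (h *\<^sub>R p' t) \<bullet> (p t - w0))) (at t)"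
      using pd unfolding has_vector_derivative_def by (auto intro!: derivative_eq_intros)
    then have "((\<lambda>t. (p t - w0) \<bullet> (p t - w0)) has_real_derivative 2 * ((p t - w0) \<bullet> p' t)) (at t)"
      unfolding has_field_derivative_def by (rule has_derivative_eq_rhs) (auto simp: inner_commute)
    then have "((\<lambda>t. ln ((p t - w0) \<bullet> (p t - w0)) / 2) has_real_derivative (2 * ((p t - w0) \<bullet> p' t) / ((p t - w0) \<bullet> (p t - w0))) / 2) (at t)"
      using pos by (auto intro!: derivative_eq_intros)
    moreover have "ln ((p t - w0) \<bullet> (p t - w0)) / 2 = ln (?q t)" for t
    proof -
      have "(p t - w0) \<bullet> (p t - w0) = (?q t)\<^sup>2" by (rule dot_square_norm)
      then show ?thesis by (cases "?q t = 0") (simp_all add: ln_realpow)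
    qed
    moreover have "(p t - w0) \<bullet> (p t - w0) = (?q t)\<^sup>2" by (rule dot_square_norm)
    ultimately have "((\<lambda>t. ln (?q t)) has_real_derivative ((p t - w0) \<bullet> p' t) / (?q t)\<^sup>2) (at t)" by simp
    then show ?thesis unfolding v_def v'_def has_real_derivative_iff_has_vector_derivative
      by (rule bounded_linear.has_vector_derivative[OF bounded_linear_of_real])
  qed
  have "(v' has_integral (v x2 - v x1)) {x1..x2}" by (rule abs_cont_FTC[OF vac _ N vder]) (use x in auto)
  from has_integral_norm_le_nn_integral[OF this]
  have "ennreal (norm (v x2 - v x1)) \<le> (\<integral>\<^sup>+t\<in>{x1..x2}. ennreal (norm (v' t)) \<partial>lborel)" unfolding nn_integral_completion .
  also have "norm (v x2 - v x1) = ln (r2 / r1)"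
    unfolding v_def of_real_diff[symmetric] norm_of_real using xr
  proof (elim disjE conjE)
    have "ln r1 < ln r2" "ln (r2 / r1) = ln r2 - ln r1" using r by (simp_all add: ln_div)
    then show "\<bar>ln (?q x2) - ln (?q x1)\<bar> = ln (r2 / r1)" if "?q x1 = r1" "?q x2 = r2" using that by simp
    show "\<bar>ln (?q x2) - ln (?q x1)\<bar> = ln (r2 / r1)" if "?q x1 = r2" "?q x2 = r1"
      using that \<open>ln r1 < ln r2\<close> \<open>ln (r2 / r1) = ln r2 - ln r1\<close> by simp
  qed
  also have "(\<integral>\<^sup>+t\<in>{x1..x2}. ennreal (norm (v' t)) \<partial>lborel) \<le> (\<integral>\<^sup>+t\<in>{t\<in>{a..b}. r1 \<le> ?q t \<and> ?q t \<le> r2}. ennreal (cmod (p' t) / ?q t) \<partial>lborel)"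
  proof (rule nn_integral_mono)
    fix t
    show "ennreal (norm (v' t)) * indicator {x1..x2} t \<le> ennreal (cmod (p' t) / ?q t) * indicator {t\<in>{a..b}. r1 \<le> ?q t \<and> ?q t \<le> r2} t"
    proof (cases "t \<in> {x1..x2}")
      case True
      then have q: "r1 \<le> ?q t" "?q t \<le> r2" using btw by auto
      have "\<bar>(p t - w0) \<bullet> p' t\<bar> / (?q t)\<^sup>2 \<le> (?q t * cmod (p' t)) / (?q t)\<^sup>2"
        by (intro divide_right_mono Cauchy_Schwarz_ineq2) auto
      also have "\<dots> = cmod (p' t) / ?q t" using q r by (simp add: power2_eq_square)
      finally have "norm (v' t) \<le> cmod (p' t) / ?q t" unfolding v'_def norm_of_real by (simp add: abs_divide)
      then show ?thesis using True q x by (auto intro!: ennreal_leI)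
    qed simp
  qed
  finally show ?thesis .
qed

lemma frechet_derivative_dz_dzbar:
  assumes "\<phi> differentiable (at z)"
  shows "frechet_derivative \<phi> (at z) v = dz \<phi> z * v + dzbar \<phi> z * cnj v"
proof -
  let ?D = "frechet_derivative \<phi> (at z)"
  have lin: "linear ?D" using frechet_derivative_works assms has_derivative_linear by blast
  have v: "Re v *\<^sub>R 1 + Im v *\<^sub>R \<i> = v" by (simp add: complex_eq_iff)
  have "?D (Re v *\<^sub>R 1 + Im v *\<^sub>R \<i>) = Re v *\<^sub>R ?D 1 + Im v *\<^sub>R ?D \<i>"
    by (simp only: linear_add[OF lin] linear_scale[OF lin])
  then have "?D v = Re v *\<^sub>R ?D 1 + Im v *\<^sub>R ?D \<i>" by (simp only: v)
  then show ?thesis by (simp add: dz_def dzbar_def complex_eq_iff field_simps)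
qed

lemma jac_eq: "jac (\<lambda>v. a * v + b * cnj v) = (cmod a)\<^sup>2 - (cmod b)\<^sup>2"
  unfolding cmod_power2 jac_def by (simp add: algebra_simps power2_eq_square)

text \<open>The area of the circumscribed square, which is precise enough here.\<close>

lemma emeasure_cball_complex_le: "0 \<le> R \<Longrightarrow> emeasure lborel (cball (w::complex) R) \<le> ennreal (4 * R\<^sup>2)"
proof -
  assume R: "0 \<le> R"
  let ?u = "Complex R R"
  have "cball w R \<subseteq> cbox (w - ?u) (w + ?u)"
  proof
    fix z assume "z \<in> cball w R"
    then have "cmod (z - w) \<le> R" by (simp add: dist_norm norm_minus_commute)
    then have "\<bar>Re (z - w)\<bar> \<le> R" "\<bar>Im (z - w)\<bar> \<le> R" using abs_Re_le_cmod abs_Im_le_cmod order_trans by blast+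
    then show "z \<in> cbox (w - ?u) (w + ?u)" by (auto simp: in_cbox_complex_iff)
  qed
  then have "emeasure lborel (cball w R) \<le> emeasure lborel (cbox (w - ?u) (w + ?u))" by (intro emeasure_mono) auto
  also have "\<dots> = ennreal (4 * R\<^sup>2)"
    using R by (subst emeasure_lborel_cbox) (auto simp: Basis_complex_def inner_complex_def power2_eq_square)
  finally show ?thesis .
qed

lemma dyadic_scale:
  fixes \<rho> q :: real
  assumes "\<rho> \<le> q" "q \<le> 2 ^ N * \<rho>" "0 < N"
  shows "\<exists>j<N. 2 ^ j * \<rho> \<le> q \<and> q \<le> 2 ^ Suc j * \<rho>"
  using assms
proof (induction N)
  case (Suc N)
  show ?case
  proof (cases "2 ^ N * \<rho> \<le> q")
    case True
    then show ?thesis using Suc.prems by (intro exI[of _ N]) auto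
  next
    case False
    then have "N > 0" using Suc.prems by (cases N) auto
    then obtain j where "j < N" "2 ^ j * \<rho> \<le> q \<and> q \<le> 2 ^ Suc j * \<rho>" using Suc.IH Suc.prems False by auto
    then show ?thesis using less_SucI by blast
  qed
qed simp

text \<open>A step function that majorizes 1 / |w - w0|^2 on the annulus between \<rho> and 2^N *
  \<rho>. Being a sum over discs, it is integrated without polar coordinates, and its integral grows
  linearly in \<open>N\<close>, that is, like the logarithm of the ratio of the radii.\<close>

definition annulus_weight :: "complex \<Rightarrow> real \<Rightarrow> nat \<Rightarrow> complex \<Rightarrow> real" where
  "annulus_weight w0 \<rho> N w = (\<Sum>j<N. indicator (cball w0 (2 ^ Suc j * \<rho>)) w / (2 ^ j * \<rho>)\<^sup>2)"

lemma annulus_weight_nonneg: "0 \<le> annulus_weight w0 \<rho> N w"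
  by (simp add: annulus_weight_def sum_nonneg)

lemma annulus_weight_ge:
  assumes "0 < \<rho>" "\<rho> \<le> cmod (w - w0)" "cmod (w - w0) \<le> 2 ^ N * \<rho>" "0 < N"
  shows "1 / (cmod (w - w0))\<^sup>2 \<le> annulus_weight w0 \<rho> N w"
proof -
  obtain j where j: "j < N" "2 ^ j * \<rho> \<le> cmod (w - w0)" "cmod (w - w0) \<le> 2 ^ Suc j * \<rho>"
    using dyadic_scale[OF assms(2-4)] by blast
  have "1 / (cmod (w - w0))\<^sup>2 \<le> 1 / (2 ^ j * \<rho>)\<^sup>2"
    using j assms by (intro divide_left_mono power_mono mult_pos_pos zero_less_power) auto
  also have "\<dots> = indicator (cball w0 (2 ^ Suc j * \<rho>)) w / (2 ^ j * \<rho>)\<^sup>2"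
    using j by (simp add: dist_norm norm_minus_commute)
  also have "\<dots> \<le> annulus_weight w0 \<rho> N w"
    unfolding annulus_weight_def using j by (intro member_le_sum) auto
  finally show ?thesis .
qed

text \<open>Every scale contributes at most 16, namely the area bound 4 * (2 * R)^2 of the disc
  divided by R^2 for R = 2^j * \<rho>.\<close>

lemma annulus_weight_integral:
  assumes "0 < \<rho>"
  shows "(\<integral>\<^sup>+w. ennreal (annulus_weight w0 \<rho> N w) \<partial>lebesgue) \<le> ennreal (16 * real N)"
    and "annulus_weight w0 \<rho> N \<in> borel_measurable borel"
    and "integrable lebesgue (annulus_weight w0 \<rho> N)"
proof -
  show m: "annulus_weight w0 \<rho> N \<in> borel_measurable borel"
    unfolding annulus_weight_def
    by (intro borel_measurable_sum borel_measurable_divide borel_measurable_indicator borel_measurable_const) auto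
  have "(\<integral>\<^sup>+w. ennreal (annulus_weight w0 \<rho> N w) \<partial>lebesgue) = (\<integral>\<^sup>+w. (\<Sum>j<N. ennreal (1 / (2 ^ j * \<rho>)\<^sup>2) * indicator (cball w0 (2 ^ Suc j * \<rho>)) w) \<partial>lborel)"
    unfolding nn_integral_completion
  proof (rule nn_integral_cong)
    fix w
    have "ennreal (annulus_weight w0 \<rho> N w) = (\<Sum>j<N. ennreal (indicator (cball w0 (2 ^ Suc j * \<rho>)) w / (2 ^ j * \<rho>)\<^sup>2))"
      unfolding annulus_weight_def by (rule sum_ennreal[symmetric]) auto
    also have "\<dots> = (\<Sum>j<N. ennreal (1 / (2 ^ j * \<rho>)\<^sup>2) * indicator (cball w0 (2 ^ Suc j * \<rho>)) w)"
      by (intro sum.cong) (auto simp: indicator_def)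
    finally show "ennreal (annulus_weight w0 \<rho> N w) = (\<Sum>j<N. ennreal (1 / (2 ^ j * \<rho>)\<^sup>2) * indicator (cball w0 (2 ^ Suc j * \<rho>)) w)" .
  qed
  also have "\<dots> = (\<Sum>j<N. ennreal (1 / (2 ^ j * \<rho>)\<^sup>2) * emeasure lborel (cball w0 (2 ^ Suc j * \<rho>)))"
    by (subst nn_integral_sum)
      (auto simp: nn_integral_cmult_indicator intro!: borel_measurable_times_ennreal borel_measurable_indicator)
  also have "\<dots> \<le> (\<Sum>j<N. ennreal 16)"
  proof (rule sum_mono)
    fix j
    have "ennreal (1 / (2 ^ j * \<rho>)\<^sup>2) * emeasure lborel (cball w0 (2 ^ Suc j * \<rho>)) \<le> ennreal (1 / (2 ^ j * \<rho>)\<^sup>2) * ennreal (4 * (2 ^ Suc j * \<rho>)\<^sup>2)"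
      using assms by (intro mult_left_mono emeasure_cball_complex_le) auto
    also have "\<dots> = ennreal (1 / (2 ^ j * \<rho>)\<^sup>2 * (4 * (2 ^ Suc j * \<rho>)\<^sup>2))" by (rule ennreal_mult[symmetric]) auto
    also have "1 / (2 ^ j * \<rho>)\<^sup>2 * (4 * (2 ^ Suc j * \<rho>)\<^sup>2) = 16" using assms by (simp add: field_simps power2_eq_square)
    finally show "ennreal (1 / (2 ^ j * \<rho>)\<^sup>2) * emeasure lborel (cball w0 (2 ^ Suc j * \<rho>)) \<le> ennreal 16" .
  qed
  also have "\<dots> = ennreal (16 * real N)" by (subst sum_ennreal) (auto simp: mult.commute)
  finally show le: "(\<integral>\<^sup>+w. ennreal (annulus_weight w0 \<rho> N w) \<partial>lebesgue) \<le> ennreal (16 * real N)" .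
  show "integrable lebesgue (annulus_weight w0 \<rho> N)"
  proof (rule integrableI_nonneg)
    show "annulus_weight w0 \<rho> N \<in> borel_measurable lebesgue" by (rule measurable_completion) (use m in simp)
    show "AE x in lebesgue. 0 \<le> annulus_weight w0 \<rho> N x" by (simp add: annulus_weight_nonneg)
    show "(\<integral>\<^sup>+w. ennreal (annulus_weight w0 \<rho> N w) \<partial>lebesgue) < \<infinity>" by (rule le_less_trans[OF le]) simp
  qed
qed

locale qc_disc =
  fixes \<phi> \<psi> :: "complex \<Rightarrow> complex" and \<Omega> :: "complex set" and L k :: real
  assumes hom: "homeomorphism (ball 0 1) \<Omega> \<phi> \<psi>"
    and cont: "continuous_on (cball 0 1) \<phi>"
    and op: "open \<Omega>" and bdd: "bounded \<Omega>" and ex: "\<exists>f. conformal_onto_disc f \<Omega>"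
    and Lpos: "0 < L"
    and bilip: "\<And>z w. z \<in> ball 0 1 \<Longrightarrow> w \<in> ball 0 1 \<Longrightarrow>
      poincare_dist \<Omega> (\<phi> z) (\<phi> w) \<le> ennreal L * poincare_dist (ball 0 1) z w \<and>
      poincare_dist (ball 0 1) z w \<le> ennreal L * poincare_dist \<Omega> (\<phi> z) (\<phi> w)"
    and k: "0 \<le> k" "k < 1"
    and good_ae: "negligible {z\<in>ball 0 1. \<not> (\<phi> differentiable (at z) \<and> cmod (dzbar \<phi> z) \<le> k * cmod (dz \<phi> z))}"
begin

sublocale Om: conformal_disc \<Omega> by unfold_locales (rule op, rule ex)

sublocale D: conformal_disc "ball 0 1"
proof
  show "\<exists>f. conformal_onto_disc f (ball 0 1)"
    by (rule exI[of _ "\<lambda>z. z"]) (auto simp: conformal_onto_disc_def)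
qed simp

lemma in\<Omega>: "z \<in> ball 0 1 \<Longrightarrow> \<phi> z \<in> \<Omega>" using hom unfolding homeomorphism_def by blast

lemma inj: "inj_on \<phi> (ball 0 1)" using hom unfolding homeomorphism_def by (metis inj_onI)

lemma disc_dist_le:
  assumes "0 < h" "z \<in> cball 0 (1 - h)" "w \<in> cball 0 (1 - h)"
  shows "poincare_dist (ball 0 1) z w \<le> ennreal (cmod (w - z) / h)"
proof (rule D.poincare_dist_segment_le[OF assms(1)])
  fix x assume "x \<in> closed_segment z w"
  then have "x \<in> cball 0 (1 - h)" using closed_segment_subset[OF assms(2,3) convex_cball] by blast
  then show "ball x h \<subseteq> ball 0 1" by (auto simp: dist_norm) (smt (verit) norm_triangle_sub norm_minus_commute)
qed

text \<open>The lower bound for the hyperbolic distance in \<Omega>, the bi-Lipschitz inequality and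
  the upper bound along a segment of the disc are chained; exponentiating the logarithm gives the
  claim.\<close>

lemma image_diff_le:
  assumes h: "0 < h" "z \<in> cball 0 (1 - h)" "w \<in> cball 0 (1 - h)" and w0: "w0 \<notin> \<Omega>"
  shows "cmod (\<phi> w - \<phi> z) \<le> cmod (\<phi> z - w0) * (exp (12 * pi * L * cmod (w - z) / h) - 1)"
proof -
  have zw: "z \<in> ball 0 1" "w \<in> ball 0 1" using h by auto
  have p: "0 < cmod (\<phi> z - w0)" using in\<Omega>[OF zw(1)] w0 by auto
  let ?X = "cmod (\<phi> w - \<phi> z) / cmod (\<phi> z - w0)"
  have "ennreal (ln (1 + ?X) / (12 * pi)) \<le> poincare_dist \<Omega> (\<phi> z) (\<phi> w)"
    by (rule Om.poincare_dist_ge[OF w0 in\<Omega> in\<Omega>]) (use zw in auto)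
  also have "\<dots> \<le> ennreal L * poincare_dist (ball 0 1) z w" using bilip zw by blast
  also have "\<dots> \<le> ennreal L * ennreal (cmod (w - z) / h)" by (intro mult_left_mono disc_dist_le h) simp
  also have "\<dots> = ennreal (L * (cmod (w - z) / h))" using Lpos h by (intro ennreal_mult[symmetric]) auto
  finally have "ln (1 + ?X) / (12 * pi) \<le> L * (cmod (w - z) / h)" using Lpos h by (subst (asm) ennreal_le_iff) auto
  then have "ln (1 + ?X) \<le> 12 * pi * L * cmod (w - z) / h" by (simp add: field_simps)
  moreover have "0 < 1 + ?X" by (rule add_pos_nonneg) auto
  ultimately have "1 + ?X \<le> exp (12 * pi * L * cmod (w - z) / h)" by (metis exp_le_cancel_iff exp_ln)
  then have "?X \<le> exp (12 * pi * L * cmod (w - z) / h) - 1" by simp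
  then show ?thesis using p by (simp add: pos_divide_le_eq mult.commute)
qed

lemma image_dist_le:
  assumes h: "0 < h" "z \<in> cball 0 (1 - h)" "w \<in> cball 0 (1 - h)" and w0: "w0 \<notin> \<Omega>"
  shows "cmod (\<phi> w - w0) \<le> cmod (\<phi> z - w0) * exp (12 * pi * L * cmod (w - z) / h)"
proof -
  have "cmod (\<phi> w - w0) \<le> cmod (\<phi> w - \<phi> z) + cmod (\<phi> z - w0)" by (metis diff_add_cancel add_diff_eq norm_triangle_ineq)
  also have "\<dots> \<le> cmod (\<phi> z - w0) * (exp (12 * pi * L * cmod (w - z) / h) - 1) + cmod (\<phi> z - w0)"
    using image_diff_le[OF assms] by simp
  finally show ?thesis by (simp add: algebra_simps)
qed

text \<open>Makes radial paths absolutely continuous as long as they stay away from the circle. A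
  far point outside the bounded domain serves as \<open>w0\<close>, and exp u - 1 \<le> u * exp u
  linearizes the exponential.\<close>

lemma locally_Lipschitz:
  assumes h: "0 < h" obtains M where "0 \<le> M" "\<And>z w :: complex. z \<in> cball 0 (1 - h) \<Longrightarrow> w \<in> cball 0 (1 - h) \<Longrightarrow> cmod (\<phi> w - \<phi> z) \<le> M * cmod (w - z)"
proof -
  obtain B where B: "\<And>z. z \<in> \<Omega> \<Longrightarrow> cmod z \<le> B" using bdd by (auto simp: bounded_iff)
  define w0 where "w0 = complex_of_real (\<bar>B\<bar> + 1)"
  have w0: "w0 \<notin> \<Omega>" using B[of w0] by (auto simp: w0_def)
  define A where "A = 12 * pi * L / h"
  have A: "0 < A" using Lpos h by (simp add: A_def)
  show thesis
  proof
    show "0 \<le> (\<bar>B\<bar> + \<bar>B\<bar> + 1) * (A * exp (2 * A))" using A by auto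
    fix z w :: complex assume zw: "z \<in> cball 0 (1 - h)" "w \<in> cball 0 (1 - h)"
    have "cmod (\<phi> z) \<le> B" using zw h by (intro B in\<Omega>) auto
    then have 1: "cmod (\<phi> z - w0) \<le> \<bar>B\<bar> + \<bar>B\<bar> + 1" using norm_triangle_ineq4[of "\<phi> z" w0] by (simp add: w0_def)
    let ?u = "A * cmod (w - z)"
    have "cmod (w - z) \<le> 2" using norm_triangle_ineq4[of w z] zw h by auto
    then have u: "0 \<le> ?u" "?u \<le> 2 * A" using A by auto
    have "1 - ?u \<le> exp (- ?u)" using exp_ge_add_one_self[of "- ?u"] by simp
    then have "exp ?u * (1 - ?u) \<le> exp ?u * exp (- ?u)" by (intro mult_left_mono) auto
    then have "exp ?u - 1 \<le> ?u * exp ?u" by (simp add: exp_minus algebra_simps)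
    also have "\<dots> \<le> ?u * exp (2 * A)" using u by (intro mult_left_mono) auto
    finally have 2: "exp ?u - 1 \<le> A * exp (2 * A) * cmod (w - z)" by (simp add: mult_ac)
    have "cmod (\<phi> w - \<phi> z) \<le> cmod (\<phi> z - w0) * (exp ?u - 1)"
      using image_diff_le[OF h zw w0] by (simp add: A_def)
    also have "\<dots> \<le> (\<bar>B\<bar> + \<bar>B\<bar> + 1) * (A * exp (2 * A) * cmod (w - z))"
      using 1 2 u by (intro mult_mono) auto
    finally show "cmod (\<phi> w - \<phi> z) \<le> (\<bar>B\<bar> + \<bar>B\<bar> + 1) * (A * exp (2 * A)) * cmod (w - z)" by (simp add: mult_ac)
  qed
qed

text \<open>The same chain read backwards: the distance is bounded below in the disc and above in
  \<Omega>. The condition \<open>near\<close> keeps the segment between the images at distance d/2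
  from the complement.\<close>

lemma preimage_diff_le:
  assumes z: "z \<in> ball 0 1" and w: "w \<in> ball 0 1" and d: "0 < d" "ball (\<phi> z) d \<subseteq> \<Omega>" and near: "cmod (\<phi> w - \<phi> z) \<le> d / 2"
  shows "cmod (w - z) \<le> (1 - cmod z) * (exp (24 * pi * L * cmod (\<phi> w - \<phi> z) / d) - 1)"
proof -
  \<comment> \<open>The point of the circle closest to \<open>z\<close>, so that |z - w0| = 1 - |z|;
    for z = 0 any point of the circle will do.\<close>
  define w0 where "w0 = (if z = 0 then 1 else sgn z)"
  have w0: "w0 \<notin> ball 0 1" by (simp add: w0_def norm_sgn)
  have zw0: "cmod (z - w0) = 1 - cmod z"
  proof (cases "z = 0")
    case False
    have "z = of_real (cmod z) * sgn z" using False by (simp add: sgn_eq)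
    then have "z - w0 = (of_real (cmod z) - 1) * sgn z" using False by (simp add: w0_def left_diff_distrib)
    then have "cmod (z - w0) = cmod (of_real (cmod z - 1)) * cmod (sgn z)"
      by (simp only: norm_mult of_real_diff of_real_1)
    then show ?thesis using False z unfolding norm_of_real by (simp add: norm_sgn)
  qed (simp add: w0_def)
  have p: "0 < 1 - cmod z" using z by simp
  let ?X = "cmod (w - z) / cmod (z - w0)"
  have "poincare_dist \<Omega> (\<phi> z) (\<phi> w) \<le> ennreal (cmod (\<phi> w - \<phi> z) / (d / 2))"
  proof (rule Om.poincare_dist_segment_le)
    fix x assume "x \<in> closed_segment (\<phi> z) (\<phi> w)"
    moreover have "closed_segment (\<phi> z) (\<phi> w) \<subseteq> cball (\<phi> z) (d / 2)"
      using near d by (intro closed_segment_subset) (auto simp: dist_norm norm_minus_commute)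
    ultimately have "x \<in> cball (\<phi> z) (d / 2)" by blast
    then have "ball x (d / 2) \<subseteq> ball (\<phi> z) d" by (auto simp: dist_norm) (smt (verit) dist_norm dist_triangle field_sum_of_halves)
    then show "ball x (d / 2) \<subseteq> \<Omega>" using d by blast
  qed (use d in auto)
  then have "ennreal L * poincare_dist \<Omega> (\<phi> z) (\<phi> w) \<le> ennreal L * ennreal (cmod (\<phi> w - \<phi> z) / (d / 2))"
    by (rule mult_left_mono) simp
  also have "\<dots> = ennreal (L * (cmod (\<phi> w - \<phi> z) / (d / 2)))" using Lpos d by (intro ennreal_mult[symmetric]) auto
  finally have "ennreal (ln (1 + ?X) / (12 * pi)) \<le> ennreal (L * (cmod (\<phi> w - \<phi> z) / (d / 2)))"
    using D.poincare_dist_ge[OF w0 z w] bilip[OF z w] by (meson order_trans)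
  then have "ln (1 + ?X) / (12 * pi) \<le> L * (cmod (\<phi> w - \<phi> z) / (d / 2))" using Lpos d by (subst (asm) ennreal_le_iff) auto
  then have "ln (1 + ?X) \<le> 24 * pi * L * cmod (\<phi> w - \<phi> z) / d" by (simp add: field_simps)
  moreover have "0 < 1 + ?X" by (rule add_pos_nonneg) auto
  ultimately have "1 + ?X \<le> exp (24 * pi * L * cmod (\<phi> w - \<phi> z) / d)" by (metis exp_le_cancel_iff exp_ln)
  then have "cmod (w - z) / (1 - cmod z) \<le> exp (24 * pi * L * cmod (\<phi> w - \<phi> z) / d) - 1" by (simp add: zw0)
  then show ?thesis using p by (simp add: pos_divide_le_eq mult.commute)
qed

text \<open>The infinitesimal form of \<open>preimage_diff_le\<close>, for points z + t with t
  tending to 0, divided by t.\<close>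

lemma derivative_lower_bound:
  assumes z: "z \<in> ball 0 1" and diff: "\<phi> differentiable (at z)" and d: "0 < d" "ball (\<phi> z) d \<subseteq> \<Omega>"
  shows "d \<le> 24 * pi * L * (1 - cmod z) * cmod (frechet_derivative \<phi> (at z) 1)"
proof -
  let ?D = "frechet_derivative \<phi> (at z)"
  have hd: "(\<phi> has_derivative ?D) (at z)" using diff by (simp add: frechet_derivative_works)
  have lin: "((\<lambda>t. z + of_real t) has_derivative (\<lambda>t. of_real t)) (at (0::real))" by (auto intro!: derivative_eq_intros)
  have "((\<lambda>t. \<phi> (z + of_real t)) has_derivative (\<lambda>t. ?D (of_real t))) (at (0::real))"
    by (rule has_derivative_compose[OF lin]) (use hd in simp)
  moreover have "?D (of_real t) = t *\<^sub>R ?D 1" for t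
    using linear_scale[OF has_derivative_linear[OF hd], of t 1] by (simp add: scaleR_conv_of_real)
  ultimately have "((\<lambda>t. \<phi> (z + of_real t)) has_vector_derivative ?D 1) (at 0)"
    by (simp add: has_vector_derivative_def)
  from has_vector_derivative_quotient[OF this]
  have q: "((\<lambda>t. (\<phi> (z + of_real t) - \<phi> z) /\<^sub>R t) \<longlongrightarrow> ?D 1) (at 0)" by simp
  define c where "c = 24 * pi * L / d"
  have c: "0 < c" using Lpos d by (simp add: c_def)
  define tn where "tn n = 1 / real (Suc n)" for n
  have "filterlim tn (at 0) sequentially"
    unfolding filterlim_at tn_def using LIMSEQ_inverse_real_of_nat by (simp add: inverse_eq_divide)
  with q have "(\<lambda>n. (\<phi> (z + of_real (tn n)) - \<phi> z) /\<^sub>R tn n) \<longlonglongrightarrow> ?D 1" by (rule filterlim_compose)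
  then have Q: "(\<lambda>n. cmod ((\<phi> (z + of_real (tn n)) - \<phi> z) /\<^sub>R tn n)) \<longlonglongrightarrow> cmod (?D 1)" (is "?Q \<longlonglongrightarrow> _") by (rule tendsto_norm)
  have t0: "tn \<longlonglongrightarrow> 0" unfolding tn_def using LIMSEQ_inverse_real_of_nat by (simp add: inverse_eq_divide)
  have tpos: "0 < tn n" for n by (simp add: tn_def)
  have lim: "(\<lambda>n. (1 - cmod z) * (c * ?Q n + c\<^sup>2 * tn n * (?Q n)\<^sup>2)) \<longlonglongrightarrow> (1 - cmod z) * (c * cmod (?D 1) + c\<^sup>2 * 0 * (cmod (?D 1))\<^sup>2)"
    by (intro tendsto_mult tendsto_add tendsto_const Q t0 tendsto_power)
  have zt: "(\<lambda>n. z + of_real (tn n)) \<longlonglongrightarrow> z + of_real 0" by (intro tendsto_add tendsto_const tendsto_of_real t0)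
  have contz: "isCont \<phi> z" using hd by (rule has_derivative_continuous)
  have "(\<lambda>n. \<phi> (z + of_real (tn n))) \<longlonglongrightarrow> \<phi> z" using isCont_tendsto_compose[OF contz, of "\<lambda>n. z + of_real (tn n)" sequentially] zt by simp
  then have "(\<lambda>n. cmod (\<phi> (z + of_real (tn n)) - \<phi> z)) \<longlonglongrightarrow> cmod (\<phi> z - \<phi> z)" by (intro tendsto_intros)
  then have e1: "\<forall>\<^sub>F n in sequentially. cmod (\<phi> (z + of_real (tn n)) - \<phi> z) < min (d / 2) (1 / c)"
    using d c by (intro order_tendstoD(2)) auto
  have e2: "\<forall>\<^sub>F n in sequentially. z + of_real (tn n) \<in> ball 0 1"
    using zt z by (intro topological_tendstoD) auto
  have "1 \<le> (1 - cmod z) * (c * cmod (?D 1) + c\<^sup>2 * 0 * (cmod (?D 1))\<^sup>2)"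
  proof (rule tendsto_lowerbound[OF lim])
    show "\<forall>\<^sub>F n in sequentially. 1 \<le> (1 - cmod z) * (c * ?Q n + c\<^sup>2 * tn n * (?Q n)\<^sup>2)"
      using e1 e2
    proof eventually_elim
      case (elim n)
      let ?w = "z + of_real (tn n)" and ?m = "cmod (\<phi> (z + of_real (tn n)) - \<phi> z)"
      have "cmod (?w - z) \<le> (1 - cmod z) * (exp (24 * pi * L * ?m / d) - 1)"
        by (rule preimage_diff_le[OF z elim(2) d]) (use elim in auto)
      then have 1: "tn n \<le> (1 - cmod z) * (exp (c * ?m) - 1)" using tpos[of n] by (simp add: c_def)
      \<comment> \<open>Within this range exp x \<le> 1 + x + x^2, and the quadratic term, divided
        by t, disappears in the limit.\<close>
      have "c * ?m \<le> 1" using elim(1) c by (simp add: field_simps)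
      then have "exp (c * ?m) \<le> 1 + c * ?m + (c * ?m)\<^sup>2" using c by (intro exp_bound) auto
      then have "(1 - cmod z) * (exp (c * ?m) - 1) \<le> (1 - cmod z) * (c * ?m + (c * ?m)\<^sup>2)" using z by (intro mult_left_mono) auto
      with 1 have "tn n \<le> (1 - cmod z) * (c * ?m + (c * ?m)\<^sup>2)" by simp
      moreover have "?m = tn n * ?Q n" using tpos[of n] by simp
      ultimately have "tn n * 1 \<le> tn n * ((1 - cmod z) * (c * ?Q n + c\<^sup>2 * tn n * (?Q n)\<^sup>2))"
        by (simp only: power_mult_distrib power2_eq_square) (simp add: algebra_simps)
      then show ?case using tpos[of n] by (simp only: mult_le_cancel_left_pos)
    qed
  qed simp
  then show ?thesis using d by (simp add: c_def field_simps)
qed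

text \<open>The lower bound for the derivative gives d \<le> const * (1 - |z|) * |dz|.
  Multiplication by |dz| produces |dz|^2 on the right, which the dilatation bound compares with the
  Jacobian |dz|^2 - |dzbar|^2.\<close>

lemma dz_le_jac:
  assumes z: "z \<in> ball 0 1" and good: "\<phi> differentiable (at z)" "cmod (dzbar \<phi> z) \<le> k * cmod (dz \<phi> z)"
    and d: "0 < d" "ball (\<phi> z) d \<subseteq> \<Omega>"
  shows "cmod (dz \<phi> z) \<le> 48 * pi * L / (1 - k\<^sup>2) * ((1 - cmod z) / d) * jac (frechet_derivative \<phi> (at z))"
proof -
  let ?a = "cmod (dz \<phi> z)" and ?b = "cmod (dzbar \<phi> z)"
  have k2: "0 < 1 - k\<^sup>2" using k by (simp add: abs_square_less_1)
  have "frechet_derivative \<phi> (at z) = (\<lambda>v. dz \<phi> z * v + dzbar \<phi> z * cnj v)"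
    using frechet_derivative_dz_dzbar[OF good(1)] by blast
  then have J: "jac (frechet_derivative \<phi> (at z)) = ?a\<^sup>2 - ?b\<^sup>2" by (simp add: jac_eq)
  have "?b\<^sup>2 \<le> (k * ?a)\<^sup>2" using good(2) by (intro power_mono) auto
  then have Jge: "(1 - k\<^sup>2) * ?a\<^sup>2 \<le> jac (frechet_derivative \<phi> (at z))" unfolding J by (simp add: power_mult_distrib algebra_simps)
  have "cmod (frechet_derivative \<phi> (at z) 1) \<le> ?a + ?b"
    using frechet_derivative_dz_dzbar[OF good(1), of 1] norm_triangle_ineq[of "dz \<phi> z" "dzbar \<phi> z"] by simp
  also have "\<dots> \<le> ?a + 1 * ?a" using good(2) k mult_right_mono[of k 1 ?a] by auto
  finally have "cmod (frechet_derivative \<phi> (at z) 1) \<le> 2 * ?a" by simp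
  moreover have "0 \<le> 24 * pi * L * (1 - cmod z)" using Lpos z by simp
  ultimately have "24 * pi * L * (1 - cmod z) * cmod (frechet_derivative \<phi> (at z) 1) \<le> 24 * pi * L * (1 - cmod z) * (2 * ?a)"
    by (rule mult_left_mono)
  then have "d \<le> 24 * pi * L * (1 - cmod z) * (2 * ?a)" by (rule order_trans[OF derivative_lower_bound[OF z good(1) d]])
  also have "\<dots> = 48 * pi * L * (1 - cmod z) * ?a" by simp
  finally have "d \<le> 48 * pi * L * (1 - cmod z) * ?a" .
  then have "d * ?a \<le> 48 * pi * L * (1 - cmod z) * ?a * ?a" by (rule mult_right_mono) simp
  then have "?a \<le> 48 * pi * L * (1 - cmod z) / d * ?a\<^sup>2" using d by (simp add: field_simps power2_eq_square)
  also have "\<dots> = 48 * pi * L / (1 - k\<^sup>2) * ((1 - cmod z) / d) * ((1 - k\<^sup>2) * ?a\<^sup>2)" using k2 by simp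
  also have "\<dots> \<le> 48 * pi * L / (1 - k\<^sup>2) * ((1 - cmod z) / d) * jac (frechet_derivative \<phi> (at z))"
    using Jge Lpos k2 z d by (intro mult_left_mono) auto
  finally show ?thesis .
qed

end

section \<open>The modulus estimate in logarithmic coordinates\<close>

lemma measurable_Complex [measurable (raw)]:
  "f \<in> borel_measurable M \<Longrightarrow> g \<in> borel_measurable M \<Longrightarrow> (\<lambda>x. Complex (f x) (g x)) \<in> borel_measurable M"
proof -
  assume fg: "f \<in> borel_measurable M" "g \<in> borel_measurable M"
  have r: "complex_of_real \<in> borel_measurable borel"
    by (intro borel_measurable_continuous_onI continuous_intros)
  show ?thesis unfolding Complex_eq
    by (intro borel_measurable_add borel_measurable_times borel_measurable_const measurable_compose[OF fg(1) r] measurable_compose[OF fg(2) r])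
qed

context qc_disc
begin

definition K :: real where "K = (1 + k) / (1 - k)"

lemma K_pos: "0 < K" using k by (simp add: K_def)

text \<open>The derivative of \<phi> o exp. In these coordinates radial segments become horizontal
  and polar sectors become rectangles, while the conformal factor leaves the dilatation
  unchanged.\<close>

definition D\<Phi> :: "complex \<Rightarrow> complex \<Rightarrow> complex" where
  "D\<Phi> z = (\<lambda>v. frechet_derivative \<phi> (at (exp z)) (exp z * v))"

lemma has_derivative_\<Phi>:
  assumes "\<phi> differentiable (at (exp z))"
  shows "((\<lambda>z. \<phi> (exp z)) has_derivative D\<Phi> z) (at z)"
proof -
  have "(exp has_derivative (\<lambda>v. exp z * v)) (at z)" using DERIV_exp[of z] by (simp add: has_field_derivative_def)
  moreover have "(\<phi> has_derivative frechet_derivative \<phi> (at (exp z))) (at (exp z))" using assms by (simp add: frechet_derivative_works)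
  ultimately show ?thesis unfolding D\<Phi>_def by (rule has_derivative_compose)
qed

text \<open>The factor exp z multiplies both Wirtinger derivatives by numbers of the same modulus,
  so |b| \<le> k * |a| persists, and (|a| + |b|)^2 \<le> K * (|a|^2 - |b|^2).\<close>

lemma D\<Phi>_quasiconformal:
  assumes "\<phi> differentiable (at (exp z))" "cmod (dzbar \<phi> (exp z)) \<le> k * cmod (dz \<phi> (exp z))"
  shows "(cmod (D\<Phi> z 1))\<^sup>2 \<le> K * jac (D\<Phi> z)" "0 \<le> jac (D\<Phi> z)"
proof -
  let ?a = "dz \<phi> (exp z) * exp z" and ?b = "dzbar \<phi> (exp z) * cnj (exp z)"
  have D: "D\<Phi> z = (\<lambda>v. ?a * v + ?b * cnj v)"
    unfolding D\<Phi>_def frechet_derivative_dz_dzbar[OF assms(1)] by (simp add: mult_ac)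
  have b: "cmod ?b \<le> k * cmod ?a" using mult_right_mono[OF assms(2), of "cmod (exp z)"] by (simp add: norm_mult mult.assoc)
  have "cmod (D\<Phi> z 1) \<le> cmod ?a + cmod ?b" unfolding D using norm_triangle_ineq[of ?a ?b] by simp
  also have "\<dots> \<le> (1 + k) * cmod ?a" using b by (simp add: algebra_simps)
  finally have "(cmod (D\<Phi> z 1))\<^sup>2 \<le> ((1 + k) * cmod ?a)\<^sup>2" by (intro power_mono) auto
  also have "\<dots> = K * ((1 - k\<^sup>2) * (cmod ?a)\<^sup>2)" using k by (simp add: K_def power2_eq_square field_simps)
  finally have 1: "(cmod (D\<Phi> z 1))\<^sup>2 \<le> K * ((1 - k\<^sup>2) * (cmod ?a)\<^sup>2)" .
  have "(cmod ?b)\<^sup>2 \<le> (k * cmod ?a)\<^sup>2" using b by (intro power_mono) auto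
  then have J: "(1 - k\<^sup>2) * (cmod ?a)\<^sup>2 \<le> jac (D\<Phi> z)" unfolding D jac_eq by (simp only: power_mult_distrib) (simp add: algebra_simps)
  have "0 \<le> 1 - k\<^sup>2" using k by (simp add: abs_square_le_1)
  then show "0 \<le> jac (D\<Phi> z)" using J by (meson mult_nonneg_nonneg order_trans zero_le_power2)
  show "(cmod (D\<Phi> z 1))\<^sup>2 \<le> K * jac (D\<Phi> z)" by (rule order_trans[OF 1 mult_left_mono[OF J less_imp_le[OF K_pos]]])
qed

text \<open>On a strip of height at most 2 * pi the exponential has a holomorphic inverse, and
  differentiable maps preserve negligible sets.\<close>

lemma exp_preimage_negligible:
  assumes "negligible B" and R: "open R" "\<And>z w. z \<in> R \<Longrightarrow> w \<in> R \<Longrightarrow> \<bar>Im z - Im w\<bar> < 2 * pi"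
  shows "negligible {z\<in>R. exp z \<in> B}"
proof -
  have inj: "inj_on exp R" using R(2) by (auto intro!: inj_onI exp_complex_eqI)
  obtain g where g: "g holomorphic_on exp ` R" "\<And>z. z \<in> R \<Longrightarrow> g (exp z) = z"
    by (rule holomorphic_has_inverse[OF holomorphic_on_exp R(1) inj]) blast
  have "g differentiable_on (exp ` R \<inter> B)"
    unfolding differentiable_on_def
  proof
    fix x assume "x \<in> exp ` R \<inter> B"
    then have "g field_differentiable (at x within exp ` R)" using g(1) by (auto simp: holomorphic_on_def)
    then have "g differentiable (at x within exp ` R)" by (rule field_differentiable_imp_differentiable)
    then show "g differentiable (at x within exp ` R \<inter> B)" by (rule differentiable_within_subset) auto
  qed
  then have "negligible (g ` (exp ` R \<inter> B))"
    using assms(1) by (intro negligible_differentiable_image_negligible) (auto intro: negligible_subset)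
  moreover have "{z\<in>R. exp z \<in> B} \<subseteq> g ` (exp ` R \<inter> B)" using g(2) by force
  ultimately show ?thesis by (rule negligible_subset)
qed

text \<open>The length part for a single ray. Its image crosses the annulus with radii \<rho> = 2 *
  r1 and 2^N * \<rho> about \<open>w0\<close>, in either direction, and the logarithmic length is
  traded for area by an inequality with a free parameter \<tau>.\<close>

lemma radial_crossing:
  assumes h: "0 < h" "h \<le> 1/2" and N: "0 < N" and r1: "0 < r1" and \<tau>: "0 < \<tau>"
    and ends: "cmod (\<phi> (of_real (1 - h) * cis y) - w0) \<le> r1 \<and> 2 ^ (N + 2) * r1 \<le> cmod (\<phi> (cis y) - w0) \<or>
       2 ^ (N + 2) * r1 \<le> cmod (\<phi> (of_real (1 - h) * cis y) - w0) \<and> cmod (\<phi> (cis y) - w0) \<le> r1"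
    and good: "AE x in lborel. x \<in> {ln (1 - h)<..<0} \<longrightarrow> \<phi> differentiable (at (exp (Complex x y))) \<and>
       cmod (dzbar \<phi> (exp (Complex x y))) \<le> k * cmod (dz \<phi> (exp (Complex x y)))"
  shows "ennreal (real N * ln 2) \<le> (\<integral>\<^sup>+x\<in>{ln (1 - h)<..<0}.
     (ennreal (\<tau> / 2) + ennreal (K / (2 * \<tau>)) * ennreal (jac (D\<Phi> (Complex x y)) * annulus_weight w0 (2 * r1) N (\<phi> (exp (Complex x y))))) \<partial>lborel)"
proof -
  define a0 where "a0 = ln (1 - h)"
  have a0: "a0 < 0" "exp a0 = 1 - h" using h by (auto simp: a0_def)
  define p where "p x = \<phi> (exp (Complex x y))" for x
  define \<rho> where "\<rho> = 2 * r1"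
  let ?q = "\<lambda>x. cmod (p x - w0)"
  have ex: "exp (Complex x y) = of_real (exp x) * cis y" for x by (simp add: exp_eq_polar)
  have pa: "p a0 = \<phi> (of_real (1 - h) * cis y)" and p0: "p 0 = \<phi> (cis y)" by (simp_all add: p_def ex a0(2) del: of_real_diff)
  have nex: "cmod (exp (Complex x y)) = exp x" for x by simp
  have "continuous_on {a0..0} (\<lambda>x. of_real (exp x) * cis y)" by (intro continuous_intros)
  moreover have "(\<lambda>x. of_real (exp x) * cis y) ` {a0..0} \<subseteq> cball 0 1" by (auto simp: norm_mult)
  ultimately have "continuous_on {a0..0} p" unfolding p_def ex by (intro continuous_on_compose2[OF cont])
  then have contq: "continuous_on {a0..0} ?q" by (intro continuous_intros)
  obtain d where d: "0 < d" "\<And>x. x \<in> {a0..0} \<Longrightarrow> dist x 0 < d \<Longrightarrow> dist (?q x) (?q 0) < r1"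
    using contq[unfolded continuous_on_iff, rule_format, of 0 r1] a0 r1 by auto
  \<comment> \<open>The Lipschitz bound fails up to the circle, so the path stops shortly before it.
    Continuity moves the end value by less than \<open>r1\<close>; the inner radius 2 * r1 and the
    exponent N + 2 absorb this.\<close>
  define b where "b = max (a0 / 2) (- d / 2)"
  have b: "a0 < b" "b < 0" "dist b 0 < d" using a0 d by (auto simp: b_def dist_real_def)
  have qb: "\<bar>?q b - ?q 0\<bar> < r1" using d(2)[of b] b by (auto simp: dist_real_def)
  have pw: "2 * r1 \<le> 2 ^ N * \<rho>" "2 ^ N * \<rho> + r1 \<le> 2 ^ (N + 2) * r1" "\<rho> < 2 ^ N * \<rho>"
  proof -
    have "(2::real) \<le> 2 ^ N" using N self_le_power[of 2 N] by simp
    then have "2 * r1 \<le> 2 ^ N * r1" "1 * r1 \<le> 2 ^ N * r1" using r1 by (auto intro!: mult_right_mono)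
    moreover have "2 ^ N * \<rho> = 2 * (2 ^ N * r1)" "2 ^ (N + 2) * r1 = 4 * (2 ^ N * r1)" by (simp_all add: \<rho>_def)
    ultimately show "2 * r1 \<le> 2 ^ N * \<rho>" "2 ^ N * \<rho> + r1 \<le> 2 ^ (N + 2) * r1" "\<rho> < 2 ^ N * \<rho>"
      using r1 by (auto simp: \<rho>_def)
  qed
  have ends': "?q a0 \<le> \<rho> \<and> 2 ^ N * \<rho> \<le> ?q b \<or> 2 ^ N * \<rho> \<le> ?q a0 \<and> ?q b \<le> \<rho>"
  proof -
    have \<rho>2: "\<rho> = 2 * r1" by (simp add: \<rho>_def)
    have q: "?q b < ?q 0 + r1" "?q 0 - r1 < ?q b" using qb by linarith+
    have "?q a0 \<le> r1 \<and> 2 ^ (N + 2) * r1 \<le> ?q 0 \<or> 2 ^ (N + 2) * r1 \<le> ?q a0 \<and> ?q 0 \<le> r1"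
      using ends unfolding pa p0 .
    then show ?thesis
    proof (elim disjE conjE)
      assume "?q a0 \<le> r1" "2 ^ (N + 2) * r1 \<le> ?q 0"
      then show ?thesis using \<rho>2 q pw(2) r1 by (intro disjI1 conjI; linarith)
    next
      assume "2 ^ (N + 2) * r1 \<le> ?q a0" "?q 0 \<le> r1"
      then show ?thesis using \<rho>2 q pw(2) r1 by (intro disjI2 conjI; linarith)
    qed
  qed
  have h': "0 < 1 - exp b" using b by simp
  obtain M where M: "0 \<le> M" "\<And>z w :: complex. z \<in> cball 0 (1 - (1 - exp b)) \<Longrightarrow> w \<in> cball 0 (1 - (1 - exp b)) \<Longrightarrow> cmod (\<phi> w - \<phi> z) \<le> M * cmod (w - z)"
    by (rule locally_Lipschitz[OF h']) (rule that)
  have lip: "cmod (p t - p s) \<le> M * (t - s)" if st: "a0 \<le> s" "s \<le> t" "t \<le> b" for s t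
  proof -
    have "cmod (p t - p s) \<le> M * cmod (exp (Complex t y) - exp (Complex s y))"
      unfolding p_def by (rule M(2)) (use st in \<open>auto\<close>)
    also have "exp (Complex t y) - exp (Complex s y) = of_real (exp t - exp s) * cis y" by (simp add: ex algebra_simps)
    also have "cmod (of_real (exp t - exp s) * cis y) = \<bar>exp t - exp s\<bar>" by (simp only: norm_mult norm_of_real norm_cis mult_1_right)
    also have "\<bar>exp t - exp s\<bar> \<le> t - s"
    proof -
      have "1 + (s - t) \<le> exp (s - t)" by (rule exp_ge_add_one_self)
      then have "exp t * (1 + (s - t)) \<le> exp t * exp (s - t)" by (intro mult_left_mono) auto
      then have "exp t - exp s \<le> exp t * (t - s)" by (simp add: exp_diff algebra_simps)
      also have "\<dots> \<le> 1 * (t - s)" using st b by (intro mult_right_mono) auto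
      finally show ?thesis using st by simp
    qed
    finally show ?thesis using M(1) by (simp add: mult_left_mono)
  qed
  let ?good = "\<lambda>x. \<phi> differentiable (at (exp (Complex x y))) \<and> cmod (dzbar \<phi> (exp (Complex x y))) \<le> k * cmod (dz \<phi> (exp (Complex x y)))"
  define N1 where "N1 = {x. \<not> (x \<in> {a0<..<0} \<longrightarrow> ?good x)} \<union> {a0}"
  have ae: "AE x in lebesgue. x \<in> {a0<..<0} \<longrightarrow> ?good x" using good unfolding a0_def by (rule AE_completion)
  then have "{x. \<not> (x \<in> {a0<..<0} \<longrightarrow> ?good x)} \<in> null_sets lebesgue"
    using completion.AE_iff_null_sets[where M=lborel and P="\<lambda>x. x \<in> {a0<..<0} \<longrightarrow> ?good x"] by simp
  then have N1: "negligible N1" unfolding N1_def by (intro negligible_Un) (auto simp: negligible_iff_null_sets)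
  have der: "(p has_vector_derivative D\<Phi> (Complex x y) 1) (at x)" if "x \<in> {a0..b} - N1" for x
  proof -
    have "x \<in> {a0<..<0}" using that b by (auto simp: N1_def)
    then have "?good x" using that by (auto simp: N1_def)
    then have \<Phi>d: "((\<lambda>z. \<phi> (exp z)) has_derivative D\<Phi> (Complex x y)) (at (Complex x y))" by (intro has_derivative_\<Phi>) auto
    have "((\<lambda>t. Complex t y) has_derivative (\<lambda>t. of_real t)) (at x)"
      unfolding Complex_eq by (auto intro!: derivative_eq_intros)
    from has_derivative_compose[OF this \<Phi>d]
    have "(p has_derivative (\<lambda>t. D\<Phi> (Complex x y) (of_real t))) (at x)" unfolding p_def .
    moreover have "D\<Phi> (Complex x y) (of_real t) = t *\<^sub>R D\<Phi> (Complex x y) 1" for t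
      using linear_scale[OF has_derivative_linear[OF \<Phi>d], of t 1] by (simp add: scaleR_conv_of_real)
    ultimately show ?thesis by (simp add: has_vector_derivative_def)
  qed
  have r: "0 < \<rho>" using r1 by (simp add: \<rho>_def)
  have "ennreal (ln (2 ^ N * \<rho> / \<rho>)) \<le> (\<integral>\<^sup>+t\<in>{t\<in>{a0..b}. \<rho> \<le> ?q t \<and> ?q t \<le> 2 ^ N * \<rho>}. ennreal (cmod (D\<Phi> (Complex t y) 1) / ?q t) \<partial>lborel)"
    using b by (intro annulus_crossing[OF _ lip M(1) N1 der r pw(3) ends']) auto
  also have "ln (2 ^ N * \<rho> / \<rho>) = real N * ln 2" using r by (simp add: ln_realpow)
  also have "(\<integral>\<^sup>+t\<in>{t\<in>{a0..b}. \<rho> \<le> ?q t \<and> ?q t \<le> 2 ^ N * \<rho>}. ennreal (cmod (D\<Phi> (Complex t y) 1) / ?q t) \<partial>lborel)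
    \<le> (\<integral>\<^sup>+x\<in>{a0<..<0}. (ennreal (\<tau> / 2) + ennreal (K / (2 * \<tau>)) * ennreal (jac (D\<Phi> (Complex x y)) * annulus_weight w0 \<rho> N (p x))) \<partial>lborel)"
  proof (rule nn_integral_mono_AE)
    have "AE x in lborel. x \<noteq> a0" by (rule AE_lborel_singleton)
    then show "AE x in lborel. ennreal (cmod (D\<Phi> (Complex x y) 1) / ?q x) * indicator {t\<in>{a0..b}. \<rho> \<le> ?q t \<and> ?q t \<le> 2 ^ N * \<rho>} x
      \<le> (ennreal (\<tau> / 2) + ennreal (K / (2 * \<tau>)) * ennreal (jac (D\<Phi> (Complex x y)) * annulus_weight w0 \<rho> N (p x))) * indicator {a0<..<0} x"
      using good[folded a0_def]
    proof eventually_elim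
      case (elim x)
      show ?case
      proof (cases "x \<in> {t\<in>{a0..b}. \<rho> \<le> ?q t \<and> ?q t \<le> 2 ^ N * \<rho>}")
        case True
        then have x: "x \<in> {a0<..<0}" "\<rho> \<le> ?q x" "?q x \<le> 2 ^ N * \<rho>" using elim(1) b by auto
        then have g: "?good x" using elim(2) by blast
        let ?u = "cmod (D\<Phi> (Complex x y) 1) / ?q x" and ?J = "jac (D\<Phi> (Complex x y))" and ?f = "annulus_weight w0 \<rho> N (p x)"
        note q = D\<Phi>_quasiconformal[OF conjunct1[OF g] conjunct2[OF g]]
        have "?u\<^sup>2 = (cmod (D\<Phi> (Complex x y) 1))\<^sup>2 * (1 / (?q x)\<^sup>2)" by (simp add: power_divide)
        also have "\<dots> \<le> (K * ?J) * ?f"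
          using q K_pos x r N by (intro mult_mono annulus_weight_ge) auto
        finally have u2: "?u\<^sup>2 \<le> K * (?J * ?f)" by (simp only: mult.assoc)
        \<comment> \<open>Young's inequality u \<le> \<tau>/2 + u^2 / (2 * \<tau>) in place of
          Cauchy-Schwarz, so that each ray can be estimated separately and \<tau> fixed after
          integration over the angle.\<close>
        have "0 \<le> (?u - \<tau>)\<^sup>2 / (2 * \<tau>)" using \<tau> by simp
        then have "?u \<le> \<tau> / 2 + ?u\<^sup>2 / (2 * \<tau>)" using \<tau> by (simp add: power2_diff diff_divide_distrib add_divide_distrib power2_eq_square[of \<tau>])
        also have "\<dots> \<le> \<tau> / 2 + K * (?J * ?f) / (2 * \<tau>)" using u2 \<tau> by (simp add: divide_right_mono)
        finally have "ennreal ?u \<le> ennreal (\<tau> / 2 + K / (2 * \<tau>) * (?J * ?f))" by (intro ennreal_leI) simp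
        also have "\<dots> = ennreal (\<tau> / 2) + ennreal (K / (2 * \<tau>)) * ennreal (?J * ?f)"
          using \<tau> K_pos q annulus_weight_nonneg[of w0 \<rho> N "p x"] by (simp add: ennreal_mult[symmetric] ennreal_plus[symmetric] del: ennreal_plus)
        finally show ?thesis using True x by simp
      qed simp
    qed
  qed
  finally show ?thesis unfolding a0_def p_def \<rho>_def .
qed

text \<open>Integration of the row estimate over the angle. By injectivity the Jacobian term is at
  most the integral of the annulus weight, which is 16 * N at most. If every radial segment of a
  sector has one end near \<open>w0\<close> and the other far away, the ratio of the distances is
  thus bounded in terms of the shape of the sector. The bound on \<theta>2 - \<theta>1 makes exp
  injective on the rectangle.\<close>

theorem modulus_bound:
  assumes h: "0 < h" "h \<le> 1/2" and s: "\<theta>1 < \<theta>2" "\<theta>2 \<le> \<theta>1 + 2 * pi" and r1: "0 < r1"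
    and ends: "\<And>y. \<theta>1 < y \<Longrightarrow> y < \<theta>2 \<Longrightarrow> cmod (\<phi> (of_real (1 - h) * cis y) - w0) \<le> r1 \<and> 2 ^ (N + 2) * r1 \<le> cmod (\<phi> (cis y) - w0) \<or>
       2 ^ (N + 2) * r1 \<le> cmod (\<phi> (of_real (1 - h) * cis y) - w0) \<and> cmod (\<phi> (cis y) - w0) \<le> r1"
  shows "real N \<le> 32 * K / (ln 2)\<^sup>2 * (h / (\<theta>2 - \<theta>1))"
proof (cases "N = 0")
  case True
  then show ?thesis using K_pos h s by simp
next
  case False
  then have N: "0 < N" by simp
  define a0 where "a0 = ln (1 - h)"
  have a0: "a0 < 0" using h by (auto simp: a0_def)
  have a02: "- a0 \<le> 2 * h"
  proof -
    have "- a0 = ln (1 / (1 - h))" using h by (simp add: a0_def ln_div)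
    also have "\<dots> \<le> 1 / (1 - h) - 1" using h by (intro ln_le_minus_one) auto
    also have "\<dots> = h / (1 - h)" using h by (simp add: field_simps)
    also have "\<dots> \<le> h / (1/2)" using h by (intro divide_left_mono) auto
    finally show ?thesis by simp
  qed
  define R where "R = box (Complex a0 \<theta>1) (Complex 0 \<theta>2)"
  have Rmem: "z \<in> R \<longleftrightarrow> a0 < Re z \<and> Re z < 0 \<and> \<theta>1 < Im z \<and> Im z < \<theta>2" for z by (auto simp: R_def in_box_complex_iff)
  have Rim: "\<bar>Im z - Im w\<bar> < 2 * pi" if "z \<in> R" "w \<in> R" for z w using that s by (auto simp: Rmem)
  have expR: "exp z \<in> ball 0 1" if "z \<in> R" for z using that by (simp add: Rmem)
  let ?good = "\<lambda>z. \<phi> differentiable (at z) \<and> cmod (dzbar \<phi> z) \<le> k * cmod (dz \<phi> z)"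
  define N1 where "N1 = {z\<in>R. \<not> ?good (exp z)}"
  have "negligible {z\<in>R. exp z \<in> {z\<in>ball 0 1. \<not> ?good z}}"
    by (rule exp_preimage_negligible[OF good_ae _ Rim]) (simp add: R_def open_box)
  then have N1: "negligible N1" by (rule negligible_subset) (use expR in \<open>auto simp: N1_def\<close>)
  define S where "S = R - N1"
  have S: "S \<in> sets lebesgue" unfolding S_def R_def using N1 by (intro sets.Diff) (auto simp: negligible_iff_null_sets)
  have Sgood: "?good (exp z)" "z \<in> R" if "z \<in> S" for z using that by (auto simp: S_def N1_def)
  have der: "((\<lambda>z. \<phi> (exp z)) has_derivative D\<Phi> z) (at z)" if "z \<in> S" for z
    using Sgood[OF that] by (intro has_derivative_\<Phi>) auto
  have injS: "inj_on (\<lambda>z. \<phi> (exp z)) S"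
  proof (rule inj_onI)
    fix z w assume zw: "z \<in> S" "w \<in> S" "\<phi> (exp z) = \<phi> (exp w)"
    then have "exp z = exp w" using inj expR Sgood(2) by (auto dest: inj_onD)
    moreover have "\<bar>Im z - Im w\<bar> < 2 * pi" "\<bar>Im w - Im z\<bar> < 2 * pi" using zw(1,2) Sgood(2) by (simp_all add: Rim)
    ultimately show "z = w" using exp_complex_eqI[of z w] exp_complex_eqI[of w z] by (simp del: exp_eq)
  qed
  define f where "f = annulus_weight w0 (2 * r1) N"
  have r: "0 < 2 * r1" using r1 by simp
  note f_int = annulus_weight_integral[OF r, of w0 N, folded f_def]
  have f0: "0 \<le> f w" for w by (simp add: f_def annulus_weight_nonneg)
  have "(\<lambda>z. \<phi> (exp z)) differentiable_on S"
    using der by (meson differentiable_on_def differentiable_def has_derivative_at_withinI)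
  then have im: "(\<lambda>z. \<phi> (exp z)) ` S \<in> sets lebesgue" using S by (intro differentiable_image_in_sets_lebesgue) auto
  have f_im: "f absolutely_integrable_on ((\<lambda>z. \<phi> (exp z)) ` S)"
    unfolding set_integrable_def by (rule integrable_mult_indicator[OF im f_int(3)])
  define G where "G z = indicator S z *\<^sub>R (\<bar>jac (D\<Phi> z)\<bar> * f (\<phi> (exp z)))" for z
  have Gm: "G \<in> borel_measurable lebesgue"
    using complex_change_of_variables(1)[OF S der injS f_im] unfolding set_integrable_def G_def[symmetric] by (rule borel_measurable_integrable)
  have Gint: "(\<integral>\<^sup>+z. ennreal (G z) \<partial>lebesgue) \<le> ennreal (16 * real N)"
  proof -
    have "(\<integral>\<^sup>+z. ennreal (G z) \<partial>lebesgue) = (\<integral>\<^sup>+z\<in>S. ennreal (\<bar>jac (D\<Phi> z)\<bar> * f (\<phi> (exp z))) \<partial>lebesgue)"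
      by (intro nn_integral_cong) (auto simp: G_def indicator_def)
    also have "\<dots> = (\<integral>\<^sup>+w\<in>(\<lambda>z. \<phi> (exp z)) ` S. ennreal (f w) \<partial>lebesgue)"
      by (rule complex_change_of_variables_nn[OF S der injS f_im f0])
    also have "\<dots> \<le> (\<integral>\<^sup>+w. ennreal (f w) \<partial>lebesgue)" by (intro nn_integral_mono) (auto simp: indicator_def)
    also have "\<dots> \<le> ennreal (16 * real N)" by (rule f_int(1))
    finally show ?thesis .
  qed
  \<comment> \<open>Fubini's theorem needs a Borel function, while \<open>G\<close> is only Lebesgue
    measurable; its Borel version agrees with it on almost every row, almost everywhere.\<close>
  obtain G0 where G0: "G0 \<in> borel_measurable lborel" "AE z in lborel. ennreal (G z) = G0 z"
    using completion_ex_borel_measurable[of "\<lambda>z. ennreal (G z)" lborel] Gm by auto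
  have [measurable]: "G0 \<in> borel_measurable borel" using G0(1) by simp
  have G0int: "(\<integral>\<^sup>+z. G0 z \<partial>lborel) \<le> ennreal (16 * real N)"
  proof -
    have "(\<integral>\<^sup>+z. G0 z \<partial>lborel) = (\<integral>\<^sup>+z. ennreal (G z) \<partial>lborel)"
      by (rule nn_integral_cong_AE) (use G0(2) in eventually_elim, simp)
    then show ?thesis using Gint by (simp add: nn_integral_completion)
  qed
  have "AE z in lebesgue. z \<notin> N1" using N1 by (simp only: negligible_iff_null_sets AE_not_in)
  then have "AE z in lborel. z \<notin> N1" by (simp only: AE_completion_iff)
  then have ae: "AE z in lborel. z \<notin> N1 \<and> ennreal (G z) = G0 z" using G0(2) by eventually_elim simp
  let ?T = "\<lambda>(y, x). Complex x y"
  have T[measurable]: "?T \<in> borel_measurable (lborel \<Otimes>\<^sub>M lborel)" by measurable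
  have "AE p in lborel \<Otimes>\<^sub>M lborel. ?T p \<notin> N1 \<and> ennreal (G (?T p)) = G0 (?T p)"
    using ae unfolding distr_Complex[symmetric] by (rule AE_distrD[OF T])
  then have ae2: "AE y in lborel. AE x in lborel. Complex x y \<notin> N1 \<and> ennreal (G (Complex x y)) = G0 (Complex x y)"
    using lborel_pair.AE_pair by fastforce
  define c where "c = ln (2::real)"
  have c: "0 < c" by (simp add: c_def)
  \<comment> \<open>With this choice \<tau> * h is half of the left-hand side N * ln 2, so the term
    linear in \<tau> can be absorbed.\<close>
  define \<tau> where "\<tau> = real N * c / (2 * h)"
  have \<tau>: "0 < \<tau>" using N c h by (simp add: \<tau>_def)
  have row: "AE y in lborel. ennreal (real N * c) * indicator {\<theta>1<..<\<theta>2} y \<le>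
      ennreal (\<tau> * h) * indicator {\<theta>1<..<\<theta>2} y + ennreal (K / (2 * \<tau>)) * (\<integral>\<^sup>+x. G0 (Complex x y) \<partial>lborel)"
    using ae2
  proof eventually_elim
    case (elim y)
    show ?case
    proof (cases "y \<in> {\<theta>1<..<\<theta>2}")
      case True
      then have y: "\<theta>1 < y" "y < \<theta>2" by auto
      have inR: "Complex x y \<in> R" if "x \<in> {a0<..<0}" for x using that y by (simp add: Rmem)
      have good: "AE x in lborel. x \<in> {ln (1 - h)<..<0} \<longrightarrow> ?good (exp (Complex x y))"
        using elim by eventually_elim (use inR in \<open>auto simp: N1_def a0_def\<close>)
      have "ennreal (real N * c) \<le> (\<integral>\<^sup>+x\<in>{a0<..<0}. (ennreal (\<tau> / 2) + ennreal (K / (2 * \<tau>)) * ennreal (jac (D\<Phi> (Complex x y)) * f (\<phi> (exp (Complex x y))))) \<partial>lborel)"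
        unfolding c_def f_def a0_def using good by (intro radial_crossing[OF h N r1 \<tau> ends[OF y]]) simp
      also have "\<dots> \<le> (\<integral>\<^sup>+x. ennreal (\<tau> / 2) * indicator {a0<..<0} x + ennreal (K / (2 * \<tau>)) * G0 (Complex x y) \<partial>lborel)"
      proof (rule nn_integral_mono_AE)
        show "AE x in lborel. (ennreal (\<tau> / 2) + ennreal (K / (2 * \<tau>)) * ennreal (jac (D\<Phi> (Complex x y)) * f (\<phi> (exp (Complex x y))))) * indicator {a0<..<0} x
           \<le> ennreal (\<tau> / 2) * indicator {a0<..<0} x + ennreal (K / (2 * \<tau>)) * G0 (Complex x y)"
          using elim
        proof eventually_elim
          case (elim x)
          show ?case
          proof (cases "x \<in> {a0<..<0}")
            case True
            then have S': "Complex x y \<in> S" using inR elim by (auto simp: S_def)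
            have "ennreal (jac (D\<Phi> (Complex x y)) * f (\<phi> (exp (Complex x y)))) \<le> ennreal (G (Complex x y))"
              using S' f0 by (intro ennreal_leI) (auto simp: G_def intro!: mult_right_mono)
            then have "ennreal (jac (D\<Phi> (Complex x y)) * f (\<phi> (exp (Complex x y)))) \<le> G0 (Complex x y)" using elim by simp
            then show ?thesis using True by (auto intro!: add_left_mono mult_left_mono)
          qed simp
        qed
      qed
      also have "\<dots> = ennreal (\<tau> / 2) * emeasure lborel {a0<..<0} + ennreal (K / (2 * \<tau>)) * (\<integral>\<^sup>+x. G0 (Complex x y) \<partial>lborel)"
        by (subst nn_integral_add) (auto simp: nn_integral_cmult_indicator nn_integral_cmult)
      also have "ennreal (\<tau> / 2) * emeasure lborel {a0<..<0} \<le> ennreal (\<tau> * h)"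
      proof -
        have "emeasure lborel {a0<..<0} = ennreal (- a0)" using a0 by simp
        moreover have "ennreal (\<tau> / 2) * ennreal (- a0) = ennreal (\<tau> / 2 * (- a0))"
          using a0 \<tau> by (intro ennreal_mult[symmetric]) auto
        ultimately have "ennreal (\<tau> / 2) * emeasure lborel {a0<..<0} = ennreal (\<tau> / 2 * (- a0))" by (simp only:)
        also have "\<dots> \<le> ennreal (\<tau> * h)"
          using mult_left_mono[OF a02, of "\<tau> / 2"] \<tau> by (intro ennreal_leI) simp
        finally show ?thesis .
      qed
      finally show ?thesis using True by (simp add: add_right_mono)
    qed simp
  qed
  have "ennreal (real N * c) * emeasure lborel {\<theta>1<..<\<theta>2} = (\<integral>\<^sup>+y. ennreal (real N * c) * indicator {\<theta>1<..<\<theta>2} y \<partial>lborel)"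
    by (simp add: nn_integral_cmult_indicator)
  also have "\<dots> \<le> (\<integral>\<^sup>+y. ennreal (\<tau> * h) * indicator {\<theta>1<..<\<theta>2} y + ennreal (K / (2 * \<tau>)) * (\<integral>\<^sup>+x. G0 (Complex x y) \<partial>lborel) \<partial>lborel)"
    using row by (rule nn_integral_mono_AE)
  also have "\<dots> = ennreal (\<tau> * h) * emeasure lborel {\<theta>1<..<\<theta>2} + ennreal (K / (2 * \<tau>)) * (\<integral>\<^sup>+y. \<integral>\<^sup>+x. G0 (Complex x y) \<partial>lborel \<partial>lborel)"
    by (subst nn_integral_add) (auto simp: nn_integral_cmult_indicator nn_integral_cmult)
  also have "(\<integral>\<^sup>+y. \<integral>\<^sup>+x. G0 (Complex x y) \<partial>lborel \<partial>lborel) = (\<integral>\<^sup>+p. G0 (?T p) \<partial>(lborel \<Otimes>\<^sub>M lborel))"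
    by (subst lborel.nn_integral_fst[symmetric]) auto
  also have "\<dots> = (\<integral>\<^sup>+z. G0 z \<partial>lborel)"
    by (subst distr_Complex[symmetric], subst nn_integral_distr) auto
  also have "ennreal (K / (2 * \<tau>)) * (\<integral>\<^sup>+z. G0 z \<partial>lborel) \<le> ennreal (K / (2 * \<tau>)) * ennreal (16 * real N)"
    by (intro mult_left_mono G0int) simp
  finally have "ennreal (real N * c) * ennreal (\<theta>2 - \<theta>1) \<le> ennreal (\<tau> * h) * ennreal (\<theta>2 - \<theta>1) + ennreal (K / (2 * \<tau>)) * ennreal (16 * real N)"
    using s by (simp add: add_left_mono)
  then have "real N * c * (\<theta>2 - \<theta>1) \<le> \<tau> * h * (\<theta>2 - \<theta>1) + K / (2 * \<tau>) * (16 * real N)"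
    using s c \<tau> h K_pos by (simp add: ennreal_mult[symmetric] ennreal_plus[symmetric] del: ennreal_plus)
  moreover have "\<tau> * h = real N * c / 2" using h by (simp add: \<tau>_def)
  moreover have "K / (2 * \<tau>) * (16 * real N) = 16 * K * h / c" using N c h by (simp add: \<tau>_def)
  ultimately have "real N * c * (\<theta>2 - \<theta>1) / 2 \<le> 16 * K * h / c" by simp
  then have "real N \<le> 32 * K / c\<^sup>2 * (h / (\<theta>2 - \<theta>1))" using c s by (simp add: field_simps power2_eq_square)
  then show ?thesis by (simp add: c_def)
qed

end

subsection \<open>Distortion of Carleson boxes\<close>

lemma cmod_cis_diff_le: "cmod (cis a - cis b) \<le> \<bar>a - b\<bar>"
  unfolding cmod_cis_diff using abs_sin_x_le_abs_x[of "(a - b) / 2"] by simp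

locale qc_curve = qc_disc \<phi> \<psi> \<Omega> L k + cu: sqs_curve g C C1 C2
  for \<phi> \<psi> \<Omega> L k g C C1 C2 +
  assumes g_eq: "\<And>t. g t = \<phi> (cis t)" and frontier_eq: "\<phi> ` sphere 0 1 = frontier \<Omega>"
begin

abbreviation "len \<equiv> cu.len"

lemma g_frontier: "g t \<in> frontier \<Omega>" using frontier_eq by (force simp: g_eq)

lemma frontier_g:
  assumes "w \<in> frontier \<Omega>" obtains t where "a \<le> t" "t < a + 2 * pi" "w = g t"
proof -
  have "w \<in> \<phi> ` (cis ` {a..<a + 2 * pi})" using assms by (simp only: cis_image_sphere frontier_eq)
  then show thesis using that by (auto simp: g_eq)
qed

lemma frontier_notin: "w \<in> frontier \<Omega> \<Longrightarrow> w \<notin> \<Omega>"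
  using op by (auto simp: frontier_def interior_open)

definition \<delta> :: "complex \<Rightarrow> real" where "\<delta> z = infdist (\<phi> z) (frontier \<Omega>)"

lemma \<delta>_pos: "z \<in> ball 0 1 \<Longrightarrow> 0 < \<delta> z"
  unfolding \<delta>_def using g_frontier in\<Omega>[of z] frontier_notin[of "\<phi> z"]
  by (intro infdist_pos_not_in_closed) auto

lemma \<delta>_ball: "z \<in> ball 0 1 \<Longrightarrow> ball (\<phi> z) (\<delta> z) \<subseteq> \<Omega>"
proof (rule ccontr)
  assume z: "z \<in> ball 0 1" and "\<not> ball (\<phi> z) (\<delta> z) \<subseteq> \<Omega>"
  then have "ball (\<phi> z) (\<delta> z) - \<Omega> \<noteq> {}" by blast
  moreover have "\<phi> z \<in> ball (\<phi> z) (\<delta> z) \<inter> \<Omega>" using \<delta>_pos[OF z] in\<Omega>[OF z] by simp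
  ultimately obtain w where "w \<in> ball (\<phi> z) (\<delta> z)" "w \<in> frontier \<Omega>"
    using connected_Int_frontier[OF connected_ball, of "\<phi> z" "\<delta> z" \<Omega>] by blast
  then show False using infdist_le[of w "frontier \<Omega>" "\<phi> z"] by (simp add: \<delta>_def)
qed

lemma \<delta>_continuous: "continuous_on (ball 0 1) \<delta>"
  unfolding \<delta>_def
  by (rule continuous_on_infdist[OF continuous_on_subset[OF cont]]) auto

lemma \<delta>_attained:
  obtains t where "a \<le> t" "t < a + 2 * pi" "\<delta> z = cmod (\<phi> z - g t)"
proof -
  obtain w where "w \<in> frontier \<Omega>" "\<delta> z = dist (\<phi> z) w"
    using infdist_attains_inf[of "frontier \<Omega>" "\<phi> z"] g_frontier unfolding \<delta>_def by auto
  moreover then obtain t where "a \<le> t" "t < a + 2 * pi" "w = g t" using frontier_g by blast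
  ultimately show thesis using that by (simp add: dist_norm)
qed

text \<open>Two points of height \<open>h\<close> whose angles differ by at most \<open>h\<close>
  have bounded hyperbolic distance, so the distances of their images to an omitted point are
  comparable. This transfers an assumption about one point to an arc above it.\<close>

lemma height_shift:
  assumes h: "0 < h" "h \<le> 1" and y: "\<bar>y - \<theta>\<bar> \<le> h" and w0: "w0 \<notin> \<Omega>"
  shows "cmod (\<phi> (of_real (1 - h) * cis y) - w0) \<le> cmod (\<phi> (of_real (1 - h) * cis \<theta>) - w0) * exp (12 * pi * L)"
proof -
  let ?z = "of_real (1 - h) * cis \<theta>" and ?w = "of_real (1 - h) * cis y"
  have "cmod (?w - ?z) = cmod (of_real (1 - h) * (cis y - cis \<theta>))" by (simp only: right_diff_distrib)
  also have "\<dots> = \<bar>1 - h\<bar> * cmod (cis y - cis \<theta>)" by (simp only: norm_mult norm_of_real)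
  also have "\<dots> \<le> 1 * h" using h y cmod_cis_diff_le[of y \<theta>] by (intro mult_mono) auto
  finally have "cmod (?w - ?z) \<le> h" by simp
  then have "12 * pi * L * cmod (?w - ?z) / h \<le> 12 * pi * L" using h Lpos by (simp add: field_simps)
  moreover have "cmod (\<phi> ?w - w0) \<le> cmod (\<phi> ?z - w0) * exp (12 * pi * L * cmod (?w - ?z) / h)"
  proof (rule image_dist_le[OF h(1) _ _ w0])
    show "?z \<in> cball 0 (1 - h)" "?w \<in> cball 0 (1 - h)" using h by (simp_all add: norm_mult del: of_real_diff)
  qed
  ultimately show ?thesis by (meson exp_le_cancel_iff mult_left_mono norm_ge_zero order_trans)
qed

text \<open>Suppose the image of a point is too close to its nearest boundary point g t0. Then the
  images of a whole arc at this height are close to g t0, while on a subarc of length h/2 the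
  boundary values stay away from it by chord-arc and doubling. This contradicts
  \<open>modulus_bound\<close>.\<close>

lemma height_lower:
  obtains c where "0 < c" "\<And>\<theta> h. 0 < h \<Longrightarrow> h \<le> 1/2 \<Longrightarrow> c * len (\<theta> - h) (\<theta> + h) \<le> \<delta> (of_real (1 - h) * cis \<theta>)"
proof -
  \<comment> \<open>The ratio 8 compares {\<theta> - 2 * h..\<theta> + 2 * h} with its subintervals
    of length h/2.\<close>
  obtain D where D: "0 < D" "\<And>a b c d. a \<le> c \<Longrightarrow> c < d \<Longrightarrow> d \<le> b \<Longrightarrow> b < a + 2 * pi \<Longrightarrow> b - a \<le> 8 * (d - c) \<Longrightarrow> len a b \<le> D * len c d"
    by (rule cu.doubling[of 8]) (rule that)
  define E where "E = D * (\<bar>C\<bar> + 1)"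
  have E: "0 < E" using D by (simp add: E_def)
  \<comment> \<open>Exceeds the value of \<open>modulus_bound\<close> for a subarc of length h/2,
    namely 32 * K / (ln 2)^2 times 2.\<close>
  define N where "N = Suc (nat \<lceil>64 * K / (ln 2)\<^sup>2\<rceil>)"
  have N: "64 * K / (ln 2)\<^sup>2 < real N" unfolding N_def by linarith
  define c where "c = 1 / (E * 2 ^ (N + 2) * exp (12 * pi * L))"
  show thesis
  proof
    show "0 < c" using E by (simp add: c_def)
    fix \<theta> h :: real assume h: "0 < h" "h \<le> 1/2"
    let ?\<zeta> = "of_real (1 - h) * cis \<theta>"
    have \<zeta>: "?\<zeta> \<in> ball 0 1" using h by (simp add: norm_mult del: of_real_diff)
    define lm where "lm = len (\<theta> - h) (\<theta> + h)"
    have lm: "0 \<le> lm" by (simp add: lm_def cu.len_nonneg)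
    obtain t0 where t0: "\<theta> - pi \<le> t0" "t0 < \<theta> - pi + 2 * pi" "\<delta> ?\<zeta> = cmod (\<phi> ?\<zeta> - g t0)" by (rule \<delta>_attained)
    have w0: "g t0 \<notin> \<Omega>" using g_frontier frontier_notin by blast
    have big: "lm \<le> D * len p q" if "\<theta> - 2 * h \<le> p" "q \<le> \<theta> + 2 * h" "q - p = h / 2" for p q
    proof -
      have "lm \<le> len (\<theta> - 2 * h) (\<theta> + 2 * h)" unfolding lm_def using h by (intro cu.len_mono) auto
      also have "\<dots> \<le> D * len p q" using that h pi_gt3 by (intro D(2)) auto
      finally show ?thesis .
    qed
    \<comment> \<open>Chord-arc controls only the shorter of the two arcs between y and t0, so both
      of them must be shown to be long.\<close>
    have chord: "lm \<le> E * cmod (g y - g t0)" if m: "lm \<le> D * u" "lm \<le> D * v" "min u v \<le> \<bar>C\<bar> * cmod (g y - g t0)" for y u v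
    proof -
      have "lm \<le> D * min u v" using m by (auto simp: min_def)
      also have "\<dots> \<le> D * (\<bar>C\<bar> * cmod (g y - g t0))" using m D by (intro mult_left_mono) auto
      also have "\<dots> \<le> E * cmod (g y - g t0)" unfolding E_def mult.assoc using D by (intro mult_left_mono mult_right_mono) auto
      finally show ?thesis .
    qed
    have pi3: "3 < pi" by (rule pi_gt3)
    \<comment> \<open>The subarc is taken on the side of \<theta> away from t0. Then the arc towards
      t0 contains an interval of length h/2 on one side of y, and the arc around the circle contains
      one on the other side.\<close>
    obtain \<theta>1 where \<theta>1: "\<And>y. \<theta>1 < y \<Longrightarrow> y < \<theta>1 + h / 2 \<Longrightarrow> \<bar>y - \<theta>\<bar> \<le> h \<and> lm \<le> E * cmod (g y - g t0)"
    proof (cases "\<theta> \<le> t0")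
      case True
      have "\<bar>y - \<theta>\<bar> \<le> h \<and> lm \<le> E * cmod (g y - g t0)" if y: "\<theta> - h < y" "y < \<theta> - h + h / 2" for y
      proof
        have m: "min (len y t0) (len t0 (y + 2 * pi)) \<le> \<bar>C\<bar> * cmod (g t0 - g y)"
          using y True t0 h pi3 by (intro cu.len_le_chord) auto
        have 1: "lm \<le> D * len y t0"
        proof -
          have "lm \<le> D * len y (y + h / 2)" using y h by (intro big) auto
          also have "\<dots> \<le> D * len y t0" using y h True D by (intro mult_left_mono cu.len_mono) auto
          finally show ?thesis .
        qed
        have 2: "lm \<le> D * len t0 (y + 2 * pi)"
        proof -
          have "lm \<le> D * len (y - h / 2) y" using y h by (intro big) auto
          also have "len (y - h / 2) y = len (y - h / 2 + 2 * pi) (y + 2 * pi)" by (rule cu.len_shift[symmetric])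
          also have "D * \<dots> \<le> D * len t0 (y + 2 * pi)" using y h t0 D pi3 by (intro mult_left_mono cu.len_mono) auto
          finally show ?thesis .
        qed
        show "lm \<le> E * cmod (g y - g t0)" by (rule chord[OF 1 2]) (use m in \<open>simp add: norm_minus_commute\<close>)
      qed (use y h in auto)
      then show thesis by (rule that)
    next
      case False
      have "\<bar>y - \<theta>\<bar> \<le> h \<and> lm \<le> E * cmod (g y - g t0)" if y: "\<theta> + h / 2 < y" "y < \<theta> + h / 2 + h / 2" for y
      proof
        have m: "min (len t0 y) (len y (t0 + 2 * pi)) \<le> \<bar>C\<bar> * cmod (g y - g t0)"
          using y False t0 h pi3 by (intro cu.len_le_chord) auto
        have 1: "lm \<le> D * len t0 y"
        proof -
          have "lm \<le> D * len (y - h / 2) y" using y h by (intro big) auto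
          also have "\<dots> \<le> D * len t0 y" using y h False D by (intro mult_left_mono cu.len_mono) auto
          finally show ?thesis .
        qed
        have 2: "lm \<le> D * len y (t0 + 2 * pi)"
        proof -
          have "lm \<le> D * len y (y + h / 2)" using y h by (intro big) auto
          also have "\<dots> \<le> D * len y (t0 + 2 * pi)" using y h t0 D pi3 by (intro mult_left_mono cu.len_mono) auto
          finally show ?thesis .
        qed
        show "lm \<le> E * cmod (g y - g t0)" by (rule chord[OF 1 2 m])
      qed (use y h in auto)
      then show thesis by (rule that)
    qed
    show "c * len (\<theta> - h) (\<theta> + h) \<le> \<delta> ?\<zeta>"
    proof (rule ccontr)
      assume neg: "\<not> c * len (\<theta> - h) (\<theta> + h) \<le> \<delta> ?\<zeta>"
      define r1 where "r1 = \<delta> ?\<zeta> * exp (12 * pi * L)"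
      have r1: "0 < r1" using \<delta>_pos[OF \<zeta>] by (simp add: r1_def)
      have "\<delta> ?\<zeta> < c * lm" using neg by (simp add: lm_def)
      then have "2 ^ (N + 2) * r1 \<le> 2 ^ (N + 2) * (c * lm * exp (12 * pi * L))" by (simp add: r1_def)
      also have "\<dots> = lm / E" using E by (simp add: c_def)
      finally have r2: "2 ^ (N + 2) * r1 \<le> lm / E" .
      have "real N \<le> 32 * K / (ln 2)\<^sup>2 * (h / (\<theta>1 + h / 2 - \<theta>1))"
      proof (rule modulus_bound[OF h _ _ r1])
        fix y assume y: "\<theta>1 < y" "y < \<theta>1 + h / 2"
        have "cmod (\<phi> (of_real (1 - h) * cis y) - g t0) \<le> r1"
          unfolding r1_def t0(3) using \<theta>1[OF y] h by (intro height_shift w0) auto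
        moreover have "2 ^ (N + 2) * r1 \<le> cmod (\<phi> (cis y) - g t0)"
        proof -
          have "lm / E \<le> cmod (g y - g t0)" using \<theta>1[OF y] E by (simp add: field_simps)
          then show ?thesis using r2 by (simp add: g_eq)
        qed
        ultimately show "cmod (\<phi> (of_real (1 - h) * cis y) - g t0) \<le> r1 \<and> 2 ^ (N + 2) * r1 \<le> cmod (\<phi> (cis y) - g t0) \<or>
           2 ^ (N + 2) * r1 \<le> cmod (\<phi> (of_real (1 - h) * cis y) - g t0) \<and> cmod (\<phi> (cis y) - g t0) \<le> r1" by blast
      qed (use h pi3 in auto)
      also have "\<dots> = 64 * K / (ln 2)\<^sup>2" using h by simp
      finally show False using N by simp
    qed
  qed
qed

text \<open>The opposite use of \<open>modulus_bound\<close>: boundary values over the arc lie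
  within its length of g \<theta>, so if the image of the inner point were far away, so would be the
  images of all points of that height over the arc.\<close>

lemma height_upper:
  obtains c where "0 < c" "\<And>\<theta> h. 0 < h \<Longrightarrow> h \<le> 1/2 \<Longrightarrow> cmod (\<phi> (of_real (1 - h) * cis \<theta>) - g \<theta>) \<le> c * len (\<theta> - h) (\<theta> + h)"
proof -
  define N where "N = Suc (nat \<lceil>64 * K / (ln 2)\<^sup>2\<rceil>)"
  have N: "64 * K / (ln 2)\<^sup>2 < real N" unfolding N_def by linarith
  define c where "c = 2 ^ (N + 2) * exp (12 * pi * L)"
  show thesis
  proof
    show "0 < c" by (simp add: c_def)
    fix \<theta> h :: real assume h: "0 < h" "h \<le> 1/2"
    let ?\<zeta> = "of_real (1 - h) * cis \<theta>"
    define r1 where "r1 = len (\<theta> - h) (\<theta> + h)"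
    have r1: "0 < r1" unfolding r1_def using h pi_gt3 by (intro cu.len_pos) auto
    have w0: "g \<theta> \<notin> \<Omega>" using g_frontier frontier_notin by blast
    show "cmod (\<phi> ?\<zeta> - g \<theta>) \<le> c * len (\<theta> - h) (\<theta> + h)"
    proof (rule ccontr)
      assume "\<not> ?thesis"
      then have neg: "2 ^ (N + 2) * r1 * exp (12 * pi * L) \<le> cmod (\<phi> ?\<zeta> - g \<theta>)" by (simp add: c_def r1_def mult_ac)
      have "real N \<le> 32 * K / (ln 2)\<^sup>2 * (h / (\<theta> + h - (\<theta> - h)))"
      proof (rule modulus_bound[OF h _ _ r1])
        fix y assume y: "\<theta> - h < y" "y < \<theta> + h"
        have "cmod (\<phi> (cis y) - g \<theta>) \<le> r1"
        proof (cases "\<theta> \<le> y")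
          case True
          have "cmod (g y - g \<theta>) \<le> len \<theta> y" by (rule cu.chord_le_len[OF True])
          also have "\<dots> \<le> r1" unfolding r1_def using y True h by (intro cu.len_mono) auto
          finally show ?thesis by (simp add: g_eq)
        next
          case False
          have "cmod (g \<theta> - g y) \<le> len y \<theta>" using False by (intro cu.chord_le_len) simp
          also have "\<dots> \<le> r1" unfolding r1_def using y False h by (intro cu.len_mono) auto
          finally show ?thesis by (simp add: g_eq norm_minus_commute)
        qed
        moreover have "2 ^ (N + 2) * r1 \<le> cmod (\<phi> (of_real (1 - h) * cis y) - g \<theta>)"
        proof -
          have "cmod (\<phi> ?\<zeta> - g \<theta>) \<le> cmod (\<phi> (of_real (1 - h) * cis y) - g \<theta>) * exp (12 * pi * L)"
            using y h by (intro height_shift w0) auto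
          with neg have "2 ^ (N + 2) * r1 * exp (12 * pi * L) \<le> cmod (\<phi> (of_real (1 - h) * cis y) - g \<theta>) * exp (12 * pi * L)" by (rule order_trans)
          then show ?thesis by (rule mult_right_le_imp_le) simp
        qed
        ultimately show "cmod (\<phi> (of_real (1 - h) * cis y) - g \<theta>) \<le> r1 \<and> 2 ^ (N + 2) * r1 \<le> cmod (\<phi> (cis y) - g \<theta>) \<or>
           2 ^ (N + 2) * r1 \<le> cmod (\<phi> (of_real (1 - h) * cis y) - g \<theta>) \<and> cmod (\<phi> (cis y) - g \<theta>) \<le> r1" by blast
      qed (use h pi_gt3 in auto)
      also have "\<dots> = 16 * K / (ln 2)\<^sup>2" using h by simp
      also have "\<dots> \<le> 64 * K / (ln 2)\<^sup>2" using K_pos by (intro divide_right_mono) auto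
      finally show False using N by simp
    qed
  qed
qed

text \<open>The interval of radius \<open>h\<close> about \<theta> lies in {a - l..a + 2 * l}, three
  times as long as the base, so doubling returns to the base; the boundary chord from g \<theta> to
  g a is added.\<close>

lemma box_upper:
  obtains c where "0 < c" "\<And>a l h \<theta>. 0 < h \<Longrightarrow> h \<le> l \<Longrightarrow> l \<le> 1/2 \<Longrightarrow> a \<le> \<theta> \<Longrightarrow> \<theta> \<le> a + l \<Longrightarrow>
    cmod (\<phi> (of_real (1 - h) * cis \<theta>) - g a) \<le> c * len a (a + l)"
proof -
  obtain c where c: "0 < c" "\<And>\<theta> h. 0 < h \<Longrightarrow> h \<le> 1/2 \<Longrightarrow> cmod (\<phi> (of_real (1 - h) * cis \<theta>) - g \<theta>) \<le> c * len (\<theta> - h) (\<theta> + h)"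
    by (rule height_upper) (rule that)
  obtain D where D: "0 < D" "\<And>a b c d. a \<le> c \<Longrightarrow> c < d \<Longrightarrow> d \<le> b \<Longrightarrow> b < a + 2 * pi \<Longrightarrow> b - a \<le> 3 * (d - c) \<Longrightarrow> len a b \<le> D * len c d"
    by (rule cu.doubling[of 3]) (rule that)
  show thesis
  proof
    show "0 < (c + 1) * D" using c D by simp
    fix a l h \<theta> :: real assume h: "0 < h" "h \<le> l" "l \<le> 1/2" and \<theta>: "a \<le> \<theta>" "\<theta> \<le> a + l"
    have 1: "cmod (\<phi> (of_real (1 - h) * cis \<theta>) - g \<theta>) \<le> c * len (\<theta> - h) (\<theta> + h)" using h by (intro c(2)) auto
    have "cmod (\<phi> (of_real (1 - h) * cis \<theta>) - g a) \<le> cmod (\<phi> (of_real (1 - h) * cis \<theta>) - g \<theta>) + cmod (g \<theta> - g a)"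
      by (metis diff_add_cancel add_diff_eq norm_triangle_ineq)
    also have "\<dots> \<le> c * len (\<theta> - h) (\<theta> + h) + len a \<theta>"
      by (rule add_mono[OF 1 cu.chord_le_len[OF \<theta>(1)]])
    also have "\<dots> \<le> c * len (a - l) (a + 2 * l) + len (a - l) (a + 2 * l)"
    proof (rule add_mono)
      show "c * len (\<theta> - h) (\<theta> + h) \<le> c * len (a - l) (a + 2 * l)"
        using h \<theta> c by (intro mult_left_mono cu.len_mono) auto
      show "len a \<theta> \<le> len (a - l) (a + 2 * l)" using h \<theta> by (intro cu.len_mono) auto
    qed
    also have "\<dots> = (c + 1) * len (a - l) (a + 2 * l)" by (simp add: algebra_simps)
    also have "\<dots> \<le> (c + 1) * (D * len a (a + l))"
      using h c pi_gt3 by (intro mult_left_mono D(2)) auto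
    finally show "cmod (\<phi> (of_real (1 - h) * cis \<theta>) - g a) \<le> (c + 1) * D * len a (a + l)" by (simp add: mult.assoc)
  qed
qed

text \<open>One of the two intervals of length l/2 adjacent to \<theta> lies in the base, and both
  lie within distance \<open>h\<close> of \<theta>; doubling with ratio 2 compares it with the
  base.\<close>

lemma box_lower:
  obtains c where "0 < c" "\<And>a l h \<theta>. 0 < l \<Longrightarrow> l / 2 \<le> h \<Longrightarrow> h \<le> l \<Longrightarrow> l \<le> 1/2 \<Longrightarrow> a \<le> \<theta> \<Longrightarrow> \<theta> \<le> a + l \<Longrightarrow>
    c * len a (a + l) \<le> \<delta> (of_real (1 - h) * cis \<theta>)"
proof -
  obtain c where c: "0 < c" "\<And>\<theta> h. 0 < h \<Longrightarrow> h \<le> 1/2 \<Longrightarrow> c * len (\<theta> - h) (\<theta> + h) \<le> \<delta> (of_real (1 - h) * cis \<theta>)"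
    by (rule height_lower) (rule that)
  obtain D where D: "0 < D" "\<And>a b c d. a \<le> c \<Longrightarrow> c < d \<Longrightarrow> d \<le> b \<Longrightarrow> b < a + 2 * pi \<Longrightarrow> b - a \<le> 2 * (d - c) \<Longrightarrow> len a b \<le> D * len c d"
    by (rule cu.doubling[of 2]) (rule that)
  show thesis
  proof
    show "0 < c / D" using c D by simp
    fix a l h \<theta> :: real assume h: "0 < l" "l / 2 \<le> h" "h \<le> l" "l \<le> 1/2" and \<theta>: "a \<le> \<theta>" "\<theta> \<le> a + l"
    have "len a (a + l) \<le> D * len (\<theta> - h) (\<theta> + h)"
    proof (cases "\<theta> \<le> a + l / 2")
      case True
      have "len a (a + l) \<le> D * len \<theta> (\<theta> + l / 2)" using True h \<theta> pi_gt3 by (intro D(2)) auto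
      also have "\<dots> \<le> D * len (\<theta> - h) (\<theta> + h)" using h D by (intro mult_left_mono cu.len_mono) auto
      finally show ?thesis .
    next
      case False
      have "len a (a + l) \<le> D * len (\<theta> - l / 2) \<theta>" using False h \<theta> pi_gt3 by (intro D(2)) auto
      also have "\<dots> \<le> D * len (\<theta> - h) (\<theta> + h)" using h D by (intro mult_left_mono cu.len_mono) auto
      finally show ?thesis .
    qed
    then have "c / D * len a (a + l) \<le> c / D * (D * len (\<theta> - h) (\<theta> + h))" using c D by (intro mult_left_mono) auto
    also have "\<dots> = c * len (\<theta> - h) (\<theta> + h)" using D by simp
    also have "\<dots> \<le> \<delta> (of_real (1 - h) * cis \<theta>)" using h by (intro c(2)) auto
    finally show "c / D * len a (a + l) \<le> \<delta> (of_real (1 - h) * cis \<theta>)" .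
  qed
qed

end

section \<open>Lower integrals of functions not known to be measurable\<close>

lemma nn_integral_measurable_minorant:
  obtains h where "h \<in> borel_measurable M" "h \<le> f" "integral\<^sup>N M h = integral\<^sup>N M f"
proof -
  let ?A = "{g. simple_function M g \<and> g \<le> f}"
  have "(\<lambda>_. 0) \<in> ?A" by (auto simp: le_fun_def)
  then have "integral\<^sup>S M ` ?A \<noteq> {}" by blast
  \<comment> \<open>The integral is a supremum over simple minorants. Countably many of them already
    exhaust it, and their pointwise supremum is a measurable minorant with the same
    integral.\<close>
  from ennreal_Sup_countable_SUP[OF this] obtain s :: "nat \<Rightarrow> ennreal" where s: "range s \<subseteq> integral\<^sup>S M ` ?A" "Sup (integral\<^sup>S M ` ?A) = (SUP i. s i)" by blast
  have "\<exists>g\<in>?A. s i = integral\<^sup>S M g" for i using s(1) by blast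
  then obtain g where g: "\<And>i. simple_function M (g i)" "\<And>i. g i \<le> f" "\<And>i. s i = integral\<^sup>S M (g i)" by (metis (no_types, lifting) mem_Collect_eq)
  define h where "h x = (SUP i. g i x)" for x
  have hm: "h \<in> borel_measurable M" unfolding h_def
    by (intro borel_measurable_SUP) (auto intro: borel_measurable_simple_function g)
  have hf: "h \<le> f" unfolding h_def le_fun_def using g(2) by (auto intro!: SUP_least simp: le_fun_def)
  have "integral\<^sup>N M f = (SUP i. s i)" using s(2) by (simp add: nn_integral_def)
  also have "\<dots> \<le> integral\<^sup>N M h"
  proof (rule SUP_least)
    fix i
    have "s i = integral\<^sup>N M (g i)" using g by (simp add: nn_integral_eq_simple_integral)
    also have "\<dots> \<le> integral\<^sup>N M h" unfolding h_def by (intro nn_integral_mono SUP_upper) auto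
    finally show "s i \<le> integral\<^sup>N M h" .
  qed
  finally have "integral\<^sup>N M f \<le> integral\<^sup>N M h" .
  moreover have "integral\<^sup>N M h \<le> integral\<^sup>N M f" using hf by (intro nn_integral_mono) (auto simp: le_fun_def)
  ultimately show thesis using that hm hf by (metis antisym)
qed

text \<open>For nonmeasurable \<open>f\<close> the integral is a lower integral, which is still countably additive
  in the domain, so \<open>density\<close> does not degenerate.\<close>
lemma emeasure_density_lower_integral:
  fixes f :: "'a \<Rightarrow> ennreal"
  assumes A: "A \<in> sets M"
  shows "emeasure (density M f) A = (\<integral>\<^sup>+x\<in>A. f x \<partial>M)"
proof -
  let ?\<mu> = "\<lambda>A. \<integral>\<^sup>+x\<in>A. f x \<partial>M"
  have ca: "countably_additive (sets M) ?\<mu>"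
    unfolding countably_additive_def
  proof (intro allI impI)
    fix B :: "nat \<Rightarrow> 'a set" assume B: "range B \<subseteq> sets M" "disjoint_family B" "(\<Union>i. B i) \<in> sets M"
    have Bm: "B i \<in> sets M" for i using B(1) by blast
    have ind: "(\<Sum>i. c * indicator (B i) x) = c * indicator (\<Union>i. B i) x" for c :: ennreal and x
      using suminf_indicator[OF B(2), of x] by (simp add: ennreal_suminf_cmult)
    show "(\<Sum>i. ?\<mu> (B i)) = ?\<mu> (\<Union>i. B i)"
    proof (rule antisym)
      have "\<exists>h. h \<in> borel_measurable M \<and> h \<le> (\<lambda>x. f x * indicator (B i) x) \<and> integral\<^sup>N M h = ?\<mu> (B i)" for i
        by (rule nn_integral_measurable_minorant[of M "\<lambda>x. f x * indicator (B i) x"]) blast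
      then obtain h where h: "\<And>i. h i \<in> borel_measurable M" "\<And>i. h i \<le> (\<lambda>x. f x * indicator (B i) x)" "\<And>i. integral\<^sup>N M (h i) = ?\<mu> (B i)"
        by metis
      have "(\<Sum>i. ?\<mu> (B i)) = (\<integral>\<^sup>+x. (\<Sum>i. h i x) \<partial>M)" unfolding h(3)[symmetric] by (rule nn_integral_suminf[symmetric]) (rule h(1))
      also have "\<dots> \<le> ?\<mu> (\<Union>i. B i)"
      proof (rule nn_integral_mono)
        fix x
        have "(\<Sum>i. h i x) \<le> (\<Sum>i. f x * indicator (B i) x)" using h(2) by (intro suminf_le) (auto simp: le_fun_def)
        then show "(\<Sum>i. h i x) \<le> f x * indicator (\<Union>i. B i) x" by (simp only: ind)
      qed
      finally show "(\<Sum>i. ?\<mu> (B i)) \<le> ?\<mu> (\<Union>i. B i)" .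
      obtain h where h: "h \<in> borel_measurable M" "h \<le> (\<lambda>x. f x * indicator (\<Union>i. B i) x)" "integral\<^sup>N M h = ?\<mu> (\<Union>i. B i)"
        by (rule nn_integral_measurable_minorant)
      have h0: "h x = h x * indicator (\<Union>i. B i) x" for x
      proof (cases "x \<in> (\<Union>i. B i)")
        case False
        have "h x \<le> f x * indicator (\<Union>i. B i) x" using h(2) by (simp add: le_fun_def)
        then show ?thesis using False by simp
      qed simp
      have "?\<mu> (\<Union>i. B i) = (\<integral>\<^sup>+x. (\<Sum>i. h x * indicator (B i) x) \<partial>M)"
        unfolding h(3)[symmetric] ind using h0 by simp
      also have "\<dots> = (\<Sum>i. \<integral>\<^sup>+x. h x * indicator (B i) x \<partial>M)"
        using h(1) Bm by (intro nn_integral_suminf borel_measurable_times_ennreal borel_measurable_indicator) auto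
      also have "\<dots> \<le> (\<Sum>i. ?\<mu> (B i))"
      proof (intro suminf_le nn_integral_mono)
        fix i x
        have "h x \<le> f x * indicator (\<Union>i. B i) x" using h(2) by (simp add: le_fun_def)
        moreover have "x \<in> (\<Union>i. B i)" if "x \<in> B i" using that by blast
        ultimately show "h x * indicator (B i) x \<le> f x * indicator (B i) x" by (cases "x \<in> B i") simp_all
      qed simp_all
      finally show "?\<mu> (\<Union>i. B i) \<le> (\<Sum>i. ?\<mu> (B i))" .
    qed
  qed
  show ?thesis unfolding density_def
    by (rule emeasure_measure_of_sigma[OF sets.sigma_algebra_axioms _ ca A]) (simp add: positive_def)
qed

lemma nn_integral_Un_le:
  assumes "A \<in> sets M" "B \<in> sets M"
  shows "(\<integral>\<^sup>+x\<in>A \<union> B. f x \<partial>M) \<le> (\<integral>\<^sup>+x\<in>A. f x \<partial>M) + (\<integral>\<^sup>+x\<in>B. f x \<partial>M)"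
  using emeasure_subadditive[of A "density M f" B] assms by (simp add: emeasure_density_lower_integral)

lemma nn_integral_UN_le:
  assumes "finite I" "\<And>i. i \<in> I \<Longrightarrow> A i \<in> sets M"
  shows "(\<integral>\<^sup>+x\<in>(\<Union>i\<in>I. A i). f x \<partial>M) \<le> (\<Sum>i\<in>I. \<integral>\<^sup>+x\<in>A i. f x \<partial>M)"
  using emeasure_subadditive_finite[of I A "density M f"] assms sets.finite_UN[of I A M]
  by (simp add: emeasure_density_lower_integral image_subset_iff)

lemma nn_integral_disjoint_Un:
  assumes "A \<in> sets M" "B \<in> sets M" "A \<inter> B = {}"
  shows "(\<integral>\<^sup>+x\<in>A \<union> B. f x \<partial>M) = (\<integral>\<^sup>+x\<in>A. f x \<partial>M) + (\<integral>\<^sup>+x\<in>B. f x \<partial>M)"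
  using plus_emeasure[of A "density M f" B] assms by (simp add: emeasure_density_lower_integral)

lemma nn_integral_incseq_UN:
  assumes "\<And>n. A n \<in> sets M" "incseq A"
  shows "(\<integral>\<^sup>+x\<in>(\<Union>n. A n). f x \<partial>M) = (SUP n. \<integral>\<^sup>+x\<in>A n. f x \<partial>M)"
  using SUP_emeasure_incseq[of A "density M f"] assms
  by (simp add: emeasure_density_lower_integral image_subset_iff)

section \<open>Polar sectors of the disc\<close>

lemma sin_ge_half: "0 \<le> x \<Longrightarrow> x \<le> pi / 2 \<Longrightarrow> x / 2 \<le> sin x"
proof -
  assume x: "0 \<le> x" "x \<le> pi / 2"
  show ?thesis
  \<comment> \<open>Up to pi/3 the derivative cos is at least 1/2; beyond it sin x \<ge> sqrt 3 / 2,
    and x \<le> 8/5 \<le> sqrt 3 is enough.\<close>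
  proof (cases "x \<le> pi / 3")
    case True
    have "sin 0 - 0 / 2 \<le> sin x - x / 2"
    proof (rule DERIV_nonneg_imp_nondecreasing[OF x(1)])
      fix t assume t: "0 \<le> t" "t \<le> x"
      have "cos (pi / 3) \<le> cos t" using t True by (intro cos_monotone_0_pi_le) auto
      then show "\<exists>y. ((\<lambda>x. sin x - x / 2) has_real_derivative y) (at t) \<and> 0 \<le> y"
        by (intro exI[of _ "cos t - 1/2"]) (auto intro!: derivative_eq_intros simp: cos_60)
    qed
    then show ?thesis by simp
  next
    case False
    have "sin (pi / 3) \<le> sin x" using False x by (intro sin_monotone_2pi_le) auto
    moreover have "sin (pi / 3) = sqrt 3 / 2" by (rule sin_60)
    moreover have "x \<le> 8 / 5" using x pi_approx by simp
    moreover have "(8::real) / 5 \<le> sqrt 3" by (rule real_le_rsqrt) (simp add: power2_eq_square)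
    ultimately show ?thesis by simp
  qed
qed

lemma cmod_cis_diff_ge: "\<bar>a - b\<bar> \<le> pi \<Longrightarrow> \<bar>a - b\<bar> / 2 \<le> cmod (cis a - cis b)"
proof -
  assume ab: "\<bar>a - b\<bar> \<le> pi"
  have "cmod (cis a - cis b) = 2 * \<bar>sin ((a - b) / 2)\<bar>" by (rule cmod_cis_diff)
  moreover have "\<bar>a - b\<bar> / 2 = (a - b) / 2 \<or> \<bar>a - b\<bar> / 2 = - ((a - b) / 2)" by linarith
  then have "\<bar>sin ((a - b) / 2)\<bar> = \<bar>sin (\<bar>a - b\<bar> / 2)\<bar>"
  proof
    assume "\<bar>a - b\<bar> / 2 = - ((a - b) / 2)"
    then show ?thesis by (simp only: sin_minus abs_minus_cancel)
  qed (simp only:)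
  moreover have "\<bar>a - b\<bar> / 2 / 2 \<le> sin (\<bar>a - b\<bar> / 2)" by (rule sin_ge_half) (use ab in auto)
  ultimately show ?thesis by linarith
qed

text \<open>For p = 0 and q = l this is the Carleson box over the arc, for p = l/2 its top half.
  Angles and heights are half-open so that a box is the disjoint union of its top half and its two
  child boxes.\<close>

definition sector :: "real \<Rightarrow> real \<Rightarrow> real \<Rightarrow> real \<Rightarrow> complex set" where
  "sector a l p q = {of_real (1 - h) * cis \<theta> | h \<theta>. a \<le> \<theta> \<and> \<theta> < a + l \<and> p < h \<and> h \<le> q}"

text \<open>A sector is the image under exp of a rectangle in logarithmic coordinates.\<close>

lemma sector_lebesgue:
  assumes "0 \<le> p" "p \<le> q" "q < 1" shows "sector a l p q \<in> sets lebesgue"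
proof -
  let ?R = "{z. ln (1 - q) \<le> Re z \<and> Re z < ln (1 - p) \<and> a \<le> Im z \<and> Im z < a + l}"
  have "sector a l p q = exp ` ?R"
  proof (intro equalityI subsetI)
    fix z assume "z \<in> sector a l p q"
    then obtain h \<theta> where z: "z = of_real (1 - h) * cis \<theta>" "a \<le> \<theta>" "\<theta> < a + l" "p < h" "h \<le> q" by (auto simp: sector_def)
    have "z = exp (Complex (ln (1 - h)) \<theta>)" using z assms by (simp add: exp_eq_polar)
    moreover have "Complex (ln (1 - h)) \<theta> \<in> ?R" using z assms by simp
    ultimately show "z \<in> exp ` ?R" by blast
  next
    fix z assume "z \<in> exp ` ?R"
    then obtain w where w: "z = exp w" "w \<in> ?R" by blast
    have "exp (ln (1 - q)) \<le> exp (Re w)" "exp (Re w) < exp (ln (1 - p))" using w by simp_all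
    then have "p < 1 - exp (Re w)" "1 - exp (Re w) \<le> q" using assms by simp_all
    moreover have "z = of_real (1 - (1 - exp (Re w))) * cis (Im w)" using w by (simp add: exp_eq_polar[of w])
    moreover have "a \<le> Im w" "Im w < a + l" using w by simp_all
    ultimately show "z \<in> sector a l p q" unfolding sector_def by blast
  qed
  moreover have "exp ` ?R \<in> sets lebesgue"
  proof (rule differentiable_image_in_sets_lebesgue)
    have "?R = (Re -` {ln (1 - q)..<ln (1 - p)}) \<inter> (Im -` {a..<a + l})" by auto
    also have "\<dots> \<in> sets borel"
      using measurable_sets[of Re borel borel "{ln (1 - q)..<ln (1 - p)}"] measurable_sets[of Im borel borel "{a..<a + l}"]
      by (auto intro!: borel_measurable_continuous_onI continuous_intros)
    finally show "?R \<in> sets lebesgue" by simp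
    show "exp differentiable_on ?R"
      by (meson DERIV_exp differentiable_at_imp_differentiable_on differentiable_def has_field_derivative_def)
  qed simp
  ultimately show ?thesis by simp
qed

lemma sector_split:
  assumes "p \<le> m" "m \<le> q" "0 \<le> l"
  shows "sector a l p q = sector a l m q \<union> (sector a (l/2) p m \<union> sector (a + l/2) (l/2) p m)"
proof (intro equalityI subsetI)
  fix z assume "z \<in> sector a l p q"
  then obtain h \<theta> where z: "z = of_real (1 - h) * cis \<theta>" "a \<le> \<theta>" "\<theta> < a + l" "p < h" "h \<le> q" by (auto simp: sector_def)
  consider "m < h" | "h \<le> m" "\<theta> < a + l/2" | "h \<le> m" "a + l/2 \<le> \<theta>" by linarith
  then show "z \<in> sector a l m q \<union> (sector a (l/2) p m \<union> sector (a + l/2) (l/2) p m)"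
  proof cases
    case 1 then have "z \<in> sector a l m q" unfolding sector_def using z by blast
    then show ?thesis by blast
  next
    case 2 then have "z \<in> sector a (l/2) p m" unfolding sector_def using z by blast
    then show ?thesis by blast
  next
    case 3
    then have "\<theta> < a + l/2 + l/2" using z by simp
    then have "z \<in> sector (a + l/2) (l/2) p m" unfolding sector_def using z 3 by blast
    then show ?thesis by blast
  qed
next
  fix z assume "z \<in> sector a l m q \<union> (sector a (l/2) p m \<union> sector (a + l/2) (l/2) p m)"
  then obtain h \<theta> where "z = of_real (1 - h) * cis \<theta>" "a \<le> \<theta>" "\<theta> < a + l" "p < h" "h \<le> q"
    using assms unfolding sector_def by fastforce
  then show "z \<in> sector a l p q" unfolding sector_def by blast
qed

lemma sector_height: "z \<in> sector a l p q \<Longrightarrow> q < 1 \<Longrightarrow> p < 1 - cmod z \<and> 1 - cmod z \<le> q"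
  by (auto simp: sector_def norm_mult simp del: of_real_diff)

lemma sector_disjoint_height: "q \<le> p' \<Longrightarrow> q' < 1 \<Longrightarrow> sector a l p q \<inter> sector a' l' p' q' = {}"
proof (rule ccontr)
  assume q: "q \<le> p'" "q' < 1" and "sector a l p q \<inter> sector a' l' p' q' \<noteq> {}"
  then obtain z where z: "z \<in> sector a l p q" "z \<in> sector a' l' p' q'" by blast
  have "p' < q'" using sector_height[OF z(2) q(2)] by simp
  then have "q < 1" using q by simp
  then show False using sector_height[OF z(1)] sector_height[OF z(2) q(2)] q by simp
qed

lemma sector_disjoint_angle:
  assumes "0 \<le> l" "2 * l \<le> 2 * pi" "q < 1"
  shows "sector a l p q \<inter> sector (a + l) l p q = {}"
proof (rule ccontr)
  assume "\<not> ?thesis"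
  then obtain z where z: "z \<in> sector a l p q" "z \<in> sector (a + l) l p q" by blast
  then obtain h \<theta> h' \<theta>' where 1: "z = of_real (1 - h) * cis \<theta>" "a \<le> \<theta>" "\<theta> < a + l" "h \<le> q"
    and 2: "z = of_real (1 - h') * cis \<theta>'" "a + l \<le> \<theta>'" "\<theta>' < a + l + l" "h' \<le> q" unfolding sector_def by blast
  have "cmod z = 1 - h" unfolding 1(1) using 1(4) assms by (simp add: norm_mult del: of_real_diff)
  moreover have "cmod z = 1 - h'" unfolding 2(1) using 2(4) assms by (simp add: norm_mult del: of_real_diff)
  ultimately have "h = h'" by simp
  then have "complex_of_real (1 - h) * cis \<theta> = of_real (1 - h) * cis \<theta>'" unfolding 1(1)[symmetric] using 2(1) by (simp only:)
  moreover have "complex_of_real (1 - h) \<noteq> 0" using 1(4) assms by (simp del: of_real_diff)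
  ultimately have "cis \<theta> = cis \<theta>'" by (simp only: mult_cancel_left) blast
  then obtain n :: int where "\<theta>' = \<theta> + of_int n * (2 * pi)" using cis_eq_cis by metis
  then have "0 < of_int n * (2 * pi)" "of_int n * (2 * pi) < 1 * (2 * pi)" using 1(2,3) 2(2,3) assms(1,2) by linarith+
  then have "(0::real) < of_int n" "(of_int n :: real) < 1" by (simp_all only: zero_less_mult_iff mult_less_cancel_right_disj) auto
  then show False by simp
qed

lemma sector_dyadic_UN: "0 < l \<Longrightarrow> sector a l 0 l = (\<Union>n. sector a l (l / 2 ^ n) l)"
proof (intro equalityI subsetI)
  fix z assume l: "0 < l" and "z \<in> sector a l 0 l"
  then obtain h \<theta> where z: "z = of_real (1 - h) * cis \<theta>" "a \<le> \<theta>" "\<theta> < a + l" "0 < h" "h \<le> l" by (auto simp: sector_def)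
  obtain n where "(1/2) ^ n < h / l" using real_arch_pow_inv[of "h / l" "1/2"] z(4) l by auto
  then have "l / 2 ^ n < h" using l by (simp add: field_simps power_one_over)
  then have "z \<in> sector a l (l / 2 ^ n) l" unfolding sector_def using z by blast
  then show "z \<in> (\<Union>n. sector a l (l / 2 ^ n) l)" by blast
next
  fix z assume l: "0 < l" and "z \<in> (\<Union>n. sector a l (l / 2 ^ n) l)"
  then obtain n where "z \<in> sector a l (l / 2 ^ n) l" by blast
  then obtain h \<theta> where z: "z = of_real (1 - h) * cis \<theta>" "a \<le> \<theta>" "\<theta> < a + l" "l / 2 ^ n < h" "h \<le> l" by (auto simp: sector_def)
  have "0 < l / 2 ^ n" using l by simp
  then have "0 < h" using z(4) by linarith
  then show "z \<in> sector a l 0 l" unfolding sector_def using z by blast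
qed

lemma sector_antimono: "p' \<le> p \<Longrightarrow> sector a l p q \<subseteq> sector a l p' q"
  unfolding sector_def using order_le_less_trans by blast

lemma sector_subset_ball: "q < 1 \<Longrightarrow> 0 \<le> p \<Longrightarrow> sector a l p q \<subseteq> ball 0 1"
  using sector_height by (fastforce)

lemma dyadic_weight_smaller: "dyadic_weight m c l0 \<Longrightarrow> l1 \<le> l0 \<Longrightarrow> dyadic_weight m c l1"
  unfolding dyadic_weight_def by (meson order_trans)

text \<open>The radial projection moves a point by 1 - |z| < r, so the chord between the angles is
  below 2 * r and the angles differ by less than 4 * r. The bound r \<le> 1/16 keeps the size 8 * r
  of the box at most 1/2.\<close>

lemma disc_nbhd_subset_sector:
  assumes "r \<le> 1/16" shows "ball 0 1 \<inter> ball (cis \<theta>0) r \<subseteq> sector (\<theta>0 - 4 * r) (8 * r) 0 (8 * r)"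
proof
  fix z assume z: "z \<in> ball 0 1 \<inter> ball (cis \<theta>0) r"
  then have r: "cmod (z - cis \<theta>0) < r" by (simp add: dist_norm norm_minus_commute)
  have rho: "1 - r < cmod z" using norm_triangle_ineq2[of "cis \<theta>0" z] r by (simp add: norm_minus_commute)
  obtain \<theta> where th: "z = of_real (cmod z) * cis \<theta>" "\<bar>\<theta> - \<theta>0\<bar> \<le> pi"
  proof -
    have "z * cis (- \<theta>0) = of_real (cmod z) * cis (Arg (z * cis (- \<theta>0)))"
      using Arg_eq[of "z * cis (- \<theta>0)"] rho r by (cases "z = 0") (auto simp: norm_mult cis_conv_exp)
    then have "z * cis (- \<theta>0) * cis \<theta>0 = of_real (cmod z) * (cis (Arg (z * cis (- \<theta>0))) * cis \<theta>0)" by simp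
    then have "z = of_real (cmod z) * cis (Arg (z * cis (- \<theta>0)) + \<theta>0)" by (simp add: cis_mult mult.assoc)
    moreover have "\<bar>Arg (z * cis (- \<theta>0)) + \<theta>0 - \<theta>0\<bar> \<le> pi"
      using Arg_le_pi[of "z * cis (- \<theta>0)"] mpi_less_Arg[of "z * cis (- \<theta>0)"] by linarith
    ultimately show thesis by (rule that)
  qed
  have "cis \<theta> - z = of_real (1 - cmod z) * cis \<theta>" by (subst th(1)) (simp add: algebra_simps)
  then have "cmod (cis \<theta> - z) = 1 - cmod z" using z by (simp add: norm_mult del: of_real_diff)
  moreover have "cmod (cis \<theta> - cis \<theta>0) \<le> cmod (cis \<theta> - z) + cmod (z - cis \<theta>0)"
    using norm_triangle_ineq[of "cis \<theta> - z" "z - cis \<theta>0"] by simp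
  ultimately have "\<bar>\<theta> - \<theta>0\<bar> / 2 < 2 * r" using cmod_cis_diff_ge[OF th(2)] rho r by linarith
  then have "\<theta>0 - 4 * r \<le> \<theta>" "\<theta> < \<theta>0 - 4 * r + 8 * r" by (simp_all add: abs_less_iff)
  moreover have "z = of_real (1 - (1 - cmod z)) * cis \<theta>" using th(1) by simp
  moreover have "0 < 1 - cmod z" using z by simp
  moreover have "1 - cmod z \<le> 8 * r" using rho norm_ge_zero[of "z - cis \<theta>0"] r by linarith
  ultimately show "z \<in> sector (\<theta>0 - 4 * r) (8 * r) 0 (8 * r)" unfolding sector_def by blast
qed

text \<open>Fourteen arcs of length 1/2 cover the angles up to 7 > 2 * pi.\<close>

lemma disc_subset_sectors: "ball 0 1 \<subseteq> cball 0 (1/2) \<union> (\<Union>j\<in>{..<14::nat}. sector (real j / 2) (1/2) 0 (1/2))"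
proof
  fix z :: complex assume z: "z \<in> ball 0 1"
  show "z \<in> cball 0 (1/2) \<union> (\<Union>j\<in>{..<14::nat}. sector (real j / 2) (1/2) 0 (1/2))"
  proof (cases "cmod z \<le> 1/2")
    case False
    define \<theta> where "\<theta> = Arg2pi z"
    have th: "0 \<le> \<theta>" "\<theta> < 2 * pi" "z = of_real (cmod z) * cis \<theta>"
      using Arg2pi[of z] Arg2pi_eq[of z] by (auto simp: \<theta>_def cis_conv_exp)
    define j where "j = nat \<lfloor>2 * \<theta>\<rfloor>"
    have j: "real j \<le> 2 * \<theta>" "2 * \<theta> < real j + 1" unfolding j_def using th(1) by linarith+
    have "pi \<le> 7/2" using pi_approx by simp
    then have "\<theta> < 7" using th(2) by linarith
    then have "real j < 14" using j(1) by linarith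
    then have "j \<in> {..<14}" by simp
    moreover have "z \<in> sector (real j / 2) (1/2) 0 (1/2)"
    proof -
      have "z = of_real (1 - (1 - cmod z)) * cis \<theta>" using th(3) by simp
      moreover have "real j / 2 \<le> \<theta>" "\<theta> < real j / 2 + 1/2" "0 < 1 - cmod z" "1 - cmod z \<le> 1/2" using j False z by auto
      ultimately show ?thesis unfolding sector_def by blast
    qed
    ultimately show ?thesis by blast
  qed simp
qed

section \<open>The weighted integral over a Carleson box\<close>

context qc_curve begin

definition \<kappa> :: "complex \<Rightarrow> real" where "\<kappa> z = (1 - cmod z) / \<delta> z"

lemma \<kappa>_nonneg: "z \<in> ball 0 1 \<Longrightarrow> 0 \<le> \<kappa> z" using \<delta>_pos[of z] by (simp add: \<kappa>_def)

text \<open>Here \<open>F\<close> plays the role of the density of the pullback measure, and the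
  dyadic estimate is turned into one for an integral. Over the top half of a box, \<kappa> is at
  most l / (c * len), so that each box contributes one term of \<open>dyadic_sum\<close>. Since
  \<open>l0\<close> is free, the estimate can be restricted to small scales.\<close>

lemma sector_energy:
  obtains B where "0 < B" "\<And>F M l0 a l. F \<in> borel_measurable lebesgue \<Longrightarrow> 0 \<le> M \<Longrightarrow> l0 \<le> 1/2 \<Longrightarrow>
     (\<And>a l. 0 < l \<Longrightarrow> l \<le> l0 \<Longrightarrow> (\<integral>\<^sup>+z\<in>sector a l 0 l. F z \<partial>lebesgue) \<le> ennreal (M * len a (a + l))) \<Longrightarrow> 0 < l \<Longrightarrow> l \<le> l0 \<Longrightarrow>
     (\<integral>\<^sup>+z\<in>sector a l 0 l. ennreal (\<kappa> z) * F z \<partial>lebesgue) \<le> ennreal (B * M * l)"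
proof -
  obtain c where c: "0 < c" "\<And>a l h \<theta>. 0 < l \<Longrightarrow> l / 2 \<le> h \<Longrightarrow> h \<le> l \<Longrightarrow> l \<le> 1/2 \<Longrightarrow> a \<le> \<theta> \<Longrightarrow> \<theta> \<le> a + l \<Longrightarrow>
    c * len a (a + l) \<le> \<delta> (of_real (1 - h) * cis \<theta>)"
    by (rule box_lower) (rule that)
  obtain c0 where c0: "dyadic_weight cu.mass c0 1" using cu.dyadic.dyadic_weight_axioms by blast
  have c0p: "0 < c0" using c0 by (rule dyadic_weight.c)
  define B where "B = 1 / c * (2 / c0)"
  show thesis
  proof
    show "0 < B" using c c0p by (simp add: B_def)
    fix F :: "complex \<Rightarrow> ennreal" and M l0 a l :: real
    assume F: "F \<in> borel_measurable lebesgue" and M: "0 \<le> M" and l0: "l0 \<le> 1/2"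
      and box: "\<And>a l. 0 < l \<Longrightarrow> l \<le> l0 \<Longrightarrow> (\<integral>\<^sup>+z\<in>sector a l 0 l. F z \<partial>lebesgue) \<le> ennreal (M * len a (a + l))"
      and l: "0 < l" "l \<le> l0"
    interpret dw: dyadic_weight cu.mass c0 l0 by (rule dyadic_weight_smaller[OF c0]) (use l0 in simp)
    let ?I = "\<lambda>A. \<integral>\<^sup>+z\<in>A. F z \<partial>lebesgue" and ?K = "\<lambda>A. \<integral>\<^sup>+z\<in>A. ennreal (\<kappa> z) * F z \<partial>lebesgue"
    define \<tau> where "\<tau> a l = enn2real (?I (sector a l (l/2) l))" for a l
    define \<nu> where "\<nu> a l = enn2real (?I (sector a l 0 l))" for a l
    have sec: "sector a l p q \<in> sets lebesgue" if "0 \<le> p" "p \<le> q" "q \<le> l0" for a l p q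
      using that l0 by (intro sector_lebesgue) auto
    have fin: "?I (sector a l 0 l) < \<infinity>" if "0 < l" "l \<le> l0" for a l
      using box[OF that, of a] by (rule order_le_less_trans) simp
    have mono: "?I A \<le> ?I A'" if "A \<subseteq> A'" for A A'
      using that by (intro nn_integral_mono) (auto simp: indicator_def)
    have fin': "?I (sector a l (l/2) l) < \<infinity>" if "0 < l" "l \<le> l0" for a l
      by (rule order_le_less_trans[OF mono[OF sector_antimono] fin]) (use that in auto)
    have sp: "\<tau> a l + \<nu> a (l/2) + \<nu> (a + l/2) (l/2) \<le> \<nu> a l" if l: "0 < l" "l \<le> l0" for a l
    proof -
      let ?T = "sector a l (l/2) l" and ?A = "sector a (l/2) 0 (l/2)" and ?B = "sector (a + l/2) (l/2) 0 (l/2)"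
      have AB: "?A \<inter> ?B = {}" using l l0 pi_gt3 by (intro sector_disjoint_angle) auto
      have T1: "?A \<inter> ?T = {}" and T2: "?B \<inter> ?T = {}" using l l0 by (intro sector_disjoint_height; simp)+
      have "?I (sector a l 0 l) = ?I (?T \<union> (?A \<union> ?B))" using l by (subst sector_split[of 0 "l/2" l l a]) auto
      also have "\<dots> = ?I ?T + ?I (?A \<union> ?B)" by (rule nn_integral_disjoint_Un) (use l sec T1 T2 in auto)
      also have "?I (?A \<union> ?B) = ?I ?A + ?I ?B" by (rule nn_integral_disjoint_Un) (use l sec AB in auto)
      finally have e: "?I (sector a l 0 l) = ?I ?T + (?I ?A + ?I ?B)" .
      have "\<nu> a l = \<tau> a l + (\<nu> a (l/2) + \<nu> (a + l/2) (l/2))"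
        unfolding \<nu>_def \<tau>_def e using fin[of "l/2"] fin'[of l] l by (subst enn2real_plus; simp add: enn2real_plus)
      then show ?thesis by simp
    qed
    have nu_le: "\<nu> a l \<le> M * dw.W a l" if "0 < l" "l \<le> l0" for a l
      unfolding \<nu>_def cu.mass_interval by (rule enn2real_leI) (use M cu.len_nonneg box[OF that] in auto)
    have D: "dyadic_sum dw.W \<tau> n a l \<le> 2 * M / c0 * l" for n
      by (rule dw.dyadic_sum_le[of \<tau> \<nu> M]) (use M l sp nu_le in \<open>auto simp: \<tau>_def \<nu>_def\<close>)
    \<comment> \<open>Cutting the box at height l / 2^n leaves exactly \<open>n\<close> generations
      of top halves; for n = 0 nothing remains.\<close>
    have claim: "0 \<le> dyadic_sum dw.W \<tau> n a l \<and> ?K (sector a l (l / 2 ^ n) l) \<le> ennreal (1 / c * dyadic_sum dw.W \<tau> n a l)" if "0 < l" "l \<le> l0" for n a l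
      using that
    proof (induction n arbitrary: a l)
      case 0
      have "sector a l l l = {}" by (auto simp: sector_def)
      then show ?case by simp
    next
      case (Suc n)
      let ?T = "sector a l (l/2) l" and ?p = "l / 2 ^ Suc n"
      let ?A = "sector a (l/2) (l / 2 / 2 ^ n) (l/2)" and ?B = "sector (a + l/2) (l/2) (l / 2 / 2 ^ n) (l/2)"
      have p: "?p = l / 2 / 2 ^ n" "0 < ?p" "?p \<le> l / 2" using Suc.prems by (auto simp: field_simps)
      have lp: "0 < len a (a + l)" using Suc.prems l0 pi_gt3 by (intro cu.len_pos) auto
      have Tm: "?T \<in> sets lebesgue" using Suc.prems by (intro sec) auto
      have ABm: "?A \<in> sets lebesgue" "?B \<in> sets lebesgue" using Suc.prems p by (auto intro!: sec)
      have \<kappa>: "\<kappa> z \<le> l / (c * len a (a + l))" if zT: "z \<in> ?T" for z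
      proof -
        obtain h \<theta> where z: "z = of_real (1 - h) * cis \<theta>" "a \<le> \<theta>" "\<theta> < a + l" "l/2 < h" "h \<le> l" using zT by (auto simp: sector_def)
        have d: "c * len a (a + l) \<le> \<delta> z" unfolding z(1) by (rule c(2)) (use z Suc.prems l0 in auto)
        have h: "1 - cmod z \<le> l" using sector_height[OF zT] Suc.prems l0 by simp
        show ?thesis unfolding \<kappa>_def by (rule frac_le) (use h d c lp Suc.prems in auto)
      qed
      have "?K ?T \<le> (\<integral>\<^sup>+z. ennreal (l / (c * len a (a + l))) * (F z * indicator ?T z) \<partial>lebesgue)"
        by (rule nn_integral_mono) (auto simp: indicator_def intro!: mult_right_mono ennreal_leI \<kappa>)
      also have "\<dots> = ennreal (l / (c * len a (a + l))) * ?I ?T"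
        using F Tm by (intro nn_integral_cmult borel_measurable_times_ennreal borel_measurable_indicator)
      also have "?I ?T = ennreal (\<tau> a l)" unfolding \<tau>_def using fin'[OF Suc.prems, of a] by simp
      finally have KT: "?K ?T \<le> ennreal (1 / c * (l / dw.W a l * \<tau> a l))"
        using c lp Suc.prems by (simp add: cu.mass_interval ennreal_mult[symmetric] \<tau>_def mult_ac)
      have IA: "0 \<le> dyadic_sum dw.W \<tau> n a (l/2)" "?K ?A \<le> ennreal (1 / c * dyadic_sum dw.W \<tau> n a (l/2))"
        using Suc.IH[of "l/2" a] Suc.prems by auto
      have IB: "0 \<le> dyadic_sum dw.W \<tau> n (a + l/2) (l/2)" "?K ?B \<le> ennreal (1 / c * dyadic_sum dw.W \<tau> n (a + l/2) (l/2))"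
        using Suc.IH[of "l/2" "a + l/2"] Suc.prems by auto
      have t0: "0 \<le> l / dw.W a l * \<tau> a l" using Suc.prems lp by (simp add: \<tau>_def cu.mass_interval)
      have "?K (sector a l ?p l) = ?K (?T \<union> (?A \<union> ?B))"
        using Suc.prems p by (subst sector_split[of ?p "l/2" l l a]) auto
      also have "\<dots> \<le> ?K ?T + ?K (?A \<union> ?B)" using Tm ABm by (intro nn_integral_Un_le) auto
      also have "\<dots> \<le> ?K ?T + (?K ?A + ?K ?B)" by (rule add_left_mono[OF nn_integral_Un_le[OF ABm]])
      also have "\<dots> \<le> ennreal (1 / c * (l / dw.W a l * \<tau> a l)) + (ennreal (1 / c * dyadic_sum dw.W \<tau> n a (l/2)) + ennreal (1 / c * dyadic_sum dw.W \<tau> n (a + l/2) (l/2)))"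
        by (rule add_mono[OF KT add_mono[OF IA(2) IB(2)]])
      also have "\<dots> = ennreal (1 / c * dyadic_sum dw.W \<tau> (Suc n) a l)"
      proof -
        have c0: "0 \<le> 1 / c" using c by simp
        show ?thesis unfolding dyadic_sum.simps distrib_left add.assoc
          using mult_nonneg_nonneg[OF c0 t0] mult_nonneg_nonneg[OF c0 IA(1)] mult_nonneg_nonneg[OF c0 IB(1)]
          by (simp only: ennreal_plus add_nonneg_nonneg)
      qed
      finally show ?case using t0 IA(1) IB(1) by simp
    qed
    \<comment> \<open>The truncated boxes exhaust the whole one; continuity from below holds for
      lower integrals too, because they define a measure.\<close>
    have "?K (sector a l 0 l) = (SUP n. ?K (sector a l (l / 2 ^ n) l))"
      unfolding sector_dyadic_UN[OF l(1)]
    proof (rule nn_integral_incseq_UN)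
      show "sector a l (l / 2 ^ n) l \<in> sets lebesgue" for n using l by (intro sec) (auto simp: field_simps)
      show "incseq (\<lambda>n. sector a l (l / 2 ^ n) l)"
        by (intro incseq_SucI sector_antimono) (use l in \<open>auto simp: field_simps\<close>)
    qed
    also have "\<dots> \<le> ennreal (B * M * l)"
    proof (rule SUP_least)
      fix n
      have "1 / c * dyadic_sum dw.W \<tau> n a l \<le> 1 / c * (2 * M / c0 * l)" using D c by (intro mult_left_mono) auto
      also have "\<dots> = B * M * l" by (simp add: B_def)
      finally show "?K (sector a l (l / 2 ^ n) l) \<le> ennreal (B * M * l)" using claim[OF l, of n a] by (meson ennreal_leI order_trans)
    qed
    finally show "?K (sector a l 0 l) \<le> ennreal (B * M * l)" .
  qed
qed

end

subsection \<open>Pullback of Carleson measures\<close>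

text \<open>The Carleson condition restricts radii to below the diameter of the boundary. Total mass
  is finite because finitely many admissible balls cover \<Omega>, and the total mass then takes
  care of the larger radii.\<close>

lemma carleson_finite:
  fixes \<mu> :: "complex measure"
  assumes op: "open \<Omega>" and bdd: "bounded \<Omega>" and ne: "\<Omega> \<noteq> {}" and sets: "sets \<mu> = sets lebesgue" and ca: "carleson \<Omega> \<mu>"
  obtains M where "0 \<le> M" "\<And>z r. z \<in> frontier \<Omega> \<Longrightarrow> 0 < r \<Longrightarrow> emeasure \<mu> (\<Omega> \<inter> ball z r) \<le> ennreal (M * r)"
    "emeasure \<mu> \<Omega> < \<infinity>"
proof -
  let ?d = "diameter (frontier \<Omega>)"
  have bf: "bounded (frontier \<Omega>)" "compact (frontier \<Omega>)"
    using bdd compact_imp_bounded[of "frontier \<Omega>"] by (auto simp: compact_frontier_bounded)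
  \<comment> \<open>Two opposite rays hit the boundary in points whose distance is the sum of the
    two lengths and at most the diameter, so the shorter ray has at most half of that
    length.\<close>
  have near: "\<exists>p\<in>frontier \<Omega>. 0 < dist w p \<and> dist w p \<le> ?d / 2" if w: "w \<in> \<Omega>" for w
  proof -
    have wi: "w \<in> interior \<Omega>" using w op by (simp add: interior_open)
    obtain s where s: "0 < s" "w + s *\<^sub>R 1 \<in> frontier \<Omega>" by (rule ray_to_frontier[OF bdd wi, of 1]) (use that in auto)
    obtain t where t: "0 < t" "w + t *\<^sub>R (-1) \<in> frontier \<Omega>" by (rule ray_to_frontier[OF bdd wi, of "-1"]) (use that in auto)
    have "dist (w + s *\<^sub>R 1) (w + t *\<^sub>R (-1)) = s + t"
    proof -
      have "(w + s *\<^sub>R 1) - (w + t *\<^sub>R (-1)) = of_real (s + t)" by (simp add: scaleR_conv_of_real)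
      then show ?thesis unfolding dist_norm using s t by (simp only: norm_of_real)
    qed
    then have "s + t \<le> ?d" using diameter_bounded_bound[OF bf(1) s(2) t(2)] by simp
    moreover have "dist w (w + s *\<^sub>R 1) = s" "dist w (w + t *\<^sub>R (-1)) = t" using s t by (simp_all add: dist_norm)
    ultimately show ?thesis using s t by (cases "s \<le> t") (force intro: bexI[OF _ s(2)] bexI[OF _ t(2)])+
  qed
  obtain w0 where "w0 \<in> \<Omega>" using ne by blast
  then obtain p0 where "0 < dist w0 p0" "dist w0 p0 \<le> ?d / 2" using near by blast
  then have d: "0 < ?d" by linarith
  obtain M where M: "\<And>z r. z \<in> frontier \<Omega> \<Longrightarrow> 0 < r \<Longrightarrow> r < ?d \<Longrightarrow> emeasure \<mu> (\<Omega> \<inter> ball z r) \<le> ennreal (M * r)"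
    using ca unfolding carleson_def by blast
  obtain P where P: "P \<subseteq> frontier \<Omega>" "finite P" "frontier \<Omega> \<subseteq> (\<Union>p\<in>P. ball p (?d / 4))"
  proof (rule compactE_image[OF bf(2), of "frontier \<Omega>" "\<lambda>p. ball p (?d / 4)"])
    show "frontier \<Omega> \<subseteq> (\<Union>p\<in>frontier \<Omega>. ball p (?d / 4))" using d by auto
  qed (use that in auto)
  \<comment> \<open>1/2 + 1/4 < 7/8 < 1: the balls reach every point of \<Omega> while their radius
    remains admissible.\<close>
  have cover: "\<Omega> \<subseteq> (\<Union>p\<in>P. \<Omega> \<inter> ball p (7 * ?d / 8))"
  proof
    fix w assume w: "w \<in> \<Omega>"
    obtain p where p: "p \<in> frontier \<Omega>" "dist w p \<le> ?d / 2" using near[OF w] by blast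
    obtain q where q: "q \<in> P" "dist q p < ?d / 4" using P(3) p(1) by auto
    have "dist q w < 7 * ?d / 8" using p(2) q(2) d dist_triangle[of q w p] by (simp add: dist_commute)
    then show "w \<in> (\<Union>p\<in>P. \<Omega> \<inter> ball p (7 * ?d / 8))" using q w by auto
  qed
  have meas: "\<Omega> \<inter> ball p r \<in> sets \<mu>" for p r using op by (simp add: sets open_Int borel_open)
  have "emeasure \<mu> \<Omega> \<le> emeasure \<mu> (\<Union>p\<in>P. \<Omega> \<inter> ball p (7 * ?d / 8))"
    by (rule emeasure_mono[OF cover sets.finite_UN[OF P(2) meas]])
  also have "\<dots> \<le> (\<Sum>p\<in>P. emeasure \<mu> (\<Omega> \<inter> ball p (7 * ?d / 8)))"
    by (rule emeasure_subadditive_finite[OF P(2)]) (use meas in auto)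
  also have "\<dots> \<le> (\<Sum>p\<in>P. ennreal (M * (7 * ?d / 8)))" using P(1) d by (intro sum_mono M) auto
  also have "\<dots> < \<infinity>" by (simp add: ennreal_mult_less_top of_nat_less_top)
  finally have fin: "emeasure \<mu> \<Omega> < \<infinity>" .
  define X where "X = enn2real (emeasure \<mu> \<Omega>)"
  have X: "emeasure \<mu> \<Omega> = ennreal X" "0 \<le> X" using fin by (simp_all add: X_def)
  show thesis
  proof (rule that[of "\<bar>M\<bar> + X / ?d"])
    have Xd: "0 \<le> X / ?d" using X(2) d by simp
    then show M': "0 \<le> \<bar>M\<bar> + X / ?d" by simp
    fix z r assume z: "z \<in> frontier \<Omega>" and r: "(0::real) < r"
    show "emeasure \<mu> (\<Omega> \<inter> ball z r) \<le> ennreal ((\<bar>M\<bar> + X / ?d) * r)"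
    proof (cases "r < ?d")
      case True
      have "M \<le> \<bar>M\<bar> + X / ?d" using Xd by linarith
      then have "M * r \<le> (\<bar>M\<bar> + X / ?d) * r" using r by (intro mult_right_mono) auto
      then show ?thesis by (rule order_trans[OF M[OF z r True] ennreal_leI])
    next
      case False
      have "X = X / ?d * ?d" using d by simp
      also have "\<dots> \<le> (\<bar>M\<bar> + X / ?d) * r" by (rule mult_mono) (use False d M' in auto)
      finally have "emeasure \<mu> \<Omega> \<le> ennreal ((\<bar>M\<bar> + X / ?d) * r)" unfolding X by (rule ennreal_leI)
      moreover have "emeasure \<mu> (\<Omega> \<inter> ball z r) \<le> emeasure \<mu> \<Omega>" using op by (intro emeasure_mono) (auto simp: sets borel_open)
      ultimately show ?thesis by (rule order_trans[rotated])
    qed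
  qed (rule fin)
qed

locale qc_weight = qc_curve \<phi> \<psi> \<Omega> L k g C C1 C2 for \<phi> \<psi> \<Omega> L k g C C1 C2 +
  fixes \<alpha> :: "complex \<Rightarrow> real"
  assumes \<alpha>0: "\<And>z. z \<in> \<Omega> \<Longrightarrow> 0 \<le> \<alpha> z" and \<alpha>m: "\<alpha> \<in> borel_measurable (lebesgue_on \<Omega>)"
    and \<alpha>_fin: "(\<integral>\<^sup>+z\<in>\<Omega>. ennreal (\<alpha> z) \<partial>lebesgue) < \<infinity>"
begin

definition good :: "complex set" where
  "good = {z\<in>ball 0 1. \<phi> differentiable (at z) \<and> cmod (dzbar \<phi> z) \<le> k * cmod (dz \<phi> z)}"

lemma good_lebesgue: "good \<in> sets lebesgue"
proof -
  have "good = ball 0 1 - {z\<in>ball 0 1. \<not> (\<phi> differentiable (at z) \<and> cmod (dzbar \<phi> z) \<le> k * cmod (dz \<phi> z))}"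
    by (auto simp: good_def)
  then show ?thesis using negligible_imp_sets[OF good_ae] by (auto intro: borel_open)
qed

lemma AE_good: "AE z in lebesgue. z \<in> ball 0 1 \<longrightarrow> z \<in> good"
proof -
  have "AE z in lebesgue. z \<notin> {z\<in>ball 0 1. \<not> (\<phi> differentiable (at z) \<and> cmod (dzbar \<phi> z) \<le> k * cmod (dz \<phi> z))}"
    using good_ae by (intro AE_not_in) (simp only: negligible_iff_null_sets)
  then show ?thesis by (rule AE_mp) (auto simp: good_def)
qed

lemma \<alpha>_integrable: "\<alpha> absolutely_integrable_on \<Omega>"
  unfolding set_integrable_def
proof (rule integrableI_bounded)
  have \<Omega>: "\<Omega> \<in> sets lebesgue" using op by (simp add: borel_open)
  show "(\<lambda>x. indicator \<Omega> x *\<^sub>R \<alpha> x) \<in> borel_measurable lebesgue"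
    using \<alpha>m \<Omega> by (subst (asm) borel_measurable_restrict_space_iff) auto
  have "(\<integral>\<^sup>+x. ennreal (norm (indicator \<Omega> x *\<^sub>R \<alpha> x)) \<partial>lebesgue) = (\<integral>\<^sup>+z\<in>\<Omega>. ennreal (\<alpha> z) \<partial>lebesgue)"
    using \<alpha>0 by (intro nn_integral_cong) (auto simp: indicator_def)
  then show "(\<integral>\<^sup>+x. ennreal (norm (indicator \<Omega> x *\<^sub>R \<alpha> x)) \<partial>lebesgue) < \<infinity>" using \<alpha>_fin by simp
qed

abbreviation J :: "complex \<Rightarrow> real" where "J z \<equiv> \<bar>jac (frechet_derivative \<phi> (at z))\<bar>"

lemma change_of_variables:
  assumes A: "A \<in> sets lebesgue"
  shows "(\<lambda>z. J z * \<alpha> (\<phi> z)) absolutely_integrable_on (good \<inter> A)"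
    and "(\<integral>\<^sup>+z\<in>good \<inter> A. ennreal (J z * \<alpha> (\<phi> z)) \<partial>lebesgue) = (\<integral>\<^sup>+w\<in>\<phi> ` (good \<inter> A). ennreal (\<alpha> w) \<partial>lebesgue)"
proof -
  let ?S = "good \<inter> A"
  have S: "?S \<in> sets lebesgue" using A good_lebesgue by blast
  have der: "(\<phi> has_derivative frechet_derivative \<phi> (at z)) (at z)" if "z \<in> ?S" for z
    using that by (intro frechet_derivative_works[THEN iffD1]) (simp add: good_def)
  have inj': "inj_on \<phi> ?S" by (rule inj_on_subset[OF inj]) (auto simp: good_def)
  have sub: "\<phi> ` ?S \<subseteq> \<Omega>" using in\<Omega> by (auto simp: good_def)
  have im: "\<phi> ` ?S \<in> sets lebesgue"
    using S der by (intro differentiable_image_in_sets_lebesgue)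
      (auto simp: differentiable_on_def good_def intro: differentiable_at_withinI)
  have f: "\<alpha> absolutely_integrable_on \<phi> ` ?S" by (rule set_integrable_subset[OF \<alpha>_integrable im sub])
  show "(\<lambda>z. J z * \<alpha> (\<phi> z)) absolutely_integrable_on ?S"
    by (rule complex_change_of_variables(1)[OF S der inj' f])
  show "(\<integral>\<^sup>+z\<in>?S. ennreal (J z * \<alpha> (\<phi> z)) \<partial>lebesgue) = (\<integral>\<^sup>+w\<in>\<phi> ` ?S. ennreal (\<alpha> w) \<partial>lebesgue)"
    by (rule complex_change_of_variables_nn[OF S der inj' f]) (use sub \<alpha>0 in auto)
qed

text \<open>The density of the pullback of \<alpha> dx dy, scaled by the constant of
  \<open>dz_le_jac\<close> and set to 0 off the good set, so that \<kappa> * F dominates the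
  integrand of the conclusion.\<close>

definition F :: "complex \<Rightarrow> ennreal" where
  "F z = ennreal (48 * pi * L / (1 - k\<^sup>2)) * (ennreal (J z * \<alpha> (\<phi> z)) * indicator good z)"

text \<open>Measurability is read off from the integrability in the change of variables; it does not
  require \<alpha> o \<phi> to be measurable on its own.\<close>

lemma F_measurable: "F \<in> borel_measurable lebesgue"
proof -
  have "(\<lambda>z. indicator good z *\<^sub>R (J z * \<alpha> (\<phi> z))) \<in> borel_measurable lebesgue"
    using change_of_variables(1)[of UNIV] borel_measurable_integrable unfolding set_integrable_def by fastforce
  moreover have "F = (\<lambda>z. ennreal (48 * pi * L / (1 - k\<^sup>2)) * ennreal (indicator good z *\<^sub>R (J z * \<alpha> (\<phi> z))))"
    by (auto simp: F_def fun_eq_iff indicator_def)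
  ultimately show ?thesis by simp
qed

lemma F_integral:
  assumes A: "A \<in> sets lebesgue" and im: "\<phi> ` (good \<inter> A) \<subseteq> E"
  shows "(\<integral>\<^sup>+z\<in>A. F z \<partial>lebesgue) \<le> ennreal (48 * pi * L / (1 - k\<^sup>2)) * (\<integral>\<^sup>+w\<in>E. ennreal (\<alpha> w) \<partial>lebesgue)"
proof -
  let ?f = "\<lambda>z. ennreal (J z * \<alpha> (\<phi> z)) * indicator (good \<inter> A) z"
  have "(\<lambda>z. indicator (good \<inter> A) z *\<^sub>R (J z * \<alpha> (\<phi> z))) \<in> borel_measurable lebesgue"
    using change_of_variables(1)[OF A] borel_measurable_integrable unfolding set_integrable_def by fastforce
  moreover have "?f = (\<lambda>z. ennreal (indicator (good \<inter> A) z *\<^sub>R (J z * \<alpha> (\<phi> z))))" by (auto simp: fun_eq_iff indicator_def)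
  ultimately have fm: "?f \<in> borel_measurable lebesgue" by simp
  have "(\<integral>\<^sup>+z\<in>A. F z \<partial>lebesgue) = (\<integral>\<^sup>+z. ennreal (48 * pi * L / (1 - k\<^sup>2)) * ?f z \<partial>lebesgue)"
    by (intro nn_integral_cong) (auto simp: F_def indicator_def)
  also have "\<dots> = ennreal (48 * pi * L / (1 - k\<^sup>2)) * (\<integral>\<^sup>+z. ?f z \<partial>lebesgue)" by (rule nn_integral_cmult[OF fm])
  also have "(\<integral>\<^sup>+z. ?f z \<partial>lebesgue) = (\<integral>\<^sup>+w\<in>\<phi> ` (good \<inter> A). ennreal (\<alpha> w) \<partial>lebesgue)" by (rule change_of_variables(2)[OF A])
  also have "\<dots> \<le> (\<integral>\<^sup>+w\<in>E. ennreal (\<alpha> w) \<partial>lebesgue)"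
    using im by (intro nn_integral_mono) (auto simp: indicator_def)
  finally show ?thesis by (simp add: mult_left_mono)
qed

text \<open>A lower integral, since no measurability of the integrand is established. Only
  monotonicity, countable additivity and comparison with \<kappa> * F are used.\<close>

definition G :: "complex set \<Rightarrow> ennreal" where
  "G A = (\<integral>\<^sup>+z\<in>A. ennreal (\<alpha> (\<phi> z) * cmod (dz \<phi> z)) \<partial>lebesgue)"

lemma G_mono: "A \<subseteq> B \<Longrightarrow> G A \<le> G B"
  unfolding G_def by (intro nn_integral_mono) (auto simp: indicator_def)

lemma G_le:
  assumes "A \<subseteq> ball 0 1" shows "G A \<le> (\<integral>\<^sup>+z\<in>A. ennreal (\<kappa> z) * F z \<partial>lebesgue)"
  unfolding G_def
proof (rule nn_integral_mono_AE, rule AE_mp[OF AE_good], rule AE_I2, rule impI)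
  fix z assume gz: "z \<in> ball 0 1 \<longrightarrow> z \<in> good"
  show "ennreal (\<alpha> (\<phi> z) * cmod (dz \<phi> z)) * indicator A z \<le> ennreal (\<kappa> z) * F z * indicator A z"
  proof (cases "z \<in> A")
    case True
    let ?c = "48 * pi * L / (1 - k\<^sup>2)"
    have z: "z \<in> ball 0 1" "z \<in> good" using True assms gz by blast+
    have c: "0 \<le> ?c" using Lpos k by (simp add: abs_square_le_1)
    have a: "0 \<le> \<alpha> (\<phi> z)" using \<alpha>0 in\<Omega> z by blast
    have "cmod (dz \<phi> z) \<le> ?c * ((1 - cmod z) / \<delta> z) * jac (frechet_derivative \<phi> (at z))"
      by (rule dz_le_jac) (use z \<delta>_pos \<delta>_ball in \<open>auto simp: good_def\<close>)
    also have "\<dots> \<le> ?c * \<kappa> z * J z" unfolding \<kappa>_def[symmetric]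
      by (rule mult_left_mono[OF abs_ge_self mult_nonneg_nonneg[OF c \<kappa>_nonneg[OF z(1)]]])
    finally have "\<alpha> (\<phi> z) * cmod (dz \<phi> z) \<le> \<alpha> (\<phi> z) * (?c * \<kappa> z * J z)" using a by (rule mult_left_mono)
    also have "\<dots> = \<kappa> z * (?c * (J z * \<alpha> (\<phi> z)))" by (simp only: mult_ac)
    finally have "ennreal (\<alpha> (\<phi> z) * cmod (dz \<phi> z)) \<le> ennreal (\<kappa> z * (?c * (J z * \<alpha> (\<phi> z))))" by (rule ennreal_leI)
    also have "\<dots> = ennreal (\<kappa> z) * F z"
      unfolding F_def using z c \<kappa>_nonneg[OF z(1)] mult_nonneg_nonneg[OF abs_ge_zero a]
      by (simp only: ennreal_mult mult_nonneg_nonneg indicator_simps mult_1_right)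
    finally show ?thesis using True by simp
  qed simp
qed

text \<open>The hypothesis tests \<alpha> only on balls about g a of radius K * len with l \<le> l0.
  Taking l0 = 1/2 serves the bounded statement; small l0 together with a small constant M serves the
  vanishing one.\<close>

lemma sector_estimate:
  obtains E K where "0 < E" "0 < K" "\<And>M l0 a l. 0 \<le> M \<Longrightarrow> l0 \<le> 1/2 \<Longrightarrow>
     (\<And>a l. 0 < l \<Longrightarrow> l \<le> l0 \<Longrightarrow> (\<integral>\<^sup>+w\<in>\<Omega> \<inter> ball (g a) (K * len a (a + l)). ennreal (\<alpha> w) \<partial>lebesgue) \<le> ennreal (M * (K * len a (a + l)))) \<Longrightarrow>
     0 < l \<Longrightarrow> l \<le> l0 \<Longrightarrow> G (sector a l 0 l) \<le> ennreal (E * M * l)"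
proof -
  let ?c = "48 * pi * L / (1 - k\<^sup>2)"
  have k2: "0 < 1 - k\<^sup>2" using k by (simp add: abs_square_less_1)
  have cp: "0 < ?c" using Lpos k2 by simp
  obtain K where K: "0 < K" "\<And>a l h \<theta>. 0 < h \<Longrightarrow> h \<le> l \<Longrightarrow> l \<le> 1/2 \<Longrightarrow> a \<le> \<theta> \<Longrightarrow> \<theta> \<le> a + l \<Longrightarrow>
    cmod (\<phi> (of_real (1 - h) * cis \<theta>) - g a) \<le> K * len a (a + l)" by (rule box_upper) (rule that)
  obtain B where B: "0 < B" "\<And>F M l0 a l. F \<in> borel_measurable lebesgue \<Longrightarrow> 0 \<le> M \<Longrightarrow> l0 \<le> 1/2 \<Longrightarrow>
     (\<And>a l. 0 < l \<Longrightarrow> l \<le> l0 \<Longrightarrow> (\<integral>\<^sup>+z\<in>sector a l 0 l. F z \<partial>lebesgue) \<le> ennreal (M * len a (a + l))) \<Longrightarrow> 0 < l \<Longrightarrow> l \<le> l0 \<Longrightarrow>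
     (\<integral>\<^sup>+z\<in>sector a l 0 l. ennreal (\<kappa> z) * F z \<partial>lebesgue) \<le> ennreal (B * M * l)"
  proof (rule sector_energy, goal_cases)
    case (1 B)
    show ?case by (rule 1(1)[OF 1(2,3)])
  qed
  show thesis
  \<comment> \<open>Doubling the radius turns the weak inequality of \<open>box_upper\<close> into
    containment in an open ball.\<close>
  proof (rule that[of "B * ?c * (2 * K)" "2 * K"])
    show K2: "0 < 2 * K" using K(1) by simp
    show "0 < B * ?c * (2 * K)" by (rule mult_pos_pos[OF mult_pos_pos[OF B(1) cp] K2])
    fix M l0 a l :: real
    assume M: "0 \<le> M" and l0: "l0 \<le> 1/2" and l: "0 < l" "l \<le> l0"
      and box: "\<And>a l. 0 < l \<Longrightarrow> l \<le> l0 \<Longrightarrow> (\<integral>\<^sup>+w\<in>\<Omega> \<inter> ball (g a) (2 * K * len a (a + l)). ennreal (\<alpha> w) \<partial>lebesgue) \<le> ennreal (M * (2 * K * len a (a + l)))"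
    have "(\<integral>\<^sup>+z\<in>sector a l 0 l. ennreal (\<kappa> z) * F z \<partial>lebesgue) \<le> ennreal (B * (?c * (M * (2 * K))) * l)"
    proof (rule B(2)[OF F_measurable _ l0 _ l])
      show M': "0 \<le> ?c * (M * (2 * K))" using K(1) by (intro mult_nonneg_nonneg[OF less_imp_le[OF cp]] mult_nonneg_nonneg[OF M]) simp
      fix a l :: real assume l: "0 < l" "l \<le> l0"
      have lp: "0 < len a (a + l)" using l l0 pi_gt3 by (intro cu.len_pos) auto
      have im: "\<phi> ` (good \<inter> sector a l 0 l) \<subseteq> \<Omega> \<inter> ball (g a) (2 * K * len a (a + l))"
      proof
        fix w assume "w \<in> \<phi> ` (good \<inter> sector a l 0 l)"
        then obtain z where z: "z \<in> good" "z \<in> sector a l 0 l" "w = \<phi> z" by blast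
        obtain h \<theta> where h: "z = of_real (1 - h) * cis \<theta>" "a \<le> \<theta>" "\<theta> < a + l" "0 < h" "h \<le> l" using z(2) by (auto simp: sector_def)
        have "cmod (\<phi> z - g a) \<le> K * len a (a + l)" unfolding h(1) by (rule K(2)) (use h l l0 in auto)
        moreover have "0 < K * len a (a + l)" using K(1) lp by simp
        ultimately have "cmod (w - g a) < 2 * K * len a (a + l)" unfolding z(3) by linarith
        moreover have "w \<in> \<Omega>" unfolding z(3) using z(1) in\<Omega> by (simp add: good_def)
        ultimately show "w \<in> \<Omega> \<inter> ball (g a) (2 * K * len a (a + l))" by (simp add: dist_norm norm_minus_commute)
      qed
      have "(\<integral>\<^sup>+z\<in>sector a l 0 l. F z \<partial>lebesgue) \<le> ennreal ?c * (\<integral>\<^sup>+w\<in>\<Omega> \<inter> ball (g a) (2 * K * len a (a + l)). ennreal (\<alpha> w) \<partial>lebesgue)"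
        by (rule F_integral[OF sector_lebesgue im]) (use l l0 in auto)
      also have "\<dots> \<le> ennreal ?c * ennreal (M * (2 * K * len a (a + l)))" by (rule mult_left_mono[OF box[OF l]]) simp
      also have "\<dots> = ennreal (?c * (M * (2 * K)) * len a (a + l))"
      proof -
        have "0 \<le> M * (2 * K * len a (a + l))" using M K(1) lp by simp
        then have "ennreal ?c * ennreal (M * (2 * K * len a (a + l))) = ennreal (?c * (M * (2 * K * len a (a + l))))"
          by (rule ennreal_mult[OF less_imp_le[OF cp], symmetric])
        then show ?thesis by (simp only: mult.assoc)
      qed
      finally show "(\<integral>\<^sup>+z\<in>sector a l 0 l. F z \<partial>lebesgue) \<le> ennreal (?c * (M * (2 * K)) * len a (a + l))" .
    qed
    then have "(\<integral>\<^sup>+z\<in>sector a l 0 l. ennreal (\<kappa> z) * F z \<partial>lebesgue) \<le> ennreal (B * ?c * (2 * K) * M * l)" by (simp only: mult_ac)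
    moreover have "sector a l 0 l \<subseteq> ball 0 1" using l l0 by (intro sector_subset_ball) auto
    ultimately show "G (sector a l 0 l) \<le> ennreal (B * ?c * (2 * K) * M * l)" by (rule order_trans[OF G_le, rotated])
  qed
qed

text \<open>On the compact core \<delta> has a positive minimum, so \<kappa> is bounded there, and
  the total mass of \<alpha> is finite.\<close>

lemma G_core: "G (cball 0 (1/2)) < \<infinity>"
proof -
  have sub: "cball 0 (1/2) \<subseteq> ball (0::complex) 1" by auto
  obtain x where x: "x \<in> cball (0::complex) (1/2)" "\<And>y. y \<in> cball 0 (1/2) \<Longrightarrow> \<delta> x \<le> \<delta> y"
    using continuous_attains_inf[of "cball (0::complex) (1/2)" \<delta>] continuous_on_subset[OF \<delta>_continuous sub] by auto
  have dx: "0 < \<delta> x" using \<delta>_pos x(1) sub by blast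
  have "\<kappa> z \<le> 1 / \<delta> x" if "z \<in> cball 0 (1/2)" for z
    unfolding \<kappa>_def by (rule frac_le) (use that x dx in auto)
  then have "(\<integral>\<^sup>+z\<in>cball 0 (1/2). ennreal (\<kappa> z) * F z \<partial>lebesgue) \<le> (\<integral>\<^sup>+z. ennreal (1 / \<delta> x) * (F z * indicator (cball 0 (1/2)) z) \<partial>lebesgue)"
    by (intro nn_integral_mono) (auto simp: indicator_def intro!: mult_right_mono ennreal_leI)
  also have "\<dots> = ennreal (1 / \<delta> x) * (\<integral>\<^sup>+z\<in>cball 0 (1/2). F z \<partial>lebesgue)"
    by (rule nn_integral_cmult) (auto intro!: borel_measurable_times_ennreal F_measurable borel_measurable_indicator)
  also have "\<dots> < \<infinity>"
  proof -
    have "(\<integral>\<^sup>+z\<in>cball 0 (1/2). F z \<partial>lebesgue) \<le> ennreal (48 * pi * L / (1 - k\<^sup>2)) * (\<integral>\<^sup>+w\<in>\<Omega>. ennreal (\<alpha> w) \<partial>lebesgue)"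
      by (rule F_integral) (use in\<Omega> in \<open>auto simp: good_def\<close>)
    also have "\<dots> < \<infinity>" using \<alpha>_fin by (simp add: ennreal_mult_less_top)
    finally show ?thesis by (simp add: ennreal_mult_less_top)
  qed
  finally show ?thesis using G_le[OF sub] by (rule order_le_less_trans[rotated])
qed

lemma frontier_disc_point:
  assumes "z \<in> frontier (ball 0 (1::real))" obtains t where "z = cis t"
proof -
  have "z \<in> cis ` {0..<0 + 2 * pi}" using assms by (simp only: cis_image_sphere) simp
  then show thesis using that by blast
qed

lemma disc_ball_estimate:
  assumes est: "\<And>a l. 0 < l \<Longrightarrow> l \<le> l0 \<Longrightarrow> G (sector a l 0 l) \<le> ennreal (E * l)" and l0: "l0 \<le> 1/2"
    and z: "z \<in> frontier (ball 0 1)" and r: "0 < r" "8 * r \<le> l0"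
  shows "G (ball 0 1 \<inter> ball z r) \<le> ennreal (8 * E * r)"
proof -
  obtain t where t: "z = cis t" by (rule frontier_disc_point[OF z])
  have "G (ball 0 1 \<inter> ball z r) \<le> G (sector (t - 4 * r) (8 * r) 0 (8 * r))"
    unfolding t by (rule G_mono[OF disc_nbhd_subset_sector]) (use r l0 in simp)
  also have "\<dots> \<le> ennreal (E * (8 * r))" by (rule est) (use r in auto)
  also have "E * (8 * r) = 8 * E * r" by simp
  finally show ?thesis .
qed

lemma G_finite:
  assumes est: "\<And>a. G (sector a (1/2) 0 (1/2)) \<le> ennreal E"
  shows "G (ball 0 1) < \<infinity>"
proof -
  let ?s = "\<lambda>j::nat. sector (real j / 2) (1/2) 0 (1/2)"
  have sm: "?s j \<in> sets lebesgue" for j by (rule sector_lebesgue) auto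
  have "G (ball 0 1) \<le> G (cball 0 (1/2) \<union> (\<Union>j\<in>{..<14}. ?s j))" by (rule G_mono[OF disc_subset_sectors])
  also have "\<dots> \<le> G (cball 0 (1/2)) + G (\<Union>j\<in>{..<14}. ?s j)"
    unfolding G_def by (rule nn_integral_Un_le) (use sm in auto)
  also have "\<dots> \<le> G (cball 0 (1/2)) + (\<Sum>j<14. G (?s j))"
    unfolding G_def by (intro add_left_mono nn_integral_UN_le sm) simp
  also have "\<dots> \<le> G (cball 0 (1/2)) + (\<Sum>j<14::nat. ennreal E)" by (intro add_left_mono sum_mono est)
  also have "\<dots> < \<infinity>" using G_core by (simp add: ennreal_mult_less_top of_nat_less_top)
  finally show ?thesis .
qed

lemma emeasure_weight:
  "emeasure (density lebesgue (\<lambda>z. ennreal (\<alpha> z))) (\<Omega> \<inter> ball w r) = (\<integral>\<^sup>+z\<in>\<Omega> \<inter> ball w r. ennreal (\<alpha> z) \<partial>lebesgue)"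
  by (rule emeasure_density_lower_integral) (use op in \<open>simp add: borel_open open_Int\<close>)

lemma emeasure_pullback:
  "emeasure (density lebesgue (\<lambda>z. ennreal (\<alpha> (\<phi> z) * cmod (dz \<phi> z)))) (ball 0 1 \<inter> ball w r) = G (ball 0 1 \<inter> ball w r)"
  unfolding G_def by (rule emeasure_density_lower_integral) (simp add: borel_open open_Int)

theorem carleson_pullback:
  assumes "carleson \<Omega> (density lebesgue (\<lambda>z. ennreal (\<alpha> z)))"
  shows "carleson (ball 0 1) (density lebesgue (\<lambda>z. ennreal (\<alpha> (\<phi> z) * cmod (dz \<phi> z))))"
proof -
  have ne: "\<Omega> \<noteq> {}" using in\<Omega>[of 0] by auto
  obtain M where M: "0 \<le> M" "\<And>z r. z \<in> frontier \<Omega> \<Longrightarrow> 0 < r \<Longrightarrow>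
      emeasure (density lebesgue (\<lambda>z. ennreal (\<alpha> z))) (\<Omega> \<inter> ball z r) \<le> ennreal (M * r)"
    by (rule carleson_finite[OF op bdd ne _ assms]) simp_all
  obtain E K where EK: "0 < E" "0 < K" "\<And>M l0 a l. 0 \<le> M \<Longrightarrow> l0 \<le> 1/2 \<Longrightarrow>
     (\<And>a l. 0 < l \<Longrightarrow> l \<le> l0 \<Longrightarrow> (\<integral>\<^sup>+w\<in>\<Omega> \<inter> ball (g a) (K * len a (a + l)). ennreal (\<alpha> w) \<partial>lebesgue) \<le> ennreal (M * (K * len a (a + l)))) \<Longrightarrow>
     0 < l \<Longrightarrow> l \<le> l0 \<Longrightarrow> G (sector a l 0 l) \<le> ennreal (E * M * l)"
  proof (rule sector_estimate, goal_cases)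
    case (1 E K)
    show ?case by (rule 1(1)[OF 1(2-4)])
  qed
  have est: "G (sector a l 0 l) \<le> ennreal (E * M * l)" if "0 < l" "l \<le> 1/2" for a l
  proof (rule EK(3)[OF M(1) order_refl _ that])
    fix a l :: real assume l: "0 < l" "l \<le> 1/2"
    have "0 < len a (a + l)" using l pi_gt3 by (intro cu.len_pos) auto
    then show "(\<integral>\<^sup>+w\<in>\<Omega> \<inter> ball (g a) (K * len a (a + l)). ennreal (\<alpha> w) \<partial>lebesgue) \<le> ennreal (M * (K * len a (a + l)))"
      using M(2)[OF g_frontier, of "K * len a (a + l)" a] EK(2) by (simp add: emeasure_weight)
  qed
  have fin: "G (ball 0 1) < \<infinity>" by (rule G_finite[OF est]) simp_all
  define X where "X = enn2real (G (ball 0 1))"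
  have X: "G (ball 0 1) = ennreal X" "0 \<le> X" using fin by (simp_all add: X_def)
  have "G (ball 0 1 \<inter> ball z r) \<le> ennreal ((8 * (E * M) + 16 * X) * r)" if z: "z \<in> frontier (ball 0 1)" and r: "0 < r" for z r
  proof (cases "r \<le> 1/16")
    case True
    have "G (ball 0 1 \<inter> ball z r) \<le> ennreal (8 * (E * M) * r)"
      by (rule disc_ball_estimate[OF est order_refl z r]) (use True in auto)
    also have "\<dots> \<le> ennreal ((8 * (E * M) + 16 * X) * r)" using r X by (intro ennreal_leI mult_right_mono) auto
    finally show ?thesis .
  next
    case False
    \<comment> \<open>For r > 1/16 the total mass X is below 16 * X * r, so large radii need no
      geometry.\<close>
    have "X = 16 * X * (1/16)" by simp
    also have "\<dots> \<le> (8 * (E * M) + 16 * X) * r" using False X EK(1) M(1) by (intro mult_mono) auto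
    finally have "G (ball 0 1) \<le> ennreal ((8 * (E * M) + 16 * X) * r)" unfolding X by (rule ennreal_leI)
    then show ?thesis using G_mono[of "ball 0 1 \<inter> ball z r" "ball 0 1"] by (meson inf_le1 order_trans)
  qed
  then show ?thesis unfolding carleson_def emeasure_pullback by blast
qed

text \<open>Short arcs have short images uniformly by \<open>len_small\<close>, so small boxes see
  \<alpha> only on small balls, where the Carleson constant can be prescribed.\<close>

theorem vanishing_carleson_pullback:
  assumes "vanishing_carleson \<Omega> (density lebesgue (\<lambda>z. ennreal (\<alpha> z)))"
  shows "vanishing_carleson (ball 0 1) (density lebesgue (\<lambda>z. ennreal (\<alpha> (\<phi> z) * cmod (dz \<phi> z))))"
  unfolding vanishing_carleson_def
proof (intro conjI allI impI)
  show "carleson (ball 0 1) (density lebesgue (\<lambda>z. ennreal (\<alpha> (\<phi> z) * cmod (dz \<phi> z))))"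
    using assms by (intro carleson_pullback) (simp add: vanishing_carleson_def)
  obtain E K where EK: "0 < E" "0 < K" "\<And>M l0 a l. 0 \<le> M \<Longrightarrow> l0 \<le> 1/2 \<Longrightarrow>
     (\<And>a l. 0 < l \<Longrightarrow> l \<le> l0 \<Longrightarrow> (\<integral>\<^sup>+w\<in>\<Omega> \<inter> ball (g a) (K * len a (a + l)). ennreal (\<alpha> w) \<partial>lebesgue) \<le> ennreal (M * (K * len a (a + l)))) \<Longrightarrow>
     0 < l \<Longrightarrow> l \<le> l0 \<Longrightarrow> G (sector a l 0 l) \<le> ennreal (E * M * l)"
  proof (rule sector_estimate, goal_cases)
    case (1 E K)
    show ?case by (rule 1(1)[OF 1(2-4)])
  qed
  fix \<epsilon> :: real assume \<epsilon>: "0 < \<epsilon>"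
  \<comment> \<open>Cancels the factor 8 * E of \<open>disc_ball_estimate\<close>, so that the final
    constant is \<epsilon>.\<close>
  define M where "M = \<epsilon> / (8 * E)"
  have M: "0 < M" using \<epsilon> EK(1) by (simp add: M_def)
  obtain d where d: "0 < d" "\<And>z r. z \<in> frontier \<Omega> \<Longrightarrow> 0 < r \<Longrightarrow> r < d \<Longrightarrow>
      emeasure (density lebesgue (\<lambda>z. ennreal (\<alpha> z))) (\<Omega> \<inter> ball z r) \<le> ennreal (M * r)"
    using assms M unfolding vanishing_carleson_def by blast
  obtain \<eta> where \<eta>: "0 < \<eta>" "\<And>a b. a < b \<Longrightarrow> b - a < \<eta> \<Longrightarrow> len a b < d / K"
    by (rule cu.len_small[of "d / K"]) (use d EK(2) in auto)
  \<comment> \<open>For l \<le> l0 the radius K * len a (a + l) stays below the scale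
    \<open>d\<close> at which \<alpha> has small Carleson constant.\<close>
  define l0 where "l0 = min (1/2) (\<eta> / 2)"
  have l0: "0 < l0" "l0 \<le> 1/2" "l0 < \<eta>" using \<eta>(1) by (auto simp: l0_def min_def)
  have est: "G (sector a l 0 l) \<le> ennreal (E * M * l)" if "0 < l" "l \<le> l0" for a l
  proof (rule EK(3)[OF less_imp_le[OF M] l0(2) _ that])
    fix a l :: real assume l: "0 < l" "l \<le> l0"
    have p: "0 < len a (a + l)" using l l0 pi_gt3 by (intro cu.len_pos) auto
    have "len a (a + l) < d / K" by (rule \<eta>(2)) (use l l0 in auto)
    then have "K * len a (a + l) < d" using EK(2) by (simp add: field_simps)
    then show "(\<integral>\<^sup>+w\<in>\<Omega> \<inter> ball (g a) (K * len a (a + l)). ennreal (\<alpha> w) \<partial>lebesgue) \<le> ennreal (M * (K * len a (a + l)))"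
      using d(2)[OF g_frontier, of "K * len a (a + l)" a] EK(2) p by (simp add: emeasure_weight)
  qed
  have "G (ball 0 1 \<inter> ball z r) \<le> ennreal (\<epsilon> * r)" if z: "z \<in> frontier (ball 0 1)" and r: "0 < r" "r < l0 / 8" for z r
  proof -
    have "G (ball 0 1 \<inter> ball z r) \<le> ennreal (8 * (E * M) * r)"
      by (rule disc_ball_estimate[OF est l0(2) z r(1)]) (use r in auto)
    then show ?thesis using EK(1) by (simp add: M_def)
  qed
  then show "\<exists>\<delta>>0. \<forall>z\<in>frontier (ball 0 1). \<forall>r. 0 < r \<and> r < \<delta> \<longrightarrow>
      emeasure (density lebesgue (\<lambda>z. ennreal (\<alpha> (\<phi> z) * cmod (dz \<phi> z)))) (ball 0 1 \<inter> ball z r) \<le> ennreal (\<epsilon> * r)"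
    unfolding emeasure_pullback using l0(1) by (intro exI[of _ "l0 / 8"]) auto
qed

end

lemma negligible_not_AE:
  assumes "AE z in lebesgue. z \<in> A \<longrightarrow> P z" shows "negligible {z\<in>A. \<not> P z}"
proof -
  obtain N where N: "negligible N" "{z. \<not> (z \<in> A \<longrightarrow> P z)} \<subseteq> N"
    using assms unfolding eventually_ae_filter_negligible by blast
  show ?thesis by (rule negligible_subset[OF N(1)]) (use N(2) in blast)
qed

text \<open>Arc mass is at most twice the Hausdorff measure, so the chord-arc constant becomes 2 *
  |C|; the absolute value appears because \<open>chord_arc\<close> does not fix the sign of its
  constant.\<close>

lemma strongly_quasisymmetric_sqs_curve:
  assumes "strongly_quasisymmetric \<phi> \<Gamma>"
  obtains C C1 C2 where "sqs_curve (\<lambda>t. \<phi> (cis t)) C C1 C2"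
proof -
  let ?g = "\<lambda>t. \<phi> (cis t)"
  obtain v where hom: "homeomorphism (sphere 0 1) \<Gamma> \<phi> v" and ac: "\<And>a b. abs_cont_on ?g a b"
    and "\<exists>C. chord_arc \<Gamma> C" and A: "A_infinity (abs_deriv_circ \<phi>)"
    using assms unfolding strongly_quasisymmetric_def by blast
  then obtain C where C: "chord_arc \<Gamma> C" by blast
  obtain C1 C2 where C12: "0 < C1" "0 < C2"
    "\<And>a b E. a < b \<Longrightarrow> b < a + 2 * pi \<Longrightarrow> E \<subseteq> {a..b} \<Longrightarrow> E \<in> sets borel \<Longrightarrow>
      arc_mass ?g E \<le> ennreal (C2 * (measure lborel E / (b - a)) powr C1) * arc_mass ?g {a..b}"
    "\<And>a b. a < b \<Longrightarrow> b < a + 2 * pi \<Longrightarrow> 0 < arc_mass ?g {a..b} \<and> arc_mass ?g {a..b} < \<infinity>"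
  proof (rule A_infinity_arc_mass[OF ac A], goal_cases)
    case (1 C1 C2)
    show ?case by (rule 1(1)[OF 1(2-5)])
  qed
  have inj: "inj_on \<phi> (sphere 0 1)" and im: "\<phi> ` sphere 0 1 = \<Gamma>"
    using hom unfolding homeomorphism_def by (metis inj_onI, blast)
  have cont: "continuous_on UNIV ?g" by (rule abs_cont_imp_continuous[OF ac])
  have inj_g: "inj_on ?g {a..b}" if "b < a + 2 * pi" for a b
  proof (rule inj_onI)
    fix s t assume st: "s \<in> {a..b}" "t \<in> {a..b}" "\<phi> (cis s) = \<phi> (cis t)"
    have "cis s = cis t" using inj_onD[OF inj st(3)] by simp
    then obtain n :: int where n: "t = s + of_int n * (2 * pi)" using cis_eq_cis by metis
    have "\<bar>t - s\<bar> < 2 * pi" using st that by auto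
    then have "\<bar>of_int n :: real\<bar> * (2 * pi) < 1 * (2 * pi)" using n by (simp add: abs_mult)
    then have "\<bar>of_int n :: real\<bar> < 1" by (simp only: mult_less_cancel_right_pos[OF pi_gt_zero[THEN mult_pos_pos[OF zero_less_numeral]]])
    then show "s = t" using n by simp
  qed
  have mass: "arc_mass ?g {s..t} \<le> ennreal (2 * \<bar>C\<bar> * x)"
    if "s < t" "t < s + 2 * pi" "hausdorff1 (?g ` {s..t}) \<le> ennreal (C * x)" "0 \<le> x" for s t x
  proof -
    have "arc_mass ?g {s..t} \<le> 2 * hausdorff1 (?g ` {s..t})" by (rule arc_mass_le_hausdorff1[OF ac that(1) inj_g[OF that(2)]])
    also have "\<dots> \<le> 2 * ennreal (\<bar>C\<bar> * x)"
      by (rule mult_left_mono[OF order_trans[OF that(3) ennreal_leI]]) (use that(4) in \<open>auto intro: mult_right_mono\<close>)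
    also have "\<dots> = ennreal (2 * \<bar>C\<bar> * x)" using that(4) by (simp add: ennreal_mult mult.assoc)
    finally show ?thesis .
  qed
  have "sqs_curve ?g (2 * \<bar>C\<bar>) C1 C2"
  proof
    show "abs_cont_on ?g a b" for a b by (rule ac)
    show "\<phi> (cis (t + 2 * pi)) = \<phi> (cis t)" for t by (simp add: cis.ctr complex_eq_iff)
    show "arc_mass ?g {a..b} \<le> ennreal (2 * \<bar>C\<bar> * cmod (\<phi> (cis b) - \<phi> (cis a))) \<or>
      arc_mass ?g {b..a + 2 * pi} \<le> ennreal (2 * \<bar>C\<bar> * cmod (\<phi> (cis b) - \<phi> (cis a)))" if ab: "a < b" "b < a + 2 * pi" for a b
      using chord_arc_two_arcs[OF C inj im cont ab]
    proof
      assume "hausdorff1 (?g ` {a..b}) \<le> ennreal (C * cmod (\<phi> (cis b) - \<phi> (cis a)))"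
      then show ?thesis using mass[OF ab] by simp
    next
      assume "hausdorff1 (?g ` {b..a + 2 * pi}) \<le> ennreal (C * cmod (\<phi> (cis b) - \<phi> (cis a)))"
      then show ?thesis using mass[of b "a + 2 * pi"] ab by simp
    qed
  qed (fact C12)+
  then show thesis by (rule that)
qed

theorem theorem3p8:
  fixes \<phi> :: "complex \<Rightarrow> complex" and \<Omega> :: "complex set" and \<alpha> :: "complex \<Rightarrow> real"
  assumes "chord_arc_domain \<Omega>"
    and "quasiconformal \<phi> (ball 0 1) \<Omega>"
    and "continuous_on (cball 0 1) \<phi>"
    and S1: "poincare_bilipschitz \<phi> (ball 0 1) \<Omega>"
    and S2: "strongly_quasisymmetric \<phi> (frontier \<Omega>)"
    and "\<forall>z\<in>\<Omega>. \<alpha> z \<ge> 0"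
    and "\<alpha> \<in> borel_measurable (lebesgue_on \<Omega>)"
  shows "(carleson \<Omega> (density lebesgue (\<lambda>z. ennreal (\<alpha> z))) \<longrightarrow>
           carleson (ball 0 1) (density lebesgue (\<lambda>z. ennreal (\<alpha> (\<phi> z) * cmod (dz \<phi> z)))))
       \<and> (vanishing_carleson \<Omega> (density lebesgue (\<lambda>z. ennreal (\<alpha> z))) \<longrightarrow>
           vanishing_carleson (ball 0 1) (density lebesgue (\<lambda>z. ennreal (\<alpha> (\<phi> z) * cmod (dz \<phi> z)))))"
proof -
  obtain \<psi> k where hom: "homeomorphism (ball 0 1) \<Omega> \<phi> \<psi>" and k: "k < 1"
    and diff: "AE z in lebesgue. z \<in> ball 0 1 \<longrightarrow> \<phi> differentiable (at z)"
    and dil: "AE z in lebesgue. z \<in> ball 0 1 \<longrightarrow> cmod (dzbar \<phi> z) \<le> k * cmod (dz \<phi> z)"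
    using assms(2) unfolding quasiconformal_def by blast
  have op: "open \<Omega>"
  proof -
    obtain \<Gamma> C where \<Gamma>: "chord_arc \<Gamma> C" "\<Omega> \<in> components (- \<Gamma>)" using assms(1) unfolding chord_arc_domain_def by blast
    then have "closed \<Gamma>"
      unfolding chord_arc_def jordan_curve_def by (metis closed_path_image simple_path_imp_path)
    then show ?thesis by (intro open_components[OF _ \<Gamma>(2)]) auto
  qed
  have im: "\<phi> ` ball 0 1 = \<Omega>" using hom by (simp add: homeomorphism_def)
  \<comment> \<open>A chord-arc domain may be either component of the complement of its curve;
    continuity on the closed disc shows that the bounded one is meant.\<close>
  have "compact (\<phi> ` cball 0 1)" by (rule compact_continuous_image[OF assms(3) compact_cball])
  moreover have "\<Omega> \<subseteq> \<phi> ` cball 0 1" unfolding im[symmetric] by (rule image_mono) auto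
  ultimately have bdd: "bounded \<Omega>" by (meson bounded_subset compact_imp_bounded)
  \<comment> \<open>Simple connectivity is inherited from the disc through \<phi>, which makes the
    Riemann mapping theorem applicable.\<close>
  have ex: "\<exists>f. conformal_onto_disc f \<Omega>"
  proof -
    have "\<Omega> homeomorphic (ball 0 1 :: complex set)" using hom homeomorphic_def homeomorphic_sym by blast
    then have "simply_connected \<Omega>"
      using homeomorphic_simply_connected_eq convex_imp_simply_connected[OF convex_ball] by blast
    moreover have "\<Omega> \<noteq> {}" using im by auto
    moreover have "\<Omega> \<noteq> UNIV" using bdd not_bounded_UNIV by blast
    ultimately obtain f h where f: "f holomorphic_on \<Omega>" "h holomorphic_on ball 0 1" "\<forall>z\<in>\<Omega>. f z \<in> ball 0 1 \<and> h (f z) = z"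
       "\<forall>z\<in>ball 0 1. h z \<in> \<Omega> \<and> f (h z) = z"
      using Riemann_mapping_theorem[of \<Omega>] op by (auto simp: dist_norm)
    have "inj_on f \<Omega>" using f(3) by (metis inj_onI)
    moreover have "f ` \<Omega> = ball 0 1"
    proof
      show "f ` \<Omega> \<subseteq> ball 0 1" using f(3) by blast
      show "ball 0 1 \<subseteq> f ` \<Omega>" using f(4) by (metis imageI subsetI)
    qed
    ultimately show ?thesis using f(1) unfolding conformal_onto_disc_def by blast
  qed
  obtain L where L: "0 < L" "\<And>z w. z \<in> ball 0 1 \<Longrightarrow> w \<in> ball 0 1 \<Longrightarrow>
      poincare_dist \<Omega> (\<phi> z) (\<phi> w) \<le> ennreal L * poincare_dist (ball 0 1) z w \<and>
      poincare_dist (ball 0 1) z w \<le> ennreal L * poincare_dist \<Omega> (\<phi> z) (\<phi> w)"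
    using S1 unfolding poincare_bilipschitz_def by blast
  \<comment> \<open>\<open>quasiconformal\<close> allows a negative \<open>k\<close>, while the
    estimates work with 0 \<le> k; hence the maximum with 0.\<close>
  have good: "negligible {z\<in>ball 0 1. \<not> (\<phi> differentiable (at z) \<and> cmod (dzbar \<phi> z) \<le> max k 0 * cmod (dz \<phi> z))}"
  proof (rule negligible_not_AE, rule AE_mp[OF diff], rule AE_mp[OF dil], rule AE_I2, intro impI conjI)
    fix z assume "z \<in> ball 0 1 \<longrightarrow> cmod (dzbar \<phi> z) \<le> k * cmod (dz \<phi> z)" "z \<in> ball (0::complex) 1"
    then have "cmod (dzbar \<phi> z) \<le> k * cmod (dz \<phi> z)" by blast
    also have "\<dots> \<le> max k 0 * cmod (dz \<phi> z)" by (rule mult_right_mono) auto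
    finally show "cmod (dzbar \<phi> z) \<le> max k 0 * cmod (dz \<phi> z)" .
  qed blast
  obtain C C1 C2 where cu: "sqs_curve (\<lambda>t. \<phi> (cis t)) C C1 C2"
    by (rule strongly_quasisymmetric_sqs_curve[OF S2])
  have fr: "\<phi> ` sphere 0 1 = frontier \<Omega>" using S2 unfolding strongly_quasisymmetric_def homeomorphism_def by blast
  have qc: "qc_curve \<phi> \<psi> \<Omega> L (max k 0) (\<lambda>t. \<phi> (cis t)) C C1 C2"
    by (intro qc_curve.intro qc_disc.intro qc_curve_axioms.intro hom assms(3) op bdd ex L cu good fr refl) (use k in auto)
  have ne: "\<Omega> \<noteq> {}" using im by auto
  \<comment> \<open>Finite total mass of \<alpha> is a consequence of the Carleson hypothesis, so
    the locale is entered separately under each of the two assumptions.\<close>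
  have qw: "qc_weight \<phi> \<psi> \<Omega> L (max k 0) (\<lambda>t. \<phi> (cis t)) C C1 C2 \<alpha>" if ca: "carleson \<Omega> (density lebesgue (\<lambda>z. ennreal (\<alpha> z)))"
  proof (intro qc_weight.intro qc qc_weight_axioms.intro)
    have "emeasure (density lebesgue (\<lambda>z. ennreal (\<alpha> z))) \<Omega> < \<infinity>"
    proof (rule carleson_finite[OF op bdd ne _ ca], goal_cases)
      case (2 M)
      show ?case by (rule 2(3))
    qed simp
    then show "(\<integral>\<^sup>+z\<in>\<Omega>. ennreal (\<alpha> z) \<partial>lebesgue) < \<infinity>"
      using op by (simp add: emeasure_density_lower_integral borel_open)
  qed (use assms(6,7) in auto)
  show ?thesis
  proof (intro conjI impI)
    assume ca: "carleson \<Omega> (density lebesgue (\<lambda>z. ennreal (\<alpha> z)))"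
    show "carleson (ball 0 1) (density lebesgue (\<lambda>z. ennreal (\<alpha> (\<phi> z) * cmod (dz \<phi> z))))"
      by (rule qc_weight.carleson_pullback[OF qw[OF ca] ca])
  next
    assume vc: "vanishing_carleson \<Omega> (density lebesgue (\<lambda>z. ennreal (\<alpha> z)))"
    then have ca: "carleson \<Omega> (density lebesgue (\<lambda>z. ennreal (\<alpha> z)))" unfolding vanishing_carleson_def by (rule conjunct1)
    show "vanishing_carleson (ball 0 1) (density lebesgue (\<lambda>z. ennreal (\<alpha> (\<phi> z) * cmod (dz \<phi> z))))"
      by (rule qc_weight.vanishing_carleson_pullback[OF qw[OF ca] vc])
  qed
qed

end
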